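(* Let $M\ge2$, let $q\in\mathbb C^\times$ not be a root of unity, and let $U=\oplus_{\mu\in\mathbb Z^M}U[\mu]$ be a finite dimensional $U_q\mathfrak{gl}_M$-module of type I. For $1\le i\le M-1$ let $A_{i,U}(z)$ be the $\operatorname{End}(U)$-valued rational function of $z=(z_1,\dots,z_M)$ such that, for all $\mu\in\mathbb Z^M$, $$A_{i,U}(z)|_{U[\mu]}=\sum_{j=0}^\infty(-q)^j\frac{z_{i+1}-q^{|\mu_i-\mu_{i+1}|}z_i}{z_{i+1}-q^{2j+|\mu_i-\mu_{i+1}|}z_i}\,E_i^{(j+(\mu_{i+1}-\mu_i)_+)}F_i^{(j+(\mu_i-\mu_{i+1})_+)}\colon U[\mu]\to U[s_i\mu].$$ Then the endomorphisms $s_1,\dots,s_{M-1}$ of the vector space $U(z)$ of $U$-valued rational functions in $M$ variables $z$ given by $$(s_if)(z)=A_{i,U}(s_iz)f(s_iz),\qquad i=1,\dots,M-1,$$ define a representation of the symmetric group $S_M$.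
   Context: $[n]_q=\frac{q^n-q^{-n}}{q-q^{-1}}$, $[n]_q!=\prod_{j=1}^n[j]_q$, $[0]_q!=1$; $(x)_+=\max(x,0)$; $E_i^{(l)}=E_i^l/[l]_q!$, $F_i^{(l)}=F_i^l/[l]_q!$. $U_q\mathfrak{gl}_M$ is the algebra generated by $E_i,F_i$ ($1\le i\le M-1$) and $t_\lambda$ ($\lambda\in\mathbb Z^M$) with $t_\lambda t_\mu=t_{\lambda+\mu}$, $t_0=1$, $t_\lambda E_it_{-\lambda}=q^{(\lambda|\alpha_i)}E_i$, $t_\lambda F_it_{-\lambda}=q^{-(\lambda|\alpha_i)}F_i$, $[E_i,F_j]=\delta_{ij}\frac{K_i-K_i^{-1}}{q-q^{-1}}$ and the $q$-Serre relations of type $A_{M-1}$, where $\alpha_i=\epsilon_i-\epsilon_{i+1}$ and $K_i=t_{\alpha_i}$; $(\ |\ )$ is the standard inner product on $\mathbb Z^M=\oplus_i\mathbb Z\epsilon_i$. The weight space $U[\mu]$ is the simultaneous eigenspace of all $t_\lambda$ with eigenvalue $q^{(\mu|\lambda)}$; $U$ is of type I if it is the direct sum of its finite dimensional weight spaces. $S_M$ acts on $\mathbb Z^M$ and on $z$ by permuting coordinates; $s_i$ is the transposition of $i$ and $i+1$. On a finite dimensional module only finitely many terms of the sum act non-trivially. *)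

theory Defs
  imports
    Complex_Main
    "HOL-Library.Poly_Mapping"
    "HOL-Library.Groups_Big_Fun"
    "HOL-Computational_Algebra.Fraction_Field"
    "HOL-Algebra.Sym_Groups"
    "HOL-Algebra.Group_Action"
begin

section \<open>Rational functions in several variables\<close>

text \<open>
  Complex polynomials in the variables \<open>z k\<close> (\<open>k :: nat\<close>), a monomial being its exponent
  vector, and their field of fractions.  The field \<open>C(z 1, ..., z M)\<close> is the subset
  \<open>ratfuns M\<close> of those fractions in which no other variables occur.
\<close>

type_synonym cpoly = "(nat \<Rightarrow>\<^sub>0 nat) \<Rightarrow>\<^sub>0 complex"
type_synonym ratfun = "cpoly fract"

definition poly_vars :: "cpoly \<Rightarrow> nat set" where
  "poly_vars p = (\<Union>m \<in> Poly_Mapping.keys p. Poly_Mapping.keys m)"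

definition ratfuns :: "nat \<Rightarrow> ratfun set" where
  "ratfuns M = {Fract p r | p r. r \<noteq> 0 \<and> poly_vars p \<subseteq> {1..M} \<and> poly_vars r \<subseteq> {1..M}}"

definition rconst :: "complex \<Rightarrow> ratfun" where
  "rconst c = Fract (Poly_Mapping.single 0 c) 1"

definition rvar :: "nat \<Rightarrow> ratfun" where
  "rvar k = Fract (Poly_Mapping.single (Poly_Mapping.single k 1) 1) 1"

text \<open>
  The substitution \<open>g(z) \<mapsto> g(s\<^sub>i z)\<close> exchanging the variables \<open>z i\<close> and \<open>z (i + 1)\<close>, first on
  exponent vectors, then on polynomials and fractions.
\<close>

definition swap_monom :: "nat \<Rightarrow> (nat \<Rightarrow>\<^sub>0 nat) \<Rightarrow> (nat \<Rightarrow>\<^sub>0 nat)" where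
  "swap_monom i = Poly_Mapping.map_key (transpose i (Suc i))"

definition swap_poly :: "nat \<Rightarrow> cpoly \<Rightarrow> cpoly" where
  "swap_poly i = Poly_Mapping.map_key (swap_monom i)"

lemma lookup_swap_monom:
  "Poly_Mapping.lookup (swap_monom i m) k = Poly_Mapping.lookup m (transpose i (Suc i) k)"
  by (simp add: swap_monom_def map_key.rep_eq)

lemma swap_monom_swap_monom [simp]: "swap_monom i (swap_monom i m) = m"
  by (rule poly_mapping_eqI) (simp add: lookup_swap_monom)

lemma inj_swap_monom: "inj (swap_monom i)"
  by (rule inj_on_inverseI[where g = "swap_monom i"]) simp

lemma swap_monom_add: "swap_monom i (m + n) = swap_monom i m + swap_monom i n"
  by (rule poly_mapping_eqI) (simp add: lookup_swap_monom lookup_add)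

lemma lookup_swap_poly:
  "Poly_Mapping.lookup (swap_poly i p) m = Poly_Mapping.lookup p (swap_monom i m)"
  by (simp add: swap_poly_def map_key.rep_eq inj_swap_monom)

lemma swap_poly_swap_poly [simp]: "swap_poly i (swap_poly i p) = p"
  by (rule poly_mapping_eqI) (simp add: lookup_swap_poly)

lemma swap_poly_0 [simp]: "swap_poly i 0 = 0"
  by (rule poly_mapping_eqI) (simp add: lookup_swap_poly)

lemma swap_poly_eq_0_iff [simp]: "swap_poly i p = 0 \<longleftrightarrow> p = 0"
  by (metis swap_poly_0 swap_poly_swap_poly)

lemma swap_poly_add: "swap_poly i (p + r) = swap_poly i p + swap_poly i r"
  by (rule poly_mapping_eqI) (simp add: lookup_swap_poly lookup_add)

lemma swap_poly_single:
  "swap_poly i (Poly_Mapping.single m c) = Poly_Mapping.single (swap_monom i m) c"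
  by (metis map_key_single inj_swap_monom swap_monom_swap_monom swap_poly_def)

lemma swap_monom_0 [simp]: "swap_monom i 0 = 0"
  by (rule poly_mapping_eqI) (simp add: lookup_swap_monom)

lemma swap_poly_1 [simp]: "swap_poly i 1 = 1"
  using swap_poly_single[of i 0 1] by (simp only: single_one swap_monom_0)

lemma cpoly_induct [case_names zero add]:
  fixes p :: cpoly
  assumes "P 0" and "\<And>m c p. P p \<Longrightarrow> P (Poly_Mapping.single m c + p)"
  shows "P p"
proof (induction p rule: update_induct)
  case const
  show ?case by fact
next
  case (update f a b)
  have "Poly_Mapping.update a b f = Poly_Mapping.single a b + f"
    using update.hyps(1)
    by (intro poly_mapping_eqI)
      (auto simp: lookup_update lookup_add lookup_single in_keys_iff when_def)
  with update.IH assms(2) show ?case by simp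
qed

lemma swap_poly_mult: "swap_poly i (p * r) = swap_poly i p * swap_poly i r"
proof -
  have single: "swap_poly i (Poly_Mapping.single m c * r)
      = swap_poly i (Poly_Mapping.single m c) * swap_poly i r" for m c
    by (induction r rule: cpoly_induct)
      (simp_all add: swap_poly_single mult_single swap_monom_add swap_poly_add distrib_left)
  show ?thesis
    by (induction p rule: cpoly_induct)
      (simp_all add: single swap_poly_add distrib_right)
qed

lift_definition swap_ratfun :: "nat \<Rightarrow> ratfun \<Rightarrow> ratfun"
  is "\<lambda>i x. (swap_poly i (fst x), swap_poly i (snd x))"
  by (auto simp flip: swap_poly_mult)

lemma swap_ratfun_Fract:
  "r \<noteq> 0 \<Longrightarrow> swap_ratfun i (Fract p r) = Fract (swap_poly i p) (swap_poly i r)"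
  by transfer simp

lemma swap_ratfun_rconst: "swap_ratfun i (rconst c) = rconst c"
  by (simp add: rconst_def swap_ratfun_Fract swap_poly_single)

lemma swap_ratfun_rvar: "swap_ratfun i (rvar k) = rvar (transpose i (Suc i) k)"
proof -
  have "swap_monom i (Poly_Mapping.single k 1)
      = Poly_Mapping.single (transpose i (Suc i) k) 1"
    by (rule poly_mapping_eqI)
      (auto simp: lookup_swap_monom lookup_single when_def transpose_eq_iff)
  then show ?thesis
    by (simp add: rvar_def swap_ratfun_Fract swap_poly_single)
qed

lemma swap_ratfun_add: "swap_ratfun i (f + g) = swap_ratfun i f + swap_ratfun i g"
  by transfer (simp add: swap_poly_add swap_poly_mult)

lemma swap_ratfun_mult: "swap_ratfun i (f * g) = swap_ratfun i f * swap_ratfun i g"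
  by transfer (simp add: swap_poly_mult)


section \<open>Modules over the quantized enveloping algebra\<close>

definition weights :: "nat \<Rightarrow> (nat \<Rightarrow> int) set" where
  "weights M = {\<mu>. \<forall>k. k \<notin> {1..M} \<longrightarrow> \<mu> k = 0}"

definition wt_inner :: "nat \<Rightarrow> (nat \<Rightarrow> int) \<Rightarrow> (nat \<Rightarrow> int) \<Rightarrow> int" where
  "wt_inner M \<nu> \<mu> = (\<Sum>k = 1..M. \<nu> k * \<mu> k)"

definition simple_root :: "nat \<Rightarrow> nat \<Rightarrow> int" where
  "simple_root i = (\<lambda>k. if k = i then 1 else if k = Suc i then -1 else 0)"

definition qint :: "complex \<Rightarrow> nat \<Rightarrow> complex" where
  "qint q n = (q ^ n - inverse q ^ n) / (q - inverse q)"

definition qfact :: "complex \<Rightarrow> nat \<Rightarrow> complex" where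
  "qfact q n = (\<Prod>j = 1..n. qint q j)"

text \<open>
  A module is given by the action of the generators on a complex vector space with scalar
  multiplication \<open>scale\<close>; \<open>K i\<close> and its inverse are \<open>t (simple_root i)\<close> and
  \<open>t (- simple_root i)\<close>.
\<close>

locale Uq_gl_module = vector_space scale
  for scale :: "complex \<Rightarrow> 'u::ab_group_add \<Rightarrow> 'u" (infixr \<open>*s\<close> 75) +
  fixes M :: nat and q :: complex
    and E F :: "nat \<Rightarrow> 'u \<Rightarrow> 'u" and t :: "(nat \<Rightarrow> int) \<Rightarrow> 'u \<Rightarrow> 'u"
  assumes linear_E: "i \<in> {1..<M} \<Longrightarrow> Vector_Spaces.linear (*s) (*s) (E i)"
    and linear_F: "i \<in> {1..<M} \<Longrightarrow> Vector_Spaces.linear (*s) (*s) (F i)"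
    and linear_t: "\<nu> \<in> weights M \<Longrightarrow> Vector_Spaces.linear (*s) (*s) (t \<nu>)"
    and t_add: "\<nu> \<in> weights M \<Longrightarrow> \<mu> \<in> weights M \<Longrightarrow> t \<nu> (t \<mu> u) = t (\<lambda>k. \<nu> k + \<mu> k) u"
    and t_0: "t (\<lambda>_. 0) u = u"
    and t_E: "\<nu> \<in> weights M \<Longrightarrow> i \<in> {1..<M} \<Longrightarrow>
      t \<nu> (E i (t (\<lambda>k. - \<nu> k) u)) = (q powi wt_inner M \<nu> (simple_root i)) *s E i u"
    and t_F: "\<nu> \<in> weights M \<Longrightarrow> i \<in> {1..<M} \<Longrightarrow>
      t \<nu> (F i (t (\<lambda>k. - \<nu> k) u)) = (q powi (- wt_inner M \<nu> (simple_root i))) *s F i u"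
    and E_F: "i \<in> {1..<M} \<Longrightarrow> j \<in> {1..<M} \<Longrightarrow>
      E i (F j u) - F j (E i u) =
        (if i = j
         then (1 / (q - inverse q)) *s (t (simple_root i) u - t (\<lambda>k. - simple_root i k) u)
         else 0)"
    and serre_E_far: "i \<in> {1..<M} \<Longrightarrow> j \<in> {1..<M} \<Longrightarrow> \<bar>int i - int j\<bar> \<ge> 2 \<Longrightarrow>
      E i (E j u) = E j (E i u)"
    and serre_F_far: "i \<in> {1..<M} \<Longrightarrow> j \<in> {1..<M} \<Longrightarrow> \<bar>int i - int j\<bar> \<ge> 2 \<Longrightarrow>
      F i (F j u) = F j (F i u)"
    and serre_E_near: "i \<in> {1..<M} \<Longrightarrow> j \<in> {1..<M} \<Longrightarrow> \<bar>int i - int j\<bar> = 1 \<Longrightarrow>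
      E i (E i (E j u)) - qint q 2 *s E i (E j (E i u)) + E j (E i (E i u)) = 0"
    and serre_F_near: "i \<in> {1..<M} \<Longrightarrow> j \<in> {1..<M} \<Longrightarrow> \<bar>int i - int j\<bar> = 1 \<Longrightarrow>
      F i (F i (F j u)) - qint q 2 *s F i (F j (F i u)) + F j (F i (F i u)) = 0"

definition weight_space ::
    "nat \<Rightarrow> complex \<Rightarrow> (complex \<Rightarrow> 'u \<Rightarrow> 'u) \<Rightarrow> ((nat \<Rightarrow> int) \<Rightarrow> 'u \<Rightarrow> 'u) \<Rightarrow> (nat \<Rightarrow> int)
      \<Rightarrow> 'u::ab_group_add set" where
  "weight_space M q scale t \<mu> =
    {u. \<forall>\<nu> \<in> weights M. t \<nu> u = scale (q powi wt_inner M \<mu> \<nu>) u}"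

definition weight_decomp ::
    "nat \<Rightarrow> complex \<Rightarrow> (complex \<Rightarrow> 'u \<Rightarrow> 'u) \<Rightarrow> ((nat \<Rightarrow> int) \<Rightarrow> 'u \<Rightarrow> 'u) \<Rightarrow> 'u
      \<Rightarrow> ((nat \<Rightarrow> int) \<Rightarrow> 'u::ab_group_add) \<Rightarrow> bool" where
  "weight_decomp M q scale t u v \<longleftrightarrow>
    finite {\<mu>. v \<mu> \<noteq> 0} \<and> (\<forall>\<mu> \<in> weights M. v \<mu> \<in> weight_space M q scale t \<mu>) \<and>
    (\<forall>\<mu>. \<mu> \<notin> weights M \<longrightarrow> v \<mu> = 0) \<and> u = (\<Sum>\<mu> | v \<mu> \<noteq> 0. v \<mu>)"

definition type_I ::
    "nat \<Rightarrow> complex \<Rightarrow> (complex \<Rightarrow> 'u \<Rightarrow> 'u) \<Rightarrow> ((nat \<Rightarrow> int) \<Rightarrow> 'u \<Rightarrow> 'u::ab_group_add) \<Rightarrow> bool" where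
  "type_I M q scale t \<longleftrightarrow>
    (\<forall>u. \<exists>!v. weight_decomp M q scale t u v) \<and>
    (\<forall>\<mu> \<in> weights M. \<exists>S. finite S \<and> weight_space M q scale t \<mu> = module.span scale S)"

definition weight_component ::
    "nat \<Rightarrow> complex \<Rightarrow> (complex \<Rightarrow> 'u \<Rightarrow> 'u) \<Rightarrow> ((nat \<Rightarrow> int) \<Rightarrow> 'u \<Rightarrow> 'u) \<Rightarrow> (nat \<Rightarrow> int)
      \<Rightarrow> 'u \<Rightarrow> 'u::ab_group_add" where
  "weight_component M q scale t \<mu> u = (THE v. weight_decomp M q scale t u v) \<mu>"

definition divided_power ::
    "complex \<Rightarrow> (complex \<Rightarrow> 'u \<Rightarrow> 'u) \<Rightarrow> ('u \<Rightarrow> 'u) \<Rightarrow> nat \<Rightarrow> 'u \<Rightarrow> 'u" where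
  "divided_power q scale X l u = scale (1 / qfact q l) ((X ^^ l) u)"


section \<open>The dynamical operators\<close>

text \<open>
  With respect to a basis \<open>B\<close> of \<open>U\<close>, a \<open>U\<close>-valued rational function is the family of its
  coordinates, and an \<open>End(U)\<close>-valued one is a \<open>B \<times> B\<close> matrix.
\<close>

definition rational_vectors :: "nat \<Rightarrow> 'u set \<Rightarrow> ('u \<Rightarrow> ratfun) set" where
  "rational_vectors M B = {f. (\<forall>b \<in> B. f b \<in> ratfuns M) \<and> (\<forall>b. b \<notin> B \<longrightarrow> f b = 0)}"

definition dyn_coeff :: "complex \<Rightarrow> nat \<Rightarrow> (nat \<Rightarrow> int) \<Rightarrow> nat \<Rightarrow> ratfun" where
  "dyn_coeff q i \<mu> j =
    (let d = nat \<bar>\<mu> i - \<mu> (Suc i)\<bar> in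
     rconst ((- q) ^ j) *
       ((rvar (Suc i) - rconst (q ^ d) * rvar i) /
        (rvar (Suc i) - rconst (q ^ (2 * j + d)) * rvar i)))"

text \<open>The truncation built into \<^const>\<open>nat\<close> on the integers yields the positive parts.\<close>

definition dyn_term ::
    "complex \<Rightarrow> (complex \<Rightarrow> 'u \<Rightarrow> 'u) \<Rightarrow> (nat \<Rightarrow> 'u \<Rightarrow> 'u) \<Rightarrow> (nat \<Rightarrow> 'u \<Rightarrow> 'u) \<Rightarrow> nat
      \<Rightarrow> (nat \<Rightarrow> int) \<Rightarrow> nat \<Rightarrow> 'u \<Rightarrow> 'u" where
  "dyn_term q scale E F i \<mu> j u =
    divided_power q scale (E i) (j + nat (\<mu> (Suc i) - \<mu> i))
      (divided_power q scale (F i) (j + nat (\<mu> i - \<mu> (Suc i))) u)"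

text \<open>
  The \<open>(b, c)\<close> entry of the matrix of \<open>A\<^sub>i(z)\<close>: decompose \<open>c\<close> into weight components, apply to
  the component of weight \<open>\<mu>\<close> the series defining \<open>A\<^sub>i(z)\<close> on the weight space of \<open>\<mu>\<close>, and
  take the coordinate at \<open>b\<close>.  \<^const>\<open>Sum_any\<close> sums the finitely many non-zero terms.
\<close>

definition dyn_matrix ::
    "nat \<Rightarrow> complex \<Rightarrow> (complex \<Rightarrow> 'u \<Rightarrow> 'u) \<Rightarrow> 'u set \<Rightarrow> (nat \<Rightarrow> 'u \<Rightarrow> 'u) \<Rightarrow> (nat \<Rightarrow> 'u \<Rightarrow> 'u)
      \<Rightarrow> ((nat \<Rightarrow> int) \<Rightarrow> 'u \<Rightarrow> 'u) \<Rightarrow> nat \<Rightarrow> 'u \<Rightarrow> 'u::ab_group_add \<Rightarrow> ratfun" where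
  "dyn_matrix M q scale B E F t i b c =
    Sum_any (\<lambda>\<mu>. Sum_any (\<lambda>j.
      dyn_coeff q i \<mu> j *
      rconst (module.representation scale B
        (dyn_term q scale E F i \<mu> j (weight_component M q scale t \<mu> c)) b)))"

text \<open>The operator \<open>(s\<^sub>i f)(z) = A\<^sub>i(s\<^sub>i z) f(s\<^sub>i z)\<close>.\<close>

definition dyn_reflection ::
    "nat \<Rightarrow> complex \<Rightarrow> (complex \<Rightarrow> 'u \<Rightarrow> 'u) \<Rightarrow> 'u set \<Rightarrow> (nat \<Rightarrow> 'u \<Rightarrow> 'u) \<Rightarrow> (nat \<Rightarrow> 'u \<Rightarrow> 'u)
      \<Rightarrow> ((nat \<Rightarrow> int) \<Rightarrow> 'u \<Rightarrow> 'u) \<Rightarrow> nat \<Rightarrow> ('u::ab_group_add \<Rightarrow> ratfun) \<Rightarrow> 'u \<Rightarrow> ratfun" where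
  "dyn_reflection M q scale B E F t i f =
    (\<lambda>b. \<Sum>c \<in> B. swap_ratfun i (dyn_matrix M q scale B E F t i b c) * swap_ratfun i (f c))"

text \<open>
  A representation of a group by complex-linear automorphisms of a space \<open>V\<close> of families of
  rational functions.
\<close>

definition linear_representation ::
    "('g, 'x) monoid_scheme \<Rightarrow> ('u \<Rightarrow> ratfun) set \<Rightarrow> ('g \<Rightarrow> ('u \<Rightarrow> ratfun) \<Rightarrow> ('u \<Rightarrow> ratfun)) \<Rightarrow> bool"
  where
  "linear_representation G V \<rho> \<longleftrightarrow>
    group_action G V \<rho> \<and>
    (\<forall>g \<in> carrier G. \<forall>f \<in> V. \<forall>h \<in> V. \<rho> g (\<lambda>b. f b + h b) = (\<lambda>b. \<rho> g f b + \<rho> g h b)) \<and>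
    (\<forall>g \<in> carrier G. \<forall>c. \<forall>f \<in> V. \<rho> g (\<lambda>b. rconst c * f b) = (\<lambda>b. rconst c * \<rho> g f b))"

end

theory Submission
  imports Defs "HOL-Library.Function_Algebras" "HOL-Computational_Algebra.Polynomial"
begin

text \<open>
  The relations \<open>s\<^sub>i s\<^sub>i = 1\<close>, \<open>s\<^sub>i s\<^sub>j = s\<^sub>j s\<^sub>i\<close> for \<open>\<bar>i - j\<bar> \<ge> 2\<close> and the braid relation have to be
  verified for the reflections; the presentation of the symmetric group then does the rest.
  Each relation is an identity of rational functions.  The reflections are semilinear over the
  rational functions, so constant functions with value in a weight space are enough, and an
  identity between their images may be checked at a Zariski dense set of points, where it says
  that products of the operators \<open>A\<^sub>i\<close> at numerical arguments agree.

  The braid relation involves three consecutive indices and so takes place in the quantized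
  enveloping algebra of rank two.  It is deduced from the representation theory of Verma
  modules.  Let \<open>W\<close> be the tensor product of a lowest weight Verma module with \<open>U\<close>, let \<open>x\<close> be a
  lowest weight vector of weight \<open>-b\<close> for the \<open>i\<close>-th copy of \<open>sl\<^sub>2\<close>, and let
  \<open>x' = E\<^sub>i^(b+1) x\<close>, again a lowest weight vector (\<open>E^(k)\<close> denotes a divided power).  Let \<open>T\<close> be a
  polynomial in the Casimir operator that annihilates the weight spaces strictly below that of \<open>x' \<otimes> y\<close>
  in the tensor product of \<open>U\<close> with the submodule generated by \<open>x'\<close>, and those strictly below that
  of \<open>x \<otimes> v\<close> in the one for \<open>x\<close>.  Then
  \<open>T (x' \<otimes> y) = E\<^sub>i^(a+1) T (x \<otimes> v)\<close>, where \<open>v\<close> is a multiple of \<open>A\<^sub>i y\<close> with \<open>z i / z (i + 1)\<close> a power of \<open>q\<close>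
  determined by \<open>a\<close> and the weight of \<open>y\<close> (lemma \<open>rank_one_transport\<close> and its projected form
  \<open>rank_one_projected\<close>).  For an antidominant lowest weight both reduced words of the longest
  element of \<open>S\<^sub>3\<close> lead from the same vector \<open>x \<otimes> y\<close> to the lowest weight vector of the Verma
  module.  By the Verma identity for divided powers (\<open>verma_identity\<close>) they start in the same
  vector and end with the same product of divided powers, which is injective on \<open>W\<close>.  So
  \<open>T (x\<^sub>0 \<otimes> v) = T (x\<^sub>0 \<otimes> w)\<close> for the two transported vectors \<open>v\<close> and \<open>w\<close>, and passing to the
  coinvariants \<open>W / (E\<^sub>1 W + E\<^sub>2 W) = U\<close>, where the Casimir operator is a scalar, gives \<open>v = w\<close>
  (\<open>braid_integral\<close>).  This is the braid relation at points whose coordinates are powers of \<open>q\<close>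
  with large gaps between the exponents, subject to finitely many linear inequations that keep
  the Casimir eigenvalues apart; such points are dense (\<open>nonzero_on_grid\<close>).

  The square of \<open>s\<^sub>i\<close> is a rank one computation: on \<open>E^(k) u\<close> with \<open>F u = 0\<close> the operator
  acts by a scalar, an alternating sum of products of \<open>q\<close>-binomials that has a product form by Lagrange
  interpolation, and the scalars for \<open>x\<close> and \<open>1 / x\<close> are inverse to each other
  (\<open>esum_unitary\<close>, \<open>dynA_unitary\<close>).
\<close>

section \<open>Symmetric \<open>q\<close>-integers and divided powers\<close>

locale generic_q =
  fixes q :: complex
  assumes q_nz [simp]: "q \<noteq> 0" and q_root: "\<And>n::nat. n > 0 \<Longrightarrow> q ^ n \<noteq> 1"
begin

definition br :: "int \<Rightarrow> complex" where
  "br n = (q powi n - q powi (- n)) / (q - inverse q)"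

lemma powi_eq_1_iff: "q powi n = 1 \<longleftrightarrow> n = 0"
proof (cases "n \<ge> 0")
  case True
  then obtain m where "n = int m" using nonneg_int_cases by blast
  then show ?thesis using q_root[of m] by (cases "m = 0") auto
next
  case False
  then have "q powi n = inverse (q ^ nat (- n))" by (simp add: power_int_def power_inverse)
  with False q_root[of "nat (- n)"] show ?thesis by auto
qed

lemma powi_eq_iff: "q powi m = q powi n \<longleftrightarrow> m = n"
  using powi_eq_1_iff[of "m - n"] by (auto simp: power_int_diff)

lemma q_neq_inverse [simp]: "q \<noteq> inverse q"
  using powi_eq_iff[of 1 "-1"] by (simp add: power_int_minus)

lemma br_0 [simp]: "br 0 = 0" by (simp add: br_def)

lemma br_1 [simp]: "br 1 = 1" by (simp add: br_def power_int_minus)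

lemma br_minus: "br (- n) = - br n" by (simp add: br_def minus_divide_left)

lemma br_eq_0_iff [simp]: "br n = 0 \<longleftrightarrow> n = 0"
  using powi_eq_iff[of n "-n"] by (auto simp: br_def)

lemma br_mult_q: "(q - inverse q) * br n = q powi n - q powi (- n)"
  by (simp add: br_def)

lemma qint_br: "qint q n = br (int n)"
  by (simp add: qint_def br_def power_int_minus power_inverse)

lemma qfact_0 [simp]: "qfact q 0 = 1" by (simp add: qfact_def)

lemma qfact_Suc: "qfact q (Suc n) = br (int (Suc n)) * qfact q n"
  by (simp add: qfact_def qint_br)

lemma qfact_nz [simp]: "qfact q n \<noteq> 0"
  by (induction n) (simp_all add: qfact_Suc)

text \<open>Multiplying brackets out over the common denominator reduces an identity between them to
  one between integral powers of \<open>q\<close>.\<close>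

lemma br_prod: "br m * br n = (q powi (m + n) + q powi (- m - n) - q powi (m - n) - q powi (n - m))
    / (q - inverse q)\<^sup>2"
proof -
  have a: "q powi (m + n) = q powi m * q powi n" by (simp add: power_int_add)
  have b: "q powi (- m - n) = q powi (- m) * q powi (- n)"
    using power_int_add[of q "-m" "-n"] by simp
  have c: "q powi (m - n) = q powi m * q powi (- n)"
    using power_int_add[of q "m" "-n"] by simp
  have d: "q powi (n - m) = q powi n * q powi (- m)"
    using power_int_add[of q "n" "-m"] by simp
  show ?thesis
    unfolding br_def a b c d by (simp add: power2_eq_square field_simps)
qed

text \<open>
  The three-term identity behind the recursion in \<open>F_ww\<close>.
\<close>

lemma br_identity:
  "br (a - k) * br (k + 1) + br (n - k) * br (a - k - 1 - n) = br (a - n) * br (n + 1)"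
proof -
  have "q powi (a - k + (k + 1)) = q powi (a + 1)" "q powi (- (a - k) - (k + 1)) = q powi (- a - 1)"
    "q powi (a - k - (k + 1)) = q powi (a - 2 * k - 1)" "q powi (k + 1 - (a - k)) = q powi (2 * k + 1 - a)"
    "q powi (n - k + (a - k - 1 - n)) = q powi (a - 2 * k - 1)"
    "q powi (- (n - k) - (a - k - 1 - n)) = q powi (2 * k + 1 - a)"
    "q powi (n - k - (a - k - 1 - n)) = q powi (2 * n + 1 - a)"
    "q powi (a - k - 1 - n - (n - k)) = q powi (a - 1 - 2 * n)"
    "q powi (a - n + (n + 1)) = q powi (a + 1)" "q powi (- (a - n) - (n + 1)) = q powi (- a - 1)"
    "q powi (a - n - (n + 1)) = q powi (a - 1 - 2 * n)" "q powi (n + 1 - (a - n)) = q powi (2 * n + 1 - a)"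
    by (rule arg_cong[where f = "(powi) q"], simp)+
  then show ?thesis unfolding br_prod by (simp add: add_divide_distrib[symmetric])
qed

lemma br_add: "br (m + n) = q powi m * br n + q powi (- n) * br m"
proof -
  have "q powi (m + n) - q powi (- (m + n))
      = q powi m * (q powi n - q powi (- n)) + q powi (- n) * (q powi m - q powi (- m))"
    by (simp add: power_int_add power_int_diff power_int_minus field_simps)
  then show ?thesis
    unfolding br_def times_divide_eq_right add_divide_distrib[symmetric] by (rule arg_cong)
qed

end

text \<open>
  The sets \<open>X h\<close> stand for the weight spaces.  The relation between \<open>E\<close> and \<open>F\<close> is imposed on weight
  vectors, where the torus acts by a scalar.
\<close>

locale qsl2 = generic_q q + Vs: vector_space sc +
    E: Vector_Spaces.linear sc sc E + F: Vector_Spaces.linear sc sc F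
  for q :: complex and sc :: "complex \<Rightarrow> 'w::ab_group_add \<Rightarrow> 'w" and E F :: "'w \<Rightarrow> 'w" +
  fixes X :: "int \<Rightarrow> 'w set"
  assumes X_E: "w \<in> X h \<Longrightarrow> E w \<in> X (h + 2)"
    and X_F: "w \<in> X h \<Longrightarrow> F w \<in> X (h - 2)"
    and X_scale: "w \<in> X h \<Longrightarrow> sc c w \<in> X h"
    and E_F_X: "w \<in> X h \<Longrightarrow> E (F w) = F (E w) + sc (br h) w"
begin

abbreviation "dpE \<equiv> divided_power q sc E"
abbreviation "dpF \<equiv> divided_power q sc F"

lemma dpE_0 [simp]: "dpE 0 w = w" and dpF_0 [simp]: "dpF 0 w = w"
  by (simp_all add: divided_power_def)

lemma E_pow_scale: "(E ^^ n) (sc c w) = sc c ((E ^^ n) w)"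
  by (induction n) (simp_all add: E.scale)
lemma F_pow_scale: "(F ^^ n) (sc c w) = sc c ((F ^^ n) w)"
  by (induction n) (simp_all add: F.scale)
lemma E_pow_add: "(E ^^ n) (v + w) = (E ^^ n) v + (E ^^ n) w"
  by (induction n) (simp_all add: E.add)
lemma F_pow_add: "(F ^^ n) (v + w) = (F ^^ n) v + (F ^^ n) w"
  by (induction n) (simp_all add: F.add)

lemma linear_dpE: "Vector_Spaces.linear sc sc (dpE n)"
  by unfold_locales
    (simp_all add: divided_power_def E_pow_add E_pow_scale Vs.scale_right_distrib
      Vs.scale_left_commute)

lemma linear_dpF: "Vector_Spaces.linear sc sc (dpF n)"
  by unfold_locales
    (simp_all add: divided_power_def F_pow_add F_pow_scale Vs.scale_right_distrib
      Vs.scale_left_commute)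

sublocale dE: Vector_Spaces.linear sc sc "dpE n" for n by (rule linear_dpE)
sublocale dF: Vector_Spaces.linear sc sc "dpF n" for n by (rule linear_dpF)

lemma E_dpE: "E (dpE n w) = sc (br (int (Suc n))) (dpE (Suc n) w)"
  by (simp add: divided_power_def E.scale qfact_Suc)

lemma F_dpF: "F (dpF n w) = sc (br (int (Suc n))) (dpF (Suc n) w)"
  by (simp add: divided_power_def F.scale qfact_Suc)

lemma dpE_E: "dpE n (E w) = sc (br (int (Suc n))) (dpE (Suc n) w)"
  by (simp add: divided_power_def qfact_Suc funpow_swap1)

lemma dpF_F: "dpF n (F w) = sc (br (int (Suc n))) (dpF (Suc n) w)"
  by (simp add: divided_power_def qfact_Suc funpow_swap1)

lemma dpE_Suc: "dpE (Suc n) w = sc (1 / br (int (Suc n))) (E (dpE n w))"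
  by (simp add: E_dpE del: of_nat_Suc)

lemma dpF_Suc: "dpF (Suc n) w = sc (1 / br (int (Suc n))) (F (dpF n w))"
  by (simp add: F_dpF del: of_nat_Suc)

lemma dpE_dpE: "dpE m (dpE n w) = sc (qfact q (m + n) / (qfact q m * qfact q n)) (dpE (m + n) w)"
  by (simp add: divided_power_def E_pow_scale funpow_add)

lemma dpF_dpF: "dpF m (dpF n w) = sc (qfact q (m + n) / (qfact q m * qfact q n)) (dpF (m + n) w)"
  by (simp add: divided_power_def F_pow_scale funpow_add)

lemma X_dpE: "w \<in> X h \<Longrightarrow> dpE n w \<in> X (h + 2 * int n)"
proof (induction n)
  case (Suc n)
  have "E (dpE n w) \<in> X (h + 2 * int n + 2)" using Suc by (intro X_E) auto
  then have "E (dpE n w) \<in> X (h + 2 * int (Suc n))" by (simp add: algebra_simps)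
  then show ?case unfolding dpE_Suc by (rule X_scale)
qed simp

lemma X_dpF: "w \<in> X h \<Longrightarrow> dpF n w \<in> X (h - 2 * int n)"
proof (induction n)
  case (Suc n)
  have "F (dpF n w) \<in> X (h - 2 * int n - 2)" using Suc by (intro X_F) auto
  then have "F (dpF n w) \<in> X (h - 2 * int (Suc n))" by (simp add: algebra_simps)
  then show ?case unfolding dpF_Suc by (rule X_scale)
qed simp

text \<open>
  Divided powers with integral index, which are zero for a negative index: shifts of the index then
  need no case distinction.
\<close>

definition dpz :: "int \<Rightarrow> 'w \<Rightarrow> 'w" where
  "dpz i w = (if i < 0 then 0 else dpE (nat i) w)"

text \<open>
  The bracket of \<open>F\<close> with a divided power.  Moving \<open>F\<close> past one factor \<open>E\<close> at a time produces a sum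
  of brackets, which the product formula for brackets collapses to a single one.
\<close>

lemma F_dpE_Suc:
  assumes "w \<in> X h"
  shows "F (dpE (Suc n) w) = dpE (Suc n) (F w) - sc (br (h + int n)) (dpE n w)"
proof (induction n)
  case 0
  have "dpE (Suc 0) u = E u" for u by (simp add: divided_power_def qfact_Suc)
  then show ?case using E_F_X[OF assms] by simp
next
  case (Suc n)
  have X: "dpE (Suc n) w \<in> X (h + 2 * int (Suc n))" by (rule X_dpE[OF assms])
  have b: "br (int (Suc n)) * br (h + int n) + br (h + 2 * int (Suc n))
      = br (int (Suc (Suc n))) * br (h + int (Suc n))"
  proof -
    define m where "m = int n"
    have "br (m + 1) * br (h + m) + br (h + 2 * m + 2) * br 1 = br (m + 2) * br (h + m + 1)"
      unfolding br_prod by (simp add: add_divide_distrib[symmetric] algebra_simps)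
    then show ?thesis by (simp add: m_def algebra_simps)
  qed
  have "F (dpE (Suc (Suc n)) w) = sc (1 / br (int (Suc (Suc n)))) (F (E (dpE (Suc n) w)))"
    by (simp add: dpE_Suc[of "Suc n"] F.scale)
  also have "F (E (dpE (Suc n) w)) = E (F (dpE (Suc n) w)) - sc (br (h + 2 * int (Suc n))) (dpE (Suc n) w)"
    using E_F_X[OF X] by simp
  also have "\<dots> = E (dpE (Suc n) (F w))
      - sc (br (int (Suc n)) * br (h + int n) + br (h + 2 * int (Suc n))) (dpE (Suc n) w)"
    by (simp add: Suc.IH E.diff E.scale E_dpE Vs.scale_left_distrib algebra_simps)
  also have "\<dots> = sc (br (int (Suc (Suc n)))) (dpE (Suc (Suc n)) (F w)
      - sc (br (h + int (Suc n))) (dpE (Suc n) w))"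
    unfolding b by (simp add: E_dpE Vs.scale_right_diff_distrib)
  finally show ?case by (simp add: del: of_nat_Suc)
qed

lemma F_dpz: "w \<in> X h \<Longrightarrow> F (dpz i w) = dpz i (F w) - sc (br (h + i - 1)) (dpz (i - 1) w)"
proof (cases "i \<le> 0")
  case False
  assume "w \<in> X h"
  moreover from False obtain n where "i = int (Suc n)" by (metis not_le pos_int_cases Suc_pred)
  ultimately show ?thesis using F_dpE_Suc[of w h n] by (simp add: dpz_def nat_add_distrib algebra_simps)
qed (auto simp: dpz_def)

end

section \<open>Unitarity in rank one\<close>

context generic_q
begin

text \<open>
  For \<open>u\<close> of lowest weight \<open>- (2 p + d)\<close> this is the coefficient in
  \<open>E^(j + d) F^(j) E^(p) u = ebin d p j E^(p + d) u\<close>; with \<open>m = p + d\<close> it is the product of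
  \<open>q\<close>-binomials \<open>[m + j, p] [p, j]\<close>.
\<close>

definition ebin :: "nat \<Rightarrow> nat \<Rightarrow> nat \<Rightarrow> complex" where
  "ebin d p j = qfact q (p + d + j) / (qfact q j * qfact q (p - j) * qfact q (j + d))"

text \<open>
  The scalar by which the dynamical operator takes \<open>E^(p) u\<close> to \<open>E^(p + d) u\<close>.  The argument \<open>\<xi>\<close>
  is \<open>q ^ d z i / z (i + 1)\<close>.
\<close>

definition esum :: "nat \<Rightarrow> nat \<Rightarrow> complex \<Rightarrow> complex" where
  "esum d p \<xi> = (\<Sum>j\<le>p. ((- q) ^ j * ((1 - \<xi>) / (1 - q ^ (2 * j) * \<xi>))) * ebin d p j)"

lemma prod_br_node:
  "j \<le> p \<Longrightarrow> (\<Prod>t\<in>{..p} - {j}. br (int t - int j)) = (- 1) ^ j * qfact q j * qfact q (p - j)"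
proof (induction p rule: dec_induct)
  case base
  have "{..j} - {j} = {..<j}" by auto
  moreover have "(\<Prod>t<j. br (int t - int j)) = (\<Prod>t<j. - br (int (Suc t)))"
  proof -
    have "(\<Prod>t<j. br (int t - int j)) = (\<Prod>t<j. (\<lambda>s. - br (int (Suc s))) (j - Suc t))"
    proof (rule prod.cong[OF refl])
      fix t assume "t \<in> {..<j}"
      then have "int t - int j = - int (Suc (j - Suc t))" by auto
      then show "br (int t - int j) = - br (int (Suc (j - Suc t)))" by (metis br_minus)
    qed
    then show ?thesis using prod.nat_diff_reindex[of "\<lambda>s. - br (int (Suc s))" j] by (simp only:)
  qed
  moreover have "(\<Prod>t<j. - br (int (Suc t))) = (- 1) ^ j * qfact q j"
    by (induction j) (simp_all add: qfact_Suc)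
  ultimately show ?case by simp
next
  case (step p)
  have "{..Suc p} - {j} = insert (Suc p) ({..p} - {j})" using step.hyps by auto
  then have "(\<Prod>t\<in>{..Suc p} - {j}. br (int t - int j)) = br (int (Suc p) - int j) * ((- 1) ^ j * qfact q j * qfact q (p - j))"
    using step.IH by (simp del: of_nat_Suc)
  moreover have "qfact q (Suc p - j) = br (int (Suc p) - int j) * qfact q (p - j)"
    using step.hyps qfact_Suc[of "p - j"] by (simp add: Suc_diff_le of_nat_diff add_diff_eq)
  ultimately show ?case by simp
qed

lemma prod_br_shift: "(\<Prod>t=1..p. br (int t + int n)) = qfact q (p + n) / qfact q n"
proof (induction p)
  case (Suc p)
  have "br (int (Suc p) + int n) * qfact q (p + n) = qfact q (Suc p + n)"
    using qfact_Suc[of "p + n"] by (simp add: algebra_simps)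
  then show ?case using Suc by (simp add: mult.commute)
qed simp

lemma one_minus_q2: "1 - q powi (2 * n) = - (q - inverse q) * (q powi n * br n)"
proof -
  have "q powi (2 * n) = q powi n * q powi n" by (simp add: power_int_add[symmetric])
  moreover have "- (q - inverse q) * (q powi n * br n) = - (q powi n * (q powi n - q powi (- n)))"
    unfolding br_mult_q[symmetric] mult_minus_left by (simp only: mult.left_commute)
  ultimately show ?thesis by (simp add: right_diff_distrib power_int_minus)
qed

text \<open>
  At \<open>\<xi> = q powi (- 2 j)\<close> only the \<open>j\<close>-th summand of the cleared sum survives.  Writing every factor
  as a bracket times a power of \<open>q\<close> turns both sides into quotients of \<open>q\<close>-factorials.
\<close>

lemma node_identity:
  assumes j: "j \<le> p"
  shows "(- q) ^ j * ebin d p j * (\<Prod>t\<in>{..p} - {j}. 1 - q ^ (2 * t) * q powi (- 2 * int j))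
    = q powi (- int (d * p)) * (\<Prod>t=1..p. q powi (- 2 * int j) - q ^ (2 * (t + d)))"
proof -
  let ?h = "- (q - inverse q)"
  have L: "1 - q ^ (2 * t) * q powi (- 2 * int j) = ?h * (q powi (int t - int j) * br (int t - int j))" for t
  proof -
    have "q ^ (2 * t) * q powi (- 2 * int j) = q powi (2 * (int t - int j))"
      unfolding power_int_of_nat[symmetric] power_int_add[symmetric, OF disjI1[OF q_nz]]
      by (rule arg_cong[where f = "(powi) q"]) simp
    then show ?thesis using one_minus_q2[of "int t - int j"] by simp
  qed
  have Rr: "q powi (- 2 * int j) - q ^ (2 * (t + d)) = ?h * (q powi (int t - int j) * (q ^ d * br (int t + int (d + j))))" for t
  proof -
    have 1: "q powi (- 2 * int j) * q powi (2 * (int t + int (d + j))) = q ^ (2 * (t + d))"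
      unfolding power_int_of_nat[symmetric] power_int_add[symmetric, OF disjI1[OF q_nz]]
      by (rule arg_cong[where f = "(powi) q"]) simp
    have 2: "q powi (- 2 * int j) * q powi (int t + int (d + j)) = q powi (int t - int j) * q ^ d"
      unfolding power_int_of_nat[symmetric] power_int_add[symmetric, OF disjI1[OF q_nz]]
      by (rule arg_cong[where f = "(powi) q"]) simp
    have "q powi (- 2 * int j) - q ^ (2 * (t + d)) = q powi (- 2 * int j) * (1 - q powi (2 * (int t + int (d + j))))"
      by (simp only: right_diff_distrib 1 mult_1_right)
    also have "\<dots> = ?h * ((q powi (- 2 * int j) * q powi (int t + int (d + j))) * br (int t + int (d + j)))"
      unfolding one_minus_q2 by (simp only: mult_ac)
    finally show ?thesis unfolding 2 by (simp only: mult_ac)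
  qed
  have c: "card ({..p} - {j}) = p" using j by simp
  have Q: "(\<Prod>t\<in>{..p} - {j}. q powi (int t - int j)) = q powi (- int j) * (\<Prod>t=1..p. q powi (int t - int j))"
  proof -
    have "(\<Prod>t\<in>{..p} - {j}. q powi (int t - int j)) = (\<Prod>t\<le>p. q powi (int t - int j))"
      using j by (subst (2) prod.remove[of _ j]) simp_all
    also have "{..p} = insert 0 {1..p} \<Longrightarrow> (\<Prod>t\<le>p. q powi (int t - int j)) = (\<Prod>t\<in>insert 0 {1..p}. q powi (int t - int j))"
      by (simp only:)
    also have "(\<Prod>t\<in>insert 0 {1..p}. q powi (int t - int j)) = q powi (int 0 - int j) * (\<Prod>t=1..p. q powi (int t - int j))"
      by (rule prod.insert) simp_all
    finally have "{..p} = insert 0 {1..p} \<Longrightarrow> ?thesis" by (simp only: of_nat_0 diff_0)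
    moreover have "{..p} = insert 0 {1..p}" by force
    ultimately show ?thesis by blast
  qed
  have qq: "(- q) ^ j * q powi (- int j) * (- 1) ^ j = 1"
  proof -
    have "(- q) ^ j * (- 1) ^ j = q ^ j" by (simp add: power_mult_distrib[symmetric])
    then show ?thesis by (simp add: power_int_minus mult_ac)
  qed
  have dp: "q powi (- int (d * p)) * (q ^ d) ^ p = 1"
    by (simp add: power_int_minus power_mult[symmetric] del: of_nat_mult)
  have "(- q) ^ j * ebin d p j * (\<Prod>t\<in>{..p} - {j}. 1 - q ^ (2 * t) * q powi (- 2 * int j))
    = (- q) ^ j * ebin d p j * (?h ^ p * ((q powi (- int j) * (\<Prod>t=1..p. q powi (int t - int j))) * ((- 1) ^ j * qfact q j * qfact q (p - j))))"
    unfolding L prod.distrib prod_constant c Q prod_br_node[OF j] ..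
  also have "\<dots> = ((- q) ^ j * q powi (- int j) * (- 1) ^ j) * (?h ^ p * (\<Prod>t=1..p. q powi (int t - int j))) * (ebin d p j * (qfact q j * qfact q (p - j)))"
    by (simp only: mult_ac)
  also have "ebin d p j * (qfact q j * qfact q (p - j)) = qfact q (p + (d + j)) / qfact q (d + j)"
    by (simp add: ebin_def add_ac)
  also have "((- q) ^ j * q powi (- int j) * (- 1) ^ j) * (?h ^ p * (\<Prod>t=1..p. q powi (int t - int j))) * (qfact q (p + (d + j)) / qfact q (d + j))
     = (q powi (- int (d * p)) * (q ^ d) ^ p) * (?h ^ p * (\<Prod>t=1..p. q powi (int t - int j))) * (qfact q (p + (d + j)) / qfact q (d + j))"
    unfolding qq dp ..
  also have "\<dots> = q powi (- int (d * p)) * (\<Prod>t=1..p. q powi (- 2 * int j) - q ^ (2 * (t + d)))"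
    unfolding Rr prod.distrib prod_constant prod_br_shift card_atLeastAtMost by (simp add: mult_ac)
  finally show ?thesis .
qed

text \<open>
  Lagrange interpolation: both sides are polynomials in \<open>\<xi>\<close> of degree at most \<open>p\<close>, and they agree at
  the \<open>p + 1\<close> points \<open>q powi (- 2 j)\<close> with \<open>j \<le> p\<close>.
\<close>

lemma esum_polynomial:
  "(\<Sum>j\<le>p. (- q) ^ j * ebin d p j * (\<Prod>t\<in>{..p} - {j}. 1 - q ^ (2 * t) * \<xi>))
    = q powi (- int (d * p)) * (\<Prod>t=1..p. \<xi> - q ^ (2 * (t + d)))"
proof -
  define L where "L = (\<Sum>j\<le>p. smult ((- q) ^ j * ebin d p j) (\<Prod>t\<in>{..p} - {j}. [:1, (- (q ^ (2 * t))):]))"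
  define R where "R = smult (q powi (- int (d * p))) (\<Prod>t=1..p. [:(- (q ^ (2 * (t + d)))), 1:])"
  have dl: "degree ([:a, b:] :: complex poly) \<le> 1" for a b by simp
  have pr: "degree (\<Prod>t\<in>A. [:f t, g t:] :: complex poly) \<le> card A" for A :: "nat set" and f g
  proof (induction A rule: infinite_finite_induct)
    case (insert x A)
    have "degree ([:f x, g x:] * (\<Prod>t\<in>A. [:f t, g t:])) \<le> degree [:f x, g x:] + degree (\<Prod>t\<in>A. [:f t, g t:])"
      by (rule degree_mult_le)
    then show ?case using insert dl[of "f x" "g x"] by simp
  qed simp_all
  have "degree L \<le> p"
    unfolding L_def
  proof (rule degree_sum_le)
    fix j assume "j \<in> {..p}"
    then have "degree (\<Prod>t\<in>{..p} - {j}. [:1, (- (q ^ (2 * t))):]) \<le> p"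
      using pr[of "\<lambda>_. 1" "\<lambda>t. - (q ^ (2 * t))" "{..p} - {j}"] by simp
    then show "degree (smult ((- q) ^ j * ebin d p j) (\<Prod>t\<in>{..p} - {j}. [:1, (- (q ^ (2 * t))):])) \<le> p"
      by (rule order_trans[OF degree_smult_le])
  qed simp
  moreover have "degree R \<le> p"
    unfolding R_def using pr[of "\<lambda>t. - (q ^ (2 * (t + d)))" "\<lambda>_. 1" "{1..p}"]
    by (intro order_trans[OF degree_smult_le]) simp
  moreover have "card ((\<lambda>j. q powi (- 2 * int j)) ` {..p}) = Suc p"
    by (subst card_image) (auto simp: inj_on_def powi_eq_iff)
  moreover have "poly L x = poly R x" if "x \<in> (\<lambda>j. q powi (- 2 * int j)) ` {..p}" for x
  proof -
    from that obtain n where n: "n \<le> p" and x: "x = q powi (- 2 * int n)" by auto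
    have z: "(\<Prod>t\<in>{..p} - {j}. 1 - q ^ (2 * t) * x) = 0" if "j \<noteq> n" "j \<le> p" for j
    proof (rule prod_zero)
      have "q ^ (2 * n) * x = 1"
        unfolding x power_int_of_nat[symmetric] power_int_add[symmetric, OF disjI1[OF q_nz]] by simp
      then show "\<exists>t\<in>{..p} - {j}. 1 - q ^ (2 * t) * x = 0"
        using that n by (intro bexI[of _ n]) simp_all
    qed simp
    have "poly L x = (\<Sum>j\<le>p. (- q) ^ j * ebin d p j * (\<Prod>t\<in>{..p} - {j}. 1 - q ^ (2 * t) * x))"
      unfolding L_def poly_sum poly_smult poly_prod by (simp add: mult.commute)
    also have "\<dots> = (\<Sum>j\<le>p. if j = n then (- q) ^ n * ebin d p n * (\<Prod>t\<in>{..p} - {n}. 1 - q ^ (2 * t) * x) else 0)"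
      by (rule sum.cong) (auto simp: z)
    also have "\<dots> = (- q) ^ n * ebin d p n * (\<Prod>t\<in>{..p} - {n}. 1 - q ^ (2 * t) * x)" using n by simp
    also have "\<dots> = poly R x"
      unfolding x node_identity[OF n] R_def poly_smult poly_prod by simp
    finally show ?thesis .
  qed
  ultimately have "L = R"
    by (intro poly_eqI_degree[of "(\<lambda>j. q powi (- 2 * int j)) ` {..p}"]) simp_all
  moreover have "poly L \<xi> = (\<Sum>j\<le>p. (- q) ^ j * ebin d p j * (\<Prod>t\<in>{..p} - {j}. 1 - q ^ (2 * t) * \<xi>))"
    unfolding L_def poly_sum poly_smult poly_prod by (simp add: mult.commute)
  moreover have "poly R \<xi> = q powi (- int (d * p)) * (\<Prod>t=1..p. \<xi> - q ^ (2 * (t + d)))"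
    unfolding R_def poly_smult poly_prod by simp
  ultimately show ?thesis by simp
qed

lemma esum_closed:
  assumes nz: "\<And>t. t \<le> p \<Longrightarrow> 1 - q ^ (2 * t) * \<xi> \<noteq> 0"
  shows "esum d p \<xi> = q powi (- int (d * p)) * (\<Prod>t=1..p. (\<xi> - q ^ (2 * (t + d))) / (1 - q ^ (2 * t) * \<xi>))"
proof -
  let ?D = "\<Prod>t=1..p. 1 - q ^ (2 * t) * \<xi>"
  have D: "?D \<noteq> 0" using nz by simp
  have "(1 - \<xi>) / (1 - q ^ (2 * j) * \<xi>) * ?D = (\<Prod>t\<in>{..p} - {j}. 1 - q ^ (2 * t) * \<xi>)" if j: "j \<le> p" for j
  proof -
    have "(1 - \<xi>) * ?D = (\<Prod>t\<in>insert 0 {1..p}. 1 - q ^ (2 * t) * \<xi>)" by simp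
    also have "insert 0 {1..p} = {..p}" by auto
    also have "(\<Prod>t\<le>p. 1 - q ^ (2 * t) * \<xi>) = (1 - q ^ (2 * j) * \<xi>) * (\<Prod>t\<in>{..p} - {j}. 1 - q ^ (2 * t) * \<xi>)"
      using j by (intro prod.remove) auto
    finally show ?thesis using nz[OF j] by simp
  qed
  note k = this
  have "esum d p \<xi> * ?D = (\<Sum>j\<le>p. (- q) ^ j * ebin d p j * (\<Prod>t\<in>{..p} - {j}. 1 - q ^ (2 * t) * \<xi>))"
    unfolding esum_def sum_distrib_right
  proof (rule sum.cong[OF refl])
    fix j assume "j \<in> {..p}"
    then have j: "j \<le> p" by simp
    have "(- q) ^ j * ((1 - \<xi>) / (1 - q ^ (2 * j) * \<xi>)) * ebin d p j * ?D
      = (- q) ^ j * ebin d p j * ((1 - \<xi>) / (1 - q ^ (2 * j) * \<xi>) * ?D)" by (simp only: mult_ac)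
    then show "(- q) ^ j * ((1 - \<xi>) / (1 - q ^ (2 * j) * \<xi>)) * ebin d p j * ?D
      = (- q) ^ j * ebin d p j * (\<Prod>t\<in>{..p} - {j}. 1 - q ^ (2 * t) * \<xi>)" unfolding k[OF j] .
  qed
  also note esum_polynomial
  finally show ?thesis using D by (simp add: prod_dividef eq_divide_eq)
qed

text \<open>
  The substitution \<open>\<xi> \<mapsto> q ^ (2 d) / \<xi>\<close> interchanges, up to a power of \<open>q\<close>, the numerator and the
  denominator of every factor of the product form.
\<close>

lemma esum_unitary:
  assumes nz: "\<And>t. t \<le> p \<Longrightarrow> 1 - q ^ (2 * t) * \<xi> \<noteq> 0" "\<And>t. t \<le> p \<Longrightarrow> 1 - q ^ (2 * t) * \<xi>' \<noteq> 0"
    and \<xi>: "\<xi> * \<xi>' = q ^ (2 * d)"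
  shows "esum d p \<xi>' * esum d p \<xi> = 1"
proof -
  have \<xi>nz: "\<xi> \<noteq> 0" using \<xi> by auto
  have \<xi>': "\<xi>' = q ^ (2 * d) / \<xi>" using \<xi> \<xi>nz by (simp add: field_simps)
  have f: "(\<xi>' - q ^ (2 * (t + d))) / (1 - q ^ (2 * t) * \<xi>') * ((\<xi> - q ^ (2 * (t + d))) / (1 - q ^ (2 * t) * \<xi>)) = q ^ (2 * d)"
    if t: "t \<le> p" for t
  proof -
    have a: "\<xi>' - q ^ (2 * (t + d)) = q ^ (2 * d) / \<xi> * (1 - q ^ (2 * t) * \<xi>)"
      using \<xi>nz unfolding \<xi>' by (simp add: field_simps power_add)
    have b: "1 - q ^ (2 * t) * \<xi>' = (\<xi> - q ^ (2 * (t + d))) / \<xi>"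
      using \<xi>nz unfolding \<xi>' by (simp add: field_simps power_add)
    have c: "\<xi> - q ^ (2 * (t + d)) \<noteq> 0" using nz(2)[OF t] unfolding b by auto
    show ?thesis unfolding a b using nz(1)[OF t] c \<xi>nz by (simp add: divide_simps)
  qed
  have e: "esum d p \<xi> = q powi (- int (d * p)) * (\<Prod>t=1..p. (\<xi> - q ^ (2 * (t + d))) / (1 - q ^ (2 * t) * \<xi>))"
    "esum d p \<xi>' = q powi (- int (d * p)) * (\<Prod>t=1..p. (\<xi>' - q ^ (2 * (t + d))) / (1 - q ^ (2 * t) * \<xi>'))"
    by (rule esum_closed[OF nz(1)], assumption, rule esum_closed[OF nz(2)])
  have "esum d p \<xi>' * esum d p \<xi> = (q powi (- int (d * p)) * q powi (- int (d * p))) *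
     (\<Prod>t=1..p. (\<xi>' - q ^ (2 * (t + d))) / (1 - q ^ (2 * t) * \<xi>') * ((\<xi> - q ^ (2 * (t + d))) / (1 - q ^ (2 * t) * \<xi>)))"
    unfolding e prod.distrib by (simp only: mult_ac)
  also have "(\<Prod>t=1..p. (\<xi>' - q ^ (2 * (t + d))) / (1 - q ^ (2 * t) * \<xi>') * ((\<xi> - q ^ (2 * (t + d))) / (1 - q ^ (2 * t) * \<xi>)))
     = (\<Prod>t=1..p. q ^ (2 * d))" by (rule prod.cong[OF refl], rule f) simp
  also have "(q powi (- int (d * p)) * q powi (- int (d * p))) * (\<Prod>t=1..p. q ^ (2 * d)) = 1"
  proof -
    have "(q ^ (2 * d)) ^ p = q ^ (d * p) * q ^ (d * p)"
      by (simp add: power_mult[symmetric] power_add[symmetric] mult_2 distrib_right)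
    moreover have "inverse x * inverse x * (x * x) = 1" if "x \<noteq> 0" for x :: complex using that by (simp add: field_simps)
    ultimately show ?thesis by (simp add: power_int_minus del: of_nat_mult)
  qed
  finally show ?thesis .
qed

end

context qsl2
begin

lemma dpF_dpE_lowest:
  assumes u: "F u = 0" "u \<in> X (- l)" and n: "n \<le> k"
  shows "dpF n (dpE k u) = sc ((\<Prod>s=1..n. br (l - int k + int s)) / qfact q n) (dpE (k - n) u)"
  using n
proof (induction n)
  case (Suc n)
  obtain k' where k': "k - n = Suc k'" using Suc.prems by (cases "k - n") auto
  then have k'': "k - Suc n = k'" "int k = int n + int k' + 1" by auto
  have "F (dpE (Suc k') u) = sc (br (l - int k + int (Suc n))) (dpE k' u)"
    using F_dpE_Suc[OF u(2), of k'] br_minus[of "l - int k'"] k''(2) by (simp add: u(1) dE.zero algebra_simps)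
  then show ?case using Suc k'' by (simp add: dpF_Suc k' F.scale qfact_Suc)
qed simp

lemma dpF_dpE_lowest_0:
  assumes u: "F u = 0" "u \<in> X (- l)" and n: "n > k"
  shows "dpF n (dpE k u) = 0"
proof -
  obtain j where j: "n = Suc j + k" using n by (metis add.commute add_Suc_right less_iff_Suc_add)
  have "dpF (Suc j) u = sc (1 / br (int (Suc j))) (dpF j (F u))" by (simp add: dpF_F del: of_nat_Suc)
  then have "dpF (Suc j) u = 0" by (simp add: u(1) dF.zero)
  then have "sc (qfact q n / (qfact q (Suc j) * qfact q k)) (dpF n (dpE k u)) = 0"
    using dpF_dpF[of "Suc j" k "dpE k u"] dpF_dpE_lowest[OF u, of k k] by (simp add: j dF.scale)
  then show ?thesis by simp
qed

text \<open>
  The dynamical operator on vectors of weight \<open>h\<close> with unspecified coefficients and truncated at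
  \<open>N\<close>.
\<close>

definition dynA :: "nat \<Rightarrow> int \<Rightarrow> (nat \<Rightarrow> complex) \<Rightarrow> 'w \<Rightarrow> 'w" where
  "dynA N h c v = (\<Sum>j\<le>N. sc (c j) (dpE (j + nat (- h)) (dpF (j + nat h) v)))"

lemma sum_trunc:
  fixes p N :: nat
  assumes "p \<le> N" and "\<And>j. j \<le> p \<Longrightarrow> f j = sc (a j) w" and "\<And>j. p < j \<Longrightarrow> f j = 0"
  shows "(\<Sum>j\<le>N. sc (c j) (f j)) = sc (\<Sum>j\<le>p. c j * a j) w"
proof -
  have "(\<Sum>j\<le>N. sc (c j) (f j)) = (\<Sum>j\<le>p. sc (c j) (f j))"
    by (rule sum.mono_neutral_right) (use assms in auto)
  also have "\<dots> = (\<Sum>j\<le>p. sc (c j * a j) w)" by (rule sum.cong) (use assms in auto)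
  finally show ?thesis by (simp add: Vs.scale_sum_left)
qed

lemma prod_br_fact: "(\<Prod>s=1..n. br (int m + int s)) = qfact q (m + n) / qfact q m"
  using prod_br_shift[of m n] by (simp add: add_ac)

text \<open>
  Each term of the series multiplies \<open>E^(k) u\<close> by the same kind of coefficient, in weight \<open>- d\<close> as
  well as in weight \<open>d\<close>; hence the same scalar occurs in both directions.
\<close>

lemma dynA_lowest:
  assumes u: "F u = 0" "u \<in> X (- (2 * int k + int d))" and k: "k \<le> N"
  shows "dynA N (- int d) c (dpE k u) = sc (\<Sum>j\<le>k. c j * ebin d k j) (dpE (k + d) u)"
    and "dynA N (int d) c (dpE (k + d) u) = sc (\<Sum>j\<le>k. c j * ebin d k j) (dpE k u)"
proof -
  show "dynA N (- int d) c (dpE k u) = sc (\<Sum>j\<le>k. c j * ebin d k j) (dpE (k + d) u)"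
    unfolding dynA_def
  proof (rule sum_trunc[OF k])
    fix j assume j: "j \<le> k"
    have "2 * int k + int d - int k + int s = int (k + d) + int s" for s by simp
    then have "dpF j (dpE k u) = sc (qfact q (k + d + j) / qfact q (k + d) / qfact q j) (dpE (k - j) u)"
      using dpF_dpE_lowest[OF u j] prod_br_fact[of "k + d" j] by simp
    then show "dpE (j + nat (- (- int d))) (dpF (j + nat (- int d)) (dpE k u)) = sc (ebin d k j) (dpE (k + d) u)"
      using j by (simp add: dE.scale dpE_dpE ebin_def add_ac)
  next
    fix j assume "k < j"
    then show "dpE (j + nat (- (- int d))) (dpF (j + nat (- int d)) (dpE k u)) = 0"
      using dpF_dpE_lowest_0[OF u] by (simp add: dE.zero)
  qed
  show "dynA N (int d) c (dpE (k + d) u) = sc (\<Sum>j\<le>k. c j * ebin d k j) (dpE k u)"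
    unfolding dynA_def
  proof (rule sum_trunc[OF k])
    fix j assume j: "j \<le> k"
    have "2 * int k + int d - int (k + d) + int s = int k + int s" for s by simp
    then have "dpF (j + d) (dpE (k + d) u) = sc (qfact q (k + (j + d)) / qfact q k / qfact q (j + d)) (dpE (k - j) u)"
      using dpF_dpE_lowest[OF u, of "j + d" "k + d"] prod_br_fact[of k "j + d"] j by simp
    then show "dpE (j + nat (- int d)) (dpF (j + nat (int d)) (dpE (k + d) u)) = sc (ebin d k j) (dpE k u)"
      using j by (simp add: dE.scale dpE_dpE ebin_def add_ac)
  next
    fix j assume "k < j"
    then show "dpE (j + nat (- int d)) (dpF (j + nat (int d)) (dpE (k + d) u)) = 0"
      using dpF_dpE_lowest_0[OF u, of "k + d" "j + d"] by (simp add: dE.zero)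
  qed
qed

text \<open>
  The symmetry exchanging \<open>E\<close> and \<open>F\<close>, which carries lowest weight vectors to highest weight
  vectors.
\<close>

lemma qsl2_swap: "qsl2 q sc F E (\<lambda>h. X (- h))"
proof unfold_locales
  fix w h assume w: "w \<in> X (- h)"
  show "F w \<in> X (- (h + 2))" using X_F[OF w] by simp
  show "E w \<in> X (- (h - 2))" using X_E[OF w] by simp
  show "sc c w \<in> X (- h)" for c by (rule X_scale[OF w])
  show "F (E w) = E (F w) + sc (br h) w" using E_F_X[OF w] by (simp add: br_minus)
qed

text \<open>
  The terms with \<open>j > k\<close> vanish since their coefficient is a product of consecutive brackets that
  contains \<open>br 0\<close>.
\<close>

lemma dynA_highest:
  assumes u: "E u = 0" "u \<in> X (2 * int k + int d)" and k: "k \<le> N"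
  shows "dynA N (int d) c (dpF k u) = sc (\<Sum>j\<le>k. c j * ebin d k j) (dpF (k + d) u)"
    and "dynA N (- int d) c (dpF (k + d) u) = sc (\<Sum>j\<le>k. c j * ebin d k j) (dpF k u)"
proof -
  interpret w: qsl2 q sc F E "\<lambda>h. X (- h)" by (rule qsl2_swap)
  have u': "u \<in> X (- (- (2 * int k + int d)))" using u(2) by (simp only: minus_minus)
  note low = w.dpF_dpE_lowest[OF u(1) u']
  have vanish: "(\<Prod>s=1..n. br (int k - int j + int s)) = 0" if "k < j" "j \<le> k + n" for j n
    by (rule prod_zero) (use that in \<open>auto intro!: bexI[of _ "j - k"]\<close>)
  show "dynA N (int d) c (dpF k u) = sc (\<Sum>j\<le>k. c j * ebin d k j) (dpF (k + d) u)"
    unfolding dynA_def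
  proof (rule sum_trunc[OF k])
    fix j assume j: "j \<le> k"
    have "2 * int k + int d - int (j + d + k) + int s = int (k - j) + int s" for s using j by simp
    then have "dpE j (dpF (j + d + k) u) = sc (qfact q k / qfact q (k - j) / qfact q j) (dpF (d + k) u)"
      using low[of j "j + d + k"] prod_br_fact[of "k - j" j] j by simp
    then show "dpE (j + nat (- int d)) (dpF (j + nat (int d)) (dpF k u)) = sc (ebin d k j) (dpF (k + d) u)"
      using j by (simp add: dE.scale dpF_dpF ebin_def add_ac)
  next
    fix j assume j: "k < j"
    have "2 * int k + int d - int (j + d + k) + int s = int k - int j + int s" for s by simp
    then have "dpE j (dpF (j + d + k) u) = 0"
      using low[of j "j + d + k"] vanish[OF j, of j] by simp
    then show "dpE (j + nat (- int d)) (dpF (j + nat (int d)) (dpF k u)) = 0"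
      by (simp add: dE.scale dpF_dpF)
  qed
  show "dynA N (- int d) c (dpF (k + d) u) = sc (\<Sum>j\<le>k. c j * ebin d k j) (dpF k u)"
    unfolding dynA_def
  proof (rule sum_trunc[OF k])
    fix j assume j: "j \<le> k"
    have "2 * int k + int d - int (j + (k + d)) + int s = int (k - j) + int s" for s using j by simp
    then have "dpE (j + d) (dpF (j + (k + d)) u) = sc (qfact q (k + d) / qfact q (k - j) / qfact q (j + d)) (dpF k u)"
      using low[of "j + d" "j + (k + d)"] prod_br_fact[of "k - j" "j + d"] j by simp
    then show "dpE (j + nat (- (- int d))) (dpF (j + nat (- int d)) (dpF (k + d) u)) = sc (ebin d k j) (dpF k u)"
      using j by (simp add: dE.scale dpF_dpF ebin_def add_ac)
  next
    fix j assume j: "k < j"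
    have "2 * int k + int d - int (j + (k + d)) + int s = int k - int j + int s" for s by simp
    then have "dpE (j + d) (dpF (j + (k + d)) u) = 0"
      using low[of "j + d" "j + (k + d)"] vanish[OF j, of "j + d"] by simp
    then show "dpE (j + nat (- (- int d))) (dpF (j + nat (- int d)) (dpF (k + d) u)) = 0"
      by (simp add: dE.scale dpF_dpF)
  qed
qed

text \<open>
  In weights \<open>h \<le> 0\<close> the operator \<open>F\<close> maps \<open>E^(k + 1) u\<close> to a non-zero multiple of \<open>E^(k) u\<close>.  A
  decomposition of \<open>F w\<close>, which is killed by a smaller power of \<open>F\<close>, therefore lifts to one of \<open>w\<close>
  up to a vector in the kernel of \<open>F\<close>.
\<close>

lemma lowest_decomposition:
  assumes sub: "\<And>h. Vs.subspace (X h)"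
  shows "h \<le> 0 \<Longrightarrow> w \<in> X h \<Longrightarrow> (F ^^ n) w = 0 \<Longrightarrow>
    w \<in> Vs.span {dpE k u | k u. k < n \<and> F u = 0 \<and> u \<in> X (h - 2 * int k)}"
proof (induction n arbitrary: w h)
  case 0
  then show ?case by (simp add: Vs.span_zero)
next
  case (Suc n)
  let ?S = "\<lambda>n h. {dpE k u | k u. k < n \<and> F u = 0 \<and> u \<in> X (h - 2 * int k)}"
  have "(F ^^ n) (F w) = 0" using Suc.prems(3) by (simp add: funpow_swap1)
  then have "F w \<in> Vs.span (?S n (h - 2))"
    using Suc.IH[of "h - 2" "F w"] Suc.prems X_F by simp
  then have "\<exists>w'\<in>X h \<inter> Vs.span (?S (Suc n) h). F w' = F w"
  proof (induction rule: Vs.span_induct_alt)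
    case base
    show ?case using Vs.subspace_0[OF sub] Vs.span_zero F.zero by blast
  next
    case (step c x y)
    then obtain w' where w': "w' \<in> X h" "w' \<in> Vs.span (?S (Suc n) h)" "F w' = y" by blast
    obtain k u where x: "x = dpE k u" "k < n" "F u = 0" and u: "u \<in> X (h - 2 - 2 * int k)" using step by blast
    have u': "u \<in> X (h - 2 * int (Suc k))" using u by (simp add: algebra_simps)
    define a where "a = - br (h - 2 - 2 * int k + int k)"
    have a: "a \<noteq> 0" using Suc.prems(1) by (simp add: a_def)
    have "F (dpE (Suc k) u) = sc a x"
      using F_dpE_Suc[OF u, of k] by (simp add: x a_def dE.zero)
    then have "F (sc (c / a) (dpE (Suc k) u) + w') = sc c x + y"
      using a by (simp add: F.add F.scale w')
    moreover have "dpE (Suc k) u \<in> X h" using X_dpE[OF u', of "Suc k"] by simp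
    moreover have "dpE (Suc k) u \<in> ?S (Suc n) h" using x u' by blast
    then have "dpE (Suc k) u \<in> Vs.span (?S (Suc n) h)" by (rule Vs.span_base)
    ultimately show ?case using w'
      by (intro bexI[of _ "sc (c / a) (dpE (Suc k) u) + w'"] IntI Vs.span_add Vs.span_scale Vs.subspace_add[OF sub] X_scale) simp_all
  qed
  then obtain w' where w': "w' \<in> X h" "w' \<in> Vs.span (?S (Suc n) h)" "F w' = F w" by blast
  have "w - w' \<in> X h" using Suc.prems(2) w'(1) Vs.subspace_diff[OF sub] by blast
  then have "dpE 0 (w - w') \<in> ?S (Suc n) h" using w'(3) F.diff[of w w'] by (intro CollectI exI[of _ 0] exI[of _ "w - w'"]) simp
  then have "w - w' \<in> Vs.span (?S (Suc n) h)" by (simp add: Vs.span_base)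
  from Vs.span_add[OF this w'(2)] show ?case by simp
qed

lemma linear_dynA: "Vector_Spaces.linear sc sc (dynA N h c)"
  by unfold_locales
    (simp_all add: dynA_def dE.add dF.add dE.scale dF.scale Vs.scale_right_distrib sum.distrib Vs.scale_sum_right mult.commute)

text \<open>
  For \<open>h \<le> 0\<close> the vector \<open>w\<close> is a combination of vectors \<open>E^(k) u\<close> with \<open>F u = 0\<close>, for \<open>h > 0\<close> one of
  vectors \<open>F^(k) u\<close> with \<open>E u = 0\<close>.  On these both operators act by scalars.
\<close>

lemma dynA_unitary:
  assumes sub: "\<And>h. Vs.subspace (X h)" and w: "w \<in> X h"
    and nil: "(F ^^ Suc N) w = 0" "(E ^^ Suc N) w = 0"
    and one: "\<And>p. p \<le> N \<Longrightarrow> (\<Sum>j\<le>p. c' j * ebin (nat \<bar>h\<bar>) p j) * (\<Sum>j\<le>p. c j * ebin (nat \<bar>h\<bar>) p j) = 1"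
  shows "dynA N (- h) c' (dynA N h c w) = w"
proof -
  interpret A: Vector_Spaces.linear sc sc "dynA N n a" for n a by (rule linear_dynA)
  show ?thesis
  proof (cases "h \<le> 0")
    case True
    define d where "d = nat \<bar>h\<bar>"
    have h: "h = - int d" using True by (simp add: d_def)
    from lowest_decomposition[OF sub True w nil(1)] show ?thesis
    proof (induction rule: Vs.span_induct_alt)
      case (step a x y)
      then obtain k u where x: "x = dpE k u" "k < Suc N" "F u = 0" "u \<in> X (h - 2 * int k)" by blast
      have "u \<in> X (- (2 * int k + int d))" using x(4) h by (simp add: algebra_simps)
      from dynA_lowest[OF x(3) this, of N] have "dynA N (- h) c' (dynA N h c x) = x"
        using x(2) one[of k] unfolding x(1) h d_def[symmetric] h by (simp add: A.scale mult.commute)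
      then show ?case using step by (simp add: A.add A.scale)
    qed (simp add: A.zero)
  next
    case False
    interpret w: qsl2 q sc F E "\<lambda>h. X (- h)" by (rule qsl2_swap)
    define d where "d = nat \<bar>h\<bar>"
    have h: "h = int d" using False by (simp add: d_def)
    have w': "w \<in> X (- (- h))" using w by simp
    from w.lowest_decomposition[OF sub _ w' nil(2)] False
    have "w \<in> Vs.span {dpF k u |k u. k < Suc N \<and> E u = 0 \<and> u \<in> X (- (- h - 2 * int k))}" by simp
    then show ?thesis
    proof (induction rule: Vs.span_induct_alt)
      case (step a x y)
      then obtain k u where x: "x = dpF k u" "k < Suc N" "E u = 0" "u \<in> X (- (- h - 2 * int k))" by blast
      have "- (- h - 2 * int k) = 2 * int k + int d" using h by simp
      with x(4) have "u \<in> X (2 * int k + int d)" by (simp only:)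
      from dynA_highest[OF x(3) this, of N] have "dynA N (- h) c' (dynA N h c x) = x"
        using x(2) one[of k] unfolding x(1) h d_def[symmetric] h by (simp add: A.scale mult.commute)
      then show ?case using step by (simp add: A.add A.scale)
    qed (simp add: A.zero)
  qed
qed

end

section \<open>Transport of singular vectors in rank one\<close>

context qsl2
begin

lemma E_dpz: "E (dpz j w) = sc (br (j + 1)) (dpz (j + 1) w)"
proof (cases "j < 0")
  case True
  then show ?thesis by (cases "j = -1") (auto simp: dpz_def)
next
  case False
  then obtain m where "j = int m" by (metis not_le nonneg_int_cases not_less)
  then show ?thesis by (simp add: dpz_def E_dpE nat_add_distrib algebra_simps del: of_nat_Suc)
      (simp add: algebra_simps)
qed

lemma dpz_add: "dpz i (v + w) = dpz i v + dpz i w"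
  and dpz_scale: "dpz i (sc c w) = sc c (dpz i w)"
  and dpz_zero [simp]: "dpz i 0 = 0"
  by (simp_all add: dpz_def dE.add dE.scale)

lemma dpz_nat [simp]: "dpz (int n) w = dpE n w"
  by (simp add: dpz_def)

end

text \<open>
  \<open>T k u\<close> is the vector \<open>E^(k) x \<otimes> u\<close> for a fixed \<open>x\<close>, and \<open>E_T\<close> expresses the coproduct
  \<open>\<Delta> E = E \<otimes> K + 1 \<otimes> E\<close>.
\<close>

locale rank_one_step = V: qsl2 q scV E F X + W: qsl2 q scW EW FW XW
  for q :: complex
    and scV :: "complex \<Rightarrow> 'v::ab_group_add \<Rightarrow> 'v" and E F X
    and scW :: "complex \<Rightarrow> 'w::ab_group_add \<Rightarrow> 'w" and EW FW XW +
  fixes T :: "nat \<Rightarrow> 'v \<Rightarrow> 'w"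
  assumes T_lin: "Vector_Spaces.linear scV scW (T k)"
    and E_T: "u \<in> X h \<Longrightarrow>
      EW (T k u) = scW (q powi h * V.br (int (Suc k))) (T (Suc k) u) + T k (E u)"
begin

sublocale T: Vector_Spaces.linear scV scW "T k" for k by (rule T_lin)

text \<open>
  The sign and power of \<open>q\<close> that accompany the antipode of \<open>E^(i)\<close>; the exponent accounts for moving the
  torus to the right, where it acts on a vector of weight \<open>h\<close>.
\<close>

definition antipode_coeff :: "int \<Rightarrow> int \<Rightarrow> int \<Rightarrow> complex" where
  "antipode_coeff m i h = (-1) powi i * q powi (- m * h - i * (m - 1))"

lemma antipode_coeff_step:
  "antipode_coeff m i h * V.br (m + 1 - i) - antipode_coeff m (i - 1) (h + 2) * V.br i
    = q powi h * V.br (m + 1) * antipode_coeff (m + 1) i h"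
proof -
  have b: "V.br (m + 1) = q powi i * V.br (m + 1 - i) + q powi (- (m + 1 - i)) * V.br i"
    using V.br_add[of i "m + 1 - i"] by simp
  have s: "(-1) powi (i - 1) = - ((-1) powi i :: complex)"
    by (simp add: power_int_diff)
  have e1: "q powi h * q powi (- (m + 1) * h - i * (m + 1 - 1)) * q powi i
      = q powi (- m * h - i * (m - 1))"
    unfolding power_int_add[symmetric, OF disjI1[OF V.q_nz]]
    by (rule arg_cong[where f = "(powi) q"]) (simp add: algebra_simps)
  have e2: "q powi h * q powi (- (m + 1) * h - i * (m + 1 - 1)) * q powi (- (m + 1 - i))
      = q powi (- m * (h + 2) - (i - 1) * (m - 1))"
    unfolding power_int_add[symmetric, OF disjI1[OF V.q_nz]]
    by (rule arg_cong[where f = "(powi) q"]) (simp add: algebra_simps)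
  show ?thesis
    unfolding antipode_coeff_def b s e1[symmetric] e2[symmetric] by (simp add: algebra_simps)
qed

text \<open>
  The tensor product is generated over the powers of \<open>E\<close> by the vectors \<open>x \<otimes> u\<close>: solving the coproduct
  formula for \<open>T (Suc m) u\<close> and inserting the induction hypothesis twice, the coefficients combine
  by \<open>antipode_coeff_step\<close>.
\<close>

lemma T_expand:
  assumes "u \<in> X h"
  shows "T m u = (\<Sum>i\<le>m. scW (antipode_coeff (int m) (int i) h)
    (W.dpz (int m - int i) (T 0 (V.dpE i u))))"
  using assms
proof (induction m arbitrary: u h)
  case 0
  then show ?case using W.dpz_nat[of 0] by (simp add: antipode_coeff_def)
next
  case (Suc m)
  let ?D = "\<lambda>i. W.dpz (int (Suc m) - int i) (T 0 (V.dpE i u))"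
  let ?g = "\<lambda>i. antipode_coeff (int m) (int i)"
  have "EW (T m u) = (\<Sum>i\<le>m. scW (?g i h * V.br (int m + 1 - int i)) (?D i))"
    unfolding Suc.IH[OF Suc.prems] W.E.sum
    by (rule sum.cong) (simp_all add: W.E.scale W.E_dpz algebra_simps)
  also have "\<dots> = (\<Sum>i\<le>Suc m. scW (?g i h * V.br (int m + 1 - int i)) (?D i))"
    by simp
  finally have 1: "EW (T m u) = \<dots>" .
  have "T m (E u) = (\<Sum>i\<le>m. scW (antipode_coeff (int m) (int (Suc i) - 1) (h + 2) * V.br (int (Suc i)))
      (?D (Suc i)))"
    unfolding Suc.IH[OF V.X_E[OF Suc.prems]]
    by (rule sum.cong) (simp_all add: V.dpE_E T.scale W.dpz_scale algebra_simps)
  also have "\<dots> = (\<Sum>i\<le>Suc m. scW (antipode_coeff (int m) (int i - 1) (h + 2) * V.br (int i)) (?D i))"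
    by (subst sum.atMost_Suc_shift) simp
  finally have 2: "T m (E u) = \<dots>" .
  have "scW (q powi h * V.br (int (Suc m))) (T (Suc m) u) = EW (T m u) - T m (E u)"
    using E_T[OF Suc.prems, of m] by simp
  also have "\<dots> = (\<Sum>i\<le>Suc m. scW (q powi h * V.br (int (Suc m)) * antipode_coeff (int (Suc m)) (int i) h) (?D i))"
    unfolding 1 2 sum_subtractf[symmetric] W.Vs.scale_left_diff_distrib[symmetric]
    by (rule sum.cong) (use antipode_coeff_step[of "int m" _ h] in \<open>simp_all add: algebra_simps\<close>)
  also have "\<dots> = scW (q powi h * V.br (int (Suc m)))
      (\<Sum>i\<le>Suc m. scW (antipode_coeff (int (Suc m)) (int i) h) (?D i))"
    by (simp add: W.Vs.scale_sum_right del: sum.atMost_Suc)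
  finally show ?case
    by (simp add: W.Vs.scale_left_imp_eq del: sum.atMost_Suc of_nat_Suc)
qed

context
  fixes b N :: nat and n a :: int and y :: 'v
  assumes y: "y \<in> X (- n)" and a_def: "a = int b - n" and a_gt: "a > int N"
    and F_y: "V.dpF (Suc N) y = 0" and E_y: "V.dpE (Suc b) y = 0"
begin

text \<open>
  A quotient of \<open>q\<close>-binomials, \<open>[m, k]\<close> over \<open>[a, k]\<close>.
\<close>

definition qbin :: "int \<Rightarrow> nat \<Rightarrow> complex" where
  "qbin m k = (\<Prod>j<k. V.br (m - int j) / V.br (a - int j))"

definition ww_coeff :: "int \<Rightarrow> nat \<Rightarrow> complex" where
  "ww_coeff m k = (-1) powi (int k + int b + 1 - m)
     * q powi ((int b + 1) * n - int b * (int b + 1) + m * int b) * qbin m k"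

text \<open>
  After expanding the vectors \<open>E^(b + 1) x \<otimes> F^(k) y\<close> by \<open>T_expand\<close>, the vector \<open>ww m\<close> collects the
  second tensor factors of all terms with outer power \<open>E^(m)\<close>.
\<close>

definition ww :: "int \<Rightarrow> 'v" where
  "ww m = (\<Sum>k\<le>N. scV (ww_coeff m k) (V.dpz (int k + int b + 1 - m) (V.dpF k y)))"

lemma qbin_shift: "qbin (m + 1) (Suc k) = qbin m k * V.br (m + 1) / V.br (a - int k)"
proof -
  have "(\<Prod>j<Suc k. V.br (m + 1 - int j)) = V.br (m + 1) * (\<Prod>j<k. V.br (m - int j))"
    by (subst prod.lessThan_Suc_shift) simp
  then show ?thesis unfolding qbin_def prod_dividef by simp
qed

lemma qbin_step:
  assumes "k \<le> N"
  shows "qbin m k * V.br (int k + 1) + qbin m (Suc k) * V.br (a - m - int k - 1)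
    = V.br (a - m) * qbin (m + 1) (Suc k)"
proof -
  have nz: "V.br (a - int k) \<noteq> 0" using assms a_gt by simp
  have 1: "qbin m (Suc k) = qbin m k * V.br (m - int k) / V.br (a - int k)"
    by (simp add: qbin_def)
  have "V.br (a - int k) * V.br (int k + 1) + V.br (m - int k) * V.br (a - m - int k - 1)
      = V.br (a - m) * V.br (m + 1)"
    using V.br_identity[of a "int k" m] by (simp add: algebra_simps)
  moreover have "qbin m k * V.br (int k + 1) + qbin m (Suc k) * V.br (a - m - int k - 1)
      = qbin m k * (V.br (a - int k) * V.br (int k + 1) + V.br (m - int k) * V.br (a - m - int k - 1))
        / V.br (a - int k)"
    unfolding 1 using nz by (simp add: field_simps)
  ultimately show ?thesis unfolding qbin_shift by (simp add: field_simps)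
qed

text \<open>
  The reason for the shape of the coefficients: \<open>F\<close> takes each of the collected vectors to a multiple of
  the next.  The multiple is zero exactly for \<open>m = a\<close>, so that the vectors below \<open>a + 1\<close> and those
  above it are independent of each other: the former are zero (\<open>ww_low\<close>), the latter are the divided
  powers of \<open>F\<close> applied to \<open>ww (a + 1)\<close> (\<open>ww_high\<close>).
\<close>

lemma F_ww: "scV (q powi int b) (F (ww m)) = scV (V.br (a - m)) (ww (m + 1))"
proof -
  let ?D = "\<lambda>k. V.dpz (int k + int b - m) (V.dpF k y)"
  let ?s = "\<lambda>j. (-1 :: complex) powi (j + int b + 1 - m)"
  let ?C = "q powi ((int b + 1) * n - int b * (int b + 1) + m * int b)"
  have D0: "?D (Suc N) = 0" by (simp add: F_y)
  have "F (ww m) = (\<Sum>k\<le>N. scV (ww_coeff m k) (V.dpz (int k + int b + 1 - m) (F (V.dpF k y))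
      - scV (V.br (a - m - int k)) (?D k)))"
    unfolding ww_def V.F.sum
  proof (rule sum.cong)
    fix k assume "k \<in> {..N}"
    have "V.dpF k y \<in> X (- n - 2 * int k)" by (rule V.X_dpF[OF y])
    from V.F_dpz[OF this, of "int k + int b + 1 - m"]
    have "F (V.dpz (int k + int b + 1 - m) (V.dpF k y))
      = V.dpz (int k + int b + 1 - m) (F (V.dpF k y)) - scV (V.br (a - m - int k)) (?D k)"
      by (simp add: a_def algebra_simps)
    then show "F (scV (ww_coeff m k) (V.dpz (int k + int b + 1 - m) (V.dpF k y)))
      = scV (ww_coeff m k) (V.dpz (int k + int b + 1 - m) (F (V.dpF k y))
        - scV (V.br (a - m - int k)) (?D k))"
      by (simp only: V.F.scale)
  qed simp
  also have "\<dots> = (\<Sum>k\<le>N. scV (ww_coeff m k * V.br (int (Suc k))) (?D (Suc k)))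
      - (\<Sum>k\<le>Suc N. scV (ww_coeff m k * V.br (a - m - int k)) (?D k))"
    using D0 by (simp add: sum_subtractf[symmetric] V.F_dpF V.dpz_scale
        V.Vs.scale_right_diff_distrib algebra_simps)
  also have "(\<Sum>k\<le>Suc N. scV (ww_coeff m k * V.br (a - m - int k)) (?D k))
      = scV (ww_coeff m 0 * V.br (a - m)) (?D 0)
        + (\<Sum>k\<le>N. scV (ww_coeff m (Suc k) * V.br (a - m - int k - 1)) (?D (Suc k)))"
    by (subst sum.atMost_Suc_shift) (simp add: algebra_simps)
  finally have fw: "F (ww m) = (\<Sum>k\<le>N. scV (ww_coeff m k * V.br (int (Suc k))) (?D (Suc k)))
      - (scV (ww_coeff m 0 * V.br (a - m)) (?D 0)
        + (\<Sum>k\<le>N. scV (ww_coeff m (Suc k) * V.br (a - m - int k - 1)) (?D (Suc k))))" .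
  have 1: "scV (q powi int b) (F (ww m)) = scV (- (q powi int b * ww_coeff m 0 * V.br (a - m))) (?D 0)
      + (\<Sum>k\<le>N. scV (q powi int b * (ww_coeff m k * V.br (int (Suc k))
          - ww_coeff m (Suc k) * V.br (a - m - int k - 1))) (?D (Suc k)))"
    unfolding fw right_diff_distrib V.Vs.scale_left_diff_distrib sum_subtractf
      V.Vs.scale_right_diff_distrib V.Vs.scale_right_distrib V.Vs.scale_sum_right V.Vs.scale_scale
    by (simp add: V.Vs.scale_minus_left mult.assoc)
  have "ww (m + 1) = (\<Sum>k\<le>Suc N. scV (ww_coeff (m + 1) k) (?D k))"
    using D0 by (simp add: ww_def)
  also have "\<dots> = scV (ww_coeff (m + 1) 0) (?D 0) + (\<Sum>k\<le>N. scV (ww_coeff (m + 1) (Suc k)) (?D (Suc k)))"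
    by (rule sum.atMost_Suc_shift)
  finally have 2: "scV (V.br (a - m)) (ww (m + 1)) = scV (V.br (a - m) * ww_coeff (m + 1) 0) (?D 0)
      + (\<Sum>k\<le>N. scV (V.br (a - m) * ww_coeff (m + 1) (Suc k)) (?D (Suc k)))"
    by (simp add: V.Vs.scale_right_distrib V.Vs.scale_sum_right)
  have C: "q powi ((int b + 1) * n - int b * (int b + 1) + (m + 1) * int b) = q powi int b * ?C"
    unfolding power_int_add[symmetric, OF disjI1[OF V.q_nz]]
    by (rule arg_cong[where f = "(powi) q"]) (simp add: algebra_simps)
  have s0: "(-1 :: complex) powi (int b + 1 - m) = - ((-1) powi (int b - m))"
    using power_int_add[of "-1::complex" "int b - m" 1] by (simp add: algebra_simps)
  have c0: "- (q powi int b * ww_coeff m 0 * V.br (a - m)) = V.br (a - m) * ww_coeff (m + 1) 0"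
    unfolding ww_coeff_def C by (simp add: s0 qbin_def)
  have cS: "q powi int b * (ww_coeff m k * V.br (int (Suc k)) - ww_coeff m (Suc k) * V.br (a - m - int k - 1))
      = V.br (a - m) * ww_coeff (m + 1) (Suc k)" if "k \<le> N" for k
  proof -
    have sS: "(-1 :: complex) powi (int (Suc k) + int b + 1 - m) = - ?s (int k)"
      using power_int_add[of "-1::complex" "int k + int b + 1 - m" 1] by (simp add: algebra_simps)
    have sS': "(-1 :: complex) powi (int (Suc k) + int b + 1 - (m + 1)) = ?s (int k)"
      by (simp add: algebra_simps)
    have "q powi int b * (ww_coeff m k * V.br (int (Suc k)) - ww_coeff m (Suc k) * V.br (a - m - int k - 1))
      = q powi int b * ?C * ?s (int k)
        * (qbin m k * V.br (int k + 1) + qbin m (Suc k) * V.br (a - m - int k - 1))"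
      unfolding ww_coeff_def sS by (simp add: algebra_simps)
    then show ?thesis unfolding qbin_step[OF that] ww_coeff_def sS' C by (simp add: algebra_simps)
  qed
  show ?thesis
    unfolding 1 2 c0 by (intro arg_cong2[where f = "(+)"] refl sum.cong) (simp only: cS atMost_iff)
qed

lemma ww_low: "m \<le> nat a \<Longrightarrow> ww (int m) = 0"
proof (induction m)
  case 0
  have "qbin 0 (Suc k) = 0" for k by (subst qbin_def, subst prod.lessThan_Suc_shift) simp
  then have "scV (ww_coeff 0 k) (V.dpz (int k + int b + 1 - 0) (V.dpF k y)) = 0" for k
    using E_y by (cases k) (simp_all add: ww_coeff_def V.dpz_def nat_add_distrib)
  then show ?case unfolding ww_def by (intro sum.neutral ballI) (simp only: of_nat_0)
next
  case (Suc m)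
  then have "V.br (a - int m) \<noteq> 0" using a_gt by simp
  moreover have "scV (V.br (a - int m)) (ww (int m + 1)) = 0"
    using F_ww[of "int m"] Suc by simp
  ultimately show ?case by (simp add: algebra_simps)
qed

lemma ww_high: "ww (a + 1 + int k) = scV ((-1) ^ k * q powi (int b * int k)) (V.dpF k (ww (a + 1)))"
proof (induction k)
  case (Suc k)
  have e: "q powi (int b * int (Suc k)) = q powi int b * q powi (int b * int k)"
    by (simp add: algebra_simps power_int_add)
  have "scV (V.br (- int (Suc k))) (ww (a + 1 + int (Suc k))) = scV (q powi int b) (F (ww (a + 1 + int k)))"
    using F_ww[of "a + 1 + int k"] by (simp add: algebra_simps)
  also have "\<dots> = scV (V.br (- int (Suc k)))
      (scV ((-1) ^ Suc k * q powi (int b * int (Suc k))) (V.dpF (Suc k) (ww (a + 1))))"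
    unfolding Suc.IH V.F.scale V.F_dpF V.br_minus e by (simp add: algebra_simps)
  finally have "scV (V.br (- int (Suc k))) (ww (a + 1 + int (Suc k))) = \<dots>" .
  moreover have "V.br (- int (Suc k)) \<noteq> 0" by simp
  ultimately show ?case using V.Vs.scale_left_imp_eq by blast
qed simp

text \<open>
  This is the dynamical operator applied to \<open>y\<close>, up to a factor: all powers of \<open>q\<close> apart from
  \<open>q powi n\<close> cancel, and the quotient of binomials telescopes.
\<close>

lemma ww_top:
  "ww (a + 1) = scV (q powi n) (\<Sum>k\<le>N. scV ((-1) powi (int k + n) * V.br (a + 1) / V.br (a + 1 - int k))
     (V.dpz (int k + n) (V.dpF k y)))"
proof -
  have q: "qbin (a + 1) k = V.br (a + 1) / V.br (a + 1 - int k)" if "k \<le> N" for k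
    using that
  proof (induction k)
    case 0
    then show ?case using a_gt by (simp add: qbin_def)
  next
    case (Suc k)
    have "V.br (a - int k) \<noteq> 0" "V.br (a + 1 - int k) \<noteq> 0" using a_gt Suc by auto
    then show ?case using Suc by (simp add: qbin_def algebra_simps)
  qed
  have e: "q powi ((int b + 1) * n - int b * (int b + 1) + (a + 1) * int b) = q powi n"
    by (rule arg_cong[where f = "(powi) q"]) (simp add: a_def algebra_simps)
  have i: "int k + int b + 1 - (a + 1) = int k + n" for k by (simp add: a_def)
  show ?thesis
    unfolding ww_def ww_coeff_def e i V.Vs.scale_sum_right
    by (rule sum.cong) (simp_all add: q mult_ac)
qed

text \<open>
  Chosen so that \<open>lead_coeffs k\<close> times the coefficient in the expansion of \<open>T (Suc b)\<close> becomes \<open>ww_coeff m k\<close>.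
\<close>

definition lead_coeffs :: "nat \<Rightarrow> complex" where
  "lead_coeffs k = q powi (- (int b + 2) * int k) * qfact q k / (\<Prod>j<k. V.br (a - int j))"

lemma prod_br_qfact: "(\<Prod>l<k. V.br (int (k + j) - int l)) = qfact q (k + j) / qfact q j"
proof (induction k)
  case (Suc k)
  have "(\<Prod>l<Suc k. V.br (int (Suc k + j) - int l)) = V.br (int (Suc (k + j))) * (\<Prod>l<k. V.br (int (k + j) - int l))"
    by (subst prod.lessThan_Suc_shift) (simp add: algebra_simps)
  then show ?case using Suc by (simp add: V.qfact_Suc)
qed simp

lemma transport:
  assumes K: "K \<ge> N + b"
  shows "(\<Sum>k\<le>N. scW (lead_coeffs k) (W.dpE k (T (Suc b) (V.dpF k y))))
    = (\<Sum>k\<le>K. scW ((-1) ^ k * q powi (int b * int k)) (W.dpE (nat a + 1 + k) (T 0 (V.dpF k (ww (a + 1))))))"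
    (is "?Y = ?R")
proof -
  define L where "L = nat a + 1 + K"
  let ?t = "\<lambda>k m. scW (ww_coeff (int m) k) (W.dpE m (T 0 (V.dpz (int k + int b + 1 - int m) (V.dpF k y))))"
  have "scW (lead_coeffs k) (W.dpE k (T (Suc b) (V.dpF k y))) = (\<Sum>m\<le>L. ?t k m)" if k: "k \<le> N" for k
  proof -
    have "V.dpF k y \<in> X (- n - 2 * int k)" by (rule V.X_dpF[OF y])
    note T_expand[OF this, of "Suc b"]
    then have "scW (lead_coeffs k) (W.dpE k (T (Suc b) (V.dpF k y)))
      = (\<Sum>i\<le>Suc b. scW (lead_coeffs k * antipode_coeff (int (Suc b)) (int i) (- n - 2 * int k))
          (W.dpE k (W.dpz (int (Suc b) - int i) (T 0 (V.dpE i (V.dpF k y))))))"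
      by (simp add: W.dE.sum W.dE.scale W.Vs.scale_sum_right del: sum.atMost_Suc)
    also have "\<dots> = (\<Sum>i\<le>Suc b. ?t k (k + Suc b - i))"
    proof (rule sum.cong)
      fix i assume "i \<in> {..Suc b}"
      then obtain j where j: "Suc b = i + j" by (metis atMost_iff le_Suc_ex)
      have m: "k + Suc b - i = k + j" using j by simp
      have ij: "int (Suc b) - int i = int j" "int k + int b + 1 - int (k + j) = int i"
        using j by linarith+
      have e: "q powi (- (int b + 2) * int k) * q powi (- int (Suc b) * (- n - 2 * int k) - int i * (int (Suc b) - 1))
        = q powi ((int b + 1) * n - int b * (int b + 1) + int (k + j) * int b)"
      proof -
        have i: "int i = int b + 1 - int j" using j by linarith
        show ?thesis
          unfolding power_int_add[symmetric, OF disjI1[OF V.q_nz]] i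
          by (rule arg_cong[where f = "(powi) q"]) (simp add: algebra_simps)
      qed
      have P: "(\<Prod>j<k. V.br (a - int j)) \<noteq> 0" using a_gt k by simp
      have c: "lead_coeffs k * antipode_coeff (int (Suc b)) (int i) (- n - 2 * int k)
          * (qfact q (k + j) / (qfact q k * qfact q j)) = ww_coeff (int (k + j)) k"
        unfolding lead_coeffs_def antipode_coeff_def ww_coeff_def qbin_def prod_dividef prod_br_qfact e[symmetric] ij
        using P by (simp add: field_simps)
      show "scW (lead_coeffs k * antipode_coeff (int (Suc b)) (int i) (- n - 2 * int k))
          (W.dpE k (W.dpz (int (Suc b) - int i) (T 0 (V.dpE i (V.dpF k y))))) = ?t k (k + Suc b - i)"
        unfolding m ij W.dpz_nat W.dpE_dpE V.dpz_nat c[symmetric] by (simp add: mult.assoc)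
    qed simp
    also have "\<dots> = (\<Sum>m\<in>{k..k + Suc b}. ?t k m)"
      by (rule sum.reindex_bij_witness[of _ "\<lambda>m. k + Suc b - m" "\<lambda>i. k + Suc b - i"]) auto
    also have "\<dots> = (\<Sum>m\<le>L. ?t k m)"
    proof (rule sum.mono_neutral_left)
      show "{k..k + Suc b} \<subseteq> {..L}" using K k a_gt by (auto simp: L_def)
      show "\<forall>m\<in>{..L} - {k..k + Suc b}. ?t k m = 0"
      proof
        fix m assume m: "m \<in> {..L} - {k..k + Suc b}"
        show "?t k m = 0"
        proof (cases "m < k")
          case True
          then have "ww_coeff (int m) k = 0" by (auto simp: ww_coeff_def qbin_def)
          then show ?thesis by simp
        next
          case False
          with m have "int k + int b + 1 - int m < 0" by auto
          then show ?thesis by (simp add: V.dpz_def)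
        qed
      qed
    qed simp
    finally show ?thesis .
  qed
  then have "?Y = (\<Sum>k\<le>N. \<Sum>m\<le>L. ?t k m)" by simp
  also have "\<dots> = (\<Sum>m\<le>L. W.dpE m (T 0 (ww (int m))))"
    by (subst sum.swap) (simp add: ww_def T.sum T.scale W.dE.sum W.dE.scale)
  also have "\<dots> = (\<Sum>m\<in>{nat a + 1..L}. W.dpE m (T 0 (ww (int m))))"
    by (rule sum.mono_neutral_right) (auto simp: ww_low)
  also have "\<dots> = (\<Sum>k\<le>K. W.dpE (nat a + 1 + k) (T 0 (ww (int (nat a + 1 + k)))))"
    by (rule sum.reindex_bij_witness[of _ "\<lambda>k. nat a + 1 + k" "\<lambda>m. m - (nat a + 1)"]) (auto simp: L_def)
  also have "\<dots> = ?R"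
  proof (rule sum.cong)
    fix k
    have "int (nat a + 1 + k) = a + 1 + int k" using a_gt by simp
    then show "W.dpE (nat a + 1 + k) (T 0 (ww (int (nat a + 1 + k))))
      = scW ((-1) ^ k * q powi (int b * int k)) (W.dpE (nat a + 1 + k) (T 0 (V.dpF k (ww (a + 1)))))"
      by (simp only: ww_high T.scale W.dE.scale)
  qed simp
  finally show ?thesis .
qed

text \<open>
  Modulo terms with positive powers of \<open>F\<close>, which a suitable projection removes, this says that
  \<open>E^(b + 1) x \<otimes> y\<close> is \<open>E^(a + 1)\<close> applied to \<open>x \<otimes> ww (a + 1)\<close>.
\<close>

theorem rank_one_transport:
  "\<exists>d d' K. d 0 = 1 \<and> d' 0 = 1 \<and>
    (\<Sum>k\<le>N. scW (d' k) (W.dpE k (T (Suc b) (V.dpF k y))))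
      = W.dpE (nat a + 1) (\<Sum>k\<le>K. scW (d k) (W.dpE k (T 0 (V.dpF k (ww (a + 1))))))"
proof (intro exI conjI)
  let ?d = "\<lambda>k. (-1) ^ k * q powi (int b * int k) * (qfact q (nat a + 1) * qfact q k) / qfact q (nat a + 1 + k)"
  show "?d 0 = 1" "lead_coeffs 0 = 1" by (simp_all add: lead_coeffs_def)
  show "(\<Sum>k\<le>N. scW (lead_coeffs k) (W.dpE k (T (Suc b) (V.dpF k y))))
      = W.dpE (nat a + 1) (\<Sum>k\<le>N + b. scW (?d k) (W.dpE k (T 0 (V.dpF k (ww (a + 1))))))"
    unfolding transport[OF order_refl] W.dE.sum W.dE.scale W.dpE_dpE by (simp add: field_simps)
qed

end

end

section \<open>Rank two: the Casimir operator and the Verma identity\<close>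

text \<open>
  The \<open>q\<close>-commutator, which gives the root vectors of the non-simple root.
\<close>

definition qcomm :: "complex \<Rightarrow> (complex \<Rightarrow> 'w \<Rightarrow> 'w) \<Rightarrow> ('w \<Rightarrow> 'w) \<Rightarrow> ('w \<Rightarrow> 'w) \<Rightarrow> 'w \<Rightarrow> 'w::ab_group_add" where
  "qcomm q sc A B w = A (B w) - sc q (B (A w))"

text \<open>
  Weight modules over the quantized enveloping algebra of \<open>gl\<^sub>3\<close>; the last four axioms are the Serre
  relations, stated as \<open>q\<close>-commutation of the non-simple root vectors with the simple ones.  All
  relations are imposed on weight vectors only: the operators of the tensor products below satisfy
  them there, but not on arbitrary functions.
\<close>

locale gl3_module = generic_q q + Vs: vector_space sc +
    E1: Vector_Spaces.linear sc sc E1 + E2: Vector_Spaces.linear sc sc E2 +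
    F1: Vector_Spaces.linear sc sc F1 + F2: Vector_Spaces.linear sc sc F2
  for q :: complex and sc :: "complex \<Rightarrow> 'w::ab_group_add \<Rightarrow> 'w" and E1 E2 F1 F2 :: "'w \<Rightarrow> 'w" +
  fixes X :: "int \<Rightarrow> int \<Rightarrow> int \<Rightarrow> 'w set"
  assumes X_subspace: "Vs.subspace (X l1 l2 l3)"
    and X_E1: "w \<in> X l1 l2 l3 \<Longrightarrow> E1 w \<in> X (l1 + 1) (l2 - 1) l3"
    and X_E2: "w \<in> X l1 l2 l3 \<Longrightarrow> E2 w \<in> X l1 (l2 + 1) (l3 - 1)"
    and X_F1: "w \<in> X l1 l2 l3 \<Longrightarrow> F1 w \<in> X (l1 - 1) (l2 + 1) l3"
    and X_F2: "w \<in> X l1 l2 l3 \<Longrightarrow> F2 w \<in> X l1 (l2 - 1) (l3 + 1)"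
    and E1_F1: "w \<in> X l1 l2 l3 \<Longrightarrow> E1 (F1 w) = F1 (E1 w) + sc (br (l1 - l2)) w"
    and E2_F2: "w \<in> X l1 l2 l3 \<Longrightarrow> E2 (F2 w) = F2 (E2 w) + sc (br (l2 - l3)) w"
    and E1_F2: "w \<in> X l1 l2 l3 \<Longrightarrow> E1 (F2 w) = F2 (E1 w)"
    and E2_F1: "w \<in> X l1 l2 l3 \<Longrightarrow> E2 (F1 w) = F1 (E2 w)"
    and E1_E3: "w \<in> X l1 l2 l3 \<Longrightarrow> qcomm q sc E1 E2 (E1 w) = sc q (E1 (qcomm q sc E1 E2 w))"
    and E2_E3: "w \<in> X l1 l2 l3 \<Longrightarrow> E2 (qcomm q sc E1 E2 w) = sc q (qcomm q sc E1 E2 (E2 w))"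
    and F1_F3: "w \<in> X l1 l2 l3 \<Longrightarrow> F1 (qcomm q sc F2 F1 w) = sc q (qcomm q sc F2 F1 (F1 w))"
    and F3_F2: "w \<in> X l1 l2 l3 \<Longrightarrow> qcomm q sc F2 F1 (F2 w) = sc q (F2 (qcomm q sc F2 F1 w))"
begin

lemmas X_0 [simp] = Vs.subspace_0[OF X_subspace]
lemmas X_add = Vs.subspace_add[OF X_subspace]
lemmas X_scale = Vs.subspace_scale[OF X_subspace]
lemmas X_diff = Vs.subspace_diff[OF X_subspace]

abbreviation "E3 \<equiv> qcomm q sc E1 E2"
abbreviation "F3 \<equiv> qcomm q sc F2 F1"

lemma linear_E3: "Vector_Spaces.linear sc sc E3"
  by unfold_locales
    (simp_all add: qcomm_def E1.add E2.add E1.scale E2.scale Vs.scale_right_distrib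
      Vs.scale_right_diff_distrib mult.commute)

lemma linear_F3: "Vector_Spaces.linear sc sc F3"
  by unfold_locales
    (simp_all add: qcomm_def F1.add F2.add F1.scale F2.scale Vs.scale_right_distrib
      Vs.scale_right_diff_distrib mult.commute)

sublocale E3: Vector_Spaces.linear sc sc E3 by (rule linear_E3)
sublocale F3: Vector_Spaces.linear sc sc F3 by (rule linear_F3)

lemma X_E3: "w \<in> X l1 l2 l3 \<Longrightarrow> E3 w \<in> X (l1 + 1) l2 (l3 - 1)"
  using X_E1[OF X_E2[of w l1 l2 l3]] X_E2[OF X_E1[of w l1 l2 l3]]
  by (simp add: qcomm_def X_diff X_scale)

lemma X_F3: "w \<in> X l1 l2 l3 \<Longrightarrow> F3 w \<in> X (l1 - 1) l2 (l3 + 1)"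
  using X_F1[OF X_F2[of w l1 l2 l3]] X_F2[OF X_F1[of w l1 l2 l3]]
  by (simp add: qcomm_def X_diff X_scale)

lemma E1_E2: "E1 (E2 w) = E3 w + sc q (E2 (E1 w))"
  by (simp add: qcomm_def)

lemma E2_E1: "E2 (E1 w) = sc (inverse q) (E1 (E2 w)) - sc (inverse q) (E3 w)"
  by (simp add: qcomm_def Vs.scale_right_diff_distrib)

lemma F2_F1: "F2 (F1 w) = F3 w + sc q (F1 (F2 w))"
  by (simp add: qcomm_def)

lemma F1_F2: "F1 (F2 w) = sc (inverse q) (F2 (F1 w)) - sc (inverse q) (F3 w)"
  by (simp add: qcomm_def Vs.scale_right_diff_distrib)

lemma br_shift:
  "q * br h - br (h - 1) = q powi h" "q * br (h - 1) - br h = - (q powi (1 - h))"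
  "q * br (h + 1) - br h = q powi (h + 1)" "q * br h - br (h + 1) = - (q powi (- h))"
proof -
  have 1: "q * br h - br (h - 1) = q powi h" for h
    using br_add[of h "-1"] br_minus[of 1] by simp
  have 2: "q * br h - br (h + 1) = - (q powi (- h))" for h
    using br_add[of 1 h] by (simp add: add.commute[of h 1])
  show "q * br h - br (h - 1) = q powi h" "q * br (h + 1) - br h = q powi (h + 1)"
    using 1[of h] 1[of "h + 1"] by simp_all
  show "q * br h - br (h + 1) = - (q powi (- h))" "q * br (h - 1) - br h = - (q powi (1 - h))"
    using 2[of h] 2[of "h - 1"] by simp_all
qed

lemma F1_E3:
  assumes w: "w \<in> X l1 l2 l3"
  shows "F1 (E3 w) = E3 (F1 w) + sc (q powi (l1 - l2)) (E2 w)"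
proof -
  have 1: "F1 (E1 (E2 w)) = E1 (E2 (F1 w)) - sc (br (l1 - l2 - 1)) (E2 w)"
    using E1_F1[OF X_E2[OF w]] E2_F1[OF w] by (simp add: algebra_simps)
  have 2: "F1 (E2 (E1 w)) = E2 (E1 (F1 w)) - sc (br (l1 - l2)) (E2 w)"
    using E2_F1[OF X_E1[OF w]] E1_F1[OF w] by (simp add: E2.add E2.scale)
  show ?thesis
    unfolding br_shift(1)[symmetric]
    by (simp add: qcomm_def F1.diff F1.scale 1 2 Vs.scale_left_diff_distrib Vs.scale_right_diff_distrib)
qed

lemma F2_E3:
  assumes w: "w \<in> X l1 l2 l3"
  shows "F2 (E3 w) = E3 (F2 w) - sc (q powi (1 - (l2 - l3))) (E1 w)"
proof -
  have 1: "F2 (E1 (E2 w)) = E1 (E2 (F2 w)) - sc (br (l2 - l3)) (E1 w)"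
    using E1_F2[OF X_E2[OF w]] E2_F2[OF w] by (simp add: E1.add E1.scale)
  have 2: "F2 (E2 (E1 w)) = E2 (E1 (F2 w)) - sc (br (l2 - l3 - 1)) (E1 w)"
    using E2_F2[OF X_E1[OF w]] E1_F2[OF w] by (simp add: algebra_simps)
  have "- (q powi (1 - (l2 - l3))) = q * br (l2 - l3 - 1) - br (l2 - l3)"
    by (rule br_shift(2)[symmetric])
  then have "- sc (q powi (1 - (l2 - l3))) (E1 w) = sc (q * br (l2 - l3 - 1) - br (l2 - l3)) (E1 w)"
    by (simp add: Vs.scale_minus_left[symmetric])
  then show ?thesis
    by (simp add: qcomm_def F2.diff F2.scale 1 2 Vs.scale_left_diff_distrib Vs.scale_right_diff_distrib
        algebra_simps)
qed

lemma F3_E1: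
  assumes w: "w \<in> X l1 l2 l3"
  shows "F3 (E1 w) = E1 (F3 w) + sc (q powi (l1 - l2 + 1)) (F2 w)"
proof -
  have 1: "F2 (F1 (E1 w)) = E1 (F2 (F1 w)) - sc (br (l1 - l2)) (F2 w)"
    using E1_F1[OF w] E1_F2[OF X_F1[OF w]] by (simp add: F2.diff F2.scale algebra_simps)
      (metis F2.add F2.scale)
  have 2: "F1 (F2 (E1 w)) = E1 (F1 (F2 w)) - sc (br (l1 - l2 + 1)) (F2 w)"
    using E1_F1[OF X_F2[OF w]] E1_F2[OF w] by (simp add: algebra_simps)
  show ?thesis
    unfolding br_shift(3)[symmetric]
    by (simp add: qcomm_def E1.diff E1.scale 1 2 Vs.scale_left_diff_distrib Vs.scale_right_diff_distrib)
qed

lemma F3_E2: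
  assumes w: "w \<in> X l1 l2 l3"
  shows "F3 (E2 w) = E2 (F3 w) - sc (q powi (- (l2 - l3))) (F1 w)"
proof -
  have 1: "F2 (F1 (E2 w)) = E2 (F2 (F1 w)) - sc (br (l2 - l3 + 1)) (F1 w)"
    using E2_F2[OF X_F1[OF w]] E2_F1[OF w] by (simp add: algebra_simps)
  have 2: "F1 (F2 (E2 w)) = E2 (F1 (F2 w)) - sc (br (l2 - l3)) (F1 w)"
    using E2_F2[OF w] E2_F1[OF X_F2[OF w]] by (simp add: algebra_simps)
      (metis F1.add F1.scale)
  have "- sc (q powi (- (l2 - l3))) (F1 w) = sc (q * br (l2 - l3) - br (l2 - l3 + 1)) (F1 w)"
    unfolding br_shift(4) by simp
  then show ?thesis
    by (simp add: qcomm_def E2.diff E2.scale 1 2 Vs.scale_left_diff_distrib Vs.scale_right_diff_distrib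
        algebra_simps)
qed

text \<open>
  The eigenvalue of the Casimir operator on a lowest weight vector.
\<close>

definition chi :: "int \<Rightarrow> int \<Rightarrow> int \<Rightarrow> complex" where
  "chi l1 l2 l3 = q powi (2 - 2 * l1) + q powi (- 2 * l2) + q powi (- 2 * l3 - 2)"

text \<open>
  The quadratic Casimir operator on the weight space of \<open>(l1, l2, l3)\<close>.  It acts as the scalar
  \<open>chi\<close> modulo the images of \<open>E1\<close> and \<open>E2\<close>, and also on vectors killed by \<open>F1\<close> and \<open>F2\<close>.
\<close>

definition cas :: "int \<Rightarrow> int \<Rightarrow> int \<Rightarrow> 'w \<Rightarrow> 'w" where
  "cas l1 l2 l3 w = sc (chi l1 l2 l3) w + sc ((q - inverse q)\<^sup>2)
    (sc (q powi (1 - l1 - l2)) (E1 (F1 w)) + sc (q powi (- l2 - l3 - 1)) (E2 (F2 w))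
      + sc (q powi (- l1 - l3 - 1)) (E3 (F3 w)))"

lemma chi_shift1:
  "chi (l1 + 1) (l2 - 1) l3 - (q - inverse q)\<^sup>2 * (q powi (1 - l1 - l2) * br (l1 - l2)) = chi l1 l2 l3"
  by (simp add: chi_def br_def power2_eq_square power_int_diff power_int_add power_int_minus
      power_int_mult_distrib)
    (simp add: field_simps power_int_mult power2_eq_square)

lemma chi_shift2:
  "chi l1 (l2 + 1) (l3 - 1) - (q - inverse q)\<^sup>2 * (q powi (- l2 - l3 - 1) * br (l2 - l3)) = chi l1 l2 l3"
  by (simp add: chi_def br_def power2_eq_square power_int_diff power_int_add power_int_minus
      power_int_mult_distrib)
    (simp add: field_simps power_int_mult power2_eq_square)

text \<open>
  Commutation with the generators: moving \<open>E1\<close> past the three terms produces the change of \<open>chi\<close> and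
  two multiples of \<open>E3 (F2 w)\<close>, which cancel.  The other three generators are treated in the same way.
\<close>

lemma cas_E1:
  assumes w: "w \<in> X l1 l2 l3"
  shows "cas (l1 + 1) (l2 - 1) l3 (E1 w) = E1 (cas l1 l2 l3 w)"
proof -
  define H where "H = (q - inverse q)\<^sup>2"
  define a b c where "a = q powi (1 - l1 - l2)" and "b = q powi (- l2 - l3 - 1)"
    and "c = q powi (- l1 - l3 - 1)"
  have a': "q powi (1 - (l1 + 1) - (l2 - 1)) = a"
    unfolding a_def by (rule arg_cong[where f = "(powi) q"]) simp
  have b': "q powi (- (l2 - 1) - l3 - 1) = q * b" 
    using power_int_add[of q 1 "- l2 - l3 - 1"] by (simp add: b_def algebra_simps)
  have c': "q powi (- (l1 + 1) - l3 - 1) = inverse q * c"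
    using power_int_add[of q "-1" "- l1 - l3 - 1"] by (simp add: c_def algebra_simps)
  have d: "inverse q * c * q powi (l1 - l2 + 1) = b"
    unfolding c'[symmetric] b_def power_int_add[symmetric, OF disjI1[OF q_nz]]
    by (rule arg_cong[where f = "(powi) q"]) simp
  have chi: "chi l1 l2 l3 = chi (l1 + 1) (l2 - 1) l3 - H * (a * br (l1 - l2))"
    unfolding H_def a_def by (rule chi_shift1[symmetric])
  have 1: "E1 (F1 (E1 w)) = E1 (E1 (F1 w)) - sc (br (l1 - l2)) (E1 w)"
    using E1_F1[OF w] by (simp add: E1.add E1.scale)
  have 2: "sc (q * b) (E2 (F2 (E1 w))) = sc b (E1 (E2 (F2 w))) - sc b (E3 (F2 w))"
  proof -
    have qb: "q * b * inverse q = b" by (simp add: field_simps)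
    show ?thesis
      unfolding E1_F2[OF w, symmetric] E2_E1 Vs.scale_right_diff_distrib Vs.scale_scale qb by simp
  qed
  have 3: "sc (inverse q * c) (E3 (F3 (E1 w))) = sc c (E1 (E3 (F3 w))) + sc b (E3 (F2 w))"
    by (simp add: F3_E1[OF w] E3.add E3.scale E1_E3[OF X_F3[OF w]] Vs.scale_right_distrib d)
  show ?thesis
    unfolding cas_def H_def[symmetric] a' b' c' a_def[symmetric] b_def[symmetric] c_def[symmetric] 1 2 3 chi
    by (simp add: E1.add E1.diff E1.scale Vs.scale_right_distrib Vs.scale_left_diff_distrib
        Vs.scale_right_diff_distrib mult.assoc)
qed

lemma cas_E2:
  assumes w: "w \<in> X l1 l2 l3"
  shows "cas l1 (l2 + 1) (l3 - 1) (E2 w) = E2 (cas l1 l2 l3 w)"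
proof -
  define H where "H = (q - inverse q)\<^sup>2"
  define a b c where "a = q powi (1 - l1 - l2)" and "b = q powi (- l2 - l3 - 1)"
    and "c = q powi (- l1 - l3 - 1)"
  have b': "q powi (- (l2 + 1) - (l3 - 1) - 1) = b"
    unfolding b_def by (rule arg_cong[where f = "(powi) q"]) simp
  have c': "q powi (- l1 - (l3 - 1) - 1) = q * c"
    using power_int_add[of q 1 "- l1 - l3 - 1"] by (simp add: c_def algebra_simps)
  have a': "q powi (1 - l1 - (l2 + 1)) = inverse q * a"
    using power_int_add[of q "-1" "1 - l1 - l2"] by (simp add: a_def algebra_simps)
  have d: "q * c * q powi (- (l2 - l3)) = inverse q * a"
    unfolding c'[symmetric] a'[symmetric] power_int_add[symmetric, OF disjI1[OF q_nz]]
    by (rule arg_cong[where f = "(powi) q"]) simp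
  have chi: "chi l1 l2 l3 = chi l1 (l2 + 1) (l3 - 1) - H * (b * br (l2 - l3))"
    unfolding H_def b_def by (rule chi_shift2[symmetric])
  have 1: "E2 (F2 (E2 w)) = E2 (E2 (F2 w)) - sc (br (l2 - l3)) (E2 w)"
    using E2_F2[OF w] by (simp add: E2.add E2.scale)
  have 2: "sc (inverse q * a) (E1 (F1 (E2 w))) = sc a (E2 (E1 (F1 w))) + sc (inverse q * a) (E3 (F1 w))"
    by (simp add: E2_F1[OF w, symmetric] E1_E2 Vs.scale_right_distrib)
  have 3: "sc (q * c) (E3 (F3 (E2 w))) = sc c (E2 (E3 (F3 w))) - sc (inverse q * a) (E3 (F1 w))"
    unfolding F3_E2[OF w] E3.diff E3.scale E2_E3[OF X_F3[OF w]] Vs.scale_right_diff_distrib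
      Vs.scale_scale d by (simp add: mult.commute)
  show ?thesis
    unfolding cas_def H_def[symmetric] a' b' c' a_def[symmetric] b_def[symmetric] c_def[symmetric] 1 2 3 chi
    by (simp add: E2.add E2.diff E2.scale Vs.scale_right_distrib Vs.scale_left_diff_distrib
        Vs.scale_right_diff_distrib mult.assoc)
qed

lemma cas_F1:
  assumes w: "w \<in> X l1 l2 l3"
  shows "cas (l1 - 1) (l2 + 1) l3 (F1 w) = F1 (cas l1 l2 l3 w)"
proof -
  define H where "H = (q - inverse q)\<^sup>2"
  define a b c where "a = q powi (1 - l1 - l2)" and "b = q powi (- l2 - l3 - 1)"
    and "c = q powi (- l1 - l3 - 1)"
  have a': "q powi (1 - (l1 - 1) - (l2 + 1)) = a"
    unfolding a_def by (rule arg_cong[where f = "(powi) q"]) simp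
  have b': "q powi (- (l2 + 1) - l3 - 1) = inverse q * b"
    using power_int_add[of q "-1" "- l2 - l3 - 1"] by (simp add: b_def algebra_simps)
  have c': "q powi (- (l1 - 1) - l3 - 1) = q * c"
    using power_int_add[of q 1 "- l1 - l3 - 1"] by (simp add: c_def algebra_simps)
  have d: "c * q powi (l1 - 1 - l2) = inverse q * b"
    unfolding c_def b'[symmetric] power_int_add[symmetric, OF disjI1[OF q_nz]]
    by (rule arg_cong[where f = "(powi) q"]) simp
  have chi: "chi (l1 - 1) (l2 + 1) l3 = chi l1 l2 l3 - H * (a * br (l1 - l2 - 2))"
    unfolding H_def a_def using chi_shift1[of "l1 - 1" "l2 + 1" l3] by (simp add: algebra_simps)
  have 1: "F1 (E1 (F1 w)) = E1 (F1 (F1 w)) - sc (br (l1 - l2 - 2)) (F1 w)"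
    using E1_F1[OF X_F1[OF w]] by (simp add: algebra_simps)
  have 2: "sc b (F1 (E2 (F2 w))) = sc (inverse q * b) (E2 (F2 (F1 w))) - sc (inverse q * b) (E2 (F3 w))"
    by (simp add: E2_F1[OF X_F2[OF w], symmetric] F1_F2 E2.scale E2.diff Vs.scale_right_diff_distrib mult.commute)
  have 3: "sc c (F1 (E3 (F3 w))) = sc (q * c) (E3 (F3 (F1 w))) + sc (inverse q * b) (E2 (F3 w))"
    by (simp add: F1_E3[OF X_F3[OF w]] F1_F3[OF w] E3.scale Vs.scale_right_distrib d mult.commute)
  show ?thesis
    unfolding cas_def H_def[symmetric] a' b' c' a_def[symmetric] b_def[symmetric] c_def[symmetric] chi
      F1.add F1.scale 1 2 3
    by (simp add: Vs.scale_right_distrib Vs.scale_left_diff_distrib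
        Vs.scale_right_diff_distrib mult.assoc)
qed

lemma cas_F2:
  assumes w: "w \<in> X l1 l2 l3"
  shows "cas l1 (l2 - 1) (l3 + 1) (F2 w) = F2 (cas l1 l2 l3 w)"
proof -
  define H where "H = (q - inverse q)\<^sup>2"
  define a b c where "a = q powi (1 - l1 - l2)" and "b = q powi (- l2 - l3 - 1)"
    and "c = q powi (- l1 - l3 - 1)"
  have b': "q powi (- (l2 - 1) - (l3 + 1) - 1) = b"
    unfolding b_def by (rule arg_cong[where f = "(powi) q"]) simp
  have a': "q powi (1 - l1 - (l2 - 1)) = q * a"
    using power_int_add[of q 1 "1 - l1 - l2"] by (simp add: a_def algebra_simps)
  have c': "q powi (- l1 - (l3 + 1) - 1) = inverse q * c"
    using power_int_add[of q "-1" "- l1 - l3 - 1"] by (simp add: c_def algebra_simps)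
  have d: "c * q powi (1 - (l2 - (l3 + 1))) = a"
    unfolding c_def a_def power_int_add[symmetric, OF disjI1[OF q_nz]]
    by (rule arg_cong[where f = "(powi) q"]) simp
  have chi: "chi l1 (l2 - 1) (l3 + 1) = chi l1 l2 l3 - H * (b * br (l2 - l3 - 2))"
    unfolding H_def b_def using chi_shift2[of l1 "l2 - 1" "l3 + 1"] by (simp add: algebra_simps)
  have 1: "F2 (E2 (F2 w)) = E2 (F2 (F2 w)) - sc (br (l2 - l3 - 2)) (F2 w)"
    using E2_F2[OF X_F2[OF w]] by (simp add: algebra_simps)
  have 2: "sc a (F2 (E1 (F1 w))) = sc (q * a) (E1 (F1 (F2 w))) + sc a (E1 (F3 w))"
    by (simp add: E1_F2[OF X_F1[OF w], symmetric] F2_F1 E1.scale E1.add Vs.scale_right_distrib mult.commute)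
  have 3: "sc c (F2 (E3 (F3 w))) = sc (inverse q * c) (E3 (F3 (F2 w))) - sc a (E1 (F3 w))"
    unfolding F2_E3[OF X_F3[OF w]] F3_F2[OF w] E3.scale Vs.scale_right_diff_distrib
      Vs.scale_scale d by (simp add: mult.commute)
  show ?thesis
    unfolding cas_def H_def[symmetric] a' b' c' a_def[symmetric] b_def[symmetric] c_def[symmetric] chi
      F2.add F2.scale 1 2 3
    by (simp add: Vs.scale_right_distrib Vs.scale_left_diff_distrib
        Vs.scale_right_diff_distrib mult.assoc)
qed

lemma linear_cas: "Vector_Spaces.linear sc sc (cas l1 l2 l3)"
  by unfold_locales
    (simp_all add: cas_def E1.add E2.add E3.add F1.add F2.add F3.add E1.scale E2.scale E3.scale
      F1.scale F2.scale F3.scale Vs.scale_right_distrib mult_ac add_ac)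

sublocale cas: Vector_Spaces.linear sc sc "cas l1 l2 l3" for l1 l2 l3 by (rule linear_cas)

lemma X_cas: "w \<in> X l1 l2 l3 \<Longrightarrow> cas l1 l2 l3 w \<in> X l1 l2 l3"
  using X_E1[OF X_F1[of w l1 l2 l3]] X_E2[OF X_F2[of w l1 l2 l3]] X_E3[OF X_F3[of w l1 l2 l3]]
  by (simp add: cas_def X_add X_scale)

text \<open>
  The polynomial in the Casimir operator with a given list of roots.
\<close>

fun cas_poly :: "complex list \<Rightarrow> int \<Rightarrow> int \<Rightarrow> int \<Rightarrow> 'w \<Rightarrow> 'w" where
  "cas_poly [] l1 l2 l3 w = w"
| "cas_poly (k # ks) l1 l2 l3 w = cas l1 l2 l3 (cas_poly ks l1 l2 l3 w) - sc k (cas_poly ks l1 l2 l3 w)"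

lemma linear_cas_poly: "Vector_Spaces.linear sc sc (cas_poly ks l1 l2 l3)"
proof (induction ks)
  case Nil
  show ?case by unfold_locales (simp_all add: Vs.scale_right_distrib)
next
  case (Cons k ks)
  interpret K: Vector_Spaces.linear sc sc "cas_poly ks l1 l2 l3" by fact
  show ?case
    by unfold_locales
      (simp_all add: K.add K.scale cas.add cas.scale Vs.scale_right_distrib
        Vs.scale_right_diff_distrib mult.commute)
qed

sublocale cas_poly: Vector_Spaces.linear sc sc "cas_poly ks l1 l2 l3" for ks l1 l2 l3
  by (rule linear_cas_poly)

lemma X_cas_poly: "w \<in> X l1 l2 l3 \<Longrightarrow> cas_poly ks l1 l2 l3 w \<in> X l1 l2 l3"
  by (induction ks) (simp_all add: X_cas X_diff X_scale)

lemma cas_poly_E1: "w \<in> X l1 l2 l3 \<Longrightarrow> cas_poly ks (l1 + 1) (l2 - 1) l3 (E1 w) = E1 (cas_poly ks l1 l2 l3 w)"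
  by (induction ks) (simp_all add: cas_E1[OF X_cas_poly] E1.diff E1.scale)
lemma cas_poly_E2: "w \<in> X l1 l2 l3 \<Longrightarrow> cas_poly ks l1 (l2 + 1) (l3 - 1) (E2 w) = E2 (cas_poly ks l1 l2 l3 w)"
  by (induction ks) (simp_all add: cas_E2[OF X_cas_poly] E2.diff E2.scale)
lemma cas_poly_F1: "w \<in> X l1 l2 l3 \<Longrightarrow> cas_poly ks (l1 - 1) (l2 + 1) l3 (F1 w) = F1 (cas_poly ks l1 l2 l3 w)"
  by (induction ks) (simp_all add: cas_F1[OF X_cas_poly] F1.diff F1.scale)
lemma cas_poly_F2: "w \<in> X l1 l2 l3 \<Longrightarrow> cas_poly ks l1 (l2 - 1) (l3 + 1) (F2 w) = F2 (cas_poly ks l1 l2 l3 w)"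
  by (induction ks) (simp_all add: cas_F2[OF X_cas_poly] F2.diff F2.scale)

lemma cas_poly_append: "cas_poly (ks @ ks') l1 l2 l3 w = cas_poly ks l1 l2 l3 (cas_poly ks' l1 l2 l3 w)"
  by (induction ks) simp_all

lemma cas_poly_singular:
  assumes "F1 w = 0" "F2 w = 0"
  shows "cas_poly ks l1 l2 l3 w = sc (\<Prod>k\<leftarrow>ks. chi l1 l2 l3 - k) w"
proof -
  have "cas l1 l2 l3 w = sc (chi l1 l2 l3) w"
    by (simp add: cas_def qcomm_def assms)
  then show ?thesis
    by (induction ks) (simp_all add: cas.scale Vs.scale_left_diff_distrib algebra_simps)
qed

text \<open>
  If the module vanishes \<open>N\<close> steps below the given weight, \<open>N\<close> passes through a list of roots containing
  all eigenvalues of lowest weight vectors suffice: by induction, \<open>N - 1\<close> passes make \<open>w\<close> singular, and the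
  last one annihilates it.
\<close>

lemma cas_poly_kills:
  assumes "\<And>n1 n2 w. n1 + n2 \<ge> N \<Longrightarrow> w \<in> X (l1 - int n1) (l2 + int n1 - int n2) (l3 + int n2) \<Longrightarrow> w = 0"
    and "\<And>n1 n2 w. chi (l1 - int n1) (l2 + int n1 - int n2) (l3 + int n2) \<notin> set ks \<Longrightarrow>
      w \<in> X (l1 - int n1) (l2 + int n1 - int n2) (l3 + int n2) \<Longrightarrow> w = 0"
    and "w \<in> X l1 l2 l3"
  shows "cas_poly (concat (replicate N ks)) l1 l2 l3 w = 0"
  using assms
proof (induction N arbitrary: l1 l2 l3 w)
  case 0
  then show ?case using "0.prems"(1)[of 0 0 w] by simp
next
  case (Suc N)
  define u where "u = cas_poly (concat (replicate N ks)) l1 l2 l3 w"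
  have u: "u \<in> X l1 l2 l3" unfolding u_def by (rule X_cas_poly) fact
  have "cas_poly (concat (replicate N ks)) (l1 - 1) (l2 + 1) l3 (F1 w) = 0"
  proof (rule Suc.IH)
    show "F1 w \<in> X (l1 - 1) (l2 + 1) l3" by (rule X_F1) fact
  next
    fix n1 n2 :: nat and v
    assume v: "v \<in> X (l1 - 1 - int n1) (l2 + 1 + int n1 - int n2) (l3 + int n2)"
    then have v': "v \<in> X (l1 - int (Suc n1)) (l2 + int (Suc n1) - int n2) (l3 + int n2)"
      by (simp add: algebra_simps)
    { assume "n1 + n2 \<ge> N" then show "v = 0" using Suc.prems(1)[OF _ v'] by simp }
    { assume "chi (l1 - 1 - int n1) (l2 + 1 + int n1 - int n2) (l3 + int n2) \<notin> set ks"
      then show "v = 0" using Suc.prems(2)[OF _ v'] by (simp add: algebra_simps) }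
  qed
  then have F1: "F1 u = 0" unfolding u_def using cas_poly_F1[OF Suc.prems(3)] by simp
  have "cas_poly (concat (replicate N ks)) l1 (l2 - 1) (l3 + 1) (F2 w) = 0"
  proof (rule Suc.IH)
    show "F2 w \<in> X l1 (l2 - 1) (l3 + 1)" by (rule X_F2) fact
  next
    fix n1 n2 :: nat and v
    assume v: "v \<in> X (l1 - int n1) (l2 - 1 + int n1 - int n2) (l3 + 1 + int n2)"
    then have v': "v \<in> X (l1 - int n1) (l2 + int n1 - int (Suc n2)) (l3 + int (Suc n2))"
      by (simp add: algebra_simps)
    { assume "n1 + n2 \<ge> N" then show "v = 0" using Suc.prems(1)[OF _ v'] by simp }
    { assume "chi (l1 - int n1) (l2 - 1 + int n1 - int n2) (l3 + 1 + int n2) \<notin> set ks"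
      then show "v = 0" using Suc.prems(2)[OF _ v'] by (simp add: algebra_simps) }
  qed
  then have F2: "F2 u = 0" unfolding u_def using cas_poly_F2[OF Suc.prems(3)] by simp
  have "cas_poly ks l1 l2 l3 u = 0"
  proof (cases "chi l1 l2 l3 \<in> set ks")
    case True
    then have "(\<Prod>k\<leftarrow>ks. chi l1 l2 l3 - k) = 0" by (auto simp: prod_list_zero_iff)
    then show ?thesis by (simp add: cas_poly_singular[OF F1 F2])
  next
    case False
    then have "u = 0" using Suc.prems(2)[of 0 0 u] u by simp
    then show ?thesis by simp
  qed
  then show ?case by (simp add: cas_poly_append u_def)
qed

definition "Xall = {w. \<exists>l1 l2 l3. w \<in> X l1 l2 l3}"

lemma Xall_E: "w \<in> Xall \<Longrightarrow> E1 w \<in> Xall" "w \<in> Xall \<Longrightarrow> E2 w \<in> Xall" "w \<in> Xall \<Longrightarrow> E3 w \<in> Xall"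
  unfolding Xall_def using X_E1 X_E2 X_E3 by blast+

lemma Xall_E_pow: "w \<in> Xall \<Longrightarrow> (E1 ^^ n) w \<in> Xall" "w \<in> Xall \<Longrightarrow> (E2 ^^ n) w \<in> Xall"
  by (induction n) (simp_all add: Xall_E)

lemma E3_E12: "w \<in> Xall \<Longrightarrow> E3 (E1 (E2 w)) = E1 (E2 (E3 w))"
  unfolding Xall_def using E1_E3[OF X_E2] E2_E3 by (auto simp: E1.scale)

text \<open>
  The operators \<open>E1\<^sup>p E2\<^sup>p\<close> and \<open>E2\<^sup>r E1\<^sup>r\<close> are polynomials in \<open>E1 E2\<close> and \<open>E3\<close>, by the recursions below.
  Since \<open>E1 E2\<close> and \<open>E3\<close> commute, so do they.
\<close>

definition E12_pow :: "nat \<Rightarrow> 'w \<Rightarrow> 'w" where "E12_pow p w = (E1 ^^ p) ((E2 ^^ p) w)"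
definition E21_pow :: "nat \<Rightarrow> 'w \<Rightarrow> 'w" where "E21_pow r w = (E2 ^^ r) ((E1 ^^ r) w)"

lemma E12_pow_Suc: "\<exists>a b. \<forall>w\<in>Xall. E12_pow (Suc p) w = sc a (E1 (E2 (E12_pow p w))) + sc b (E3 (E12_pow p w))"
proof -
  have "\<exists>a b. \<forall>w\<in>Xall. (E1 ^^ p) (E1 (E2 w)) = sc a (E1 (E2 ((E1 ^^ p) w))) + sc b (E3 ((E1 ^^ p) w))"
  proof (induction p)
    case 0
    show ?case by (rule exI[of _ 1], rule exI[of _ 0]) simp
  next
    case (Suc p)
    then obtain a b where ab: "\<And>w. w \<in> Xall \<Longrightarrow>
        (E1 ^^ p) (E1 (E2 w)) = sc a (E1 (E2 ((E1 ^^ p) w))) + sc b (E3 ((E1 ^^ p) w))" by blast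
    have "(E1 ^^ Suc p) (E1 (E2 w)) = sc (a * q) (E1 (E2 ((E1 ^^ Suc p) w)))
        + sc ((a + b) * inverse q) (E3 ((E1 ^^ Suc p) w))" if w: "w \<in> Xall" for w
    proof -
      define u where "u = (E1 ^^ p) w"
      have "u \<in> Xall" unfolding u_def by (rule Xall_E_pow) fact
      then have 1: "E1 (E3 u) = sc (inverse q) (E3 (E1 u))"
        using E1_E3 by (auto simp: Xall_def)
      have 2: "E1 (E1 (E2 u)) = sc q (E1 (E2 (E1 u))) + sc (inverse q) (E3 (E1 u))"
        unfolding E1_E2[of u] by (simp add: E1.add E1.scale 1)
      have "(E1 ^^ Suc p) (E1 (E2 w)) = E1 (sc a (E1 (E2 u)) + sc b (E3 u))"
        by (simp add: ab[OF w] u_def)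
      also have "\<dots> = sc (a * q) (E1 (E2 (E1 u))) + sc ((a + b) * inverse q) (E3 (E1 u))"
        by (simp add: E1.add E1.scale 1 2 Vs.scale_right_distrib Vs.scale_left_distrib algebra_simps)
      finally show ?thesis by (simp add: u_def)
    qed
    then show ?case by blast
  qed
  then obtain a b where ab: "\<And>w. w \<in> Xall \<Longrightarrow>
      (E1 ^^ p) (E1 (E2 w)) = sc a (E1 (E2 ((E1 ^^ p) w))) + sc b (E3 ((E1 ^^ p) w))" by blast
  have "E12_pow (Suc p) w = (E1 ^^ p) (E1 (E2 ((E2 ^^ p) w)))" for w
    by (simp add: E12_pow_def funpow_swap1)
  then show ?thesis using ab[OF Xall_E_pow(2)] unfolding E12_pow_def by metis
qed

lemma E21_pow_Suc: "\<exists>a b. \<forall>w\<in>Xall. E21_pow (Suc r) w = sc a (E1 (E2 (E21_pow r w))) + sc b (E3 (E21_pow r w))"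
proof -
  have "\<exists>a b. \<forall>w\<in>Xall. (E2 ^^ r) (E2 (E1 w)) = sc a (E1 (E2 ((E2 ^^ r) w))) + sc b (E3 ((E2 ^^ r) w))"
  proof (induction r)
    case 0
    show ?case
      by (rule exI[of _ "inverse q"], rule exI[of _ "- inverse q"])
        (simp add: E2_E1 Vs.scale_minus_left)
  next
    case (Suc r)
    then obtain a b where ab: "\<And>w. w \<in> Xall \<Longrightarrow>
        (E2 ^^ r) (E2 (E1 w)) = sc a (E1 (E2 ((E2 ^^ r) w))) + sc b (E3 ((E2 ^^ r) w))" by blast
    have "(E2 ^^ Suc r) (E2 (E1 w)) = sc (a * inverse q) (E1 (E2 ((E2 ^^ Suc r) w)))
        + sc (b * q - a * inverse q) (E3 ((E2 ^^ Suc r) w))" if w: "w \<in> Xall" for w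
    proof -
      define u where "u = (E2 ^^ r) w"
      have "u \<in> Xall" unfolding u_def by (rule Xall_E_pow) fact
      then have 1: "E2 (E3 u) = sc q (E3 (E2 u))"
        using E2_E3 by (auto simp: Xall_def)
      have "(E2 ^^ Suc r) (E2 (E1 w)) = E2 (sc a (E1 (E2 u)) + sc b (E3 u))"
        by (simp add: ab[OF w] u_def)
      also have "\<dots> = sc (a * inverse q) (E1 (E2 (E2 u))) + sc (b * q - a * inverse q) (E3 (E2 u))"
        by (simp add: E2.add E2.scale 1 E2_E1[of "E2 u"] Vs.scale_right_diff_distrib
            Vs.scale_left_diff_distrib)
      finally show ?thesis by (simp add: u_def)
    qed
    then show ?case by blast
  qed
  then obtain a b where ab: "\<And>w. w \<in> Xall \<Longrightarrow>
      (E2 ^^ r) (E2 (E1 w)) = sc a (E1 (E2 ((E2 ^^ r) w))) + sc b (E3 ((E2 ^^ r) w))" by blast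
  have "E21_pow (Suc r) w = (E2 ^^ r) (E2 (E1 ((E1 ^^ r) w)))" for w
    by (simp add: E21_pow_def funpow_swap1)
  then show ?thesis using ab[OF Xall_E_pow(1)] unfolding E21_pow_def by metis
qed

lemma E12_pow_E21_pow_Xall: "w \<in> Xall \<Longrightarrow> E12_pow p w \<in> Xall" "w \<in> Xall \<Longrightarrow> E21_pow p w \<in> Xall"
  by (simp_all add: E12_pow_def E21_pow_def Xall_E_pow)

lemma commutes_with_E12_pow_E21_pow:
  assumes Z: "Vector_Spaces.linear sc sc Z" and Zall: "\<And>w. w \<in> Xall \<Longrightarrow> Z w \<in> Xall"
    and Z12: "\<And>w. w \<in> Xall \<Longrightarrow> Z (E1 (E2 w)) = E1 (E2 (Z w))"
    and Z3: "\<And>w. w \<in> Xall \<Longrightarrow> Z (E3 w) = E3 (Z w)"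
    and w: "w \<in> Xall"
  shows "Z (E12_pow p w) = E12_pow p (Z w)" "Z (E21_pow p w) = E21_pow p (Z w)"
proof -
  interpret Z: Vector_Spaces.linear sc sc Z by fact
  show "Z (E12_pow p w) = E12_pow p (Z w)"
  proof (induction p)
    case (Suc p)
    obtain a b where "\<And>w. w \<in> Xall \<Longrightarrow> E12_pow (Suc p) w = sc a (E1 (E2 (E12_pow p w))) + sc b (E3 (E12_pow p w))"
      using E12_pow_Suc by metis
    then show ?case
      using w Suc by (simp add: Zall Z.add Z.scale Z12 Z3 E12_pow_E21_pow_Xall)
  qed (simp add: E12_pow_def)
  show "Z (E21_pow p w) = E21_pow p (Z w)"
  proof (induction p)
    case (Suc p)
    obtain a b where "\<And>w. w \<in> Xall \<Longrightarrow> E21_pow (Suc p) w = sc a (E1 (E2 (E21_pow p w))) + sc b (E3 (E21_pow p w))"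
      using E21_pow_Suc by metis
    then show ?case
      using w Suc by (simp add: Zall Z.add Z.scale Z12 Z3 E12_pow_E21_pow_Xall)
  qed (simp add: E21_pow_def)
qed

lemma E1_pow_lin: "(E1 ^^ n) (v + w) = (E1 ^^ n) v + (E1 ^^ n) w" "(E1 ^^ n) (sc c w) = sc c ((E1 ^^ n) w)"
  by (induction n) (simp_all add: E1.add E1.scale)
lemma E2_pow_lin: "(E2 ^^ n) (v + w) = (E2 ^^ n) v + (E2 ^^ n) w" "(E2 ^^ n) (sc c w) = sc c ((E2 ^^ n) w)"
  by (induction n) (simp_all add: E2.add E2.scale)

text \<open>
  Commutation of \<open>E1\<^sup>p E2\<^sup>p\<close> with \<open>E2\<^sup>r E1\<^sup>r\<close>, written out.
\<close>

theorem verma_identity: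
  assumes w: "w \<in> Xall"
  shows "(E1 ^^ p) ((E2 ^^ (p + r)) ((E1 ^^ r) w)) = (E2 ^^ r) ((E1 ^^ (p + r)) ((E2 ^^ p) w))"
proof -
  \<comment> \<open>\<open>E1 E2\<close> and \<open>E3\<close> commute with each other, hence with \<open>E21_pow r\<close>, hence \<open>E21_pow r\<close> commutes with \<open>E12_pow p\<close>.\<close>
  have Q12: "E21_pow r (E1 (E2 w)) = E1 (E2 (E21_pow r w))" if "w \<in> Xall" for w
    by (rule commutes_with_E12_pow_E21_pow(2)[of "\<lambda>w. E1 (E2 w)", symmetric])
      (unfold_locales, auto simp: E1.add E2.add E1.scale E2.scale that Xall_E E3_E12)
  have Q3: "E21_pow r (E3 w) = E3 (E21_pow r w)" if "w \<in> Xall" for w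
    by (rule commutes_with_E12_pow_E21_pow(2)[of E3, symmetric])
      (unfold_locales, auto simp: E3.add E3.scale that Xall_E E3_E12)
  have "E21_pow r (E12_pow p w) = E12_pow p (E21_pow r w)"
  proof (rule commutes_with_E12_pow_E21_pow(1)[of "E21_pow r"])
    show "Vector_Spaces.linear sc sc (E21_pow r)"
      by unfold_locales (simp_all add: E21_pow_def E1_pow_lin E2_pow_lin)
  qed (simp_all add: w Q12 Q3 E12_pow_E21_pow_Xall)
  moreover have "(E1 ^^ (p + r)) v = (E1 ^^ r) ((E1 ^^ p) v)" "(E2 ^^ (p + r)) v = (E2 ^^ p) ((E2 ^^ r) v)" for v
    by (metis add.commute comp_apply funpow_add) (simp add: funpow_add)
  ultimately show ?thesis by (simp add: E12_pow_def E21_pow_def)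
qed

end

section \<open>Tensor products\<close>

text \<open>
  The coproduct is \<open>\<Delta> E = E \<otimes> K + 1 \<otimes> E\<close> and \<open>\<Delta> F = F \<otimes> 1 + K\<inverse> \<otimes> F\<close>.  The tensor product itself is
  represented by any bilinear map into a space with operators that satisfy these formulas.
\<close>

locale gl3_tensor =
    M: gl3_module q scM E1M E2M F1M F2M XM + V: gl3_module q scV E1V E2V F1V F2V XV +
    Vs: vector_space sc +
    E1: Vector_Spaces.linear sc sc E1 + E2: Vector_Spaces.linear sc sc E2 +
    F1: Vector_Spaces.linear sc sc F1 + F2: Vector_Spaces.linear sc sc F2
  for q :: complex
    and scM :: "complex \<Rightarrow> 'm::ab_group_add \<Rightarrow> 'm" and E1M E2M F1M F2M XM
    and scV :: "complex \<Rightarrow> 'v::ab_group_add \<Rightarrow> 'v" and E1V E2V F1V F2V XV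
    and sc :: "complex \<Rightarrow> 'w::ab_group_add \<Rightarrow> 'w" and E1 E2 F1 F2 +
  fixes tens :: "'m \<Rightarrow> 'v \<Rightarrow> 'w"
  assumes tens_left: "Vector_Spaces.linear scM sc (\<lambda>x. tens x v)"
    and tens_right: "Vector_Spaces.linear scV sc (tens x)"
    and E1_tens: "x \<in> XM m1 m2 m3 \<Longrightarrow> v \<in> XV n1 n2 n3 \<Longrightarrow>
      E1 (tens x v) = sc (q powi (n1 - n2)) (tens (E1M x) v) + tens x (E1V v)"
    and E2_tens: "x \<in> XM m1 m2 m3 \<Longrightarrow> v \<in> XV n1 n2 n3 \<Longrightarrow>
      E2 (tens x v) = sc (q powi (n2 - n3)) (tens (E2M x) v) + tens x (E2V v)"
    and F1_tens: "x \<in> XM m1 m2 m3 \<Longrightarrow> v \<in> XV n1 n2 n3 \<Longrightarrow>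
      F1 (tens x v) = tens (F1M x) v + sc (q powi (m2 - m1)) (tens x (F1V v))"
    and F2_tens: "x \<in> XM m1 m2 m3 \<Longrightarrow> v \<in> XV n1 n2 n3 \<Longrightarrow>
      F2 (tens x v) = tens (F2M x) v + sc (q powi (m3 - m2)) (tens x (F2V v))"
begin

sublocale tl: Vector_Spaces.linear scM sc "\<lambda>x. tens x v" for v by (rule tens_left)
sublocale tr: Vector_Spaces.linear scV sc "tens x" for x by (rule tens_right)

definition XW :: "int \<Rightarrow> int \<Rightarrow> int \<Rightarrow> 'w set" where
  "XW l1 l2 l3 = Vs.span {tens x v | x v m1 m2 m3 n1 n2 n3. x \<in> XM m1 m2 m3 \<and> v \<in> XV n1 n2 n3
     \<and> l1 = m1 + n1 \<and> l2 = m2 + n2 \<and> l3 = m3 + n3}"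

lemma tens_XW: "x \<in> XM m1 m2 m3 \<Longrightarrow> v \<in> XV n1 n2 n3 \<Longrightarrow> tens x v \<in> XW (m1 + n1) (m2 + n2) (m3 + n3)"
  unfolding XW_def by (rule Vs.span_base) blast

lemma tens_XW': "x \<in> XM m1 m2 m3 \<Longrightarrow> v \<in> XV n1 n2 n3 \<Longrightarrow> l1 = m1 + n1 \<Longrightarrow> l2 = m2 + n2 \<Longrightarrow> l3 = m3 + n3 \<Longrightarrow>
    tens x v \<in> XW l1 l2 l3"
  using tens_XW by simp

lemma XW_subspace: "Vs.subspace (XW l1 l2 l3)"
  unfolding XW_def by (rule Vs.subspace_span)

lemmas XW_closed = Vs.subspace_0[OF XW_subspace] Vs.subspace_add[OF XW_subspace]
  Vs.subspace_scale[OF XW_subspace]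

lemma XW_induct [consumes 1, case_names tens zero add scale]:
  assumes "w \<in> XW l1 l2 l3"
    and "\<And>x v m1 m2 m3 n1 n2 n3. x \<in> XM m1 m2 m3 \<Longrightarrow> v \<in> XV n1 n2 n3 \<Longrightarrow>
      l1 = m1 + n1 \<Longrightarrow> l2 = m2 + n2 \<Longrightarrow> l3 = m3 + n3 \<Longrightarrow> P (tens x v)"
    and "P 0" and "\<And>v w. P v \<Longrightarrow> P w \<Longrightarrow> P (v + w)" and "\<And>c w. P w \<Longrightarrow> P (sc c w)"
  shows "P w"
proof -
  have "w \<in> {w. P w}"
    by (rule Vs.span_induct[OF assms(1)[unfolded XW_def]])
      (use assms(2-) in \<open>auto simp: Vs.subspace_def\<close>)
  then show ?thesis by simp
qed

abbreviation "E3 \<equiv> qcomm q sc E1 E2"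
abbreviation "F3 \<equiv> qcomm q sc F2 F1"

text \<open>
  The coproducts of the non-simple root vectors have one additional mixed term.  In the Serre relations
  for the tensor product, which follow, the contributions of this term compensate the failure of the
  two summands of \<open>\<Delta> E1\<close> to \<open>q\<close>-commute with those of \<open>\<Delta> E2\<close>.
\<close>

lemma E3_tens:
  assumes x: "x \<in> XM m1 m2 m3" and v: "v \<in> XV n1 n2 n3"
  shows "E3 (tens x v) = sc (q powi (n1 - n3)) (tens (M.E3 x) v) + tens x (V.E3 v)
    + sc ((inverse q - q) * q powi (n1 - n2)) (tens (E1M x) (E2V v))"
proof -
  define A B where "A = q powi (n1 - n2)" and "B = q powi (n2 - n3)"
  have AB: "q powi (n1 - n3) = A * B"
    unfolding A_def B_def power_int_add[symmetric, OF disjI1[OF M.q_nz]] by simp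
  have A': "q powi (n1 - (n2 + 1)) = A * inverse q" and B': "q powi (n2 - 1 - n3) = B * inverse q"
    using power_int_add[of q "n1 - n2" "-1"] power_int_add[of q "n2 - n3" "-1"]
    by (simp_all add: A_def B_def algebra_simps)
  have 1: "E1 (E2 (tens x v)) = sc (A * B) (tens (E1M (E2M x)) v) + sc B (tens (E2M x) (E1V v))
      + sc (A * inverse q) (tens (E1M x) (E2V v)) + tens x (E1V (E2V v))"
    by (simp add: E2_tens[OF x v] E1_tens[OF x V.X_E2[OF v]] E1_tens[OF M.X_E2[OF x] v]
        E1.add E1.scale A' A_def[symmetric] B_def[symmetric] Vs.scale_right_distrib mult.commute)
  have 2: "E2 (E1 (tens x v)) = sc (A * B) (tens (E2M (E1M x)) v) + sc A (tens (E1M x) (E2V v))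
      + sc (B * inverse q) (tens (E2M x) (E1V v)) + tens x (E2V (E1V v))"
    by (simp add: E1_tens[OF x v] E2_tens[OF x V.X_E1[OF v]] E2_tens[OF M.X_E1[OF x] v]
        E2.add E2.scale B' A_def[symmetric] B_def[symmetric] Vs.scale_right_distrib)
  have qB: "q * (B * inverse q) = B" by (simp add: field_simps)
  have c: "(inverse q - q) * A = A * inverse q - q * A" by (simp add: algebra_simps)
  show ?thesis
    unfolding AB A_def[symmetric] c qcomm_def 1 2 Vs.scale_right_distrib Vs.scale_scale qB
      Vs.scale_left_diff_distrib tl.diff tl.scale tr.diff tr.scale Vs.scale_right_diff_distrib
    by (simp add: mult_ac)
qed

lemma F3_tens:
  assumes x: "x \<in> XM m1 m2 m3" and v: "v \<in> XV n1 n2 n3"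
  shows "F3 (tens x v) = tens (M.F3 x) v + sc (q powi (m3 - m1)) (tens x (V.F3 v))
    + sc ((inverse q - q) * q powi (m3 - m2)) (tens (F1M x) (F2V v))"
proof -
  define A B where "A = q powi (m2 - m1)" and "B = q powi (m3 - m2)"
  have AB: "q powi (m3 - m1) = A * B"
    unfolding A_def B_def power_int_add[symmetric, OF disjI1[OF M.q_nz]] by simp
  have A': "q powi (m2 - 1 - m1) = A * inverse q" and B': "q powi (m3 - (m2 + 1)) = B * inverse q"
    using power_int_add[of q "m2 - m1" "-1"] power_int_add[of q "m3 - m2" "-1"]
    by (simp_all add: A_def B_def algebra_simps)
  have 1: "F2 (F1 (tens x v)) = tens (F2M (F1M x)) v + sc (B * inverse q) (tens (F1M x) (F2V v))
      + sc A (tens (F2M x) (F1V v)) + sc (A * B) (tens x (F2V (F1V v)))"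
    by (simp add: F1_tens[OF x v] F2_tens[OF x V.X_F1[OF v]] F2_tens[OF M.X_F1[OF x] v]
        F2.add F2.scale B' A_def[symmetric] B_def[symmetric] Vs.scale_right_distrib)
  have 2: "F1 (F2 (tens x v)) = tens (F1M (F2M x)) v + sc (A * inverse q) (tens (F2M x) (F1V v))
      + sc B (tens (F1M x) (F2V v)) + sc (A * B) (tens x (F1V (F2V v)))"
    by (simp add: F2_tens[OF x v] F1_tens[OF x V.X_F2[OF v]] F1_tens[OF M.X_F2[OF x] v]
        F1.add F1.scale A' A_def[symmetric] B_def[symmetric] Vs.scale_right_distrib mult.commute)
  have qA: "q * (A * inverse q) = A" by (simp add: field_simps)
  have c: "(inverse q - q) * B = B * inverse q - q * B" by (simp add: algebra_simps)
  show ?thesis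
    unfolding AB B_def[symmetric] c qcomm_def 1 2 Vs.scale_right_distrib Vs.scale_scale qA
      Vs.scale_left_diff_distrib tl.diff tl.scale tr.diff tr.scale Vs.scale_right_diff_distrib
    by (simp add: mult_ac)
qed

lemma E3_lin: "E3 (v + w) = E3 v + E3 w" "E3 (sc c w) = sc c (E3 w)" "E3 0 = 0"
  by (simp_all add: qcomm_def E1.add E2.add E1.scale E2.scale Vs.scale_right_distrib
      Vs.scale_right_diff_distrib mult.commute)
lemma F3_lin: "F3 (v + w) = F3 v + F3 w" "F3 (sc c w) = sc c (F3 w)" "F3 0 = 0"
  by (simp_all add: qcomm_def F1.add F2.add F1.scale F2.scale Vs.scale_right_distrib
      Vs.scale_right_diff_distrib mult.commute)

lemma E1_E3_tens:
  assumes x: "x \<in> XM m1 m2 m3" and v: "v \<in> XV n1 n2 n3"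
  shows "E3 (E1 (tens x v)) = sc q (E1 (E3 (tens x v)))"
proof -
  define A B d where "A = q powi (n1 - n2)" and "B = q powi (n1 - n3)" and "d = inverse q - q"
  have s: "q powi (n1 + 1 - n3) = q * B" "q powi (n1 + 1 - (n2 - 1)) = q * (q * A)"
    "q powi (n1 - (n2 + 1)) = A * inverse q" "q powi (n1 + 1 - n2) = q * A"
    using power_int_add[of q 1 "n1 - n3"] power_int_add[of q 2 "n1 - n2"] power_int_add[of q 1 "n1 - n2"]
      power_int_add[of q "n1 - n2" "-1"]
    by (simp_all add: A_def B_def algebra_simps power2_eq_square)
  have L: "E3 (E1 (tens x v)) = sc (A * B) (tens (M.E3 (E1M x)) v) + sc A (tens (E1M x) (V.E3 v))
      + sc (A * d * A) (tens (E1M (E1M x)) (E2V v)) + sc (q * B) (tens (M.E3 x) (E1V v))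
      + tens x (V.E3 (E1V v)) + sc (d * (q * (q * A))) (tens (E1M x) (E2V (E1V v)))"
    unfolding E1_tens[OF x v] E3_lin E3_tens[OF M.X_E1[OF x] v] E3_tens[OF x V.X_E1[OF v]] s
      A_def[symmetric] B_def[symmetric] d_def[symmetric] Vs.scale_right_distrib Vs.scale_scale
    by (simp add: mult_ac add_ac)
  have R: "E1 (E3 (tens x v)) = sc (A * B) (tens (E1M (M.E3 x)) v) + sc B (tens (M.E3 x) (E1V v))
      + sc (q * A) (tens (E1M x) (V.E3 v)) + tens x (E1V (V.E3 v))
      + sc (d * A * (A * inverse q)) (tens (E1M (E1M x)) (E2V v))
      + sc (d * A) (tens (E1M x) (E1V (E2V v)))"
    unfolding E3_tens[OF x v] E1.add E1.scale E1_tens[OF M.X_E3[OF x] v] E1_tens[OF x V.X_E3[OF v]]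
      E1_tens[OF M.X_E1[OF x] V.X_E2[OF v]] s
      A_def[symmetric] B_def[symmetric] d_def[symmetric] Vs.scale_right_distrib Vs.scale_scale
    by (simp add: mult_ac add_ac)
  have c1: "A * B * q = q * (A * B)" "q * (d * A * (A * inverse q)) = A * d * A"
    "q * (d * A * q) = d * (q * (q * A))" "q * (q * A) + q * (d * A) = A"
    by (simp_all add: field_simps d_def)
  show ?thesis
    unfolding L R M.E1_E3[OF x] V.E1_E3[OF v] V.E1_E2 Vs.scale_right_distrib Vs.scale_scale tl.scale
      tr.scale tr.add c1 
    using arg_cong[OF c1(4), of "\<lambda>c. sc c (tens (E1M x) (V.E3 v))"]
    by (simp add: Vs.scale_left_distrib algebra_simps)
qed

lemma E2_E3_tens:
  assumes x: "x \<in> XM m1 m2 m3" and v: "v \<in> XV n1 n2 n3"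
  shows "E2 (E3 (tens x v)) = sc q (E3 (E2 (tens x v)))"
proof -
  define A B C d where "A = q powi (n1 - n2)" and "B = q powi (n1 - n3)"
    and "C = q powi (n2 - n3)" and "d = inverse q - q"
  have AC: "B = A * C"
    unfolding A_def B_def C_def power_int_add[symmetric, OF disjI1[OF M.q_nz]] by simp
  have s: "q powi (n1 - (n3 - 1)) = q * B" "q powi (n1 - (n2 + 1)) = A * inverse q"
    "q powi (n2 - (n3 - 1)) = q * C" "q powi (n2 + 1 - (n3 - 1)) = q * (q * C)"
    using power_int_add[of q 1 "n1 - n3"] power_int_add[of q 1 "n2 - n3"]
      power_int_add[of q 2 "n2 - n3"] power_int_add[of q "n1 - n2" "-1"]
    by (simp_all add: A_def B_def C_def algebra_simps power2_eq_square)
  have L: "E2 (E3 (tens x v)) = sc (B * C) (tens (E2M (M.E3 x)) v) + sc B (tens (M.E3 x) (E2V v))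
      + sc (q * C) (tens (E2M x) (V.E3 v)) + tens x (E2V (V.E3 v))
      + sc (d * A * (q * (q * C))) (tens (E2M (E1M x)) (E2V v))
      + sc (d * A) (tens (E1M x) (E2V (E2V v)))"
    unfolding E3_tens[OF x v] E2.add E2.scale E2_tens[OF M.X_E3[OF x] v] E2_tens[OF x V.X_E3[OF v]]
      E2_tens[OF M.X_E1[OF x] V.X_E2[OF v]] s
      A_def[symmetric] B_def[symmetric] C_def[symmetric] d_def[symmetric] Vs.scale_right_distrib Vs.scale_scale
    by (simp add: mult_ac add_ac)
  have R: "E3 (E2 (tens x v)) = sc (B * C) (tens (M.E3 (E2M x)) v) + sc C (tens (E2M x) (V.E3 v))
      + sc (C * d * A) (tens (E1M (E2M x)) (E2V v)) + sc (q * B) (tens (M.E3 x) (E2V v))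
      + tens x (V.E3 (E2V v)) + sc (d * (A * inverse q)) (tens (E1M x) (E2V (E2V v)))"
    unfolding E2_tens[OF x v] E3_lin E3_tens[OF M.X_E2[OF x] v] E3_tens[OF x V.X_E2[OF v]] s
      A_def[symmetric] B_def[symmetric] C_def[symmetric] d_def[symmetric] Vs.scale_right_distrib Vs.scale_scale
    by (simp add: mult_ac add_ac)
  have c1: "q * (C * d * A) * q = d * A * (q * (q * C))" "q * (d * (A * inverse q)) = d * A"
    "q * (q * B) + q * (C * d * A) = B"
    by (simp_all add: field_simps d_def AC)
  have c2: "B * C * q = q * (B * C)" "q * (C * d * A * q) = d * A * (q * (q * C))"
    using c1(1) by (simp_all add: mult_ac)
  show ?thesis
    unfolding L R M.E2_E3[OF x] V.E2_E3[OF v] M.E1_E2 Vs.scale_right_distrib Vs.scale_scale tl.scale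
      tr.scale tl.add c1(1,2) c2
    using arg_cong[OF c1(3), of "\<lambda>c. sc c (tens (M.E3 x) (E2V v))"]
    by (simp add: Vs.scale_left_distrib algebra_simps)
qed

lemma F1_F3_tens:
  assumes x: "x \<in> XM m1 m2 m3" and v: "v \<in> XV n1 n2 n3"
  shows "F1 (F3 (tens x v)) = sc q (F3 (F1 (tens x v)))"
proof -
  define A B C d where "A = q powi (m3 - m2)" and "B = q powi (m3 - m1)"
    and "C = q powi (m2 - m1)" and "d = inverse q - q"
  have AC: "B = A * C"
    unfolding A_def B_def C_def power_int_add[symmetric, OF disjI1[OF M.q_nz]] by simp
  have s: "q powi (m3 - (m1 - 1)) = q * B" "q powi (m3 - (m2 + 1)) = A * inverse q"
    "q powi (m2 - (m1 - 1)) = q * C" "q powi (m2 + 1 - (m1 - 1)) = q * (q * C)"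
    using power_int_add[of q 1 "m3 - m1"] power_int_add[of q 1 "m2 - m1"]
      power_int_add[of q 2 "m2 - m1"] power_int_add[of q "m3 - m2" "-1"]
    by (simp_all add: A_def B_def C_def algebra_simps power2_eq_square)
  have L: "F1 (F3 (tens x v)) = tens (F1M (M.F3 x)) v + sc (q * C) (tens (M.F3 x) (F1V v))
      + sc B (tens (F1M x) (V.F3 v)) + sc (B * C) (tens x (F1V (V.F3 v)))
      + sc (d * A) (tens (F1M (F1M x)) (F2V v))
      + sc (d * A * (q * (q * C))) (tens (F1M x) (F1V (F2V v)))"
    unfolding F3_tens[OF x v] F1.add F1.scale F1_tens[OF M.X_F3[OF x] v] F1_tens[OF x V.X_F3[OF v]]
      F1_tens[OF M.X_F1[OF x] V.X_F2[OF v]] s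
      A_def[symmetric] B_def[symmetric] C_def[symmetric] d_def[symmetric] Vs.scale_right_distrib Vs.scale_scale
    by (simp add: mult_ac add_ac)
  have R: "F3 (F1 (tens x v)) = tens (M.F3 (F1M x)) v + sc (q * B) (tens (F1M x) (V.F3 v))
      + sc (d * (A * inverse q)) (tens (F1M (F1M x)) (F2V v)) + sc C (tens (M.F3 x) (F1V v))
      + sc (B * C) (tens x (V.F3 (F1V v))) + sc (C * d * A) (tens (F1M x) (F2V (F1V v)))"
    unfolding F1_tens[OF x v] F3_lin F3_tens[OF M.X_F1[OF x] v] F3_tens[OF x V.X_F1[OF v]] s
      A_def[symmetric] B_def[symmetric] C_def[symmetric] d_def[symmetric] Vs.scale_right_distrib Vs.scale_scale
    by (simp add: mult_ac add_ac)
  have c1: "q * (d * (A * inverse q)) = d * A" "q * (C * d * A * q) = d * A * (q * (q * C))"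
     "q * (q * B) + q * (C * d * A) = B" "B * C * q = q * (B * C)"
    by (simp_all add: field_simps d_def AC)
  show ?thesis
    unfolding L R M.F1_F3[OF x] V.F1_F3[OF v] V.F2_F1 Vs.scale_right_distrib Vs.scale_scale tl.scale
      tr.scale tr.add c1(1,2,4)
    using arg_cong[OF c1(3), of "\<lambda>c. sc c (tens (F1M x) (V.F3 v))"] c1(2)
    by (simp add: Vs.scale_left_distrib algebra_simps)
qed

lemma F3_F2_tens:
  assumes x: "x \<in> XM m1 m2 m3" and v: "v \<in> XV n1 n2 n3"
  shows "F3 (F2 (tens x v)) = sc q (F2 (F3 (tens x v)))"
proof -
  define A B d where "A = q powi (m3 - m2)" and "B = q powi (m3 - m1)" and "d = inverse q - q"
  have s: "q powi (m3 + 1 - m1) = q * B" "q powi (m3 + 1 - (m2 - 1)) = q * (q * A)"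
    "q powi (m3 - (m2 + 1)) = A * inverse q" "q powi (m3 + 1 - m2) = q * A"
    using power_int_add[of q 1 "m3 - m1"] power_int_add[of q 2 "m3 - m2"] power_int_add[of q 1 "m3 - m2"]
      power_int_add[of q "m3 - m2" "-1"]
    by (simp_all add: A_def B_def algebra_simps power2_eq_square)
  have L: "F3 (F2 (tens x v)) = tens (M.F3 (F2M x)) v + sc (q * B) (tens (F2M x) (V.F3 v))
      + sc (d * (q * (q * A))) (tens (F1M (F2M x)) (F2V v)) + sc A (tens (M.F3 x) (F2V v))
      + sc (A * B) (tens x (V.F3 (F2V v))) + sc (A * d * A) (tens (F1M x) (F2V (F2V v)))"
    unfolding F2_tens[OF x v] F3_lin F3_tens[OF M.X_F2[OF x] v] F3_tens[OF x V.X_F2[OF v]] s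
      A_def[symmetric] B_def[symmetric] d_def[symmetric] Vs.scale_right_distrib Vs.scale_scale
    by (simp add: mult_ac add_ac)
  have R: "F2 (F3 (tens x v)) = tens (F2M (M.F3 x)) v + sc (q * A) (tens (M.F3 x) (F2V v))
      + sc B (tens (F2M x) (V.F3 v)) + sc (A * B) (tens x (F2V (V.F3 v)))
      + sc (d * A) (tens (F2M (F1M x)) (F2V v))
      + sc (d * A * (A * inverse q)) (tens (F1M x) (F2V (F2V v)))"
    unfolding F3_tens[OF x v] F2.add F2.scale F2_tens[OF M.X_F3[OF x] v] F2_tens[OF x V.X_F3[OF v]]
      F2_tens[OF M.X_F1[OF x] V.X_F2[OF v]] s
      A_def[symmetric] B_def[symmetric] d_def[symmetric] Vs.scale_right_distrib Vs.scale_scale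
    by (simp add: mult_ac add_ac)
  have c1: "A * B * q = q * (A * B)" "q * (d * A * (A * inverse q)) = A * d * A"
    "q * (d * A * q) = d * (q * (q * A))" "q * (q * A) + q * (d * A) = A"
    by (simp_all add: field_simps d_def)
  show ?thesis
    unfolding L R M.F3_F2[OF x] V.F3_F2[OF v] M.F2_F1 Vs.scale_right_distrib Vs.scale_scale tl.scale
      tr.scale tl.add c1
    using arg_cong[OF c1(4), of "\<lambda>c. sc c (tens (M.F3 x) (F2V v))"]
    by (simp add: Vs.scale_left_distrib algebra_simps)
qed

lemma XW_E1: "w \<in> XW l1 l2 l3 \<Longrightarrow> E1 w \<in> XW (l1 + 1) (l2 - 1) l3"
proof (induction rule: XW_induct)
  case (tens x v m1 m2 m3 n1 n2 n3)
  have "tens (E1M x) v \<in> XW (l1 + 1) (l2 - 1) l3" "tens x (E1V v) \<in> XW (l1 + 1) (l2 - 1) l3"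
    by (rule tens_XW'[OF M.X_E1 tens(2)], use tens in simp_all)
      (rule tens_XW'[OF tens(1) V.X_E1], use tens in simp_all)
  then show ?case by (simp add: E1_tens[OF tens(1,2)] XW_closed)
qed (simp_all add: E1.add E1.scale XW_closed)

lemma XW_E2: "w \<in> XW l1 l2 l3 \<Longrightarrow> E2 w \<in> XW l1 (l2 + 1) (l3 - 1)"
proof (induction rule: XW_induct)
  case (tens x v m1 m2 m3 n1 n2 n3)
  have "tens (E2M x) v \<in> XW l1 (l2 + 1) (l3 - 1)" "tens x (E2V v) \<in> XW l1 (l2 + 1) (l3 - 1)"
    by (rule tens_XW'[OF M.X_E2 tens(2)], use tens in simp_all)
      (rule tens_XW'[OF tens(1) V.X_E2], use tens in simp_all)
  then show ?case by (simp add: E2_tens[OF tens(1,2)] XW_closed)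
qed (simp_all add: E2.add E2.scale XW_closed)

lemma XW_F1: "w \<in> XW l1 l2 l3 \<Longrightarrow> F1 w \<in> XW (l1 - 1) (l2 + 1) l3"
proof (induction rule: XW_induct)
  case (tens x v m1 m2 m3 n1 n2 n3)
  have "tens (F1M x) v \<in> XW (l1 - 1) (l2 + 1) l3" "tens x (F1V v) \<in> XW (l1 - 1) (l2 + 1) l3"
    by (rule tens_XW'[OF M.X_F1 tens(2)], use tens in simp_all)
      (rule tens_XW'[OF tens(1) V.X_F1], use tens in simp_all)
  then show ?case by (simp add: F1_tens[OF tens(1,2)] XW_closed)
qed (simp_all add: F1.add F1.scale XW_closed)

lemma XW_F2: "w \<in> XW l1 l2 l3 \<Longrightarrow> F2 w \<in> XW l1 (l2 - 1) (l3 + 1)"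
proof (induction rule: XW_induct)
  case (tens x v m1 m2 m3 n1 n2 n3)
  have "tens (F2M x) v \<in> XW l1 (l2 - 1) (l3 + 1)" "tens x (F2V v) \<in> XW l1 (l2 - 1) (l3 + 1)"
    by (rule tens_XW'[OF M.X_F2 tens(2)], use tens in simp_all)
      (rule tens_XW'[OF tens(1) V.X_F2], use tens in simp_all)
  then show ?case by (simp add: F2_tens[OF tens(1,2)] XW_closed)
qed (simp_all add: F2.add F2.scale XW_closed)

lemma E1_F1_W: "w \<in> XW l1 l2 l3 \<Longrightarrow> E1 (F1 w) = F1 (E1 w) + sc (M.br (l1 - l2)) w"
proof (induction rule: XW_induct)
  case (tens x v m1 m2 m3 n1 n2 n3)
  note x = tens(1) and v = tens(2)
  have c: "q powi (m2 - m1) * q powi (n1 - 1 - (n2 + 1)) = q powi (n1 - n2) * q powi (m2 - 1 - (m1 + 1))"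
    unfolding power_int_add[symmetric, OF disjI1[OF M.q_nz]] by (simp add: algebra_simps)
  have b: "M.br (l1 - l2) = q powi (n1 - n2) * M.br (m1 - m2) + q powi (m2 - m1) * M.br (n1 - n2)"
    using M.br_add[of "n1 - n2" "m1 - m2"] M.br_add[of "m1 - m2" "n1 - n2"]
      M.br_add[of "n1 - n2" "m1 - m2"] tens by (simp add: algebra_simps)
  show ?case
    unfolding F1_tens[OF x v] E1_tens[OF x v] E1.add E1.scale F1.add F1.scale
      E1_tens[OF M.X_F1[OF x] v] E1_tens[OF x V.X_F1[OF v]]
      F1_tens[OF M.X_E1[OF x] v] F1_tens[OF x V.X_E1[OF v]] M.E1_F1[OF x] V.E1_F1[OF v] tl.add tl.scale
      tr.add tr.scale Vs.scale_right_distrib Vs.scale_scale c b Vs.scale_left_distrib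
    by (simp add: add_ac)
qed (simp_all add: E1.add F1.add E1.scale F1.scale Vs.scale_right_distrib mult.commute)

lemma E2_F2_W: "w \<in> XW l1 l2 l3 \<Longrightarrow> E2 (F2 w) = F2 (E2 w) + sc (M.br (l2 - l3)) w"
proof (induction rule: XW_induct)
  case (tens x v m1 m2 m3 n1 n2 n3)
  note x = tens(1) and v = tens(2)
  have c: "q powi (m3 - m2) * q powi (n2 - 1 - (n3 + 1)) = q powi (n2 - n3) * q powi (m3 - 1 - (m2 + 1))"
    unfolding power_int_add[symmetric, OF disjI1[OF M.q_nz]] by (simp add: algebra_simps)
  have b: "M.br (l2 - l3) = q powi (n2 - n3) * M.br (m2 - m3) + q powi (m3 - m2) * M.br (n2 - n3)"
    using M.br_add[of "n2 - n3" "m2 - m3"] M.br_add[of "m2 - m3" "n2 - n3"] tens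
    by (simp add: algebra_simps)
  show ?case
    unfolding F2_tens[OF x v] E2_tens[OF x v] E2.add E2.scale F2.add F2.scale
      E2_tens[OF M.X_F2[OF x] v] E2_tens[OF x V.X_F2[OF v]]
      F2_tens[OF M.X_E2[OF x] v] F2_tens[OF x V.X_E2[OF v]] M.E2_F2[OF x] V.E2_F2[OF v] tl.add tl.scale
      tr.add tr.scale Vs.scale_right_distrib Vs.scale_scale c b Vs.scale_left_distrib
    by (simp add: add_ac)
qed (simp_all add: E2.add F2.add E2.scale F2.scale Vs.scale_right_distrib mult.commute)

lemma E1_F2_W: "w \<in> XW l1 l2 l3 \<Longrightarrow> E1 (F2 w) = F2 (E1 w)"
proof (induction rule: XW_induct)
  case (tens x v m1 m2 m3 n1 n2 n3)
  note x = tens(1) and v = tens(2)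
  have c: "q powi (m3 - m2) * q powi (n1 - (n2 - 1)) = q powi (n1 - n2) * q powi (m3 - (m2 - 1))"
    unfolding power_int_add[symmetric, OF disjI1[OF M.q_nz]] by (simp add: algebra_simps)
  show ?case
    unfolding F2_tens[OF x v] E1_tens[OF x v] E1.add E1.scale F2.add F2.scale
      E1_tens[OF M.X_F2[OF x] v] E1_tens[OF x V.X_F2[OF v]]
      F2_tens[OF M.X_E1[OF x] v] F2_tens[OF x V.X_E1[OF v]] M.E1_F2[OF x] V.E1_F2[OF v]
      Vs.scale_right_distrib Vs.scale_scale c
    by (simp add: add_ac)
qed (simp_all add: E1.add F2.add E1.scale F2.scale)

lemma E2_F1_W: "w \<in> XW l1 l2 l3 \<Longrightarrow> E2 (F1 w) = F1 (E2 w)"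
proof (induction rule: XW_induct)
  case (tens x v m1 m2 m3 n1 n2 n3)
  note x = tens(1) and v = tens(2)
  have c: "q powi (m2 - m1) * q powi (n2 + 1 - n3) = q powi (n2 - n3) * q powi (m2 + 1 - m1)"
    unfolding power_int_add[symmetric, OF disjI1[OF M.q_nz]] by (simp add: algebra_simps)
  show ?case
    unfolding F1_tens[OF x v] E2_tens[OF x v] E2.add E2.scale F1.add F1.scale
      E2_tens[OF M.X_F1[OF x] v] E2_tens[OF x V.X_F1[OF v]]
      F1_tens[OF M.X_E2[OF x] v] F1_tens[OF x V.X_E2[OF v]] M.E2_F1[OF x] V.E2_F1[OF v]
      Vs.scale_right_distrib Vs.scale_scale c
    by (simp add: add_ac)
qed (simp_all add: E2.add F1.add E2.scale F1.scale)

theorem tensor_gl3_module: "gl3_module q sc E1 E2 F1 F2 XW"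
proof unfold_locales
  show "Vs.subspace (XW l1 l2 l3)" for l1 l2 l3 by (rule XW_subspace)
next
  fix w l1 l2 l3 assume w: "w \<in> XW l1 l2 l3"
  show "E1 w \<in> XW (l1 + 1) (l2 - 1) l3" "E2 w \<in> XW l1 (l2 + 1) (l3 - 1)"
    "F1 w \<in> XW (l1 - 1) (l2 + 1) l3" "F2 w \<in> XW l1 (l2 - 1) (l3 + 1)"
    using w by (simp_all add: XW_E1 XW_E2 XW_F1 XW_F2)
  show "E1 (F1 w) = F1 (E1 w) + sc (M.br (l1 - l2)) w" by (rule E1_F1_W) fact
  show "E2 (F2 w) = F2 (E2 w) + sc (M.br (l2 - l3)) w" by (rule E2_F2_W) fact
  show "E1 (F2 w) = F2 (E1 w)" by (rule E1_F2_W) fact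
  show "E2 (F1 w) = F1 (E2 w)" by (rule E2_F1_W) fact
  show "E3 (E1 w) = sc q (E1 (E3 w))" using w
    by (induction rule: XW_induct)
      (simp_all add: E1_E3_tens E3_lin E1.add E1.scale Vs.scale_right_distrib mult.commute)
  show "E2 (E3 w) = sc q (E3 (E2 w))" using w
    by (induction rule: XW_induct)
      (simp_all add: E2_E3_tens E3_lin E2.add E2.scale Vs.scale_right_distrib mult.commute)
  show "F1 (F3 w) = sc q (F3 (F1 w))" using w
    by (induction rule: XW_induct)
      (simp_all add: F1_F3_tens F3_lin F1.add F1.scale Vs.scale_right_distrib mult.commute)
  show "F3 (F2 w) = sc q (F2 (F3 w))" using w
    by (induction rule: XW_induct)
      (simp_all add: F3_F2_tens F3_lin F2.add F2.scale Vs.scale_right_distrib mult.commute)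
qed

end

section \<open>The universal lowest weight module\<close>

text \<open>
  The Verma module is the space of functions on the PBW basis, \<open>(a, c, b)\<close> standing for
  \<open>E1\<^sup>a E3\<^sup>c E2\<^sup>b\<close> applied to the lowest weight vector.  Integral exponents are allowed in the index set, with
  functions in weight spaces supported on non-negative ones, so that the formulas need no boundary
  cases: every coefficient that would lead out of the support from inside contains a vanishing
  bracket.
\<close>

type_synonym pbw = "int \<times> int \<times> int"

context generic_q
begin

definition vE1 :: "(pbw \<Rightarrow> complex) \<Rightarrow> pbw \<Rightarrow> complex" where
  "vE1 f = (\<lambda>(a, c, b). f (a - 1, c, b))"

definition vE2 :: "(pbw \<Rightarrow> complex) \<Rightarrow> pbw \<Rightarrow> complex" where
  "vE2 f = (\<lambda>(a, c, b). q powi (c - a) * f (a, c, b - 1) - inverse q * br (a + 1) * f (a + 1, c - 1, b))"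

text \<open>
  The structure constants of \<open>F1\<close> (\<open>cR1\<close>, \<open>cD1\<close>), of \<open>F2\<close> (\<open>cP2\<close>, \<open>cS2\<close>) and of \<open>F3\<close> (\<open>cA3\<close>, \<open>cB3\<close>,
  \<open>cC3\<close>) in this basis; \<open>h\<close> and \<open>g\<close> are the first and second coroot on the lowest weight, and in \<open>cP2\<close>, \<open>cS2\<close> the
  parameter stands for the second.
\<close>

definition "cR1 h a c b = q powi (h - b + 1 + c) * br (c + 1)"
definition "cD1 h a c b = br (a + 1) * br (h + c - b + a)"
definition "cP2 h a c b = br (b + 1) * br (h + b)"
definition "cS2 h a c b = q powi (1 - h - 2 * b) * br (c + 1)"
definition "cA3 h g a c b = br (a + 1) * br (b + 1) * br (g + b) * q powi (h + c - b + a)"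
definition "cB3 h g a c b = br (c + 1) * br (c + 2) * q powi (h + c - g + 4 - 3 * b) * (q - inverse q)"
definition "cC3 h g a c b = br (c + 1) * (q powi (h + c - b) * (q * q * br b * br (g + b - 1) - br (b + 1) * br (g + b))
         - q powi (2 - g - 2 * b + a) * br (h + c - b + a))"

lemmas verma_coeffs = cR1_def cD1_def cP2_def cS2_def cA3_def cB3_def cC3_def

definition vF1 :: "int \<Rightarrow> (pbw \<Rightarrow> complex) \<Rightarrow> pbw \<Rightarrow> complex" where
  "vF1 h f = (\<lambda>(a, c, b). cR1 h a c b * f (a, c + 1, b - 1) - cD1 h a c b * f (a + 1, c, b))"

definition vF2 :: "int \<Rightarrow> (pbw \<Rightarrow> complex) \<Rightarrow> pbw \<Rightarrow> complex" where
  "vF2 h f = (\<lambda>(a, c, b). - (cP2 h a c b * f (a, c, b + 1)) - cS2 h a c b * f (a - 1, c + 1, b))"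

definition vscale :: "complex \<Rightarrow> (pbw \<Rightarrow> complex) \<Rightarrow> pbw \<Rightarrow> complex" where
  "vscale c f = (\<lambda>i. c * f i)"

lemma vE3: "qcomm q vscale vE1 vE2 f = (\<lambda>(a, c, b). q powi a * f (a, c - 1, b))"
proof (rule ext, clarify)
  fix a c b
  have 1: "q powi (c - (a - 1)) = q * q powi (c - a)"
    using power_int_add[of q 1 "c - a"] by (simp add: algebra_simps)
  have 2: "br (a + 1) = inverse q * br a + q powi a"
    using br_add[of a 1] by (simp add: power_int_minus)
  show "qcomm q vscale vE1 vE2 f (a, c, b) = q powi a * f (a, c - 1, b)"
    unfolding qcomm_def vE1_def vE2_def vscale_def prod.case minus_apply 1 2
    by (simp add: field_simps)
qed

lemma br_expand: "br n = (q powi n - inverse (q powi n)) / ((q * q - 1) / q)"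
proof -
  have "q - inverse q = (q * q - 1) / q" by (simp add: field_simps)
  then show ?thesis unfolding br_def by (simp add: power_int_minus)
qed

lemma q_q_1: "q * q \<noteq> 1" using q_root[of 2] by (simp add: power2_eq_square)

lemma powi_mult_2_3: "q powi (2 * n) = q powi n * q powi n" "q powi (3 * n) = q powi n * q powi n * q powi n"
   "q powi 2 = q * q" "q powi 3 = q * q * q" "q powi 4 = q * q * q * q"
  using power_int_add[of q n n] power_int_add[of q "2*n" n]
  by (simp_all add: eval_nat_numeral)

text \<open>
  The relations of the Verma module amount to identities between structure constants.  Written in
  terms of \<open>q powi a\<close>, \<open>q powi b\<close> and so on, they become identities between rational functions, checked by
  clearing denominators.
\<close>

lemmas expand = verma_coeffs br_expand power_int_add power_int_diff power_int_minus powi_mult_2_3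

lemma F21_a: "cP2 g a c b * cD1 h a c (b + 1) - q * (cD1 h a c b * cP2 g (a + 1) c b) = - cA3 h g a c b"
  using q_q_1 by (simp add: expand divide_simps) (simp add: algebra_simps eval_nat_numeral)
lemma F21_b: "- cS2 g a c b * cR1 h (a - 1) (c + 1) b + q * (cR1 h a c b * cS2 g a (c + 1) (b - 1)) = cB3 h g a c b"
  using q_q_1 by (simp add: expand divide_simps) (simp add: algebra_simps eval_nat_numeral)
lemma F21_c: "- cP2 g a c b * cR1 h a c (b + 1) + cS2 g a c b * cD1 h (a - 1) (c + 1) b
   - q * (- cR1 h a c b * cP2 g a (c + 1) (b - 1) + cD1 h a c b * cS2 g (a + 1) c b) = cC3 h g a c b"
  using q_q_1 by (simp add: expand divide_simps) (simp add: algebra_simps eval_nat_numeral)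
lemma F13_a: "cD1 h a c b * cA3 h g (a + 1) c b = q * (cA3 h g a c b * cD1 h (a + 1) c (b + 1))"
  using q_q_1 by (simp add: expand divide_simps)
lemma F13_b: "cR1 h a c b * cB3 h g a (c + 1) (b - 1) = q * (cB3 h g a c b * cR1 h (a - 1) (c + 2) (b - 1))"
  using q_q_1 by (simp add: expand divide_simps)
lemma F13_c: "- cR1 h a c b * cA3 h g a (c + 1) (b - 1) - cD1 h a c b * cC3 h g (a + 1) c b
  = q * (- cA3 h g a c b * cR1 h (a + 1) c (b + 1) - cC3 h g a c b * cD1 h a (c + 1) b)"
  using q_q_1 by (simp add: expand divide_simps) (simp add: algebra_simps eval_nat_numeral)
lemma F13_d: "cR1 h a c b * cC3 h g a (c + 1) (b - 1) - cD1 h a c b * cB3 h g (a + 1) c b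
  = q * (cC3 h g a c b * cR1 h a (c + 1) b - cB3 h g a c b * cD1 h (a - 1) (c + 2) (b - 1))"
  using q_q_1 by (simp add: expand divide_simps) (simp add: algebra_simps eval_nat_numeral)

lemma F32_a: "cA3 h g a c b * cP2 g (a + 1) c (b + 1) = q * (cP2 g a c b * cA3 h g a c (b + 1))"
  using q_q_1 by (simp add: expand divide_simps)
lemma F32_b: "cB3 h g a c b * cS2 g (a - 1) (c + 2) (b - 1) = q * (cS2 g a c b * cB3 h g (a - 1) (c + 1) b)"
  using q_q_1 by (simp add: expand divide_simps) (simp add: algebra_simps eval_nat_numeral)
lemma F32_c: "cA3 h g a c b * cS2 g (a + 1) c (b + 1) - cC3 h g a c b * cP2 g a (c + 1) b
  = q * (cS2 g a c b * cA3 h g (a - 1) (c + 1) b - cP2 g a c b * cC3 h g a c (b + 1))"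
  using q_q_1 by (simp add: expand divide_simps) (simp add: algebra_simps eval_nat_numeral)
lemma F32_d: "- cB3 h g a c b * cP2 g (a - 1) (c + 2) (b - 1) - cC3 h g a c b * cS2 g a (c + 1) b
  = q * (- cP2 g a c b * cB3 h g a c (b + 1) - cS2 g a c b * cC3 h g (a - 1) (c + 1) b)"
  using q_q_1 by (simp add: expand divide_simps) (simp add: algebra_simps eval_nat_numeral)

lemma E1F1_id: "cD1 h a c b - cD1 h (a - 1) c b = br (h + 2 * a + c - b)"
  using q_q_1 by (simp add: expand divide_simps) (simp add: algebra_simps eval_nat_numeral)
lemma E2F2_id: "- (q powi (c - a) * cP2 g a c (b - 1)) + inverse q * br (a + 1) * cS2 g (a + 1) (c - 1) b
   + q powi (c - a) * cP2 g a c b - inverse q * br a * cS2 g a c b = br (g - a + 2 * b + c)"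
  using q_q_1 by (simp add: expand divide_simps) (simp add: algebra_simps eval_nat_numeral)
lemma E2F2_id': "q powi (c - a) * cS2 g a c (b - 1) = cS2 g a c b * q powi (c + 2 - a)"
  using q_q_1 by (simp add: expand divide_simps) (simp add: algebra_simps eval_nat_numeral)
lemma E2F1_id1: "q powi (c - a) * cR1 h a c (b - 1) = cR1 h a c b * q powi (c + 1 - a)"
  using q_q_1 by (simp add: expand divide_simps) (simp add: algebra_simps eval_nat_numeral)
lemma E2F1_id2: "q powi (c - a) * cD1 h a c (b - 1) + inverse q * br (a + 1) * cR1 h (a + 1) (c - 1) b
   = cR1 h a c b * (inverse q * br (a + 1)) + cD1 h a c b * q powi (c - a - 1)"
  using q_q_1 by (simp add: expand divide_simps) (simp add: algebra_simps eval_nat_numeral)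
lemma E2F1_id3: "br (a + 1) * cD1 h (a + 1) (c - 1) b = cD1 h a c b * br (a + 2)"
  using q_q_1 by (simp add: expand divide_simps) (simp add: algebra_simps eval_nat_numeral)

lemma vF3: "qcomm q vscale (vF2 g) (vF1 h) f = (\<lambda>(a, c, b). - (cA3 h g a c b * f (a + 1, c, b + 1))
    + cB3 h g a c b * f (a - 1, c + 2, b - 1) + cC3 h g a c b * f (a, c + 1, b))"
proof (rule ext, clarify)
  fix a c b
  show "qcomm q vscale (vF2 g) (vF1 h) f (a, c, b) = - (cA3 h g a c b * f (a + 1, c, b + 1))
    + cB3 h g a c b * f (a - 1, c + 2, b - 1) + cC3 h g a c b * f (a, c + 1, b)"
    unfolding F21_b[symmetric] F21_c[symmetric]
    using arg_cong[OF F21_a[of g a c b h], of "\<lambda>z. z * f (a + 1, c, b + 1)"]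
    by (simp add: qcomm_def vF1_def vF2_def vscale_def) (simp add: algebra_simps)
qed

definition vX :: "int \<Rightarrow> int \<Rightarrow> int \<Rightarrow> int \<Rightarrow> int \<Rightarrow> int \<Rightarrow> (pbw \<Rightarrow> complex) set" where
  "vX m1 m2 m3 l1 l2 l3 = {f. \<forall>a c b. f (a, c, b) \<noteq> 0 \<longrightarrow> 0 \<le> a \<and> 0 \<le> c \<and> 0 \<le> b \<and>
     l1 = m1 + a + c \<and> l2 = m2 - a + b \<and> l3 = m3 - c - b}"

lemma br_arg: "f \<in> vX m1 m2 m3 l1 l2 l3 \<Longrightarrow>
    br (l1 - l2) * f (a, c, b) = br (m1 - m2 + 2 * a + c - b) * f (a, c, b)"
  "f \<in> vX m1 m2 m3 l1 l2 l3 \<Longrightarrow>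
    br (l2 - l3) * f (a, c, b) = br (m2 - m3 - a + 2 * b + c) * f (a, c, b)"
proof -
  assume f: "f \<in> vX m1 m2 m3 l1 l2 l3"
  have "f (a, c, b) = 0 \<or> l1 - l2 = m1 - m2 + 2 * a + c - b \<and> l2 - l3 = m2 - m3 - a + 2 * b + c"
    using f unfolding vX_def by (auto; smt (verit))
  then show "br (l1 - l2) * f (a, c, b) = br (m1 - m2 + 2 * a + c - b) * f (a, c, b)"
    "br (l2 - l3) * f (a, c, b) = br (m2 - m3 - a + 2 * b + c) * f (a, c, b)"
    by auto
qed

lemma vscale_vector_space: "vector_space vscale"
  by unfold_locales (auto simp: vscale_def fun_eq_iff algebra_simps)

lemma vE2_vF1: "vE2 (vF1 h f) = vF1 h (vE2 f)"
proof (rule ext, clarify)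
  fix a c b
  \<comment> \<open>Comparison of coefficients; with variables for the structure constants it is a consequence of the three hypotheses in any field.\<close>
  have aux: "A * (r * x - d * y) - i * B * (r' * y - d' * z) = r0 * (A' * x - i * B * y) - d0 * (A'' * y - i * B' * z)"
    if "A * r = r0 * A'" "A * d + i * B * r' = r0 * (i * B) + d0 * A''" "B * d' = d0 * B'"
    for A r x d y i B r' d' z r0 A' d0 A'' B' :: complex
    using that by algebra
  show "vE2 (vF1 h f) (a, c, b) = vF1 h (vE2 f) (a, c, b)"
    using aux[OF E2F1_id1[of c a h b] E2F1_id2[of c a h b] E2F1_id3[of a h c b],
        of "f (a, c + 1, b - 2)" "f (a + 1, c, b - 1)" "f (a + 2, c - 1, b)"]
    by (simp add: vE2_def vF1_def diff_diff_eq add.commute[of 2 a])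
qed

lemma vF1_vF3: "vF1 h (qcomm q vscale (vF2 g) (vF1 h) f) = vscale q (qcomm q vscale (vF2 g) (vF1 h) (vF1 h f))"
proof (rule ext, clarify)
  fix a c b
  have aux: "r * (- (a1 * x) + b1 * y + c1 * z) - d * (- (a2 * w) + b2 * z + c2 * x)
      = q * (- (a0 * (cR1 * x - cD1 * w)) + b0 * (r2 * y - d2 * z) + c0 * (r3 * z - d3 * x))"
    if "d * a2 = q * (a0 * cD1)" "r * b1 = q * (b0 * r2)" "- r * a1 - d * c2 = q * (- a0 * cR1 - c0 * d3)"
      "r * c1 - d * b2 = q * (c0 * r3 - b0 * d2)"
    for r a1 x b1 y c1 z d a2 w b2 c2 a0 cR1 cD1 b0 r2 d2 c0 r3 d3 :: complex
    using that by algebra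
  show "vF1 h (qcomm q vscale (vF2 g) (vF1 h) f) (a, c, b)
     = vscale q (qcomm q vscale (vF2 g) (vF1 h) (vF1 h f)) (a, c, b)"
    unfolding vF3
    using aux[OF F13_a[of h a c b g] F13_b[of h a c b g] F13_c[of h a c b g] F13_d[of h a c b g],
        of "f (a + 1, c + 1, b)" "f (a - 1, c + 3, b - 2)" "f (a, c + 2, b - 1)" "f (a + 2, c, b + 1)"]
    by (simp add: vF1_def vscale_def add.commute[of 2] add.commute[of 3])
qed

lemma vF3_vF2: "qcomm q vscale (vF2 g) (vF1 h) (vF2 g f) = vscale q (vF2 g (qcomm q vscale (vF2 g) (vF1 h) f))"
proof (rule ext, clarify)
  fix a c b
  have aux: "- (a0 * (- (p1 * x) - s1 * y)) + b0 * (- (cP2 * z) - cS2 * w) + c0 * (- (p3 * y) - s3 * z)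
      = q * (- (p * (- (a1 * x) + b1 * z + c1 * y)) - s * (- (a2 * y) + b2 * w + c2 * z))"
    if "a0 * p1 = q * (p * a1)" "b0 * cS2 = q * (s * b2)" "a0 * s1 - c0 * p3 = q * (s * a2 - p * c1)"
      "- b0 * cP2 - c0 * s3 = q * (- p * b1 - s * c2)"
    for a0 p1 x s1 y b0 cP2 z cS2 w c0 p3 s3 p a1 b1 c1 s a2 b2 c2 :: complex
    using that by algebra
  show "qcomm q vscale (vF2 g) (vF1 h) (vF2 g f) (a, c, b)
     = vscale q (vF2 g (qcomm q vscale (vF2 g) (vF1 h) f)) (a, c, b)"
    unfolding vF3
    using aux[OF F32_a[of h g a c b] F32_b[of h g a c b] F32_c[of h g a c b] F32_d[of h g a c b],
        of "f (a + 1, c, b + 2)" "f (a, c + 1, b + 1)" "f (a - 1, c + 2, b)" "f (a - 2, c + 3, b - 1)"]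
    by (simp add: vF2_def vscale_def add.commute[of 2] add.commute[of 3])
qed

text \<open>
  The support condition in \<open>vX\<close> records the weight of a basis vector, and \<open>br_arg\<close> uses it to replace the
  bracket of the weight by a function of the basis index.
\<close>

theorem verma_gl3_module:
  "gl3_module q vscale vE1 vE2 (vF1 (m1 - m2)) (vF2 (m2 - m3)) (vX m1 m2 m3)"
proof -
  interpret vector_space vscale by (rule vscale_vector_space)
  show ?thesis
  proof unfold_locales
    fix f l1 l2 l3 assume f: "f \<in> vX m1 m2 m3 l1 l2 l3"
    have D: "f (a, c, b) = 0 \<or> 0 \<le> a \<and> 0 \<le> c \<and> 0 \<le> b \<and>
       l1 = m1 + a + c \<and> l2 = m2 - a + b \<and> l3 = m3 - c - b" for a c b
      using f unfolding vX_def by auto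
    show "vE1 f \<in> vX m1 m2 m3 (l1 + 1) (l2 - 1) l3"
      using D unfolding vX_def vE1_def by (auto; smt (verit))
    show "vE2 f \<in> vX m1 m2 m3 l1 (l2 + 1) (l3 - 1)"
    proof -
      { fix a c b assume "vE2 f (a, c, b) \<noteq> 0"
        then have "f (a, c, b - 1) \<noteq> 0 \<or> a + 1 \<noteq> 0 \<and> f (a + 1, c - 1, b) \<noteq> 0"
          by (auto simp: vE2_def)
        then have "0 \<le> a \<and> 0 \<le> c \<and> 0 \<le> b \<and>
            l1 = m1 + a + c \<and> l2 + 1 = m2 - a + b \<and> l3 - 1 = m3 - c - b"
          using D[of a c "b - 1"] D[of "a + 1" "c - 1" b] by auto }
      then show ?thesis unfolding vX_def by blast
    qed
    show "vF1 (m1 - m2) f \<in> vX m1 m2 m3 (l1 - 1) (l2 + 1) l3"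
    proof -
      { fix a c b assume "vF1 (m1 - m2) f (a, c, b) \<noteq> 0"
        then have "c + 1 \<noteq> 0 \<and> f (a, c + 1, b - 1) \<noteq> 0 \<or> a + 1 \<noteq> 0 \<and> f (a + 1, c, b) \<noteq> 0"
          by (auto simp: vF1_def cR1_def cD1_def)
        then have "0 \<le> a \<and> 0 \<le> c \<and> 0 \<le> b \<and>
            l1 - 1 = m1 + a + c \<and> l2 + 1 = m2 - a + b \<and> l3 = m3 - c - b"
          using D[of a "c + 1" "b - 1"] D[of "a + 1" c b] by auto }
      then show ?thesis unfolding vX_def by blast
    qed
    show "vF2 (m2 - m3) f \<in> vX m1 m2 m3 l1 (l2 - 1) (l3 + 1)"
    proof -
      { fix a c b assume "vF2 (m2 - m3) f (a, c, b) \<noteq> 0"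
        then have "b + 1 \<noteq> 0 \<and> f (a, c, b + 1) \<noteq> 0 \<or> c + 1 \<noteq> 0 \<and> f (a - 1, c + 1, b) \<noteq> 0"
          by (auto simp: vF2_def cP2_def cS2_def)
        then have "0 \<le> a \<and> 0 \<le> c \<and> 0 \<le> b \<and>
            l1 = m1 + a + c \<and> l2 - 1 = m2 - a + b \<and> l3 + 1 = m3 - c - b"
          using D[of a c "b + 1"] D[of "a - 1" "c + 1" b] by auto }
      then show ?thesis unfolding vX_def by blast
    qed
    show "vE1 (vF1 (m1 - m2) f) = vF1 (m1 - m2) (vE1 f) + vscale (br (l1 - l2)) f"
    proof (rule ext, clarify)
      fix a c b
      show "vE1 (vF1 (m1 - m2) f) (a, c, b) = (vF1 (m1 - m2) (vE1 f) + vscale (br (l1 - l2)) f) (a, c, b)"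
        unfolding vscale_def plus_fun_apply br_arg(1)[OF f] E1F1_id[symmetric]
        by (simp add: vE1_def vF1_def cR1_def algebra_simps)
    qed
    show "vE2 (vF2 (m2 - m3) f) = vF2 (m2 - m3) (vE2 f) + vscale (br (l2 - l3)) f"
    proof (rule ext, clarify)
      fix a c b
      show "vE2 (vF2 (m2 - m3) f) (a, c, b) = (vF2 (m2 - m3) (vE2 f) + vscale (br (l2 - l3)) f) (a, c, b)"
        unfolding vscale_def plus_fun_apply br_arg(2)[OF f] E2F2_id[symmetric]
        using arg_cong[OF E2F2_id'[of c a "m2 - m3" b, symmetric], of "\<lambda>z. z * f (a - 1, c + 1, b - 1)"]
        by (simp add: vE2_def vF2_def) (simp add: algebra_simps cP2_def)
    qed
    show "vE1 (vF2 (m2 - m3) f) = vF2 (m2 - m3) (vE1 f)"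
      by (rule ext, clarify) (simp add: vE1_def vF2_def cP2_def cS2_def)
    show "vE2 (vF1 (m1 - m2) f) = vF1 (m1 - m2) (vE2 f)"
      by (rule vE2_vF1)
    show "qcomm q vscale vE1 vE2 (vE1 f) = vscale q (vE1 (qcomm q vscale vE1 vE2 f))"
      unfolding vE3 by (rule ext, clarify) (simp add: vE1_def vscale_def power_int_diff)
    show "vE2 (qcomm q vscale vE1 vE2 f) = vscale q (qcomm q vscale vE1 vE2 (vE2 f))"
      unfolding vE3 by (rule ext, clarify)
        (simp add: vE2_def vscale_def power_int_diff power_int_add field_simps)
    show "vF1 (m1 - m2) (qcomm q vscale (vF2 (m2 - m3)) (vF1 (m1 - m2)) f)
       = vscale q (qcomm q vscale (vF2 (m2 - m3)) (vF1 (m1 - m2)) (vF1 (m1 - m2) f))"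
      by (rule vF1_vF3)
    show "qcomm q vscale (vF2 (m2 - m3)) (vF1 (m1 - m2)) (vF2 (m2 - m3) f)
       = vscale q (vF2 (m2 - m3) (qcomm q vscale (vF2 (m2 - m3)) (vF1 (m1 - m2)) f))"
      by (rule vF3_vF2)
  next
    fix l1 l2 l3
    show "subspace (vX m1 m2 m3 l1 l2 l3)"
      unfolding subspace_def vX_def by (auto simp: vscale_def; metis add_cancel_right_right)
  qed (auto simp: vE1_def vE2_def vF1_def vF2_def vscale_def fun_eq_iff algebra_simps)
qed

end

section \<open>Lowest weight vectors and projected transport\<close>

context rank_one_step
begin

text \<open>
  \<open>C j\<close> is a family of operators commuting with \<open>E\<close> that annihilates the terms with a positive power of
  \<open>F\<close> on both sides of \<open>rank_one_transport\<close>; then only the leading terms remain.  The index \<open>j\<close>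
  keeps track of the weight.
\<close>

lemma rank_one_projected:
  fixes C :: "int \<Rightarrow> 'w \<Rightarrow> 'w" and Z :: "int \<Rightarrow> 'w set"
  assumes y: "y \<in> X (- n)" and a_def: "a = int b - n" and a_gt: "a > int N"
    and F_y: "V.dpF (Suc N) y = 0" and E_y: "V.dpE (Suc b) y = 0"
    and C_lin: "\<And>j. Vector_Spaces.linear scW scW (C j)"
    and C_E: "\<And>j w. w \<in> Z j \<Longrightarrow> C (j + 1) (EW w) = EW (C j w)"
    and Z_E: "\<And>j w. w \<in> Z j \<Longrightarrow> EW w \<in> Z (j + 1)"
    and Z_scale: "\<And>j c w. w \<in> Z j \<Longrightarrow> scW c w \<in> Z j"
    and Z_add: "\<And>j v w. w \<in> Z j \<Longrightarrow> v \<in> Z j \<Longrightarrow> v + w \<in> Z j"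
    and top: "\<And>k. T (Suc b) (V.dpF k y) \<in> Z (J + a + 1 - int k)"
      "\<And>k. k > 0 \<Longrightarrow> C (J + a + 1 - int k) (T (Suc b) (V.dpF k y)) = 0"
    and bot: "\<And>k. T 0 (V.dpF k v) \<in> Z (J - int k)"
      "\<And>k. k > 0 \<Longrightarrow> C (J - int k) (T 0 (V.dpF k v)) = 0"
    and v: "v = scV (q powi n) (\<Sum>k\<le>N. scV ((-1) powi (int k + n) * V.br (a + 1) / V.br (a + 1 - int k))
     (V.dpz (int k + n) (V.dpF k y)))"
  shows "C (J + a + 1) (T (Suc b) y) = W.dpE (nat a + 1) (C J (T 0 v))"
proof -
  interpret C: Vector_Spaces.linear scW scW "C j" for j by (rule C_lin)
  have E_pow: "W.dpE m w \<in> Z (j + int m) \<and> C (j + int m) (W.dpE m w) = W.dpE m (C j w)"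
    if w: "w \<in> Z j" for m j w
  proof (induction m)
    case (Suc m)
    have j: "j + int (Suc m) = (j + int m) + 1" by simp
    show ?case
      unfolding j W.dpE_Suc C.scale using Suc C_E Z_E Z_scale by simp
  qed (use w in simp)
  have v': "ww b N n a y (a + 1) = v"
    unfolding ww_top[OF y a_def a_gt F_y E_y] v ..
  obtain d d' K where d: "d 0 = 1" "d' 0 = 1" and eq:
    "(\<Sum>k\<le>N. scW (d' k) (W.dpE k (T (Suc b) (V.dpF k y))))
      = W.dpE (nat a + 1) (\<Sum>k\<le>K. scW (d k) (W.dpE k (T 0 (V.dpF k v))))"
    using rank_one_transport[OF y a_def a_gt F_y E_y] unfolding v' by blast
  have single: "(\<Sum>k\<le>n. f k) = f 0" if "\<And>k. k > 0 \<Longrightarrow> f k = 0" for f :: "nat \<Rightarrow> 'w" and n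
    using that by (subst sum.mono_neutral_right[of "{..n}" "{0}"]) auto
  have dpE0: "W.dpE k 0 = 0" for k by (rule W.dE.zero)
  have 1: "C (J + a + 1) (\<Sum>k\<le>N. scW (d' k) (W.dpE k (T (Suc b) (V.dpF k y)))) = C (J + a + 1) (T (Suc b) y)"
    unfolding C.sum C.scale
  proof (subst single)
    fix k :: nat assume "k > 0"
    then show "scW (d' k) (C (J + a + 1) (W.dpE k (T (Suc b) (V.dpF k y)))) = 0"
      using E_pow[OF top(1)[of k], of k] top(2)[of k] dpE0[of k] by simp
  qed (simp add: d)
  have in_Z: "(\<Sum>k\<le>K. scW (d k) (W.dpE k (T 0 (V.dpF k v)))) \<in> Z J"
  proof -
    have mem: "W.dpE k (T 0 (V.dpF k v)) \<in> Z J" for k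
      using E_pow[OF bot(1)[of k], of k] by simp
    have "(\<Sum>k\<le>K. scW (d k) (W.dpE k (T 0 (V.dpF k v)))) \<in> Z J" for K
      by (induction K) (use mem mem[of 0] in \<open>auto intro!: Z_add Z_scale simp: sum.atMost_Suc\<close>)
    then show ?thesis .
  qed
  have 2: "C J (\<Sum>k\<le>K. scW (d k) (W.dpE k (T 0 (V.dpF k v)))) = C J (T 0 v)"
    unfolding C.sum C.scale
  proof (subst single)
    fix k :: nat assume "k > 0"
    then show "scW (d k) (C J (W.dpE k (T 0 (V.dpF k v)))) = 0"
      using E_pow[OF bot(1)[of k], of k] bot(2)[of k] dpE0[of k] by simp
  qed (simp add: d)
  have J: "J + int (nat a + 1) = J + a + 1" using a_gt by simp
  show ?thesis
    using E_pow[OF in_Z, of "nat a + 1"] unfolding J 1[symmetric] eq 2[symmetric] by simp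
qed

end

context gl3_module
begin

definition X1 :: "int \<Rightarrow> 'w set" where "X1 h = {w. \<exists>l1 l2 l3. w \<in> X l1 l2 l3 \<and> h = l1 - l2}"
definition X2 :: "int \<Rightarrow> 'w set" where "X2 h = {w. \<exists>l1 l2 l3. w \<in> X l1 l2 l3 \<and> h = l2 - l3}"

lemma qsl2_1: "qsl2 q sc E1 F1 X1"
proof unfold_locales
  fix w h assume "w \<in> X1 h"
  then obtain l1 l2 l3 where w: "w \<in> X l1 l2 l3" and h: "h = l1 - l2" by (auto simp: X1_def)
  show "E1 w \<in> X1 (h + 2)" unfolding X1_def using X_E1[OF w] h by (smt (verit) mem_Collect_eq)
  show "F1 w \<in> X1 (h - 2)" unfolding X1_def using X_F1[OF w] h by (smt (verit) mem_Collect_eq)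
  show "sc c w \<in> X1 h" for c unfolding X1_def using X_scale[OF w] h by blast
  show "E1 (F1 w) = F1 (E1 w) + sc (br h) w" using E1_F1[OF w] h by simp
qed

lemma qsl2_2: "qsl2 q sc E2 F2 X2"
proof unfold_locales
  fix w h assume "w \<in> X2 h"
  then obtain l1 l2 l3 where w: "w \<in> X l1 l2 l3" and h: "h = l2 - l3" by (auto simp: X2_def)
  show "E2 w \<in> X2 (h + 2)" unfolding X2_def using X_E2[OF w] h by (smt (verit) mem_Collect_eq)
  show "F2 w \<in> X2 (h - 2)" unfolding X2_def using X_F2[OF w] h by (smt (verit) mem_Collect_eq)
  show "sc c w \<in> X2 h" for c unfolding X2_def using X_scale[OF w] h by blast
  show "E2 (F2 w) = F2 (E2 w) + sc (br h) w" using E2_F2[OF w] h by simp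
qed

sublocale s1: qsl2 q sc E1 F1 X1 by (rule qsl2_1)
sublocale s2: qsl2 q sc E2 F2 X2 by (rule qsl2_2)

lemma X_dpE1: "w \<in> X l1 l2 l3 \<Longrightarrow> s1.dpE n w \<in> X (l1 + int n) (l2 - int n) l3"
proof (induction n)
  case (Suc n)
  have "E1 (s1.dpE n w) \<in> X (l1 + int n + 1) (l2 - int n - 1) l3" by (rule X_E1) (use Suc in simp)
  then show ?case unfolding s1.dpE_Suc by (intro X_scale) (simp add: algebra_simps)
qed simp

lemma X_dpE2: "w \<in> X l1 l2 l3 \<Longrightarrow> s2.dpE n w \<in> X l1 (l2 + int n) (l3 - int n)"
proof (induction n)
  case (Suc n)
  have "E2 (s2.dpE n w) \<in> X l1 (l2 + int n + 1) (l3 - int n - 1)" by (rule X_E2) (use Suc in simp)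
  then show ?case unfolding s2.dpE_Suc by (intro X_scale) (simp add: algebra_simps)
qed simp

lemma X_dpF1: "w \<in> X l1 l2 l3 \<Longrightarrow> s1.dpF n w \<in> X (l1 - int n) (l2 + int n) l3"
proof (induction n)
  case (Suc n)
  have "F1 (s1.dpF n w) \<in> X (l1 - int n - 1) (l2 + int n + 1) l3" by (rule X_F1) (use Suc in simp)
  then show ?case unfolding s1.dpF_Suc by (intro X_scale) (simp add: algebra_simps)
qed simp

lemma X_dpF2: "w \<in> X l1 l2 l3 \<Longrightarrow> s2.dpF n w \<in> X l1 (l2 - int n) (l3 + int n)"
proof (induction n)
  case (Suc n)
  have "F2 (s2.dpF n w) \<in> X l1 (l2 - int n - 1) (l3 + int n + 1)" by (rule X_F2) (use Suc in simp)
  then show ?case unfolding s2.dpF_Suc by (intro X_scale) (simp add: algebra_simps)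
qed simp

theorem verma_identity_dp:
  assumes "w \<in> X l1 l2 l3"
  shows "s1.dpE p (s2.dpE (p + r) (s1.dpE r w)) = s2.dpE r (s1.dpE (p + r) (s2.dpE p w))"
proof -
  have "w \<in> Xall" using assms by (auto simp: Xall_def)
  from verma_identity[OF this, of p r] show ?thesis
    by (simp add: divided_power_def E1_pow_lin E2_pow_lin mult_ac)
qed

definition lowest :: "'w \<Rightarrow> int \<Rightarrow> int \<Rightarrow> int \<Rightarrow> bool" where
  "lowest x l1 l2 l3 \<longleftrightarrow> x \<in> X l1 l2 l3 \<and> F1 x = 0 \<and> F2 x = 0"

text \<open>
  The rank one singular vectors of a Verma module.
\<close>

lemma lowest_dpE1:
  assumes "lowest x l1 l2 l3" and b: "int b = l2 - l1"
  shows "lowest (s1.dpE (Suc b) x) (l2 + 1) (l1 - 1) l3"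
proof -
  have x: "x \<in> X l1 l2 l3" "F1 x = 0" "F2 x = 0" using assms by (auto simp: lowest_def)
  have F2: "F2 (s1.dpE n x) = 0" for n
  proof (induction n)
    case (Suc n)
    then show ?case unfolding s1.dpE_Suc F2.scale using E1_F2[OF X_dpE1[OF x(1), of n]]
      by (metis E1.zero Vs.scale_zero_right)
  qed (simp add: x)
  have "x \<in> X1 (- int b)" using x b by (auto simp: X1_def)
  then have "F1 (s1.dpE (Suc b) x) = 0"
    using s1.F_dpE_Suc[of x "- int b" b] x(2) by (simp add: s1.dE.zero)
  moreover have "s1.dpE (Suc b) x \<in> X (l2 + 1) (l1 - 1) l3"
    using X_dpE1[OF x(1), of "Suc b"] b by (simp add: algebra_simps)
  ultimately show ?thesis using F2 by (auto simp: lowest_def)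
qed

lemma lowest_dpE2:
  assumes "lowest x l1 l2 l3" and b: "int b = l3 - l2"
  shows "lowest (s2.dpE (Suc b) x) l1 (l3 + 1) (l2 - 1)"
proof -
  have x: "x \<in> X l1 l2 l3" "F1 x = 0" "F2 x = 0" using assms by (auto simp: lowest_def)
  have F1: "F1 (s2.dpE n x) = 0" for n
  proof (induction n)
    case (Suc n)
    then show ?case unfolding s2.dpE_Suc F1.scale using E2_F1[OF X_dpE2[OF x(1), of n]]
      by (metis E2.zero Vs.scale_zero_right)
  qed (simp add: x)
  have "x \<in> X2 (- int b)" using x b by (auto simp: X2_def)
  then have "F2 (s2.dpE (Suc b) x) = 0"
    using s2.F_dpE_Suc[of x "- int b" b] x(3) by (simp add: s2.dE.zero)
  moreover have "s2.dpE (Suc b) x \<in> X l1 (l3 + 1) (l2 - 1)"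
    using X_dpE2[OF x(1), of "Suc b"] b by (simp add: algebra_simps)
  ultimately show ?thesis using F1 by (auto simp: lowest_def)
qed

text \<open>
  The submodule generated by a lowest weight vector is spanned by words in \<open>E1\<close> and \<open>E2\<close>.  What matters
  is that its weights lie in the cone above the generating weight (\<open>subX_cone\<close>), while the ambient Verma
  module has further weights below.
\<close>

inductive gen :: "'w \<Rightarrow> int \<Rightarrow> int \<Rightarrow> int \<Rightarrow> 'w \<Rightarrow> int \<Rightarrow> int \<Rightarrow> int \<Rightarrow> bool"
  for x p1 p2 p3 where
  gen_base: "gen x p1 p2 p3 x p1 p2 p3"
| gen_E1: "gen x p1 p2 p3 w l1 l2 l3 \<Longrightarrow> gen x p1 p2 p3 (E1 w) (l1 + 1) (l2 - 1) l3"
| gen_E2: "gen x p1 p2 p3 w l1 l2 l3 \<Longrightarrow> gen x p1 p2 p3 (E2 w) l1 (l2 + 1) (l3 - 1)"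

definition subX :: "'w \<Rightarrow> int \<Rightarrow> int \<Rightarrow> int \<Rightarrow> int \<Rightarrow> int \<Rightarrow> int \<Rightarrow> 'w set" where
  "subX x p1 p2 p3 l1 l2 l3 = Vs.span {w. gen x p1 p2 p3 w l1 l2 l3}"

lemma gen_cone: "gen x p1 p2 p3 w l1 l2 l3 \<Longrightarrow> \<exists>n1 n2 :: nat. l1 = p1 + int n1 \<and> l2 = p2 - int n1 + int n2 \<and> l3 = p3 - int n2"
proof (induction rule: gen.induct)
  case gen_base
  then show ?case by (auto intro: exI[of _ 0])
next
  case (gen_E1 w l1 l2 l3)
  then obtain n1 n2 :: nat where "l1 = p1 + int n1 \<and> l2 = p2 - int n1 + int n2 \<and> l3 = p3 - int n2" by blast
  then show ?case by (intro exI[of _ "Suc n1"] exI[of _ n2]) simp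
next
  case (gen_E2 w l1 l2 l3)
  then obtain n1 n2 :: nat where "l1 = p1 + int n1 \<and> l2 = p2 - int n1 + int n2 \<and> l3 = p3 - int n2" by blast
  then show ?case by (intro exI[of _ n1] exI[of _ "Suc n2"]) simp
qed

context
  fixes x p1 p2 p3 assumes x: "lowest x p1 p2 p3"
begin

lemma gen_X: "gen x p1 p2 p3 w l1 l2 l3 \<Longrightarrow> w \<in> X l1 l2 l3"
  by (induction rule: gen.induct) (use x in \<open>auto simp: lowest_def X_E1 X_E2\<close>)

lemma subX_X: "subX x p1 p2 p3 l1 l2 l3 \<subseteq> X l1 l2 l3"
  unfolding subX_def by (rule Vs.span_minimal) (auto simp: gen_X X_subspace)

lemma subX_base: "x \<in> subX x p1 p2 p3 p1 p2 p3"
  unfolding subX_def by (rule Vs.span_base) (simp add: gen_base)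

lemma subX_induct [consumes 1, case_names gen zero add scale]:
  assumes "w \<in> subX x p1 p2 p3 l1 l2 l3"
    and "\<And>w. gen x p1 p2 p3 w l1 l2 l3 \<Longrightarrow> P w"
    and "P 0" and "\<And>v w. P v \<Longrightarrow> P w \<Longrightarrow> P (v + w)" and "\<And>c w. P w \<Longrightarrow> P (sc c w)"
  shows "P w"
proof -
  have "w \<in> {w. P w}"
    by (rule Vs.span_induct[OF assms(1)[unfolded subX_def]])
      (use assms(2-) in \<open>auto simp: Vs.subspace_def\<close>)
  then show ?thesis by simp
qed

lemma subX_closed:
  "0 \<in> subX x p1 p2 p3 l1 l2 l3"
  "v \<in> subX x p1 p2 p3 l1 l2 l3 \<Longrightarrow> w \<in> subX x p1 p2 p3 l1 l2 l3 \<Longrightarrow> v + w \<in> subX x p1 p2 p3 l1 l2 l3"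
  "v \<in> subX x p1 p2 p3 l1 l2 l3 \<Longrightarrow> w \<in> subX x p1 p2 p3 l1 l2 l3 \<Longrightarrow> v - w \<in> subX x p1 p2 p3 l1 l2 l3"
  "w \<in> subX x p1 p2 p3 l1 l2 l3 \<Longrightarrow> sc c w \<in> subX x p1 p2 p3 l1 l2 l3"
  unfolding subX_def by (rule Vs.span_zero, auto intro: Vs.span_add Vs.span_diff Vs.span_scale)

lemma subX_E1: "w \<in> subX x p1 p2 p3 l1 l2 l3 \<Longrightarrow> E1 w \<in> subX x p1 p2 p3 (l1 + 1) (l2 - 1) l3"
  by (induction rule: subX_induct)
    (simp_all add: E1.add E1.scale subX_closed, simp add: subX_def Vs.span_base gen_E1)

lemma subX_E2: "w \<in> subX x p1 p2 p3 l1 l2 l3 \<Longrightarrow> E2 w \<in> subX x p1 p2 p3 l1 (l2 + 1) (l3 - 1)"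
  by (induction rule: subX_induct)
    (simp_all add: E2.add E2.scale subX_closed, simp add: subX_def Vs.span_base gen_E2)

lemma gen_subX: "gen x p1 p2 p3 w l1 l2 l3 \<Longrightarrow> w \<in> subX x p1 p2 p3 l1 l2 l3"
  by (simp add: subX_def Vs.span_base)

text \<open>
  Closure under \<open>F\<close>: by induction on the word, commuting \<open>F\<close> to the generating vector, where it
  vanishes.
\<close>

lemma gen_F1: "gen x p1 p2 p3 w l1 l2 l3 \<Longrightarrow> F1 w \<in> subX x p1 p2 p3 (l1 - 1) (l2 + 1) l3"
proof (induction rule: gen.induct)
  case gen_base
  then show ?case using x by (simp add: lowest_def subX_closed)
next
  case (gen_E1 w l1 l2 l3)
  have "F1 (E1 w) = E1 (F1 w) - sc (br (l1 - l2)) w" using E1_F1[OF gen_X[OF gen_E1.hyps]] by simp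
  moreover have "E1 (F1 w) \<in> subX x p1 p2 p3 l1 l2 l3" using subX_E1[OF gen_E1.IH] by simp
  ultimately show ?case using gen_subX[OF gen_E1.hyps] by (simp add: subX_closed)
next
  case (gen_E2 w l1 l2 l3)
  then show ?case using E2_F1[OF gen_X[OF gen_E2.hyps]] subX_E2[OF gen_E2.IH]
    by (simp add: algebra_simps)
qed

lemma gen_F2: "gen x p1 p2 p3 w l1 l2 l3 \<Longrightarrow> F2 w \<in> subX x p1 p2 p3 l1 (l2 - 1) (l3 + 1)"
proof (induction rule: gen.induct)
  case gen_base
  then show ?case using x by (simp add: lowest_def subX_closed)
next
  case (gen_E2 w l1 l2 l3)
  have "F2 (E2 w) = E2 (F2 w) - sc (br (l2 - l3)) w" using E2_F2[OF gen_X[OF gen_E2.hyps]] by simp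
  moreover have "E2 (F2 w) \<in> subX x p1 p2 p3 l1 l2 l3" using subX_E2[OF gen_E2.IH] by simp
  ultimately show ?case using gen_subX[OF gen_E2.hyps] by (simp add: subX_closed)
next
  case (gen_E1 w l1 l2 l3)
  then show ?case using E1_F2[OF gen_X[OF gen_E1.hyps]] subX_E1[OF gen_E1.IH]
    by (simp add: algebra_simps)
qed

theorem subX_gl3_module: "gl3_module q sc E1 E2 F1 F2 (subX x p1 p2 p3)"
proof unfold_locales
  fix w l1 l2 l3 assume w: "w \<in> subX x p1 p2 p3 l1 l2 l3"
  then have wX: "w \<in> X l1 l2 l3" using subX_X by blast
  show "E1 w \<in> subX x p1 p2 p3 (l1 + 1) (l2 - 1) l3" "E2 w \<in> subX x p1 p2 p3 l1 (l2 + 1) (l3 - 1)"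
    using w by (simp_all add: subX_E1 subX_E2)
  show "F1 w \<in> subX x p1 p2 p3 (l1 - 1) (l2 + 1) l3" using w
    by (induction rule: subX_induct) (simp_all add: gen_F1 F1.add F1.scale subX_closed)
  show "F2 w \<in> subX x p1 p2 p3 l1 (l2 - 1) (l3 + 1)" using w
    by (induction rule: subX_induct) (simp_all add: gen_F2 F2.add F2.scale subX_closed)
  note E1_F1[OF wX] E2_F2[OF wX] E1_F2[OF wX] E2_F1[OF wX] E1_E3[OF wX] E2_E3[OF wX] F1_F3[OF wX] F3_F2[OF wX]
  then show "E1 (F1 w) = F1 (E1 w) + sc (br (l1 - l2)) w" "E2 (F2 w) = F2 (E2 w) + sc (br (l2 - l3)) w"
    "E1 (F2 w) = F2 (E1 w)" "E2 (F1 w) = F1 (E2 w)" "E3 (E1 w) = sc q (E1 (E3 w))"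
    "E2 (E3 w) = sc q (E3 (E2 w))" "F1 (F3 w) = sc q (F3 (F1 w))" "F3 (F2 w) = sc q (F2 (F3 w))"
    by auto
qed (simp add: subX_def)

lemma subX_cone: "w \<in> subX x p1 p2 p3 l1 l2 l3 \<Longrightarrow> w \<noteq> 0 \<Longrightarrow>
   \<exists>n1 n2 :: nat. l1 = p1 + int n1 \<and> l2 = p2 - int n1 + int n2 \<and> l3 = p3 - int n2"
proof (rule ccontr)
  assume w: "w \<in> subX x p1 p2 p3 l1 l2 l3" "w \<noteq> 0" 
    and "\<not> (\<exists>n1 n2 :: nat. l1 = p1 + int n1 \<and> l2 = p2 - int n1 + int n2 \<and> l3 = p3 - int n2)"
  then have "{w. gen x p1 p2 p3 w l1 l2 l3} = {}" using gen_cone by blast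
  then show False using w unfolding subX_def by (metis Vs.span_empty singletonD)
qed

end

end

section \<open>Tensoring with a bounded weight module\<close>

text \<open>
  The torus acts through \<open>K1\<close>, \<open>K2\<close> and their inverses \<open>L1\<close>, \<open>L2\<close>; as globally defined linear maps they make
  the operators on the tensor product linear.  The weights are bounded by \<open>R\<close>.
\<close>

locale gl3_weighted = gl3_module q sc E1 E2 F1 F2 X +
    K1: Vector_Spaces.linear sc sc K1 + K2: Vector_Spaces.linear sc sc K2 +
    L1: Vector_Spaces.linear sc sc L1 + L2: Vector_Spaces.linear sc sc L2
  for q :: complex and sc :: "complex \<Rightarrow> 'u::ab_group_add \<Rightarrow> 'u" and E1 E2 F1 F2 X K1 K2 L1 L2 +
  fixes R :: int
  assumes K1: "v \<in> X l1 l2 l3 \<Longrightarrow> K1 v = sc (q powi (l1 - l2)) v"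
    and K2: "v \<in> X l1 l2 l3 \<Longrightarrow> K2 v = sc (q powi (l2 - l3)) v"
    and L1: "v \<in> X l1 l2 l3 \<Longrightarrow> L1 v = sc (q powi (l2 - l1)) v"
    and L2: "v \<in> X l1 l2 l3 \<Longrightarrow> L2 v = sc (q powi (l3 - l2)) v"
    and bound: "v \<in> X l1 l2 l3 \<Longrightarrow> v \<noteq> 0 \<Longrightarrow> \<bar>l1\<bar> \<le> R \<and> \<bar>l2\<bar> \<le> R \<and> \<bar>l3\<bar> \<le> R"
begin

definition wsc :: "complex \<Rightarrow> (pbw \<Rightarrow> 'u) \<Rightarrow> pbw \<Rightarrow> 'u" where
  "wsc c f = (\<lambda>i. sc c (f i))"

text \<open>
  The tensor product of the Verma module with \<open>V\<close> is realised on functions from the PBW basis to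
  \<open>V\<close>, with the operators forced by the coproduct.
\<close>

definition wE1 :: "(pbw \<Rightarrow> 'u) \<Rightarrow> pbw \<Rightarrow> 'u" where
  "wE1 f = (\<lambda>(a, c, b). K1 (f (a - 1, c, b)) + E1 (f (a, c, b)))"

definition wE2 :: "(pbw \<Rightarrow> 'u) \<Rightarrow> pbw \<Rightarrow> 'u" where
  "wE2 f = (\<lambda>(a, c, b). sc (q powi (c - a)) (K2 (f (a, c, b - 1)))
     - sc (inverse q * br (a + 1)) (K2 (f (a + 1, c - 1, b))) + E2 (f (a, c, b)))"

definition wF1 :: "int \<Rightarrow> (pbw \<Rightarrow> 'u) \<Rightarrow> pbw \<Rightarrow> 'u" where
  "wF1 h f = (\<lambda>(a, c, b). sc (cR1 h a c b) (f (a, c + 1, b - 1)) - sc (cD1 h a c b) (f (a + 1, c, b))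
     + sc (q powi (- (h + 2 * a + c - b))) (F1 (f (a, c, b))))"

definition wF2 :: "int \<Rightarrow> (pbw \<Rightarrow> 'u) \<Rightarrow> pbw \<Rightarrow> 'u" where
  "wF2 h f = (\<lambda>(a, c, b). - sc (cP2 h a c b) (f (a, c, b + 1)) - sc (cS2 h a c b) (f (a - 1, c + 1, b))
     + sc (q powi (- (h - a + 2 * b + c))) (F2 (f (a, c, b))))"

definition tens :: "(pbw \<Rightarrow> complex) \<Rightarrow> 'u \<Rightarrow> pbw \<Rightarrow> 'u" where
  "tens x v = (\<lambda>i. sc (x i) v)"

lemma wsc_vector_space: "vector_space wsc"
  by unfold_locales (auto simp: wsc_def fun_eq_iff Vs.scale_right_distrib Vs.scale_left_distrib)

lemma tensor_locale:
  assumes "gl3_module q vscale vE1 vE2 (vF1 (m1 - m2)) (vF2 (m2 - m3)) XM"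
    and sub: "\<And>l1 l2 l3. XM l1 l2 l3 \<subseteq> vX m1 m2 m3 l1 l2 l3"
  shows "gl3_tensor q vscale vE1 vE2 (vF1 (m1 - m2)) (vF2 (m2 - m3)) XM sc E1 E2 F1 F2 X
    wsc wE1 wE2 (wF1 (m1 - m2)) (wF2 (m2 - m3)) tens"
proof -
  interpret M: gl3_module q vscale vE1 vE2 "vF1 (m1 - m2)" "vF2 (m2 - m3)" XM by fact
  interpret W: vector_space wsc by (rule wsc_vector_space)
  show ?thesis
  proof unfold_locales
    show "wE1 (f + g) = wE1 f + wE1 g" "wE2 (f + g) = wE2 f + wE2 g" "wF1 h (f + g) = wF1 h f + wF1 h g"
      "wF2 h (f + g) = wF2 h f + wF2 h g" for f g h
      by (auto simp: fun_eq_iff wE1_def wE2_def wF1_def wF2_def K1.add K2.add E1.add E2.add F1.add F2.add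
          Vs.scale_right_distrib algebra_simps)
    show "wE1 (wsc k f) = wsc k (wE1 f)" "wE2 (wsc k f) = wsc k (wE2 f)" "wF1 h (wsc k f) = wsc k (wF1 h f)"
      "wF2 h (wsc k f) = wsc k (wF2 h f)" for f k h
      by (auto simp: fun_eq_iff wE1_def wE2_def wF1_def wF2_def wsc_def K1.scale K2.scale E1.scale E2.scale
          F1.scale F2.scale Vs.scale_right_distrib Vs.scale_right_diff_distrib mult_ac)
    show "tens (f + g) v = tens f v + tens g v" "tens (vscale k f) v = wsc k (tens f v)" for f g v k
      by (auto simp: fun_eq_iff tens_def Vs.scale_left_distrib vscale_def wsc_def)
    show "tens f (v + w) = tens f v + tens f w" "tens f (sc k v) = wsc k (tens f v)" for f v w k
      by (auto simp: fun_eq_iff tens_def Vs.scale_right_distrib vscale_def wsc_def mult.commute)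
  next
    fix x v l1 l2 l3 n1 n2 n3 assume x: "x \<in> XM l1 l2 l3" and v: "v \<in> X n1 n2 n3"
    show "wE1 (tens x v) = wsc (q powi (n1 - n2)) (tens (vE1 x) v) + tens x (E1 v)"
      by (auto simp: fun_eq_iff wE1_def tens_def vE1_def wsc_def K1.scale E1.scale K1[OF v] mult.commute)
    show "wE2 (tens x v) = wsc (q powi (n2 - n3)) (tens (vE2 x) v) + tens x (E2 v)"
      by (auto simp: fun_eq_iff wE2_def tens_def vE2_def wsc_def K2.scale E2.scale K2[OF v]
          Vs.scale_left_diff_distrib right_diff_distrib mult_ac)
    have D: "x (a, c, b) = 0 \<or> l1 = m1 + a + c \<and> l2 = m2 - a + b \<and> l3 = m3 - c - b" for a c b
      using x sub unfolding vX_def by blast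
    show "wF1 (m1 - m2) (tens x v) = tens (vF1 (m1 - m2) x) v + wsc (q powi (l2 - l1)) (tens x (F1 v))"
    proof (rule ext, clarify)
      fix a c b
      have "x (a, c, b) = 0 \<or> l2 - l1 = - (m1 - m2 + 2 * a + c - b)" using D[of a c b] by auto
      then show "wF1 (m1 - m2) (tens x v) (a, c, b)
          = (tens (vF1 (m1 - m2) x) v + wsc (q powi (l2 - l1)) (tens x (F1 v))) (a, c, b)"
        by (auto simp: wF1_def tens_def vF1_def wsc_def F1.scale Vs.scale_left_diff_distrib)
    qed
    show "wF2 (m2 - m3) (tens x v) = tens (vF2 (m2 - m3) x) v + wsc (q powi (l3 - l2)) (tens x (F2 v))"
    proof (rule ext, clarify)
      fix a c b
      have "x (a, c, b) = 0 \<or> l3 - l2 = - (m2 - m3 - a + 2 * b + c)" using D[of a c b] by auto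
      then show "wF2 (m2 - m3) (tens x v) (a, c, b)
          = (tens (vF2 (m2 - m3) x) v + wsc (q powi (l3 - l2)) (tens x (F2 v))) (a, c, b)"
        by (auto simp: wF2_def tens_def vF2_def wsc_def F2.scale Vs.scale_left_diff_distrib)
    qed
  qed
qed

text \<open>
  In the coinvariants of the tensor product, \<open>E x \<otimes> K v\<close> equals \<open>- x \<otimes> E v\<close>, hence
  \<open>E x \<otimes> v\<close> equals \<open>x \<otimes> Eb v\<close>.  As the factors arrive in the opposite order, the operators \<open>Eb\<close> satisfy
  the opposite Serre relations.
\<close>

definition "Eb1 v = - E1 (L1 v)"
definition "Eb2 v = - E2 (L2 v)"
definition "Eb3 v = Eb2 (Eb1 v) - sc q (Eb1 (Eb2 v))"

lemma linear_Eb: "Vector_Spaces.linear sc sc Eb1" "Vector_Spaces.linear sc sc Eb2" "Vector_Spaces.linear sc sc Eb3"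
  by (unfold_locales; simp add: Eb1_def Eb2_def Eb3_def E1.add E2.add L1.add L2.add E1.scale E2.scale
      L1.scale L2.scale E1.neg E2.neg L1.neg L2.neg E1.diff E2.diff L1.diff L2.diff Vs.scale_right_distrib Vs.scale_right_diff_distrib
      mult.commute)+

sublocale Eb1: Vector_Spaces.linear sc sc Eb1 by (rule linear_Eb)
sublocale Eb2: Vector_Spaces.linear sc sc Eb2 by (rule linear_Eb)
sublocale Eb3: Vector_Spaces.linear sc sc Eb3 by (rule linear_Eb)

lemma Eb1_X: "v \<in> X l1 l2 l3 \<Longrightarrow> Eb1 v = sc (- (q powi (l2 - l1))) (E1 v)"
  and Eb2_X: "v \<in> X l1 l2 l3 \<Longrightarrow> Eb2 v = sc (- (q powi (l3 - l2))) (E2 v)"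
  by (simp_all add: Eb1_def Eb2_def L1 L2 E1.scale E2.scale Vs.scale_minus_left)

lemma X_Eb: "v \<in> X l1 l2 l3 \<Longrightarrow> Eb1 v \<in> X (l1 + 1) (l2 - 1) l3"
  "v \<in> X l1 l2 l3 \<Longrightarrow> Eb2 v \<in> X l1 (l2 + 1) (l3 - 1)"
  by (simp_all only: Eb1_X Eb2_X X_scale X_E1 X_E2)

lemma X_Eb3: "v \<in> X l1 l2 l3 \<Longrightarrow> Eb3 v \<in> X (l1 + 1) l2 (l3 - 1)"
  using X_Eb(2)[OF X_Eb(1)[of v l1 l2 l3]] X_Eb(1)[OF X_Eb(2)[of v l1 l2 l3]]
  by (simp add: Eb3_def X_diff X_scale)

lemma Eb3_Eb1:
  assumes v: "v \<in> X l1 l2 l3"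
  shows "Eb1 (Eb3 v) = sc q (Eb3 (Eb1 v))"
proof -
  define P where "P = - (q powi (l2 - l1) * q powi (l2 - l1 - 2) * q powi (l3 - l2 + 2))"
  have e: "q powi (l3 - l2) * q powi (l2 + 1 - l1) * q powi (l2 + 1 - 1 - (l1 + 1)) = - P"
    "q powi (l2 - l1) * q powi (l3 - (l2 - 1)) * q powi (l2 - 1 + 1 - (l1 + 1)) = - P"
    "q powi (l2 - l1) * q powi (l2 - 1 - (l1 + 1)) * q powi (l3 - (l2 - 1 - 1)) = - P"
    unfolding P_def minus_minus power_int_add[symmetric, OF disjI1[OF q_nz]]
    by (rule arg_cong[where f = "(powi) q"], simp)+
  note E = X_E1 X_E2
  have a: "Eb1 (Eb1 (Eb2 v)) = sc P (E1 (E1 (E2 v)))"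
    unfolding Eb2_X[OF v] Eb1_X[OF X_E2[OF v]] Eb1_X[OF X_E1[OF X_E2[OF v]]] Eb1.scale Eb2.scale Vs.scale_scale
    using e(1) by (simp add: mult.assoc)
  have b: "Eb1 (Eb2 (Eb1 v)) = sc P (E1 (E2 (E1 v)))"
    unfolding Eb1_X[OF v] Eb2_X[OF X_E1[OF v]] Eb1_X[OF X_E2[OF X_E1[OF v]]] Eb1.scale Eb2.scale Vs.scale_scale
    using e(2) by (simp add: mult.assoc)
  have c: "Eb2 (Eb1 (Eb1 v)) = sc P (E2 (E1 (E1 v)))"
    unfolding Eb1_X[OF v] Eb1_X[OF X_E1[OF v]] Eb2_X[OF X_E1[OF X_E1[OF v]]] Eb1.scale Eb2.scale Vs.scale_scale
    using e(3) by (simp add: mult.assoc)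
  have "E1 (E2 (E1 v)) - sc q (E2 (E1 (E1 v))) = sc q (E1 (E1 (E2 v))) - sc (q * q) (E1 (E2 (E1 v)))"
    using E1_E3[OF v] by (simp add: qcomm_def E1.diff E1.scale Vs.scale_right_diff_distrib)
  then have "E1 (E2 (E1 v)) - sc q (E1 (E1 (E2 v))) = sc q (E2 (E1 (E1 v))) - sc (q * q) (E1 (E2 (E1 v)))"
    by (simp add: algebra_simps)
  from arg_cong[OF this, of "sc P"] show ?thesis
    unfolding Eb3_def Eb1.diff Eb1.scale a b c by (simp add: Vs.scale_right_diff_distrib mult_ac)
qed

lemma Eb3_Eb2:
  assumes v: "v \<in> X l1 l2 l3"
  shows "Eb3 (Eb2 v) = sc q (Eb2 (Eb3 v))"
proof -
  define P where "P = - (q powi (l3 - l2) * q powi (l3 - l2 - 2) * q powi (l2 + 2 - l1))"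
  have e: "q powi (l3 - l2) * q powi (l3 - 1 - (l2 + 1)) * q powi (l2 + 1 + 1 - l1) = - P"
    "q powi (l3 - l2) * q powi (l2 + 1 - l1) * q powi (l3 - 1 - (l2 + 1 - 1)) = - P"
    "q powi (l2 - l1) * q powi (l3 - (l2 - 1)) * q powi (l3 - 1 - (l2 - 1 + 1)) = - P"
    unfolding P_def minus_minus power_int_add[symmetric, OF disjI1[OF q_nz]]
    by (rule arg_cong[where f = "(powi) q"], simp)+
  have a: "Eb1 (Eb2 (Eb2 v)) = sc P (E1 (E2 (E2 v)))"
    unfolding Eb2_X[OF v] Eb2_X[OF X_E2[OF v]] Eb1_X[OF X_E2[OF X_E2[OF v]]] Eb1.scale Eb2.scale Vs.scale_scale
    using e(1) by (simp add: mult.assoc)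
  have b: "Eb2 (Eb1 (Eb2 v)) = sc P (E2 (E1 (E2 v)))"
    unfolding Eb2_X[OF v] Eb1_X[OF X_E2[OF v]] Eb2_X[OF X_E1[OF X_E2[OF v]]] Eb1.scale Eb2.scale Vs.scale_scale
    using e(2) by (simp add: mult.assoc)
  have c: "Eb2 (Eb2 (Eb1 v)) = sc P (E2 (E2 (E1 v)))"
    unfolding Eb1_X[OF v] Eb2_X[OF X_E1[OF v]] Eb2_X[OF X_E2[OF X_E1[OF v]]] Eb1.scale Eb2.scale Vs.scale_scale
    using e(3) by (simp add: mult.assoc)
  have "E2 (E1 (E2 v)) - sc q (E2 (E2 (E1 v))) = sc q (E1 (E2 (E2 v))) - sc (q * q) (E2 (E1 (E2 v)))"
    using E2_E3[OF v] by (simp add: qcomm_def E2.diff E2.scale Vs.scale_right_diff_distrib)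
  then have "E2 (E1 (E2 v)) - sc q (E1 (E2 (E2 v))) = sc q (E2 (E2 (E1 v))) - sc (q * q) (E2 (E1 (E2 v)))"
    by (simp add: algebra_simps)
  from arg_cong[OF this, of "sc P"] show ?thesis
    unfolding Eb3_def Eb2.diff Eb2.scale a b c by (simp add: Vs.scale_right_diff_distrib mult_ac)
qed

lemma X_Eb_pow: "v \<in> X l1 l2 l3 \<Longrightarrow> (Eb1 ^^ n) v \<in> X (l1 + int n) (l2 - int n) l3"
  "v \<in> X l1 l2 l3 \<Longrightarrow> (Eb2 ^^ n) v \<in> X l1 (l2 + int n) (l3 - int n)"
  "v \<in> X l1 l2 l3 \<Longrightarrow> (Eb3 ^^ n) v \<in> X (l1 + int n) l2 (l3 - int n)"
proof (induction n)
  case (Suc n)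
  show "v \<in> X l1 l2 l3 \<Longrightarrow> (Eb1 ^^ Suc n) v \<in> X (l1 + int (Suc n)) (l2 - int (Suc n)) l3"
    using X_Eb(1)[OF Suc.IH(1)] by (simp add: algebra_simps)
  show "v \<in> X l1 l2 l3 \<Longrightarrow> (Eb2 ^^ Suc n) v \<in> X l1 (l2 + int (Suc n)) (l3 - int (Suc n))"
    using X_Eb(2)[OF Suc.IH(2)] by (simp add: algebra_simps)
  show "v \<in> X l1 l2 l3 \<Longrightarrow> (Eb3 ^^ Suc n) v \<in> X (l1 + int (Suc n)) l2 (l3 - int (Suc n))"
    using X_Eb3[OF Suc.IH(3)] by (simp add: algebra_simps)
qed simp_all

text \<open>
  The image in the coinvariants of \<open>E1\<^sup>a E3\<^sup>c E2\<^sup>b x\<^sub>0 \<otimes> v\<close>.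
\<close>

definition Phi :: "nat \<Rightarrow> nat \<Rightarrow> nat \<Rightarrow> 'u \<Rightarrow> 'u" where
  "Phi a c b v = (Eb2 ^^ b) ((Eb3 ^^ c) ((Eb1 ^^ a) v))"

lemma funpow_lin:
  assumes "Vector_Spaces.linear sc sc A"
  shows "Vector_Spaces.linear sc sc (A ^^ n)"
proof -
  interpret A: Vector_Spaces.linear sc sc A by fact
  show ?thesis by (unfold_locales; induction n) (simp_all add: A.add A.scale)
qed

lemma linear_Phi: "Vector_Spaces.linear sc sc (Phi a c b)"
proof -
  interpret A: Vector_Spaces.linear sc sc "Eb1 ^^ a" by (rule funpow_lin[OF linear_Eb(1)])
  interpret B: Vector_Spaces.linear sc sc "Eb2 ^^ b" by (rule funpow_lin[OF linear_Eb(2)])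
  interpret C: Vector_Spaces.linear sc sc "Eb3 ^^ c" by (rule funpow_lin[OF linear_Eb(3)])
  show ?thesis by unfold_locales (simp_all add: Phi_def A.add A.scale B.add B.scale C.add C.scale)
qed

sublocale Phi: Vector_Spaces.linear sc sc "Phi a c b" for a c b by (rule linear_Phi)

lemma Phi_Eb1: "Phi a c b (Eb1 v) = Phi (Suc a) c b v"
  by (simp add: Phi_def funpow_swap1)

lemma Eb1_pow_Eb2:
  assumes v: "v \<in> X l1 l2 l3"
  shows "(Eb1 ^^ a) (Eb2 v) = sc (q powi (- int a)) (Eb2 ((Eb1 ^^ a) v))
    - sc (inverse q * br (int a)) (Eb3 ((Eb1 ^^ (a - 1)) v))"
proof (induction a)
  case (Suc a)
  define u where "u = (Eb1 ^^ a) v"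
  have e12: "Eb1 (Eb2 w) = sc (inverse q) (Eb2 (Eb1 w)) - sc (inverse q) (Eb3 w)" for w
    by (simp add: Eb3_def Vs.scale_right_diff_distrib)
  have e13: "Eb1 (sc (inverse q * br (int a)) (Eb3 ((Eb1 ^^ (a - 1)) v))) = sc (br (int a)) (Eb3 u)"
  proof (cases a)
    case (Suc a')
    then show ?thesis
      using Eb3_Eb1[OF X_Eb_pow(1)[OF v, of a']] by (simp add: Eb1.scale u_def)
  qed (simp add: Eb1.zero)
  have c: "q powi (- int a) * inverse q = q powi (- int (Suc a))"
    using power_int_add[of q "- int a" "-1"] by (simp add: algebra_simps)
  have d: "q powi (- int (Suc a)) + br (int a) = inverse q * br (int (Suc a))"
  proof -
    have "br (int (Suc a)) = q * br (int a) + q powi (- int a)"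
      using br_add[of 1 "int a"] by simp
    then have "inverse q * br (int (Suc a)) = br (int a) + inverse q * q powi (- int a)"
      by (simp only: distrib_left mult.assoc[symmetric]) simp
    then show ?thesis by (simp only: c[symmetric] add.commute mult.commute)
  qed
  have "(Eb1 ^^ Suc a) (Eb2 v) = sc (q powi (- int a)) (Eb1 (Eb2 u)) - sc (br (int a)) (Eb3 u)"
    unfolding funpow.simps comp_apply Suc.IH Eb1.diff e13 by (simp add: Eb1.scale u_def)
  also have "\<dots> = sc (q powi (- int (Suc a))) (Eb2 (Eb1 u)) - sc (q powi (- int (Suc a)) + br (int a)) (Eb3 u)"
    unfolding e12 Vs.scale_right_diff_distrib Vs.scale_scale c Vs.scale_left_distrib by simp
  finally show ?case unfolding d by (simp add: u_def)
qed simp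

lemma Eb3_pow_Eb2:
  assumes v: "v \<in> X l1 l2 l3"
  shows "(Eb3 ^^ c) (Eb2 v) = sc (q ^ c) (Eb2 ((Eb3 ^^ c) v))"
proof (induction c)
  case (Suc c)
  then show ?case using Eb3_Eb2[OF X_Eb_pow(3)[OF v, of c]] by (simp add: Eb3.scale)
qed simp

text \<open>
  The coefficients are those of the action of \<open>E2\<close> on the PBW basis, which makes the coinvariant map
  vanish on the image of \<open>E2\<close>.
\<close>

lemma Phi_Eb2:
  assumes v: "v \<in> X l1 l2 l3"
  shows "Phi a c b (Eb2 v) = sc (q powi (int c - int a)) (Phi a c (Suc b) v)
    - sc (inverse q * br (int a)) (Phi (a - 1) (Suc c) b v)"
proof -
  interpret B: Vector_Spaces.linear sc sc "Eb2 ^^ b" by (rule funpow_lin[OF linear_Eb(2)])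
  interpret C: Vector_Spaces.linear sc sc "Eb3 ^^ c" by (rule funpow_lin[OF linear_Eb(3)])
  have q: "q powi (- int a) * q ^ c = q powi (int c - int a)"
    using power_int_add[of q "int c" "- int a"] by (simp add: mult.commute)
  show ?thesis
    unfolding Phi_def Eb1_pow_Eb2[OF v] C.diff C.scale Eb3_pow_Eb2[OF X_Eb_pow(1)[OF v]] B.diff B.scale
      Vs.scale_scale q by (simp add: funpow_swap1)
qed

end

section \<open>Injectivity and coinvariants\<close>

locale verma_tensor = gl3_weighted q sc E1 E2 F1 F2 X K1 K2 L1 L2 R
  for q :: complex and sc :: "complex \<Rightarrow> 'u::ab_group_add \<Rightarrow> 'u" and E1 E2 F1 F2 X K1 K2 L1 L2 R +
  fixes m1 m2 m3 :: int
begin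

abbreviation "FM1 \<equiv> vF1 (m1 - m2)"
abbreviation "FM2 \<equiv> vF2 (m2 - m3)"
abbreviation "FW1 \<equiv> wF1 (m1 - m2)"
abbreviation "FW2 \<equiv> wF2 (m2 - m3)"

sublocale M: gl3_module q vscale vE1 vE2 FM1 FM2 "vX m1 m2 m3" by (rule verma_gl3_module)

sublocale W: gl3_tensor q vscale vE1 vE2 FM1 FM2 "vX m1 m2 m3" sc E1 E2 F1 F2 X wsc wE1 wE2 FW1 FW2 tens
  by (rule tensor_locale[OF verma_gl3_module order_refl])

sublocale G: gl3_module q wsc wE1 wE2 FW1 FW2 W.XW by (rule W.tensor_gl3_module)

lemma XW_pointwise:
  assumes "f \<in> W.XW l1 l2 l3"
  shows "f (a, c, b) \<in> X (l1 - m1 - a - c) (l2 - m2 + a - b) (l3 - m3 + c + b) \<and>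
    (f (a, c, b) \<noteq> 0 \<longrightarrow> 0 \<le> a \<and> 0 \<le> c \<and> 0 \<le> b)"
  using assms
proof (induction rule: W.XW_induct)
  case (tens x v p1 p2 p3 n1 n2 n3)
  show ?case
  proof (cases "x (a, c, b) = 0")
    case False
    then have "0 \<le> a \<and> 0 \<le> c \<and> 0 \<le> b \<and> p1 = m1 + a + c \<and> p2 = m2 - a + b \<and> p3 = m3 - c - b"
      using tens(1) unfolding vX_def by auto
    moreover from this have "v \<in> X (l1 - m1 - a - c) (l2 - m2 + a - b) (l3 - m3 + c + b)"
    proof -
      have "n1 = l1 - m1 - a - c" "n2 = l2 - m2 + a - b" "n3 = l3 - m3 + c + b"
        using tens calculation by simp_all
      then show ?thesis using tens(2) by simp
    qed
    ultimately show ?thesis by (simp add: tens_def X_scale)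
  qed (simp add: tens_def)
qed (auto simp: X_add X_scale wsc_def)

lemma XW_bounded:
  assumes "f \<in> W.XW l1 l2 l3" and "f (a, c, b) \<noteq> 0"
  shows "0 \<le> a" "0 \<le> c" "0 \<le> b" "a \<le> l1 - m1 + R" "c \<le> l1 - m1 + R" "b \<le> m3 - l3 + R"
proof -
  have "0 \<le> a \<and> 0 \<le> c \<and> 0 \<le> b" using XW_pointwise[OF assms(1)] assms(2) by blast
  moreover have "\<bar>l1 - m1 - a - c\<bar> \<le> R \<and> \<bar>l3 - m3 + c + b\<bar> \<le> R"
    using bound[OF conjunct1[OF XW_pointwise[OF assms(1)]] assms(2)] by blast
  ultimately show "0 \<le> a" "0 \<le> c" "0 \<le> b" "a \<le> l1 - m1 + R" "c \<le> l1 - m1 + R" "b \<le> m3 - l3 + R"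
    by linarith+
qed

lemma XW_finite:
  assumes "f \<in> W.XW l1 l2 l3"
  shows "finite {i. f i \<noteq> 0}"
proof (rule finite_subset)
  show "{i. f i \<noteq> 0} \<subseteq> {0..l1 - m1 + R} \<times> {0..l1 - m1 + R} \<times> {0..m3 - l3 + R}"
    using XW_bounded[OF assms] by auto
qed simp

lemma K_cancel:
  "v \<in> X l1 l2 l3 \<Longrightarrow> K1 v = 0 \<Longrightarrow> v = 0" "v \<in> X l1 l2 l3 \<Longrightarrow> K2 v = 0 \<Longrightarrow> v = 0"
  by (simp_all add: K1 K2)

text \<open>
  \<open>wE1 f\<close> is \<open>K1\<close> applied to a shift of \<open>f\<close> in the first exponent plus a term without shift.  Starting
  above the support of \<open>f\<close>, its vanishing gives the vanishing of \<open>f\<close> one exponent after the other.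
\<close>

lemma wE1_injective:
  assumes f: "f \<in> W.XW l1 l2 l3" and "wE1 f = 0"
  shows "f = 0"
proof -
  have z: "f (l1 - m1 + R + 1 - int n, c, b) = 0" for n c b
  proof (induction n)
    case 0
    show ?case using XW_bounded(4)[OF f, of "l1 - m1 + R + 1" c b] by force
  next
    case (Suc n)
    have a: "l1 - m1 + R + 1 - int n - 1 = l1 - m1 + R + 1 - int (Suc n)" by simp
    have "wE1 f (l1 - m1 + R + 1 - int n, c, b) = 0" using assms(2) by simp
    then have "K1 (f (l1 - m1 + R + 1 - int (Suc n), c, b)) = 0"
      unfolding wE1_def prod.case Suc.IH a by (simp add: E1.zero)
    then show ?case using K_cancel(1)[OF conjunct1[OF XW_pointwise[OF f]]] by blast
  qed
  have "f (a, c, b) = 0" for a c b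
  proof (cases "a \<le> l1 - m1 + R + 1")
    case True
    then show ?thesis using z[of "nat (l1 - m1 + R + 1 - a)" c b] by simp
  next
    case False
    then show ?thesis using XW_bounded(4)[OF f, of a c b] by force
  qed
  then show ?thesis by (auto simp: fun_eq_iff)
qed

text \<open>
  The same argument with the third exponent; the additional term involves \<open>f\<close> at the exponent already known
  to vanish.
\<close>

lemma wE2_injective:
  assumes f: "f \<in> W.XW l1 l2 l3" and "wE2 f = 0"
  shows "f = 0"
proof -
  have z: "f (a, c, m3 - l3 + R + 1 - int n) = 0" for n a c
  proof (induction n arbitrary: a c)
    case 0
    show ?case using XW_bounded(6)[OF f, of a c "m3 - l3 + R + 1"] by force
  next
    case (Suc n)
    have a: "m3 - l3 + R + 1 - int n - 1 = m3 - l3 + R + 1 - int (Suc n)" by simp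
    have "wE2 f (a, c, m3 - l3 + R + 1 - int n) = 0" using assms(2) by simp
    then have "K2 (f (a, c, m3 - l3 + R + 1 - int (Suc n))) = 0"
      unfolding wE2_def prod.case Suc.IH a by (simp add: E2.zero K2.zero)
    then show ?case using K_cancel(2)[OF conjunct1[OF XW_pointwise[OF f]]] by blast
  qed
  have "f (a, c, b) = 0" for a c b
  proof (cases "b \<le> m3 - l3 + R + 1")
    case True
    then show ?thesis using z[of a c "nat (m3 - l3 + R + 1 - b)"] by simp
  next
    case False
    then show ?thesis using XW_bounded(6)[OF f, of a c b] by force
  qed
  then show ?thesis by (auto simp: fun_eq_iff)
qed

lemma dpE_injective:
  assumes "f \<in> W.XW l1 l2 l3"
  shows "G.s1.dpE n f = 0 \<Longrightarrow> f = 0" "G.s2.dpE n f = 0 \<Longrightarrow> f = 0"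
proof (induction n)
  case (Suc n)
  show "f = 0" if "G.s1.dpE (Suc n) f = 0"
    using that wE1_injective[OF G.X_dpE1[OF assms, of n]] Suc.IH
    unfolding G.s1.dpE_Suc by (auto simp: W.Vs.scale_eq_0_iff)
  show "f = 0" if "G.s2.dpE (Suc n) f = 0"
    using that wE2_injective[OF G.X_dpE2[OF assms, of n]] Suc.IH
    unfolding G.s2.dpE_Suc by (auto simp: W.Vs.scale_eq_0_iff)
qed simp_all

definition phi :: "pbw \<Rightarrow> 'u \<Rightarrow> 'u" where
  "phi = (\<lambda>(a, c, b) v. if 0 \<le> a \<and> 0 \<le> c \<and> 0 \<le> b then Phi (nat a) (nat c) (nat b) v else 0)"

text \<open>
  The projection to the coinvariants, identified with \<open>V\<close>.
\<close>

definition coinv :: "(pbw \<Rightarrow> 'u) \<Rightarrow> 'u" where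
  "coinv f = Sum_any (\<lambda>i. phi i (f i))"

lemma phi_lin: "phi i (v + w) = phi i v + phi i w" "phi i (sc k v) = sc k (phi i v)" "phi i 0 = 0"
  "phi i (v - w) = phi i v - phi i w"
  by (auto simp: phi_def Phi.add Phi.scale Phi.zero Phi.diff split: prod.splits)

lemma finite_phi: "finite {i. f i \<noteq> 0} \<Longrightarrow> finite {i. phi i (f i) \<noteq> 0}"
  by (erule rev_finite_subset) (auto simp: phi_lin)

lemma coinv_add: "finite {i. f i \<noteq> 0} \<Longrightarrow> finite {i. g i \<noteq> 0} \<Longrightarrow> coinv (f + g) = coinv f + coinv g"
  unfolding coinv_def by (subst Sum_any.distrib[symmetric]) (simp_all add: finite_phi phi_lin)

lemma coinv_scale: "finite {i. f i \<noteq> 0} \<Longrightarrow> coinv (wsc k f) = sc k (coinv f)"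
proof (cases "k = 0")
  case False
  have "{i. phi i (sc k (f i)) \<noteq> 0} = {i. phi i (f i) \<noteq> 0}" using False by (auto simp: phi_lin)
  then show ?thesis
    unfolding coinv_def Sum_any.expand_set by (simp add: wsc_def Vs.scale_sum_right phi_lin)
qed (simp add: coinv_def wsc_def phi_lin)

lemma coinv_tens0: "x = (\<lambda>i. if i = (0,0,0) then 1 else 0) \<Longrightarrow> coinv (tens x v) = v"
proof -
  assume x: "x = (\<lambda>i. if i = (0,0,0) then 1 else 0)"
  have "(\<lambda>i. phi i (tens x v i)) = (\<lambda>i. if i = (0,0,0) then v else 0)"
    by (auto simp: fun_eq_iff phi_def tens_def x Phi_def Phi.zero[unfolded Phi_def])
  moreover have "Sum_any (\<lambda>i :: pbw. if i = (0, 0, 0) then v else 0) = v"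
    by (subst Sum_any.expand_superset[of "{(0, 0, 0)}"]) auto
  ultimately show ?thesis unfolding coinv_def by (simp only:)
qed

lemma Sum_any_shift:
  fixes g :: "pbw \<Rightarrow> 'u"
  shows "Sum_any (\<lambda>(a, c, b). g (a + r, c + s, b + t)) = Sum_any g"
proof (rule Sum_any.reindex_cong[symmetric])
  show "bij (\<lambda>(a, c, b). (a + r :: int, c + s :: int, b + t :: int))"
    by (rule bij_betw_byWitness[where f' = "\<lambda>(a, c, b). (a - r, c - s, b - t)"]) auto
  show "g \<circ> (\<lambda>(a, c, b). (a + r, c + s, b + t)) = (\<lambda>(a, c, b). g (a + r, c + s, b + t))"
    by auto
qed

lemma finite_shift:
  fixes g :: "pbw \<Rightarrow> 'u"
  assumes "finite {i. g i \<noteq> 0}"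
  shows "finite {i. (case i of (a, c, b) \<Rightarrow> g (a + r, c + s, b + t)) \<noteq> 0}"
proof (rule finite_subset)
  show "{i. (case i of (a, c, b) \<Rightarrow> g (a + r, c + s, b + t)) \<noteq> 0}
      \<subseteq> (\<lambda>(a, c, b). (a - r, c - s, b - t)) ` {i. g i \<noteq> 0}"
    by (auto simp: image_iff) (metis add_diff_cancel_right')
qed (use assms in simp)

text \<open>
  The contributions of \<open>E \<otimes> K\<close> and \<open>1 \<otimes> E\<close> cancel after shifting the summation index.
\<close>

lemma coinv_E1:
  assumes f: "f \<in> W.XW l1 l2 l3"
  shows "coinv (wE1 f) = 0"
proof -
  define g where "g = (\<lambda>(a, c, b). phi (a, c, b) (E1 (f (a, c, b))))"
  have fin: "finite {i. g i \<noteq> 0}"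
    by (rule finite_subset[OF _ XW_finite[OF f]]) (auto simp: g_def E1.zero phi_lin)
  have eq: "phi (a, c, b) (wE1 f (a, c, b)) = g (a, c, b) - g (a - 1, c, b)" for a c b
  proof -
    have "phi (a, c, b) (K1 (f (a - 1, c, b))) = - phi (a - 1, c, b) (E1 (f (a - 1, c, b)))"
    proof (cases "f (a - 1, c, b) = 0")
      case False
      note nn = XW_bounded(1-3)[OF f False]
      have v: "f (a - 1, c, b) \<in> X (l1 - m1 - (a - 1) - c) (l2 - m2 + (a - 1) - b) (l3 - m3 + c + b)"
        using XW_pointwise[OF f] by blast
      have "Eb1 (K1 (f (a - 1, c, b))) = - E1 (f (a - 1, c, b))"
        unfolding K1[OF v] Eb1.scale Eb1_X[OF v] Vs.scale_scale
        by (simp add: power_int_add[symmetric] algebra_simps Vs.scale_minus_left)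
      moreover have "nat a = Suc (nat (a - 1))" using nn by simp
      ultimately show ?thesis
        using nn Phi_Eb1[of "nat (a - 1)" "nat c" "nat b" "K1 (f (a - 1, c, b))"]
        by (simp add: phi_def Phi.neg)
    qed (simp add: K1.zero E1.zero phi_lin)
    then show ?thesis by (simp add: wE1_def g_def phi_lin)
  qed
  have "coinv (wE1 f) = Sum_any (\<lambda>i. g i + (case i of (a, c, b) \<Rightarrow> - g (a + (-1), c + 0, b + 0)))"
    unfolding coinv_def by (rule arg_cong[where f = Sum_any]) (auto simp: fun_eq_iff eq)
  also have "\<dots> = Sum_any g + Sum_any (\<lambda>(a, c, b). - g (a + (-1), c + 0, b + 0))"
    using finite_shift[of "\<lambda>i. - g i" "-1" 0 0] fin by (intro Sum_any.distrib) simp_all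
  also have "Sum_any (\<lambda>(a, c, b). - g (a + (-1), c + 0, b + 0)) = Sum_any (\<lambda>i. - g i)"
    by (rule Sum_any_shift[of "\<lambda>i. - g i"])
  also have "Sum_any g + Sum_any (\<lambda>i. - g i) = Sum_any (\<lambda>i. g i + - g i)"
    using fin by (intro Sum_any.distrib[symmetric]) simp_all
  finally show ?thesis by simp
qed

lemma coinv_E2:
  assumes f: "f \<in> W.XW l1 l2 l3"
  shows "coinv (wE2 f) = 0"
proof -
  define g where "g = (\<lambda>(a, c, b). sc (q powi (c - a)) (phi (a, c, b + 1) (K2 (f (a, c, b)))))"
  define h where "h = (\<lambda>(a, c, b). - sc (inverse q * br a) (phi (a - 1, c + 1, b) (K2 (f (a, c, b)))))"
  define k where "k = (\<lambda>(a, c, b). phi (a, c, b) (E2 (f (a, c, b))))"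
  have fin: "finite {i. g i \<noteq> 0}" "finite {i. h i \<noteq> 0}" "finite {i. k i \<noteq> 0}"
    by (rule finite_subset[OF _ XW_finite[OF f]]; auto simp: g_def h_def k_def E2.zero K2.zero phi_lin)+
  have eq: "phi (a, c, b) (wE2 f (a, c, b)) = g (a, c, b - 1) + h (a + 1, c - 1, b) + k (a, c, b)" for a c b
    by (simp add: wE2_def g_def h_def k_def phi_lin)
  have zero: "g (a, c, b) + h (a, c, b) + k (a, c, b) = 0" for a c b
  proof (cases "f (a, c, b) = 0")
    case False
    note nn = XW_bounded(1-3)[OF f False]
    have v: "f (a, c, b) \<in> X (l1 - m1 - a - c) (l2 - m2 + a - b) (l3 - m3 + c + b)"
      using XW_pointwise[OF f] by blast
    then have Kv: "K2 (f (a, c, b)) \<in> X (l1 - m1 - a - c) (l2 - m2 + a - b) (l3 - m3 + c + b)"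
      by (simp add: K2 X_scale)
    have "Eb2 (K2 (f (a, c, b))) = - E2 (f (a, c, b))"
      unfolding K2[OF v] Eb2.scale Eb2_X[OF v] Vs.scale_scale
      by (simp add: power_int_add[symmetric] algebra_simps Vs.scale_minus_left)
    then have "k (a, c, b) = - Phi (nat a) (nat c) (nat b) (Eb2 (K2 (f (a, c, b))))"
      using nn by (simp add: k_def phi_def Phi.neg)
    moreover have "nat (b + 1) = Suc (nat b)" "nat (c + 1) = Suc (nat c)" "nat a - 1 = nat (a - 1)"
      using nn by auto
    moreover have "a = 0 \<or> 0 \<le> a - 1" using nn by auto
    ultimately show ?thesis
      using nn unfolding Phi_Eb2[OF Kv] by (auto simp: g_def h_def phi_def)
  qed (simp add: g_def h_def k_def E2.zero K2.zero phi_lin)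
  have fg: "finite {i. (case i of (a, c, b) \<Rightarrow> g (a + 0, c + 0, b + (-1))) \<noteq> 0}" by (rule finite_shift) fact
  have fh: "finite {i. (case i of (a, c, b) \<Rightarrow> h (a + 1, c + (-1), b + 0)) \<noteq> 0}" by (rule finite_shift) fact
  have add: "Sum_any (\<lambda>i. u i + v i) = Sum_any u + Sum_any v" "finite {i. u i + v i \<noteq> 0}"
    if "finite {i. u i \<noteq> 0}" "finite {i. v i \<noteq> 0}" for u v :: "pbw \<Rightarrow> 'u"
    using that by (auto intro: Sum_any.distrib finite_subset[of _ "{i. u i \<noteq> 0} \<union> {i. v i \<noteq> 0}"])
  have "coinv (wE2 f) = Sum_any (\<lambda>i. ((case i of (a, c, b) \<Rightarrow> g (a + 0, c + 0, b + (-1)))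
      + (case i of (a, c, b) \<Rightarrow> h (a + 1, c + (-1), b + 0))) + k i)"
    unfolding coinv_def by (rule arg_cong[where f = Sum_any]) (auto simp: fun_eq_iff eq)
  also have "\<dots> = Sum_any (\<lambda>(a, c, b). g (a + 0, c + 0, b + (-1)))
      + Sum_any (\<lambda>(a, c, b). h (a + 1, c + (-1), b + 0)) + Sum_any k"
    using fg fh fin by (simp only: add)
  also have "\<dots> = Sum_any g + Sum_any h + Sum_any k"
    unfolding Sum_any_shift[of g] Sum_any_shift[of h] ..
  also have "\<dots> = Sum_any (\<lambda>i. (g i + h i) + k i)" using fin by (simp only: add)
  also have "(\<lambda>i. (g i + h i) + k i) = (\<lambda>i. 0)" using zero by auto
  finally show ?thesis by simp
qed

lemma coinv_lin_X:
  "f \<in> W.XW l1 l2 l3 \<Longrightarrow> g \<in> W.XW l1 l2 l3 \<Longrightarrow> coinv (f + g) = coinv f + coinv g"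
  "f \<in> W.XW l1 l2 l3 \<Longrightarrow> coinv (wsc k f) = sc k (coinv f)"
  by (simp_all add: coinv_add coinv_scale XW_finite)

text \<open>
  All terms of the Casimir operator other than the scalar lie in the image of \<open>E1\<close> or \<open>E2\<close>.
\<close>

lemma coinv_cas_poly:
  assumes f: "f \<in> W.XW l1 l2 l3"
  shows "coinv (G.cas_poly ks l1 l2 l3 f) = sc (\<Prod>k\<leftarrow>ks. chi l1 l2 l3 - k) (coinv f)"
  using f
proof (induction ks)
  case (Cons k ks)
  define u where "u = G.cas_poly ks l1 l2 l3 f"
  have u: "u \<in> W.XW l1 l2 l3" unfolding u_def by (rule G.X_cas_poly) fact
  note fin = XW_finite
  have 3: "coinv (G.E3 (G.F3 u)) = 0"
  proof -
    have "G.E3 (G.F3 u) = wE1 (wE2 (G.F3 u)) + wsc (- q) (wE2 (wE1 (G.F3 u)))"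
      by (simp add: qcomm_def W.Vs.scale_minus_left)
    then show ?thesis
      using coinv_E1[OF G.X_E2[OF G.X_F3[OF u]]] coinv_E2[OF G.X_E1[OF G.X_F3[OF u]]]
        fin[OF G.X_E1[OF G.X_E2[OF G.X_F3[OF u]]]] fin[OF G.X_E2[OF G.X_E1[OF G.X_F3[OF u]]]]
        fin[OF G.X_scale[OF G.X_E2[OF G.X_E1[OF G.X_F3[OF u]]]]]
      by (simp add: coinv_add coinv_scale del: W.Vs.scale_minus_left)
  qed
  define A where "A = wE1 (FW1 u)"
  define B where "B = wE2 (FW2 u)"
  define C where "C = G.E3 (G.F3 u)"
  have X: "A \<in> W.XW l1 l2 l3" "B \<in> W.XW l1 l2 l3" "C \<in> W.XW l1 l2 l3"
    using G.X_E1[OF G.X_F1[OF u]] G.X_E2[OF G.X_F2[OF u]] G.X_E3[OF G.X_F3[OF u]]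
    by (simp_all add: A_def B_def C_def)
  have z: "coinv A = 0" "coinv B = 0" "coinv C = 0"
    unfolding A_def B_def C_def using coinv_E1[OF G.X_F1[OF u]] coinv_E2[OF G.X_F2[OF u]] 3 by auto
  have "G.cas_poly (k # ks) l1 l2 l3 f = wsc (chi l1 l2 l3) u + wsc ((q - inverse q)\<^sup>2)
      (wsc (q powi (1 - l1 - l2)) A + wsc (q powi (- l2 - l3 - 1)) B
      + wsc (q powi (- l1 - l3 - 1)) C) + wsc (- k) u"
    by (simp add: G.cas_def u_def A_def B_def C_def W.Vs.scale_minus_left)
  then have "coinv (G.cas_poly (k # ks) l1 l2 l3 f) = sc (chi l1 l2 l3) (coinv u) + sc (- k) (coinv u)"
    using X u z by (simp add: coinv_lin_X[of _ l1 l2 l3] G.X_add G.X_scale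
        del: W.Vs.scale_minus_left Vs.scale_minus_left G.cas_poly.simps)
  also have "\<dots> = sc (chi l1 l2 l3 - k) (coinv u)"
    by (simp add: Vs.scale_left_distrib[symmetric] del: Vs.scale_minus_left)
  finally show ?case using Cons by (simp add: u_def del: G.cas_poly.simps)
qed simp

end

section \<open>The braid relation for transported vectors\<close>

context gl3_weighted
begin

text \<open>
  The vector of \<open>ww_top\<close>, for the first and second simple root.
\<close>

definition transport1 :: "int \<Rightarrow> int \<Rightarrow> 'u \<Rightarrow> 'u" where
  "transport1 n a y = sc (q powi n) (\<Sum>k\<le>nat (2 * R). sc ((-1) powi (int k + n) * br (a + 1) / br (a + 1 - int k))
     (s1.dpz (int k + n) (s1.dpF k y)))"

definition transport2 :: "int \<Rightarrow> int \<Rightarrow> 'u \<Rightarrow> 'u" where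
  "transport2 n a y = sc (q powi n) (\<Sum>k\<le>nat (2 * R). sc ((-1) powi (int k + n) * br (a + 1) / br (a + 1 - int k))
     (s2.dpz (int k + n) (s2.dpF k y)))"

lemma X_sum: "(\<And>i. i \<in> A \<Longrightarrow> f i \<in> X l1 l2 l3) \<Longrightarrow> sum f A \<in> X l1 l2 l3"
  by (rule Vs.subspace_sum[OF X_subspace])

lemma X_transport1:
  assumes y: "y \<in> X l1 l2 l3" and n: "n = l2 - l1"
  shows "transport1 n a y \<in> X l2 l1 l3"
  unfolding transport1_def
proof (intro X_scale X_sum)
  fix k
  show "s1.dpz (int k + n) (s1.dpF k y) \<in> X l2 l1 l3"
    using X_dpE1[OF X_dpF1[OF y, of k], of "nat (int k + n)"] n by (auto simp: s1.dpz_def algebra_simps)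
qed

lemma X_transport2:
  assumes y: "y \<in> X l1 l2 l3" and n: "n = l3 - l2"
  shows "transport2 n a y \<in> X l1 l3 l2"
  unfolding transport2_def
proof (intro X_scale X_sum)
  fix k
  show "s2.dpz (int k + n) (s2.dpF k y) \<in> X l1 l3 l2"
    using X_dpE2[OF X_dpF2[OF y, of k], of "nat (int k + n)"] n by (auto simp: s2.dpz_def algebra_simps)
qed

lemma out_of_bound: "v \<in> X l1 l2 l3 \<Longrightarrow> R < \<bar>l1\<bar> \<or> R < \<bar>l2\<bar> \<or> R < \<bar>l3\<bar> \<Longrightarrow> v = 0"
  using bound[of v l1 l2 l3] by force

end

context verma_tensor
begin

definition x0 :: "pbw \<Rightarrow> complex" where "x0 = (\<lambda>i. if i = (0,0,0) then 1 else 0)"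

lemma lowest_x0: "M.lowest x0 m1 m2 m3"
  unfolding M.lowest_def
  by (auto simp: vX_def x0_def vF1_def vF2_def fun_eq_iff cR1_def cD1_def cP2_def cS2_def)

text \<open>
  The list contains the eigenvalues of the Casimir operator on lowest weight vectors of all weights
  strictly below \<open>(l1, l2, l3)\<close> in the relevant range.
\<close>

definition separates :: "complex list \<Rightarrow> int \<Rightarrow> int \<Rightarrow> int \<Rightarrow> bool" where
  "separates ks l1 l2 l3 \<longleftrightarrow> (\<forall>n1 n2 :: nat. int n1 \<le> 2 * R \<longrightarrow> int n2 \<le> 2 * R \<longrightarrow> (n1, n2) \<noteq> (0, 0) \<longrightarrow>
     chi (l1 - int n1) (l2 + int n1 - int n2) (l3 + int n2) \<in> set ks)"

text \<open>
  Submodules generated by \<open>x \<otimes> V\<close> have at most \<open>4 R\<close> levels below a weight of the form (weight of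
  \<open>x\<close>) + (weight of \<open>V\<close>), hence the number of repetitions.
\<close>

definition cas_proj :: "complex list \<Rightarrow> int \<Rightarrow> int \<Rightarrow> int \<Rightarrow> (pbw \<Rightarrow> 'u) \<Rightarrow> pbw \<Rightarrow> 'u" where
  "cas_proj ks = G.cas_poly (concat (replicate (nat (4 * R + 1)) ks))"

text \<open>
  The weights of the submodule generated by \<open>x \<otimes> V\<close> are at most \<open>2 R\<close> below in each direction, since those
  of the submodule generated by \<open>x\<close> lie above the weight of \<open>x\<close> and those of \<open>V\<close> are bounded by \<open>R\<close>.
\<close>

lemma cas_proj_kills:
  assumes x: "M.lowest x p1 p2 p3" and u: "u \<in> X (l1 - int k1) (l2 + int k1 - int k2) (l3 + int k2)"
    and l: "\<bar>l1\<bar> \<le> R" "\<bar>l2\<bar> \<le> R" "\<bar>l3\<bar> \<le> R" and k: "(k1, k2) \<noteq> (0, 0)"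
    and ks: "separates ks (p1 + l1) (p2 + l2) (p3 + l3)"
  shows "cas_proj ks (p1 + l1 - int k1) (p2 + l2 + int k1 - int k2) (p3 + l3 + int k2) (tens x u) = 0"
proof -
  interpret S: gl3_tensor q vscale vE1 vE2 FM1 FM2 "M.subX x p1 p2 p3" sc E1 E2 F1 F2 X wsc wE1 wE2 FW1 FW2 tens
    by (rule tensor_locale[OF M.subX_gl3_module[OF x] M.subX_X[OF x]])
  interpret H: gl3_module q wsc wE1 wE2 FW1 FW2 S.XW by (rule S.tensor_gl3_module)
  have small: "w = 0"
    if w: "w \<in> S.XW (p1 + l1 - int n1) (p2 + l2 + int n1 - int n2) (p3 + l3 + int n2)"
      and n: "\<not> (int n1 \<le> 2 * R \<and> int n2 \<le> 2 * R)" for w n1 n2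
    using w
  proof (induction rule: S.XW_induct)
    case (tens z v a1 a2 a3 b1 b2 b3)
    show ?case
    proof (cases "z = 0 \<or> v = 0")
      case False
      then obtain g1 g2 :: nat where "a1 = p1 + int g1 \<and> a2 = p2 - int g1 + int g2 \<and> a3 = p3 - int g2"
        using M.subX_cone[OF x tens(1)] by blast
      moreover have "\<bar>b1\<bar> \<le> R \<and> \<bar>b2\<bar> \<le> R \<and> \<bar>b3\<bar> \<le> R" using bound[OF tens(2)] False by blast
      ultimately have False using n l tens(3-5) by linarith
      then show ?thesis ..
    qed (auto simp: tens_def fun_eq_iff)
  qed (simp_all add: wsc_def fun_eq_iff)
  show ?thesis unfolding cas_proj_def
  proof (rule H.cas_poly_kills)
    show "tens x u \<in> S.XW (p1 + l1 - int k1) (p2 + l2 + int k1 - int k2) (p3 + l3 + int k2)"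
      by (rule S.tens_XW'[OF M.subX_base[OF x] u]) simp_all
  next
    fix n1 n2 :: nat and w
    assume "w \<in> S.XW (p1 + l1 - int k1 - int n1) (p2 + l2 + int k1 - int k2 + int n1 - int n2)
       (p3 + l3 + int k2 + int n2)"
    then have w: "w \<in> S.XW (p1 + l1 - int (k1 + n1)) (p2 + l2 + int (k1 + n1) - int (k2 + n2))
       (p3 + l3 + int (k2 + n2))" by (simp add: algebra_simps)
    { assume "nat (4 * R + 1) \<le> n1 + n2"
      then show "w = 0" using small[OF w] by linarith }
    { assume chi: "H.chi (p1 + l1 - int k1 - int n1) (p2 + l2 + int k1 - int k2 + int n1 - int n2)
         (p3 + l3 + int k2 + int n2) \<notin> set ks"
      have "(k1 + n1, k2 + n2) \<noteq> (0, 0)" using k by auto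
      moreover have "chi (p1 + l1 - int (k1 + n1)) (p2 + l2 + int (k1 + n1) - int (k2 + n2)) (p3 + l3 + int (k2 + n2)) \<notin> set ks"
        using chi by (simp add: algebra_simps)
      ultimately show "w = 0" using small[OF w] ks unfolding separates_def by blast }
  qed
qed

lemma linear_cas_proj: "Vector_Spaces.linear wsc wsc (cas_proj ks l1 l2 l3)"
  unfolding cas_proj_def by (rule G.linear_cas_poly)

text \<open>
  \<open>rank_one_projected\<close> for the first simple root with \<open>cas_proj\<close> as projection.  The shift by one in the weights
  of \<open>x\<close> is the one of the shifted Weyl group action.
\<close>

lemma transport_step1:
  assumes x: "M.lowest x p1 p2 p3" and y: "y \<in> X l1 l2 l3"
    and l: "\<bar>l1\<bar> \<le> R" "\<bar>l2\<bar> \<le> R" "\<bar>l3\<bar> \<le> R"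
    and b: "int b = p2 - p1" "int b > 4 * R" and n: "n = l2 - l1" and a: "a = int b - n"
    and ks: "separates ks (p1 + l2) (p2 + l1) (p3 + l3)" "separates ks (p2 + 1 + l1) (p1 - 1 + l2) (p3 + l3)"
  shows "cas_proj ks (p2 + 1 + l1) (p1 - 1 + l2) (p3 + l3) (tens (M.s1.dpE (Suc b) x) y)
    = G.s1.dpE (nat a + 1) (cas_proj ks (p1 + l2) (p2 + l1) (p3 + l3) (tens x (transport1 n a y)))"
proof -
  have xX: "x \<in> vX m1 m2 m3 p1 p2 p3" using x by (simp add: M.lowest_def)
  interpret r: rank_one_step q sc E1 F1 X1 wsc wE1 FW1 G.X1 "\<lambda>k. tens (M.s1.dpE k x)"
  proof unfold_locales
    fix k u h assume "u \<in> X1 h"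
    then obtain n1 n2 n3 where u: "u \<in> X n1 n2 n3" and h: "h = n1 - n2" by (auto simp: X1_def)
    show "wE1 (tens (M.s1.dpE k x) u)
      = wsc (q powi h * br (int (Suc k))) (tens (M.s1.dpE (Suc k) x) u) + tens (M.s1.dpE k x) (E1 u)"
      unfolding W.E1_tens[OF M.X_dpE1[OF xX] u] M.s1.E_dpE W.tl.scale h by simp
  qed
  have x': "M.lowest (M.s1.dpE (Suc b) x) (p2 + 1) (p1 - 1) p3"
    by (rule M.lowest_dpE1[OF x b(1)])
  have R: "R \<ge> 0" using l by linarith
  have v: "transport1 n a y \<in> X l2 l1 l3" by (rule X_transport1[OF y n])
  let ?Z = "\<lambda>j. W.XW (p1 + l2 + j) (p2 + l1 - j) (p3 + l3)"
  let ?C = "\<lambda>j. cas_proj ks (p1 + l2 + j) (p2 + l1 - j) (p3 + l3)"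
  have idx: "p1 + l2 + (0 + a + 1 - int k) = p2 + 1 + (l1 - int k)" "p2 + l1 - (0 + a + 1 - int k) = p1 - 1 + (l2 + int k)"
    "p1 + l2 + (0 - int k) = p1 + (l2 - int k)" "p2 + l1 - (0 - int k) = p2 + (l1 + int k)" for k
    using a b(1) n by linarith+
  have "?C (0 + a + 1) (tens (M.s1.dpE (Suc b) x) y) = G.s1.dpE (nat a + 1) (?C 0 (tens (M.s1.dpE 0 x) (transport1 n a y)))"
  proof (rule r.rank_one_projected[where Z = ?Z and N = "nat (2 * R)"])
    show "y \<in> X1 (- n)" using y n by (auto simp: X1_def)
    show "a = int b - n" by fact
    show "int (nat (2 * R)) < a" using a b(2) l n R by simp
    show "s1.dpF (Suc (nat (2 * R))) y = 0"
    proof (rule out_of_bound[OF X_dpF1[OF y, of "Suc (nat (2 * R))"]])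
      have "int (Suc (nat (2 * R))) = 2 * R + 1" using R by simp
      then show "R < \<bar>l1 - int (Suc (nat (2 * R)))\<bar> \<or> R < \<bar>l2 + int (Suc (nat (2 * R)))\<bar> \<or> R < \<bar>l3\<bar>"
        using l by linarith
    qed
    show "s1.dpE (Suc b) y = 0"
      by (rule out_of_bound[OF X_dpE1[OF y, of "Suc b"]]) (use l R b(2) in linarith)
    show "Vector_Spaces.linear wsc wsc (?C j)" for j by (rule linear_cas_proj)
    show "?C (j + 1) (wE1 w) = wE1 (?C j w)" if "w \<in> ?Z j" for j w
      using G.cas_poly_E1[OF that] by (simp add: cas_proj_def algebra_simps)
    show "wE1 w \<in> ?Z (j + 1)" if "w \<in> ?Z j" for j w
      using G.X_E1[OF that] by (simp add: algebra_simps)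
    show "wsc c w \<in> ?Z j" if "w \<in> ?Z j" for c w j by (rule G.X_scale[OF that])
    show "v + w \<in> ?Z j" if "w \<in> ?Z j" "v \<in> ?Z j" for v w j by (rule G.X_add[OF that(2,1)])
    show "tens (M.s1.dpE (Suc b) x) (s1.dpF k y) \<in> ?Z (0 + a + 1 - int k)" for k
      unfolding idx using W.tens_XW[OF _ X_dpF1[OF y], of "M.s1.dpE (Suc b) x" "p2 + 1" "p1 - 1" p3 k] x'
      by (simp add: M.lowest_def)
    show "?C (0 + a + 1 - int k) (tens (M.s1.dpE (Suc b) x) (s1.dpF k y)) = 0" if "k > 0" for k
    proof -
      have F: "s1.dpF k y \<in> X (l1 - int k) (l2 + int k - int 0) (l3 + int 0)"
        using X_dpF1[OF y, of k] by simp
      show ?thesis unfolding idx using cas_proj_kills[OF x' F l _ ks(2)] that by (simp add: algebra_simps)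
    qed
    show "tens (M.s1.dpE 0 x) (s1.dpF k (transport1 n a y)) \<in> ?Z (0 - int k)" for k
      unfolding idx using W.tens_XW[OF xX X_dpF1[OF v], of k] by simp
    show "?C (0 - int k) (tens (M.s1.dpE 0 x) (s1.dpF k (transport1 n a y))) = 0" if "k > 0" for k
    proof -
      have F: "s1.dpF k (transport1 n a y) \<in> X (l2 - int k) (l1 + int k - int 0) (l3 + int 0)"
        using X_dpF1[OF v, of k] by simp
      show ?thesis unfolding idx using cas_proj_kills[OF x F l(2,1,3) _ ks(1)] that by (simp add: algebra_simps)
    qed
  qed (rule transport1_def)
  note eq = this
  have e: "p1 + l2 + (0 + a + 1) = p2 + 1 + l1" "p2 + l1 - (0 + a + 1) = p1 - 1 + l2"
    using idx[of 0] by simp_all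
  show ?thesis using eq unfolding e by simp
qed

lemma transport_step2:
  assumes x: "M.lowest x p1 p2 p3" and y: "y \<in> X l1 l2 l3"
    and l: "\<bar>l1\<bar> \<le> R" "\<bar>l2\<bar> \<le> R" "\<bar>l3\<bar> \<le> R"
    and b: "int b = p3 - p2" "int b > 4 * R" and n: "n = l3 - l2" and a: "a = int b - n"
    and ks: "separates ks (p1 + l1) (p2 + l3) (p3 + l2)" "separates ks (p1 + l1) (p3 + 1 + l2) (p2 - 1 + l3)"
  shows "cas_proj ks (p1 + l1) (p3 + 1 + l2) (p2 - 1 + l3) (tens (M.s2.dpE (Suc b) x) y)
    = G.s2.dpE (nat a + 1) (cas_proj ks (p1 + l1) (p2 + l3) (p3 + l2) (tens x (transport2 n a y)))"
proof -
  have xX: "x \<in> vX m1 m2 m3 p1 p2 p3" using x by (simp add: M.lowest_def)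
  interpret r: rank_one_step q sc E2 F2 X2 wsc wE2 FW2 G.X2 "\<lambda>k. tens (M.s2.dpE k x)"
  proof unfold_locales
    fix k u h assume "u \<in> X2 h"
    then obtain n1 n2 n3 where u: "u \<in> X n1 n2 n3" and h: "h = n2 - n3" by (auto simp: X2_def)
    show "wE2 (tens (M.s2.dpE k x) u)
      = wsc (q powi h * br (int (Suc k))) (tens (M.s2.dpE (Suc k) x) u) + tens (M.s2.dpE k x) (E2 u)"
      unfolding W.E2_tens[OF M.X_dpE2[OF xX] u] M.s2.E_dpE W.tl.scale h by simp
  qed
  have x': "M.lowest (M.s2.dpE (Suc b) x) p1 (p3 + 1) (p2 - 1)"
    by (rule M.lowest_dpE2[OF x b(1)])
  have R: "R \<ge> 0" using l by linarith
  have v: "transport2 n a y \<in> X l1 l3 l2" by (rule X_transport2[OF y n])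
  let ?Z = "\<lambda>j. W.XW (p1 + l1) (p2 + l3 + j) (p3 + l2 - j)"
  let ?C = "\<lambda>j. cas_proj ks (p1 + l1) (p2 + l3 + j) (p3 + l2 - j)"
  have idx: "p2 + l3 + (0 + a + 1 - int k) = p3 + 1 + (l2 - int k)" "p3 + l2 - (0 + a + 1 - int k) = p2 - 1 + (l3 + int k)"
    "p2 + l3 + (0 - int k) = p2 + (l3 - int k)" "p3 + l2 - (0 - int k) = p3 + (l2 + int k)" for k
    using a b(1) n by linarith+
  have "?C (0 + a + 1) (tens (M.s2.dpE (Suc b) x) y) = G.s2.dpE (nat a + 1) (?C 0 (tens (M.s2.dpE 0 x) (transport2 n a y)))"
  proof (rule r.rank_one_projected[where Z = ?Z and N = "nat (2 * R)"])
    show "y \<in> X2 (- n)" using y n by (auto simp: X2_def)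
    show "a = int b - n" by fact
    show "int (nat (2 * R)) < a" using a b(2) l n R by simp
    show "s2.dpF (Suc (nat (2 * R))) y = 0"
    proof (rule out_of_bound[OF X_dpF2[OF y, of "Suc (nat (2 * R))"]])
      have "int (Suc (nat (2 * R))) = 2 * R + 1" using R by simp
      then show "R < \<bar>l1\<bar> \<or> R < \<bar>l2 - int (Suc (nat (2 * R)))\<bar> \<or> R < \<bar>l3 + int (Suc (nat (2 * R)))\<bar>"
        using l by linarith
    qed
    show "s2.dpE (Suc b) y = 0"
      by (rule out_of_bound[OF X_dpE2[OF y, of "Suc b"]]) (use l R b(2) in linarith)
    show "Vector_Spaces.linear wsc wsc (?C j)" for j by (rule linear_cas_proj)
    show "?C (j + 1) (wE2 w) = wE2 (?C j w)" if "w \<in> ?Z j" for j w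
      using G.cas_poly_E2[OF that] by (simp add: cas_proj_def algebra_simps)
    show "wE2 w \<in> ?Z (j + 1)" if "w \<in> ?Z j" for j w
      using G.X_E2[OF that] by (simp add: algebra_simps)
    show "wsc c w \<in> ?Z j" if "w \<in> ?Z j" for c w j by (rule G.X_scale[OF that])
    show "v + w \<in> ?Z j" if "w \<in> ?Z j" "v \<in> ?Z j" for v w j by (rule G.X_add[OF that(2,1)])
    show "tens (M.s2.dpE (Suc b) x) (s2.dpF k y) \<in> ?Z (0 + a + 1 - int k)" for k
      unfolding idx using W.tens_XW[OF _ X_dpF2[OF y], of "M.s2.dpE (Suc b) x" p1 "p3 + 1" "p2 - 1" k] x'
      by (simp add: M.lowest_def)
    show "?C (0 + a + 1 - int k) (tens (M.s2.dpE (Suc b) x) (s2.dpF k y)) = 0" if "k > 0" for k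
    proof -
      have F: "s2.dpF k y \<in> X (l1 - int 0) (l2 + int 0 - int k) (l3 + int k)"
        using X_dpF2[OF y, of k] by simp
      show ?thesis unfolding idx using cas_proj_kills[OF x' F l _ ks(2)] that by (simp add: algebra_simps)
    qed
    show "tens (M.s2.dpE 0 x) (s2.dpF k (transport2 n a y)) \<in> ?Z (0 - int k)" for k
      unfolding idx using W.tens_XW[OF xX X_dpF2[OF v], of k] by simp
    show "?C (0 - int k) (tens (M.s2.dpE 0 x) (s2.dpF k (transport2 n a y))) = 0" if "k > 0" for k
    proof -
      have F: "s2.dpF k (transport2 n a y) \<in> X (l1 - int 0) (l3 + int 0 - int k) (l2 + int k)"
        using X_dpF2[OF v, of k] by simp
      show ?thesis unfolding idx using cas_proj_kills[OF x F l(1,3,2) _ ks(1)] that by (simp add: algebra_simps)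
    qed
  qed (rule transport2_def)
  note eq = this
  have e: "p2 + l3 + (0 + a + 1) = p3 + 1 + l2" "p3 + l2 - (0 + a + 1) = p2 - 1 + l3"
    using idx[of 0] by simp_all
  show ?thesis using eq unfolding e by simp
qed

text \<open>
  The integers \<open>m1\<close>, \<open>m2\<close>, \<open>m3\<close> are the lowest weight of the Verma module.  Applying the transport step
  along both reduced words, the vectors \<open>T (x\<^sub>0 \<otimes> v)\<close> and \<open>T (x\<^sub>0 \<otimes> w)\<close> have the same image under a
  product of divided powers of \<open>E1\<close> and \<open>E2\<close>, by the Verma identity in the Verma module for \<open>x\<^sub>0\<close> and in the
  tensor product for the remaining powers.  That product is injective, and the coinvariants recover \<open>v - w\<close> because
  \<open>ks0\<close> keeps the scalar of \<open>T\<close> different from zero.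
\<close>

theorem braid_integral:
  assumes y: "y \<in> X l1 l2 l3"
    and l: "\<bar>l1\<bar> \<le> R" "\<bar>l2\<bar> \<le> R" "\<bar>l3\<bar> \<le> R"
    and m: "m2 - m1 > 8 * R" "m3 - m2 > 8 * R"
    and ks: "separates ks (m1 + l3) (m2 + l2) (m3 + l1)"
      "separates ks (m2 + 1 + l2) (m1 - 1 + l3) (m3 + l1)" "separates ks (m2 + 1 + l2) (m3 + 1 + l1) (m1 - 2 + l3)"
      "separates ks (m3 + 2 + l1) (m2 + l2) (m1 - 2 + l3)"
      "separates ks (m1 + l3) (m3 + 1 + l1) (m2 - 1 + l2)" "separates ks (m3 + 2 + l1) (m1 - 1 + l3) (m2 - 1 + l2)"
    and ks0: "chi (m1 + l3) (m2 + l2) (m3 + l1) \<notin> set ks"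
    and a: "a1 = m2 - m1 - (l3 - l2)" "a2 = m3 - m2 - (l2 - l1)" "a3 = m3 - m1 + 1 - (l3 - l1)"
  shows "transport1 (l3 - l2) a1 (transport2 (l3 - l1) a3 (transport1 (l2 - l1) a2 y))
    = transport2 (l2 - l1) a2 (transport1 (l3 - l1) a3 (transport2 (l3 - l2) a1 y))"
proof -
  have R: "R \<ge> 0" using l by linarith
  \<comment> \<open>The three positive roots in the shifted action; the exponents along the two words.\<close>
  define b1 b2 b3 where "b1 = nat (m2 - m1)" and "b2 = nat (m3 - m2)" and "b3 = nat (m3 - m1 + 1)"
  have b: "int b1 = m2 - m1" "int b2 = m3 - m2" "int b3 = m3 - m1 + 1"
    using m R by (simp_all add: b1_def b2_def b3_def)
  have b_gt: "int b1 > 4 * R" "int b2 > 4 * R" "int b3 > 4 * R" using b m R by linarith+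
  have ab: "a1 = int b1 - (l3 - l2)" "a2 = int b2 - (l2 - l1)" "a3 = int b3 - (l3 - l1)"
    using a b by simp_all
  define x1 x21 x121 where "x1 = M.s1.dpE (Suc b1) x0" and "x21 = M.s2.dpE (Suc b3) x1"
    and "x121 = M.s1.dpE (Suc b2) x21"
  define x2 x12 x212 where "x2 = M.s2.dpE (Suc b2) x0" and "x12 = M.s1.dpE (Suc b3) x2"
    and "x212 = M.s2.dpE (Suc b1) x12"
  define v1 v2 v3 where "v1 = transport1 (l2 - l1) a2 y" and "v2 = transport2 (l3 - l1) a3 v1" and "v3 = transport1 (l3 - l2) a1 v2"
  define w1 w2 w3 where "w1 = transport2 (l3 - l2) a1 y" and "w2 = transport1 (l3 - l1) a3 w1" and "w3 = transport2 (l2 - l1) a2 w2"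
  have v1: "v1 \<in> X l2 l1 l3" unfolding v1_def by (rule X_transport1[OF y]) simp
  have v2: "v2 \<in> X l2 l3 l1" unfolding v2_def by (rule X_transport2[OF v1]) simp
  have v3: "v3 \<in> X l3 l2 l1" unfolding v3_def by (rule X_transport1[OF v2]) simp
  have w1: "w1 \<in> X l1 l3 l2" unfolding w1_def by (rule X_transport2[OF y]) simp
  have w2: "w2 \<in> X l3 l1 l2" unfolding w2_def by (rule X_transport1[OF w1]) simp
  have w3: "w3 \<in> X l3 l2 l1" unfolding w3_def by (rule X_transport2[OF w2]) simp
  have x1: "M.lowest x1 (m2 + 1) (m1 - 1) m3"
    unfolding x1_def by (rule M.lowest_dpE1[OF lowest_x0]) (simp add: b)
  have x21: "M.lowest x21 (m2 + 1) (m3 + 1) (m1 - 2)"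
    using M.lowest_dpE2[OF x1, of b3] by (simp add: b x21_def)
  have x2: "M.lowest x2 m1 (m3 + 1) (m2 - 1)"
    unfolding x2_def by (rule M.lowest_dpE2[OF lowest_x0]) (simp add: b)
  have x12: "M.lowest x12 (m3 + 2) (m1 - 1) (m2 - 1)"
    using M.lowest_dpE1[OF x2, of b3] by (simp add: b x12_def add.commute[of 2])
  have e: "nat a3 + 1 = (nat a2 + 1) + (nat a1 + 1)" "Suc b3 = Suc b2 + Suc b1"
    using a m l b by linarith+
  have x0X: "x0 \<in> vX m1 m2 m3 m1 m2 m3" using lowest_x0 by (simp add: M.lowest_def)
  have x_eq: "x121 = x212"
    unfolding x121_def x21_def x1_def x212_def x12_def x2_def e by (rule M.verma_identity_dp[OF x0X])
  let ?T = "cas_proj ks"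
  have chain1: "?T (m3 + 2 + l1) (m2 + l2) (m1 - 2 + l3) (tens x121 y)
      = G.s1.dpE (nat a2 + 1) (?T (m2 + 1 + l2) (m3 + 1 + l1) (m1 - 2 + l3) (tens x21 v1))"
    unfolding x121_def v1_def
    using transport_step1[OF x21 y l _ b_gt(2) refl ab(2), of ks] b ks
    by (simp add: algebra_simps)
  have chain2: "?T (m2 + 1 + l2) (m3 + 1 + l1) (m1 - 2 + l3) (tens x21 v1)
      = G.s2.dpE (nat a3 + 1) (?T (m2 + 1 + l2) (m1 - 1 + l3) (m3 + l1) (tens x1 v2))"
    unfolding x21_def v2_def
    using transport_step2[OF x1 v1 l(2,1,3) _ b_gt(3) refl ab(3), of ks] b ks
    by (simp add: algebra_simps)
  have chain3: "?T (m2 + 1 + l2) (m1 - 1 + l3) (m3 + l1) (tens x1 v2)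
      = G.s1.dpE (nat a1 + 1) (?T (m1 + l3) (m2 + l2) (m3 + l1) (tens x0 v3))"
    unfolding x1_def v3_def
    using transport_step1[OF lowest_x0 v2 l(2,3,1) _ b_gt(1) refl ab(1), of ks] b ks
    by (simp add: algebra_simps)
  have chain1': "?T (m3 + 2 + l1) (m2 + l2) (m1 - 2 + l3) (tens x212 y)
      = G.s2.dpE (nat a1 + 1) (?T (m3 + 2 + l1) (m1 - 1 + l3) (m2 - 1 + l2) (tens x12 w1))"
    unfolding x212_def w1_def
    using transport_step2[OF x12 y l _ b_gt(1) refl ab(1), of ks] b ks
    by (simp add: algebra_simps)
  have chain2': "?T (m3 + 2 + l1) (m1 - 1 + l3) (m2 - 1 + l2) (tens x12 w1)
      = G.s1.dpE (nat a3 + 1) (?T (m1 + l3) (m3 + 1 + l1) (m2 - 1 + l2) (tens x2 w2))"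
    unfolding x12_def w2_def
    using transport_step1[OF x2 w1 l(1,3,2) _ b_gt(3) refl ab(3), of ks] b ks
    by (simp add: algebra_simps)
  have chain3': "?T (m1 + l3) (m3 + 1 + l1) (m2 - 1 + l2) (tens x2 w2)
      = G.s2.dpE (nat a2 + 1) (?T (m1 + l3) (m2 + l2) (m3 + l1) (tens x0 w3))"
    unfolding x2_def w3_def
    using transport_step2[OF lowest_x0 w2 l(3,1,2) _ b_gt(2) refl ab(2), of ks] b ks
    by (simp add: algebra_simps)
  define D where "D = v3 - w3"
  have tD: "tens x0 D \<in> W.XW (m1 + l3) (m2 + l2) (m3 + l1)"
    unfolding D_def by (rule W.tens_XW[OF x0X X_diff[OF v3 w3]])
  define z where "z = ?T (m1 + l3) (m2 + l2) (m3 + l1) (tens x0 D)"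
  have zX: "z \<in> W.XW (m1 + l3) (m2 + l2) (m3 + l1)" unfolding z_def cas_proj_def by (rule G.X_cas_poly[OF tD])
  interpret C: Vector_Spaces.linear wsc wsc "cas_proj ks i j k" for i j k by (rule linear_cas_proj)
  let ?U = "\<lambda>w. G.s1.dpE (nat a2 + 1) (G.s2.dpE (nat a3 + 1) (G.s1.dpE (nat a1 + 1) w))"
  have "?U (?T (m1 + l3) (m2 + l2) (m3 + l1) (tens x0 v3)) = ?T (m3 + 2 + l1) (m2 + l2) (m1 - 2 + l3) (tens x121 y)"
    by (rule chain1[unfolded chain2 chain3, symmetric])
  also have "\<dots> = G.s2.dpE (nat a1 + 1) (G.s1.dpE (nat a3 + 1) (G.s2.dpE (nat a2 + 1)
      (?T (m1 + l3) (m2 + l2) (m3 + l1) (tens x0 w3))))"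
    unfolding x_eq by (rule chain1'[unfolded chain2' chain3'])
  also have "\<dots> = ?U (?T (m1 + l3) (m2 + l2) (m3 + l1) (tens x0 w3))"
    unfolding e(1)
    by (rule G.verma_identity_dp[symmetric, of _ "m1 + l3" "m2 + l2" "m3 + l1"])
      (unfold cas_proj_def, rule G.X_cas_poly[OF W.tens_XW[OF x0X w3]])
  finally have "?U z = 0"
    unfolding z_def D_def W.tr.diff C.diff G.s1.dE.diff G.s2.dE.diff by simp
  then have "z = 0"
    using dpE_injective(1)[OF zX] dpE_injective(2)[OF G.X_dpE1[OF zX]]
      dpE_injective(1)[OF G.X_dpE2[OF G.X_dpE1[OF zX]]] by blast
  then have "coinv z = 0" by (simp add: coinv_def phi_lin)
  moreover have "coinv z = sc (\<Prod>k\<leftarrow>concat (replicate (nat (4 * R + 1)) ks). chi (m1 + l3) (m2 + l2) (m3 + l1) - k) D"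
    unfolding z_def cas_proj_def coinv_cas_poly[OF tD] using coinv_tens0[OF x0_def] by simp
  moreover have "(\<Prod>k\<leftarrow>concat (replicate (nat (4 * R + 1)) ks). chi (m1 + l3) (m2 + l2) (m3 + l1) - k) \<noteq> 0"
    using ks0 by (auto simp: prod_list_zero_iff)
  ultimately have "D = 0" by (simp add: Vs.scale_eq_0_iff)
  then show ?thesis by (simp add: D_def v3_def v2_def v1_def w3_def w2_def w1_def)
qed

end

section \<open>Rational functions and their values\<close>

definition mon :: "(nat \<Rightarrow> complex) \<Rightarrow> (nat \<Rightarrow>\<^sub>0 nat) \<Rightarrow> complex" where
  "mon \<zeta> m = (\<Prod>k\<in>Poly_Mapping.keys m. \<zeta> k ^ Poly_Mapping.lookup m k)"

definition peval :: "(nat \<Rightarrow> complex) \<Rightarrow> cpoly \<Rightarrow> complex" where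
  "peval \<zeta> p = (\<Sum>m\<in>Poly_Mapping.keys p. Poly_Mapping.lookup p m * mon \<zeta> m)"

lemma mon_superset: "finite A \<Longrightarrow> Poly_Mapping.keys m \<subseteq> A \<Longrightarrow> mon \<zeta> m = (\<Prod>k\<in>A. \<zeta> k ^ Poly_Mapping.lookup m k)"
  unfolding mon_def by (rule prod.mono_neutral_left) (auto simp: in_keys_iff)

lemma peval_superset: "finite A \<Longrightarrow> Poly_Mapping.keys p \<subseteq> A \<Longrightarrow>
    peval \<zeta> p = (\<Sum>m\<in>A. Poly_Mapping.lookup p m * mon \<zeta> m)"
  unfolding peval_def by (rule sum.mono_neutral_left) (auto simp: in_keys_iff)

lemma mon_add: "mon \<zeta> (m + n) = mon \<zeta> m * mon \<zeta> n"
proof -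
  define A where "A = Poly_Mapping.keys m \<union> Poly_Mapping.keys n"
  have A: "finite A" "Poly_Mapping.keys m \<subseteq> A" "Poly_Mapping.keys n \<subseteq> A" "Poly_Mapping.keys (m + n) \<subseteq> A"
    using Poly_Mapping.keys_add[of m n] by (auto simp: A_def)
  show ?thesis
    by (simp add: mon_superset[OF A(1)] A lookup_add power_add prod.distrib)
qed

lemma mon_0 [simp]: "mon \<zeta> 0 = 1" by (simp add: mon_def)

lemma mon_single [simp]: "mon \<zeta> (Poly_Mapping.single k n) = \<zeta> k ^ n"
  by (cases "n = 0") (simp_all add: mon_def)

lemma peval_0 [simp]: "peval \<zeta> 0 = 0" by (simp add: peval_def)

lemma peval_single [simp]: "peval \<zeta> (Poly_Mapping.single m c) = c * mon \<zeta> m"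
  by (cases "c = 0") (simp_all add: peval_def)

lemma peval_1 [simp]: "peval \<zeta> 1 = 1"
  using peval_single[of \<zeta> 0 1] by (simp only: single_one mon_0 mult_1)

lemma peval_add: "peval \<zeta> (p + r) = peval \<zeta> p + peval \<zeta> r"
proof -
  define A where "A = Poly_Mapping.keys p \<union> Poly_Mapping.keys r"
  have A: "finite A" "Poly_Mapping.keys p \<subseteq> A" "Poly_Mapping.keys r \<subseteq> A" "Poly_Mapping.keys (p + r) \<subseteq> A"
    using Poly_Mapping.keys_add[of p r] by (auto simp: A_def)
  show ?thesis
    by (simp add: peval_superset[OF A(1)] A lookup_add distrib_right sum.distrib)
qed

lemma peval_mult: "peval \<zeta> (p * r) = peval \<zeta> p * peval \<zeta> r"
proof -
  have single: "peval \<zeta> (Poly_Mapping.single m c * r) = c * mon \<zeta> m * peval \<zeta> r" for m c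
    by (induction r rule: cpoly_induct)
      (simp_all add: mult_single mon_add peval_add distrib_left mult_ac)
  show ?thesis
    by (induction p rule: cpoly_induct) (simp_all add: single peval_add distrib_right)
qed

lemma peval_prod: "peval \<zeta> (prod f A) = (\<Prod>x\<in>A. peval \<zeta> (f x))"
  by (induction A rule: infinite_finite_induct) (simp_all add: peval_mult)

lemma mon_swap: "mon \<zeta> (swap_monom i m) = mon (\<zeta> \<circ> transpose i (Suc i)) m"
proof -
  define A where "A = Poly_Mapping.keys m \<union> transpose i (Suc i) ` Poly_Mapping.keys m"
  have A: "finite A" "Poly_Mapping.keys m \<subseteq> A" "Poly_Mapping.keys (swap_monom i m) \<subseteq> A"
    "bij_betw (transpose i (Suc i)) A A"
  proof -
    show "Poly_Mapping.keys (swap_monom i m) \<subseteq> A"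
    proof
      fix k assume "k \<in> Poly_Mapping.keys (swap_monom i m)"
      then have "transpose i (Suc i) k \<in> Poly_Mapping.keys m"
        by (simp add: in_keys_iff lookup_swap_monom)
      then have "transpose i (Suc i) (transpose i (Suc i) k) \<in> A" unfolding A_def by blast
      then show "k \<in> A" by simp
    qed
    show "bij_betw (transpose i (Suc i)) A A"
      by (rule bij_betw_byWitness[where f' = "transpose i (Suc i)"]) (auto simp: A_def)
  qed (auto simp: A_def)
  have "mon \<zeta> (swap_monom i m) = (\<Prod>k\<in>A. \<zeta> k ^ Poly_Mapping.lookup m (transpose i (Suc i) k))"
    by (simp add: mon_superset[OF A(1)] A lookup_swap_monom)
  also have "\<dots> = (\<Prod>k\<in>A. \<zeta> (transpose i (Suc i) k) ^ Poly_Mapping.lookup m k)"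
    by (rule prod.reindex_bij_witness[of _ "transpose i (Suc i)" "transpose i (Suc i)"])
      (use A(4) in \<open>auto simp: bij_betw_def\<close>)
  finally show ?thesis by (simp add: mon_superset[OF A(1)] A)
qed

lemma peval_swap: "peval \<zeta> (swap_poly i p) = peval (\<zeta> \<circ> transpose i (Suc i)) p"
  by (induction p rule: cpoly_induct) (simp_all add: swap_poly_add swap_poly_single peval_add mon_swap comp_def)

text \<open>
  A relation and not a function: a rational function has a value at \<open>\<zeta>\<close> if some fraction representing it
  has a denominator that does not vanish there.
\<close>

definition has_value :: "ratfun \<Rightarrow> (nat \<Rightarrow> complex) \<Rightarrow> complex \<Rightarrow> bool" where
  "has_value r \<zeta> c \<longleftrightarrow> (\<exists>p d. r = Fract p d \<and> peval \<zeta> d \<noteq> 0 \<and> c = peval \<zeta> p / peval \<zeta> d)"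

lemma peval_nz: "peval \<zeta> d \<noteq> 0 \<Longrightarrow> d \<noteq> 0" by auto

lemma has_value_unique:
  assumes "has_value r \<zeta> c" "has_value r \<zeta> c'"
  shows "c = c'"
proof -
  obtain p d p' d' where *: "r = Fract p d" "peval \<zeta> d \<noteq> 0" "c = peval \<zeta> p / peval \<zeta> d"
    "r = Fract p' d'" "peval \<zeta> d' \<noteq> 0" "c' = peval \<zeta> p' / peval \<zeta> d'"
    using assms unfolding has_value_def by blast
  have "p * d' = p' * d" using * peval_nz[of \<zeta> d] peval_nz[of \<zeta> d'] eq_fract(1)[of d d' p p'] by auto
  then have "peval \<zeta> p * peval \<zeta> d' = peval \<zeta> p' * peval \<zeta> d" by (simp flip: peval_mult)
  then show ?thesis using * by (simp add: frac_eq_eq)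
qed

lemma has_value_rconst: "has_value (rconst c) \<zeta> c"
  unfolding has_value_def rconst_def
  by (rule exI[of _ "Poly_Mapping.single 0 c"], rule exI[of _ 1]) simp

lemma has_value_rvar: "has_value (rvar k) \<zeta> (\<zeta> k)"
  unfolding has_value_def rvar_def
  by (rule exI[of _ "Poly_Mapping.single (Poly_Mapping.single k 1) 1"], rule exI[of _ 1]) simp

lemma has_value_add: "has_value r \<zeta> c \<Longrightarrow> has_value r' \<zeta> c' \<Longrightarrow> has_value (r + r') \<zeta> (c + c')"
  unfolding has_value_def
proof (elim exE conjE)
  fix p d p' d'
  assume "r = Fract p d" "peval \<zeta> d \<noteq> 0" "c = peval \<zeta> p / peval \<zeta> d"
    "r' = Fract p' d'" "peval \<zeta> d' \<noteq> 0" "c' = peval \<zeta> p' / peval \<zeta> d'"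
  then show "\<exists>p d. r + r' = Fract p d \<and> peval \<zeta> d \<noteq> 0 \<and> c + c' = peval \<zeta> p / peval \<zeta> d"
    using peval_nz[of \<zeta> d] peval_nz[of \<zeta> d']
    by - (rule exI[of _ "p * d' + p' * d"], rule exI[of _ "d * d'"], simp add: peval_mult peval_add add_frac_eq)
qed

lemma has_value_mult: "has_value r \<zeta> c \<Longrightarrow> has_value r' \<zeta> c' \<Longrightarrow> has_value (r * r') \<zeta> (c * c')"
  unfolding has_value_def
proof (elim exE conjE)
  fix p d p' d'
  assume "r = Fract p d" "peval \<zeta> d \<noteq> 0" "c = peval \<zeta> p / peval \<zeta> d"
    "r' = Fract p' d'" "peval \<zeta> d' \<noteq> 0" "c' = peval \<zeta> p' / peval \<zeta> d'"
  then show "\<exists>p d. r * r' = Fract p d \<and> peval \<zeta> d \<noteq> 0 \<and> c * c' = peval \<zeta> p / peval \<zeta> d"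
    by - (rule exI[of _ "p * p'"], rule exI[of _ "d * d'"], simp add: peval_mult)
qed

lemma has_value_inverse: "has_value r \<zeta> c \<Longrightarrow> c \<noteq> 0 \<Longrightarrow> has_value (inverse r) \<zeta> (inverse c)"
  unfolding has_value_def
proof (elim exE conjE)
  fix p d
  assume "r = Fract p d" "peval \<zeta> d \<noteq> 0" "c = peval \<zeta> p / peval \<zeta> d" "c \<noteq> 0"
  then show "\<exists>p d. inverse r = Fract p d \<and> peval \<zeta> d \<noteq> 0 \<and> inverse c = peval \<zeta> p / peval \<zeta> d"
    by - (rule exI[of _ d], rule exI[of _ p], simp)
qed

lemma has_value_diff: "has_value r \<zeta> c \<Longrightarrow> has_value r' \<zeta> c' \<Longrightarrow> has_value (r - r') \<zeta> (c - c')"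
proof -
  have r: "rconst (-1) = - 1"
    unfolding rconst_def by (simp add: One_fract_def[symmetric] single_uminus)
       (metis One_fract_def minus_fract single_one)
  assume "has_value r \<zeta> c" "has_value r' \<zeta> c'"
  then have "has_value (r + rconst (-1) * r') \<zeta> (c + (-1) * c')"
    by (intro has_value_add has_value_mult has_value_rconst)
  then show ?thesis by (simp add: r)
qed

lemma has_value_divide:
  "has_value r \<zeta> c \<Longrightarrow> has_value r' \<zeta> c' \<Longrightarrow> c' \<noteq> 0 \<Longrightarrow> has_value (r / r') \<zeta> (c / c')"
  unfolding divide_inverse by (intro has_value_mult has_value_inverse)

lemma rconst_0 [simp]: "rconst 0 = 0" by (simp add: rconst_def Zero_fract_def)

lemma has_value_sum: "(\<And>x. x \<in> A \<Longrightarrow> has_value (f x) \<zeta> (g x)) \<Longrightarrow> has_value (sum f A) \<zeta> (sum g A)"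
proof (induction A rule: infinite_finite_induct)
  case (insert x A)
  then show ?case by (simp add: has_value_add)
qed (use has_value_rconst[of 0] in auto)

lemma has_value_swap: "has_value r (\<zeta> \<circ> transpose i (Suc i)) c \<Longrightarrow> has_value (swap_ratfun i r) \<zeta> c"
  unfolding has_value_def
proof (elim exE conjE)
  fix p d
  assume "r = Fract p d" "peval (\<zeta> \<circ> transpose i (Suc i)) d \<noteq> 0"
    "c = peval (\<zeta> \<circ> transpose i (Suc i)) p / peval (\<zeta> \<circ> transpose i (Suc i)) d"
  then show "\<exists>p d. swap_ratfun i r = Fract p d \<and> peval \<zeta> d \<noteq> 0 \<and> c = peval \<zeta> p / peval \<zeta> d"
    using peval_nz[of "\<zeta> \<circ> transpose i (Suc i)" d]
    by - (rule exI[of _ "swap_poly i p"], rule exI[of _ "swap_poly i d"], simp add: peval_swap swap_ratfun_Fract)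
qed

definition drop_var :: "nat \<Rightarrow> (nat \<Rightarrow>\<^sub>0 nat) \<Rightarrow> (nat \<Rightarrow>\<^sub>0 nat)" where
  "drop_var n m = Poly_Mapping.update n 0 m"

lemma lookup_drop_var: "Poly_Mapping.lookup (drop_var n m) k = (if k = n then 0 else Poly_Mapping.lookup m k)"
  by (simp add: drop_var_def lookup_update)

lemma mon_drop_var: "mon (\<zeta>(n := z)) m = z ^ Poly_Mapping.lookup m n * mon \<zeta> (drop_var n m)"
proof -
  define A where "A = insert n (Poly_Mapping.keys m)"
  have A: "finite A" "Poly_Mapping.keys m \<subseteq> A" "Poly_Mapping.keys (drop_var n m) \<subseteq> A" "n \<in> A"
    by (auto simp: A_def in_keys_iff lookup_drop_var split: if_splits)
  show ?thesis
    unfolding mon_superset[OF A(1,2)] mon_superset[OF A(1,3)]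
    by (subst (1 2) prod.remove[OF A(1,4)]) (auto simp: lookup_drop_var intro!: prod.cong)
qed

text \<open>
  The coefficient of the \<open>d\<close>-th power of the \<open>n\<close>-th variable, a polynomial in the other variables.
\<close>

definition coeff_var :: "nat \<Rightarrow> cpoly \<Rightarrow> nat \<Rightarrow> cpoly" where
  "coeff_var n p d = (\<Sum>m\<in>{m\<in>Poly_Mapping.keys p. Poly_Mapping.lookup m n = d}.
     Poly_Mapping.single (drop_var n m) (Poly_Mapping.lookup p m))"

lemma peval_sum: "peval \<zeta> (sum f A) = (\<Sum>x\<in>A. peval \<zeta> (f x))"
  by (induction A rule: infinite_finite_induct) (simp_all add: peval_add)

lemma drop_var_inj: "drop_var n m = drop_var n m' \<Longrightarrow> Poly_Mapping.lookup m n = Poly_Mapping.lookup m' n \<Longrightarrow> m = m'"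
  by (rule poly_mapping_eqI) (metis lookup_drop_var)

lemma coeff_var_nz:
  assumes m: "m \<in> Poly_Mapping.keys p"
  shows "coeff_var n p (Poly_Mapping.lookup m n) \<noteq> 0"
proof -
  let ?K = "{m'\<in>Poly_Mapping.keys p. Poly_Mapping.lookup m' n = Poly_Mapping.lookup m n}"
  have "Poly_Mapping.lookup (coeff_var n p (Poly_Mapping.lookup m n)) (drop_var n m)
    = (\<Sum>m'\<in>?K. if m' = m then Poly_Mapping.lookup p m' else 0)"
    unfolding coeff_var_def lookup_sum
  proof (rule sum.cong)
    fix m' assume "m' \<in> ?K"
    then have "drop_var n m' = drop_var n m \<longleftrightarrow> m' = m" using drop_var_inj by blast
    then show "Poly_Mapping.lookup (Poly_Mapping.single (drop_var n m') (Poly_Mapping.lookup p m')) (drop_var n m)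
      = (if m' = m then Poly_Mapping.lookup p m' else 0)"
      by (simp add: lookup_single when_def)
  qed simp
  also have "\<dots> = Poly_Mapping.lookup p m" using m by (simp add: sum.delta')
  finally have "Poly_Mapping.lookup (coeff_var n p (Poly_Mapping.lookup m n)) (drop_var n m) \<noteq> 0"
    using m by (simp add: in_keys_iff)
  then show ?thesis by (metis lookup_zero)
qed

lemma keys_drop_var: "Poly_Mapping.keys (drop_var n m) = Poly_Mapping.keys m - {n}"
  by (auto simp: in_keys_iff lookup_drop_var split: if_splits)

lemma keys_sum_subset: "Poly_Mapping.keys (sum f A) \<subseteq> (\<Union>a\<in>A. Poly_Mapping.keys (f a))"
proof (induction A rule: infinite_finite_induct)
  case (insert x A)
  then show ?case using Poly_Mapping.keys_add[of "f x" "sum f A"] by auto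
qed simp_all

lemma poly_vars_coeff_var: "poly_vars (coeff_var n p d) \<subseteq> poly_vars p - {n}"
proof
  fix k assume "k \<in> poly_vars (coeff_var n p d)"
  then obtain m where m: "m \<in> Poly_Mapping.keys (coeff_var n p d)" "k \<in> Poly_Mapping.keys m"
    unfolding poly_vars_def by (rule UN_E)
  from subsetD[OF keys_sum_subset m(1)[unfolded coeff_var_def]] obtain m' where
    m': "m' \<in> {m\<in>Poly_Mapping.keys p. Poly_Mapping.lookup m n = d}"
    "m \<in> Poly_Mapping.keys (Poly_Mapping.single (drop_var n m') (Poly_Mapping.lookup p m'))"
    by (rule UN_E)
  then have "m = drop_var n m'" by (metis empty_iff keys_single singletonD)
  then have "k \<in> Poly_Mapping.keys m' - {n}" using m(2) keys_drop_var by simp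
  then show "k \<in> poly_vars p - {n}" using m'(1) unfolding poly_vars_def by blast
qed

lemma peval_coeff_var:
  "\<exists>P :: complex poly. (\<forall>z. peval (\<zeta>(n := z)) p = poly P z) \<and> (\<forall>d. coeff P d = peval \<zeta> (coeff_var n p d))"
proof -
  define P where "P = (\<Sum>m\<in>Poly_Mapping.keys p.
    monom (Poly_Mapping.lookup p m * mon \<zeta> (drop_var n m)) (Poly_Mapping.lookup m n))"
  have "peval (\<zeta>(n := z)) p = poly P z" for z
    by (simp add: P_def peval_def poly_sum poly_monom mon_drop_var mult_ac)
  moreover have "coeff P d = peval \<zeta> (coeff_var n p d)" for d
    unfolding P_def coeff_var_def peval_sum coeff_sum
    by (subst sum.inter_filter) (auto intro!: sum.cong)
  ultimately show ?thesis by blast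
qed

text \<open>
  The admissible values of each coordinate may depend on the coordinates chosen before.  Choosing the
  coordinates successively, some coefficient of the last variable is non-zero at the point chosen so far,
  and a non-zero polynomial in one variable has finitely many roots.
\<close>

lemma nonzero_on_grid:
  fixes S :: "(nat \<Rightarrow> complex) \<Rightarrow> nat \<Rightarrow> complex set"
  assumes inf: "\<And>\<zeta> k. infinite (S \<zeta> k)"
    and dep: "\<And>\<zeta> \<zeta>' k. (\<And>j. j < k \<Longrightarrow> \<zeta> j = \<zeta>' j) \<Longrightarrow> S \<zeta> k = S \<zeta>' k"
  shows "p \<noteq> 0 \<Longrightarrow> poly_vars p \<subseteq> {..<n} \<Longrightarrow> \<exists>\<zeta>. (\<forall>k<n. \<zeta> k \<in> S \<zeta> k) \<and> peval \<zeta> p \<noteq> 0"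
proof (induction n arbitrary: p)
  case 0
  have m: "m = 0" if "m \<in> Poly_Mapping.keys p" for m
    using 0 that by (auto simp: poly_vars_def)
  have "Poly_Mapping.keys p \<noteq> {}" using 0 by simp
  then have k: "Poly_Mapping.keys p = {0}" using m by blast
  then have "0 \<in> Poly_Mapping.keys p" by simp
  then have "Poly_Mapping.lookup p 0 \<noteq> 0" by (simp only: in_keys_iff not_False_eq_True)
  then show ?case by (simp add: peval_def k)
next
  case (Suc n)
  have "Poly_Mapping.keys p \<noteq> {}" using Suc.prems(1) by simp
  then obtain m where m: "m \<in> Poly_Mapping.keys p" by blast
  define d where "d = Poly_Mapping.lookup m n"
  have "coeff_var n p d \<noteq> 0" unfolding d_def by (rule coeff_var_nz[OF m])
  moreover have "poly_vars (coeff_var n p d) \<subseteq> {..<n}"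
    using poly_vars_coeff_var[of n p d] Suc.prems(2) by force
  ultimately obtain \<zeta> where \<zeta>: "\<forall>k<n. \<zeta> k \<in> S \<zeta> k" "peval \<zeta> (coeff_var n p d) \<noteq> 0"
    using Suc.IH[of "coeff_var n p d"] by blast
  obtain P :: "complex poly" where P: "\<And>z. peval (\<zeta>(n := z)) p = poly P z"
    "\<And>d. coeff P d = peval \<zeta> (coeff_var n p d)"
    using peval_coeff_var[of \<zeta> n p] by blast
  have "P \<noteq> 0" using P(2)[of d] \<zeta>(2) by auto
  then have "finite {z. poly P z = 0}" by (rule poly_roots_finite)
  then have "\<not> S \<zeta> n \<subseteq> {z. poly P z = 0}" using inf[of \<zeta> n] finite_subset by blast
  then obtain z where z: "z \<in> S \<zeta> n" "poly P z \<noteq> 0" by blast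
  have "(\<zeta>(n := z)) k \<in> S (\<zeta>(n := z)) k" if "k < Suc n" for k
  proof -
    have "S (\<zeta>(n := z)) k = S \<zeta> k" using that by (intro dep) auto
    then show ?thesis using \<zeta>(1) z(1) that by (cases "k = n") auto
  qed
  then have "\<forall>k<Suc n. (\<zeta>(n := z)) k \<in> S (\<zeta>(n := z)) k" by blast
  moreover have "peval (\<zeta>(n := z)) p \<noteq> 0" using P(1)[of z] z(2) by (simp only: not_False_eq_True)
  ultimately show ?case by - (rule exI[of _ "\<zeta>(n := z)"], rule conjI)
qed

text \<open>
  The polynomial \<open>g\<close> allows one to exclude a further hypersurface.  Only the coordinates below \<open>N\<close> are
  constrained by the grid; a rational function may involve any finite number of others.
\<close>

lemma ratfun_eq_0_if_grid:
  fixes S :: "(nat \<Rightarrow> complex) \<Rightarrow> nat \<Rightarrow> complex set"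
  assumes inf: "\<And>\<zeta> k. infinite (S \<zeta> k)"
    and dep: "\<And>\<zeta> \<zeta>' k. (\<And>j. j < k \<Longrightarrow> \<zeta> j = \<zeta>' j) \<Longrightarrow> S \<zeta> k = S \<zeta>' k"
    and g: "g \<noteq> 0"
    and zero: "\<And>\<zeta>. (\<And>k. k < N \<Longrightarrow> \<zeta> k \<in> S \<zeta> k) \<Longrightarrow> peval \<zeta> g \<noteq> 0 \<Longrightarrow> has_value r \<zeta> 0"
  shows "r = 0"
proof (rule ccontr)
  assume "r \<noteq> 0"
  obtain p d where r: "r = Fract p d" "d \<noteq> 0" by (cases r) auto
  with \<open>r \<noteq> 0\<close> have p: "p \<noteq> 0" by (auto simp: eq_fract Zero_fract_def)
  have fin: "finite (poly_vars (p * d * g))" by (simp add: poly_vars_def)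
  then obtain n where n: "poly_vars (p * d * g) \<subseteq> {..<n}" by (auto simp: finite_nat_iff_bounded)
  have "p * d * g \<noteq> 0" using p r g by simp
  moreover have "poly_vars (p * d * g) \<subseteq> {..<max n N}" using n by force
  ultimately obtain \<zeta> where \<zeta>: "\<forall>k<max n N. \<zeta> k \<in> S \<zeta> k" "peval \<zeta> (p * d * g) \<noteq> 0"
    using nonzero_on_grid[of S "p * d * g" "max n N", OF inf dep] by blast
  then have "has_value r \<zeta> 0" by (intro zero) (auto simp: peval_mult)
  moreover have "has_value r \<zeta> (peval \<zeta> p / peval \<zeta> d)"
    unfolding has_value_def using r \<zeta>(2) by (auto simp: peval_mult)
  ultimately have "peval \<zeta> p / peval \<zeta> d = 0" by (rule has_value_unique[symmetric])
  then show False using \<zeta>(2) by (auto simp: peval_mult)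
qed

lemma poly_vars_add: "poly_vars (p + r) \<subseteq> poly_vars p \<union> poly_vars r"
  using Poly_Mapping.keys_add[of p r] by (auto simp: poly_vars_def)

lemma poly_vars_mult: "poly_vars (p * r) \<subseteq> poly_vars p \<union> poly_vars r"
proof
  fix k assume "k \<in> poly_vars (p * r)"
  then obtain m where m: "m \<in> Poly_Mapping.keys (p * r)" "k \<in> Poly_Mapping.keys m" by (auto simp: poly_vars_def)
  from subsetD[OF keys_mult m(1)] obtain a b where
    ab: "a \<in> Poly_Mapping.keys p" "b \<in> Poly_Mapping.keys r" "m = a + b" by blast
  then have "k \<in> Poly_Mapping.keys a \<or> k \<in> Poly_Mapping.keys b"
    using m(2) subsetD[OF Poly_Mapping.keys_add[of a b], of k] by blast
  then show "k \<in> poly_vars p \<union> poly_vars r"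
    unfolding poly_vars_def using ab(1,2) by blast
qed

lemma ratfuns_rconst: "rconst c \<in> ratfuns M"
  unfolding ratfuns_def rconst_def
  by (rule CollectI, rule exI[of _ "Poly_Mapping.single 0 c"], rule exI[of _ 1])
    (auto simp: poly_vars_def split: if_splits)

lemma ratfuns_0: "0 \<in> ratfuns M" using ratfuns_rconst[of 0] by simp

lemma ratfuns_rvar: "k \<in> {1..M} \<Longrightarrow> rvar k \<in> ratfuns M"
  unfolding ratfuns_def rvar_def
  by (rule CollectI, rule exI[of _ "Poly_Mapping.single (Poly_Mapping.single k 1) 1"], rule exI[of _ 1])
    (auto simp: poly_vars_def split: if_splits)

lemma ratfuns_add: "r \<in> ratfuns M \<Longrightarrow> s \<in> ratfuns M \<Longrightarrow> r + s \<in> ratfuns M"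
  unfolding ratfuns_def
proof clarify
  fix p d p' d' :: cpoly
  assume *: "d \<noteq> 0" "poly_vars p \<subseteq> {1..M}" "poly_vars d \<subseteq> {1..M}" "d' \<noteq> 0" "poly_vars p' \<subseteq> {1..M}" "poly_vars d' \<subseteq> {1..M}"
  have "poly_vars (p * d' + p' * d) \<subseteq> {1..M}" "poly_vars (d * d') \<subseteq> {1..M}"
    by (rule order_trans[OF poly_vars_add] order_trans[OF poly_vars_mult] Un_least * | assumption)+
  then show "\<exists>pa r. Fract p d + Fract p' d' = Fract pa r \<and> r \<noteq> 0 \<and> poly_vars pa \<subseteq> {1..M} \<and> poly_vars r \<subseteq> {1..M}"
    using * by - (rule exI[of _ "p * d' + p' * d"], rule exI[of _ "d * d'"], simp)
qed

lemma ratfuns_mult: "r \<in> ratfuns M \<Longrightarrow> s \<in> ratfuns M \<Longrightarrow> r * s \<in> ratfuns M"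
  unfolding ratfuns_def
proof clarify
  fix p d p' d' :: cpoly
  assume *: "d \<noteq> 0" "poly_vars p \<subseteq> {1..M}" "poly_vars d \<subseteq> {1..M}" "d' \<noteq> 0" "poly_vars p' \<subseteq> {1..M}" "poly_vars d' \<subseteq> {1..M}"
  have "poly_vars (p * p') \<subseteq> {1..M}" "poly_vars (d * d') \<subseteq> {1..M}"
    by (rule order_trans[OF poly_vars_mult] Un_least *)+
  then show "\<exists>pa r. Fract p d * Fract p' d' = Fract pa r \<and> r \<noteq> 0 \<and> poly_vars pa \<subseteq> {1..M} \<and> poly_vars r \<subseteq> {1..M}"
    using * by - (rule exI[of _ "p * p'"], rule exI[of _ "d * d'"], simp)
qed

lemma ratfuns_inverse: "r \<in> ratfuns M \<Longrightarrow> inverse r \<in> ratfuns M"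
proof (cases "r = 0")
  case False
  assume "r \<in> ratfuns M"
  then obtain p d where *: "r = Fract p d" "d \<noteq> 0" "poly_vars p \<subseteq> {1..M}" "poly_vars d \<subseteq> {1..M}"
    by (auto simp: ratfuns_def)
  with False have "p \<noteq> 0" by (auto simp: eq_fract Zero_fract_def)
  then show ?thesis using * unfolding ratfuns_def
    by - (rule CollectI, rule exI[of _ d], rule exI[of _ p], simp)
qed simp

lemma ratfuns_diff:
  assumes "r \<in> ratfuns M" "s \<in> ratfuns M"
  shows "r - rconst c * s \<in> ratfuns M"
proof -
  have "rconst (- c) = - rconst c" by (simp add: rconst_def single_uminus)
  then have "r - rconst c * s = r + rconst (- c) * s"
    by (simp only: mult_minus_left add_uminus_conv_diff)
  then show ?thesis using assms by (simp only: ratfuns_add ratfuns_mult ratfuns_rconst)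
qed

lemma ratfuns_sum: "(\<And>x. x \<in> A \<Longrightarrow> f x \<in> ratfuns M) \<Longrightarrow> sum f A \<in> ratfuns M"
  by (induction A rule: infinite_finite_induct) (simp_all add: ratfuns_0 ratfuns_add)

lemma poly_vars_swap: "poly_vars (swap_poly i p) \<subseteq> transpose i (Suc i) ` poly_vars p"
proof
  fix k assume "k \<in> poly_vars (swap_poly i p)"
  then obtain m where m: "m \<in> Poly_Mapping.keys (swap_poly i p)" "k \<in> Poly_Mapping.keys m" by (auto simp: poly_vars_def)
  then have "swap_monom i m \<in> Poly_Mapping.keys p" by (simp add: in_keys_iff lookup_swap_poly)
  moreover have "transpose i (Suc i) k \<in> Poly_Mapping.keys (swap_monom i m)"
    using m(2) by (simp add: in_keys_iff lookup_swap_monom)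
  ultimately have "transpose i (Suc i) k \<in> poly_vars p" by (auto simp: poly_vars_def)
  then show "k \<in> transpose i (Suc i) ` poly_vars p" by (metis image_eqI transpose_involutory)
qed

lemma ratfuns_swap:
  assumes i: "i \<in> {1..<M}" and "r \<in> ratfuns M"
  shows "swap_ratfun i r \<in> ratfuns M"
proof -
  obtain p d where *: "r = Fract p d" "d \<noteq> 0" "poly_vars p \<subseteq> {1..M}" "poly_vars d \<subseteq> {1..M}"
    using assms(2) by (auto simp: ratfuns_def)
  have sub: "transpose i (Suc i) ` {1..M} \<subseteq> {1..M}" using i by (auto simp: transpose_def)
  have "poly_vars (swap_poly i p) \<subseteq> {1..M}" "poly_vars (swap_poly i d) \<subseteq> {1..M}"
    by (rule order_trans[OF poly_vars_swap order_trans[OF image_mono[OF *(3)] sub]],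
        rule order_trans[OF poly_vars_swap order_trans[OF image_mono[OF *(4)] sub]])
  then show ?thesis using * unfolding ratfuns_def
    by - (rule CollectI, rule exI[of _ "swap_poly i p"], rule exI[of _ "swap_poly i d"], simp add: swap_ratfun_Fract)
qed

lemma swap_ratfun_sum: "swap_ratfun i (sum f A) = (\<Sum>x\<in>A. swap_ratfun i (f x))"
proof -
  have "swap_ratfun i 0 = 0" using swap_ratfun_rconst[of i 0] by simp
  then show ?thesis
    by (induction A rule: infinite_finite_induct) (simp_all add: swap_ratfun_add)
qed

lemma swap_ratfun_involutive [simp]: "swap_ratfun i (swap_ratfun i r) = r"
  by (cases r) (simp add: swap_ratfun_Fract)

lemma transpose_braid:
  "transpose i (Suc i) (transpose (Suc i) (Suc (Suc i)) (transpose i (Suc i) k))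
    = transpose (Suc i) (Suc (Suc i)) (transpose i (Suc i) (transpose (Suc i) (Suc (Suc i)) k))"
  by (cases "k = i"; cases "k = Suc i"; cases "k = Suc (Suc i)") (simp_all add: transpose_def)

lemma transpose_far:
  "Suc i < j \<Longrightarrow> transpose i (Suc i) (transpose j (Suc j) k) = transpose j (Suc j) (transpose i (Suc i) k)"
  by (cases "k = i"; cases "k = Suc i"; cases "k = j"; cases "k = Suc j") (simp_all add: transpose_def)

lemma swap_monom_braid:
  "swap_monom i (swap_monom (Suc i) (swap_monom i m)) = swap_monom (Suc i) (swap_monom i (swap_monom (Suc i) m))"
  by (rule poly_mapping_eqI) (simp add: lookup_swap_monom transpose_braid)

lemma swap_ratfun_braid:
  "swap_ratfun i (swap_ratfun (Suc i) (swap_ratfun i r)) = swap_ratfun (Suc i) (swap_ratfun i (swap_ratfun (Suc i) r))"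
proof -
  have "swap_poly i (swap_poly (Suc i) (swap_poly i p)) = swap_poly (Suc i) (swap_poly i (swap_poly (Suc i) p))" for p
    by (rule poly_mapping_eqI) (simp add: lookup_swap_poly swap_monom_braid)
  then show ?thesis by (cases r) (simp add: swap_ratfun_Fract)
qed

lemma swap_ratfun_far:
  assumes "Suc i < j"
  shows "swap_ratfun i (swap_ratfun j r) = swap_ratfun j (swap_ratfun i r)"
proof -
  have "swap_monom i (swap_monom j m) = swap_monom j (swap_monom i m)" for m
    by (rule poly_mapping_eqI) (simp only: lookup_swap_monom, subst transpose_far[OF assms], rule refl)
  then have "swap_poly i (swap_poly j p) = swap_poly j (swap_poly i p)" for p
    by (intro poly_mapping_eqI) (simp add: lookup_swap_poly)
  then show ?thesis by (cases r) (simp add: swap_ratfun_Fract)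
qed

section \<open>Type I modules\<close>

locale type_I_module = Uq_gl_module scale M q E F t +
    finite_dimensional_vector_space scale B + generic_q q
  for scale :: "complex \<Rightarrow> 'u::ab_group_add \<Rightarrow> 'u" (infixr \<open>*s\<close> 75)
    and M :: nat and q E F t B +
  assumes typeI: "type_I M q scale t"
begin

abbreviation "ws \<equiv> weight_space M q scale t"
abbreviation "wcomp \<equiv> weight_component M q scale t"

lemma wt_inner_commute: "wt_inner M \<mu> \<nu> = wt_inner M \<nu> \<mu>"
  by (simp add: wt_inner_def mult.commute)

lemma wt_inner_add: "wt_inner M (\<lambda>k. \<mu> k + \<nu> k) \<kappa> = wt_inner M \<mu> \<kappa> + wt_inner M \<nu> \<kappa>"
  by (simp add: wt_inner_def distrib_right sum.distrib)

lemma wt_inner_uminus: "wt_inner M (\<lambda>k. - \<mu> k) \<kappa> = - wt_inner M \<mu> \<kappa>"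
  by (simp add: wt_inner_def sum_negf)

lemma weights_closed: "\<nu> \<in> weights M \<Longrightarrow> (\<lambda>k. - \<nu> k) \<in> weights M"
  "\<mu> \<in> weights M \<Longrightarrow> \<nu> \<in> weights M \<Longrightarrow> (\<lambda>k. \<mu> k + \<nu> k) \<in> weights M"
  "\<mu> \<in> weights M \<Longrightarrow> \<nu> \<in> weights M \<Longrightarrow> (\<lambda>k. \<mu> k - \<nu> k) \<in> weights M"
  by (auto simp: weights_def)

lemma simple_root_weights: "i \<in> {1..<M} \<Longrightarrow> simple_root i \<in> weights M"
  by (auto simp: weights_def simple_root_def)

lemma wt_inner_simple_root:
  assumes "i \<in> {1..<M}"
  shows "wt_inner M \<mu> (simple_root i) = \<mu> i - \<mu> (Suc i)"
proof -
  have "wt_inner M \<mu> (simple_root i) = (\<Sum>k = 1..M. (if k = i then \<mu> k else 0) - (if k = Suc i then \<mu> k else 0))"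
    unfolding wt_inner_def by (rule sum.cong) (auto simp: simple_root_def)
  also have "\<dots> = \<mu> i - \<mu> (Suc i)"
    using assms by (simp add: sum_subtractf sum.delta)
  finally show ?thesis .
qed

lemma ws_t: "v \<in> ws \<mu> \<Longrightarrow> \<nu> \<in> weights M \<Longrightarrow> t \<nu> v = q powi wt_inner M \<mu> \<nu> *s v"
  by (simp add: weight_space_def)

lemma t_lin: 
  assumes "\<nu> \<in> weights M"
  shows "t \<nu> (u + v) = t \<nu> u + t \<nu> v" "t \<nu> (c *s v) = c *s t \<nu> v" "t \<nu> 0 = 0"
proof -
  interpret T: Vector_Spaces.linear scale scale "t \<nu>" by (rule linear_t[OF assms])
  show "t \<nu> (u + v) = t \<nu> u + t \<nu> v" "t \<nu> (c *s v) = c *s t \<nu> v" "t \<nu> 0 = 0"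
    by (simp_all add: T.add T.scale T.zero)
qed

lemma E_lin: 
  assumes "i \<in> {1..<M}"
  shows "E i (u + v) = E i u + E i v" "E i (c *s v) = c *s E i v"
    "F i (u + v) = F i u + F i v" "F i (c *s v) = c *s F i v"
proof -
  interpret T: Vector_Spaces.linear scale scale "E i" by (rule linear_E[OF assms])
  interpret S: Vector_Spaces.linear scale scale "F i" by (rule linear_F[OF assms])
  show "E i (u + v) = E i u + E i v" "E i (c *s v) = c *s E i v"
    "F i (u + v) = F i u + F i v" "F i (c *s v) = c *s F i v"
    by (simp_all add: T.add T.scale S.add S.scale)
qed

lemma subspace_ws: "subspace (ws \<mu>)"
  unfolding subspace_def weight_space_def by (auto simp: t_lin scale_right_distrib mult.commute)

lemmas ws_closed = subspace_0[OF subspace_ws] subspace_add[OF subspace_ws] subspace_scale[OF subspace_ws]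
  subspace_diff[OF subspace_ws]

lemma t_inv: "\<nu> \<in> weights M \<Longrightarrow> t (\<lambda>k. - \<nu> k) (t \<nu> u) = u" "\<nu> \<in> weights M \<Longrightarrow> t \<nu> (t (\<lambda>k. - \<nu> k) u) = u"
  using t_add[of "\<lambda>k. - \<nu> k" \<nu> u] t_add[of \<nu> "\<lambda>k. - \<nu> k" u] t_0[of u] by (simp_all add: weights_closed)

lemma t_E': "\<nu> \<in> weights M \<Longrightarrow> i \<in> {1..<M} \<Longrightarrow> t \<nu> (E i u) = q powi wt_inner M \<nu> (simple_root i) *s E i (t \<nu> u)"
  using t_E[of \<nu> i "t \<nu> u"] by (simp add: t_inv)

lemma t_F': "\<nu> \<in> weights M \<Longrightarrow> i \<in> {1..<M} \<Longrightarrow> t \<nu> (F i u) = q powi (- wt_inner M \<nu> (simple_root i)) *s F i (t \<nu> u)"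
  using t_F[of \<nu> i "t \<nu> u"] by (simp add: t_inv)

lemma ws_E:
  assumes "i \<in> {1..<M}" "v \<in> ws \<mu>"
  shows "E i v \<in> ws (\<lambda>k. \<mu> k + simple_root i k)" "F i v \<in> ws (\<lambda>k. \<mu> k - simple_root i k)"
proof -
  have s: "wt_inner M \<nu> (simple_root i) = wt_inner M (simple_root i) \<nu>" for \<nu> by (rule wt_inner_commute)
  show "E i v \<in> ws (\<lambda>k. \<mu> k + simple_root i k)"
    using assms by (auto simp: weight_space_def t_E' E_lin wt_inner_add s power_int_add mult.commute)
  have "wt_inner M (\<lambda>k. \<mu> k - simple_root i k) \<nu> = wt_inner M \<mu> \<nu> - wt_inner M (simple_root i) \<nu>" for \<nu>
    using wt_inner_add[of \<mu> "\<lambda>k. - simple_root i k" \<nu>] by (simp add: wt_inner_uminus)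
  note e = this
  show "F i v \<in> ws (\<lambda>k. \<mu> k - simple_root i k)"
    unfolding weight_space_def
  proof (intro CollectI ballI)
    fix \<nu> assume \<nu>: "\<nu> \<in> weights M"
    have "q powi (- wt_inner M (simple_root i) \<nu>) * q powi wt_inner M \<mu> \<nu>
        = q powi wt_inner M (\<lambda>k. \<mu> k - simple_root i k) \<nu>"
      unfolding e power_int_add[symmetric, OF disjI1[OF q_nz]] by simp
    then show "t \<nu> (F i v) = q powi wt_inner M (\<lambda>k. \<mu> k - simple_root i k) \<nu> *s F i v"
      unfolding t_F'[OF \<nu> assms(1)] ws_t[OF assms(2) \<nu>] E_lin(4)[OF assms(1)] s scale_scale
      by (simp only:)
  qed
qed

text \<open>
  Weight spaces for the \<open>i\<close>-th copy of \<open>sl\<^sub>2\<close>.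
\<close>

definition Xi :: "nat \<Rightarrow> int \<Rightarrow> 'u set" where
  "Xi i h = {v. t (simple_root i) v = q powi h *s v}"

lemma ws_Xi: "i \<in> {1..<M} \<Longrightarrow> v \<in> ws \<mu> \<Longrightarrow> v \<in> Xi i (\<mu> i - \<mu> (Suc i))"
  by (simp add: Xi_def ws_t simple_root_weights wt_inner_simple_root)

lemma qsl2_i:
  assumes i: "i \<in> {1..<M}"
  shows "qsl2 q scale (E i) (F i) (Xi i)"
proof -
  interpret E: Vector_Spaces.linear scale scale "E i" by (rule linear_E[OF i])
  interpret F: Vector_Spaces.linear scale scale "F i" by (rule linear_F[OF i])
  have r: "simple_root i \<in> weights M" by (rule simple_root_weights[OF i])
  have rr: "wt_inner M (simple_root i) (simple_root i) = 2"
    by (simp add: wt_inner_simple_root[OF i]) (simp add: simple_root_def)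
  show ?thesis
  proof unfold_locales
    fix w h assume w: "w \<in> Xi i h"
    show "E i w \<in> Xi i (h + 2)" using w by (simp add: Xi_def t_E'[OF r i] rr E.scale power_int_add mult.commute)
    show "F i w \<in> Xi i (h - 2)"
      using w by (simp add: Xi_def t_F'[OF r i] rr F.scale power_int_diff power_int_minus field_simps)
    show "c *s w \<in> Xi i h" for c using w by (simp add: Xi_def t_lin r mult.commute)
    have "t (\<lambda>k. - simple_root i k) (q powi h *s w) = w" using w t_inv(1)[OF r, of w] by (simp add: Xi_def)
    then have "q powi h *s t (\<lambda>k. - simple_root i k) w = w" by (simp add: t_lin weights_closed r)
    then have "t (\<lambda>k. - simple_root i k) w = q powi (- h) *s w"
      by (metis power_int_minus q_nz power_int_eq_0_iff scale_left_imp_eq scale_scale right_inverse scale_one)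
    then have "E i (F i w) - F i (E i w) = br h *s w"
      using w E_F[OF i i, of w] by (simp add: Xi_def br_def scale_left_diff_distrib[symmetric] diff_divide_distrib scale_right_diff_distrib)
    then show "E i (F i w) = F i (E i w) + br h *s w" by (simp add: algebra_simps)
  qed
qed

lemma decomp_ex: "weight_decomp M q scale t u (\<lambda>\<mu>. wcomp \<mu> u)"
proof -
  have "\<exists>!v. weight_decomp M q scale t u v" using typeI by (simp add: type_I_def)
  from theI'[OF this] show ?thesis unfolding weight_component_def .
qed

lemma decomp_unique: "weight_decomp M q scale t u v \<Longrightarrow> v = (\<lambda>\<mu>. wcomp \<mu> u)"
  using typeI decomp_ex[of u] unfolding type_I_def by blast

lemma wcomp_ws: "\<mu> \<in> weights M \<Longrightarrow> wcomp \<mu> u \<in> ws \<mu>"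
  and wcomp_outside: "\<mu> \<notin> weights M \<Longrightarrow> wcomp \<mu> u = 0"
  and wcomp_finite: "finite {\<mu>. wcomp \<mu> u \<noteq> 0}"
  and wcomp_sum: "u = (\<Sum>\<mu> | wcomp \<mu> u \<noteq> 0. wcomp \<mu> u)"
  using decomp_ex[of u] unfolding weight_decomp_def by blast+

lemma wcomp_sum_superset: "finite A \<Longrightarrow> {\<mu>. wcomp \<mu> u \<noteq> 0} \<subseteq> A \<Longrightarrow> (\<Sum>\<mu>\<in>A. wcomp \<mu> u) = u"
  by (subst (2) wcomp_sum[of u]) (rule sum.mono_neutral_right, auto)

lemma wcomp_add: "wcomp \<mu> (u + v) = wcomp \<mu> u + wcomp \<mu> v"
proof -
  define A where "A = {\<mu>. wcomp \<mu> u \<noteq> 0} \<union> {\<mu>. wcomp \<mu> v \<noteq> 0}"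
  have A: "finite A" by (simp add: A_def wcomp_finite)
  have "weight_decomp M q scale t (u + v) (\<lambda>\<mu>. wcomp \<mu> u + wcomp \<mu> v)"
    unfolding weight_decomp_def
  proof (intro conjI)
    show "finite {\<mu>. wcomp \<mu> u + wcomp \<mu> v \<noteq> 0}" by (rule finite_subset[OF _ A]) (auto simp: A_def)
    have "u + v = (\<Sum>\<mu>\<in>A. wcomp \<mu> u + wcomp \<mu> v)"
      unfolding sum.distrib using wcomp_sum_superset[OF A, of u] wcomp_sum_superset[OF A, of v] by (auto simp: A_def)
    also have "\<dots> = (\<Sum>\<mu> | wcomp \<mu> u + wcomp \<mu> v \<noteq> 0. wcomp \<mu> u + wcomp \<mu> v)"
      by (rule sum.mono_neutral_right[OF A]) (auto simp: A_def)
    finally show "u + v = \<dots>" .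
  qed (auto simp: wcomp_ws wcomp_outside ws_closed)
  from decomp_unique[OF this] show ?thesis by metis
qed

lemma wcomp_scale: "wcomp \<mu> (c *s u) = c *s wcomp \<mu> u"
proof -
  have "weight_decomp M q scale t (c *s u) (\<lambda>\<mu>. c *s wcomp \<mu> u)"
    unfolding weight_decomp_def
  proof (intro conjI)
    show "finite {\<mu>. c *s wcomp \<mu> u \<noteq> 0}" by (rule finite_subset[OF _ wcomp_finite[of u]]) auto
    have "c *s u = (\<Sum>\<mu> | wcomp \<mu> u \<noteq> 0. c *s wcomp \<mu> u)"
      by (subst wcomp_sum[of u]) (simp add: scale_sum_right)
    also have "\<dots> = (\<Sum>\<mu> | c *s wcomp \<mu> u \<noteq> 0. c *s wcomp \<mu> u)"
      by (rule sum.mono_neutral_right[OF wcomp_finite]) auto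
    finally show "c *s u = \<dots>" .
  qed (auto simp: wcomp_ws wcomp_outside ws_closed)
  from decomp_unique[OF this] show ?thesis by metis
qed

lemma wcomp_lin: "Vector_Spaces.linear scale scale (wcomp \<mu>)"
  by unfold_locales (simp_all add: wcomp_add wcomp_scale)

lemma wcomp_self:
  assumes "v \<in> ws \<mu>" "\<mu> \<in> weights M"
  shows "wcomp \<nu> v = (if \<nu> = \<mu> then v else 0)"
proof -
  have "weight_decomp M q scale t v (\<lambda>\<nu>. if \<nu> = \<mu> then v else 0)"
  proof (cases "v = 0")
    case True
    then show ?thesis by (simp add: weight_decomp_def ws_closed)
  next
    case False
    then have "{\<nu>. (if \<nu> = \<mu> then v else 0) \<noteq> 0} = {\<mu>}" by auto
    then show ?thesis using assms by (auto simp: weight_decomp_def ws_closed)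
  qed
  from decomp_unique[OF this] show ?thesis by metis
qed

text \<open>
  A finite set containing all weights of the module.
\<close>

definition P :: "(nat \<Rightarrow> int) set" where "P = (\<Union>b\<in>B. {\<mu>. wcomp \<mu> b \<noteq> 0})"

lemma finite_P: "finite P" unfolding P_def using finite_Basis wcomp_finite by blast

lemma P_weights: "P \<subseteq> weights M" unfolding P_def using wcomp_outside by blast

lemma wcomp_P: "\<mu> \<notin> P \<Longrightarrow> wcomp \<mu> u = 0"
proof -
  assume "\<mu> \<notin> P"
  then have *: "wcomp \<mu> b = 0" if "b \<in> B" for b using that by (auto simp: P_def)
  interpret L: Vector_Spaces.linear scale scale "wcomp \<mu>" by (rule wcomp_lin)
  have "u \<in> span B" by (simp add: span_Basis)
  then show ?thesis by (induction rule: span_induct_alt) (simp_all add: L.zero L.add L.scale *)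
qed

lemma sum_wcomp: "(\<Sum>\<mu>\<in>P. wcomp \<mu> u) = u"
  by (rule wcomp_sum_superset[OF finite_P]) (use wcomp_P in blast)

lemma ws_P: "v \<in> ws \<mu> \<Longrightarrow> \<mu> \<in> weights M \<Longrightarrow> v \<noteq> 0 \<Longrightarrow> \<mu> \<in> P"
  using wcomp_self[of v \<mu> \<mu>] wcomp_P[of \<mu> v] by auto

text \<open>
  A bound for all coordinates of all weights.
\<close>

definition R :: int where "R = Max (insert 0 ((\<lambda>(\<mu>, k). \<bar>\<mu> k\<bar>) ` (P \<times> {1..M})))"

lemma R_bound: "\<mu> \<in> P \<Longrightarrow> \<bar>\<mu> k\<bar> \<le> R" and R_nonneg: "R \<ge> 0"
proof -
  have fin: "finite (insert 0 ((\<lambda>(\<mu>, k). \<bar>\<mu> k\<bar>) ` (P \<times> {1..M})))" using finite_P by simp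
  then show "R \<ge> 0" unfolding R_def by (rule Max_ge) simp
  then show "\<bar>\<mu> k\<bar> \<le> R" if "\<mu> \<in> P"
  proof (cases "k \<in> {1..M}")
    case True
    then show ?thesis unfolding R_def using that by (intro Max_ge[OF fin]) (auto intro!: image_eqI[of _ _ "(\<mu>, k)"])
  next
    case False
    then show ?thesis using P_weights that \<open>R \<ge> 0\<close> by (auto simp: weights_def)
  qed
qed

lemma ws_bound: "v \<in> ws \<mu> \<Longrightarrow> \<mu> \<in> weights M \<Longrightarrow> v \<noteq> 0 \<Longrightarrow> \<bar>\<mu> k\<bar> \<le> R"
  using ws_P R_bound by blast

text \<open>
  The Serre relation says that a \<open>q\<close>-commutator \<open>q\<close>-commutes with its constituents.
\<close>

lemma serre_reform:
  assumes "a - qint q 2 *s b + d = 0"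
  shows "b - q *s d = q *s (a - q *s b)" "b - q *s a = q *s (d - q *s b)"
proof -
  have c: "q * qint q 2 = 1 + q * q"
  proof -
    have "q * q \<noteq> 1" using q_root[of 2] by (simp add: power2_eq_square)
    then show ?thesis by (simp add: qint_def field_simps power2_eq_square)
  qed
  have "q *s (a - qint q 2 *s b + d) = 0" using assms by simp
  then have "q *s a - (1 + q * q) *s b + q *s d = 0"
    by (simp add: scale_right_distrib scale_right_diff_distrib c)
  then show "b - q *s d = q *s (a - q *s b)" "b - q *s a = q *s (d - q *s b)"
    by (simp_all add: scale_left_distrib scale_right_diff_distrib algebra_simps)
qed

definition upd3 :: "(nat \<Rightarrow> int) \<Rightarrow> nat \<Rightarrow> int \<Rightarrow> int \<Rightarrow> int \<Rightarrow> nat \<Rightarrow> int" where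
  "upd3 \<mu> i l1 l2 l3 = \<mu>(i := l1, Suc i := l2, Suc (Suc i) := l3)"

lemma upd3_simps:
  "(\<lambda>k. upd3 \<mu> i l1 l2 l3 k + simple_root i k) = upd3 \<mu> i (l1 + 1) (l2 - 1) l3"
  "(\<lambda>k. upd3 \<mu> i l1 l2 l3 k - simple_root i k) = upd3 \<mu> i (l1 - 1) (l2 + 1) l3"
  "(\<lambda>k. upd3 \<mu> i l1 l2 l3 k + simple_root (Suc i) k) = upd3 \<mu> i l1 (l2 + 1) (l3 - 1)"
  "(\<lambda>k. upd3 \<mu> i l1 l2 l3 k - simple_root (Suc i) k) = upd3 \<mu> i l1 (l2 - 1) (l3 + 1)"
  by (auto simp: upd3_def simple_root_def fun_eq_iff)

text \<open>
  Two neighbouring indices generate an action of the rank two algebra; the coordinates of the weight other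
  than \<open>i\<close>, \<open>i + 1\<close>, \<open>i + 2\<close> stay fixed and are taken from \<open>\<mu>\<close>.
\<close>

lemma gl3_weighted_i:
  assumes i: "i \<in> {1..<M}" "Suc i \<in> {1..<M}" and \<mu>: "\<mu> \<in> weights M"
  shows "gl3_weighted q scale (E i) (E (Suc i)) (F i) (F (Suc i)) (\<lambda>l1 l2 l3. ws (upd3 \<mu> i l1 l2 l3))
    (t (simple_root i)) (t (simple_root (Suc i)))
    (t (\<lambda>k. - simple_root i k)) (t (\<lambda>k. - simple_root (Suc i) k)) R"
proof -
  interpret s1: qsl2 q scale "E i" "F i" "Xi i" by (rule qsl2_i[OF i(1)])
  interpret s2: qsl2 q scale "E (Suc i)" "F (Suc i)" "Xi (Suc i)" by (rule qsl2_i[OF i(2)])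
  have r: "simple_root i \<in> weights M" "simple_root (Suc i) \<in> weights M"
    "(\<lambda>k. - simple_root i k) \<in> weights M" "(\<lambda>k. - simple_root (Suc i) k) \<in> weights M"
    by (intro weights_closed(1) simple_root_weights i)+
  have w: "upd3 \<mu> i l1 l2 l3 \<in> weights M" for l1 l2 l3
    using \<mu> i by (auto simp: weights_def upd3_def)
  have a: "\<bar>int i - int (Suc i)\<bar> = 1" "\<bar>int (Suc i) - int i\<bar> = 1" by simp_all
  show ?thesis
  proof unfold_locales
    show "subspace (ws (upd3 \<mu> i l1 l2 l3))" for l1 l2 l3 by (rule subspace_ws)
  next
    fix v l1 l2 l3 assume v: "v \<in> ws (upd3 \<mu> i l1 l2 l3)"
    show "E i v \<in> ws (upd3 \<mu> i (l1 + 1) (l2 - 1) l3)" "E (Suc i) v \<in> ws (upd3 \<mu> i l1 (l2 + 1) (l3 - 1))"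
      "F i v \<in> ws (upd3 \<mu> i (l1 - 1) (l2 + 1) l3)" "F (Suc i) v \<in> ws (upd3 \<mu> i l1 (l2 - 1) (l3 + 1))"
      using ws_E[OF i(1) v] ws_E[OF i(2) v] by (simp_all add: upd3_simps)
    have X: "v \<in> Xi i (l1 - l2)" "v \<in> Xi (Suc i) (l2 - l3)"
      using ws_Xi[OF i(1) v] ws_Xi[OF i(2) v] by (simp_all add: upd3_def)
    show "E i (F i v) = F i (E i v) + br (l1 - l2) *s v" by (rule s1.E_F_X[OF X(1)])
    show "E (Suc i) (F (Suc i) v) = F (Suc i) (E (Suc i) v) + br (l2 - l3) *s v" by (rule s2.E_F_X[OF X(2)])
    show "E i (F (Suc i) v) = F (Suc i) (E i v)" "E (Suc i) (F i v) = F i (E (Suc i) v)"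
      using E_F[OF i(1) i(2), of v] E_F[OF i(2) i(1), of v] by simp_all
    show "qcomm q scale (E i) (E (Suc i)) (E i v) = q *s E i (qcomm q scale (E i) (E (Suc i)) v)"
      using serre_reform(1)[OF serre_E_near[OF i(1) i(2) a(1), of v]]
      by (simp add: qcomm_def s1.E.diff s1.E.scale)
    show "E (Suc i) (qcomm q scale (E i) (E (Suc i)) v) = q *s qcomm q scale (E i) (E (Suc i)) (E (Suc i) v)"
      using serre_reform(2)[OF serre_E_near[OF i(2) i(1) a(2), of v]]
      by (simp add: qcomm_def s2.E.diff s2.E.scale)
    show "F i (qcomm q scale (F (Suc i)) (F i) v) = q *s qcomm q scale (F (Suc i)) (F i) (F i v)"
      using serre_reform(2)[OF serre_F_near[OF i(1) i(2) a(1), of v]]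
      by (simp add: qcomm_def s1.F.diff s1.F.scale)
    show "qcomm q scale (F (Suc i)) (F i) (F (Suc i) v) = q *s F (Suc i) (qcomm q scale (F (Suc i)) (F i) v)"
      using serre_reform(1)[OF serre_F_near[OF i(2) i(1) a(2), of v]]
      by (simp add: qcomm_def s2.F.diff s2.F.scale)
    have wt: "wt_inner M (upd3 \<mu> i l1 l2 l3) (simple_root i) = l1 - l2"
      "wt_inner M (upd3 \<mu> i l1 l2 l3) (simple_root (Suc i)) = l2 - l3"
      using i by (simp_all add: wt_inner_simple_root upd3_def)
    have wt': "wt_inner M (upd3 \<mu> i l1 l2 l3) (\<lambda>k. - simple_root i k) = l2 - l1"
      "wt_inner M (upd3 \<mu> i l1 l2 l3) (\<lambda>k. - simple_root (Suc i) k) = l3 - l2"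
      using wt wt_inner_commute wt_inner_uminus by (metis minus_diff_eq)+
    show "t (simple_root i) v = q powi (l1 - l2) *s v" "t (simple_root (Suc i)) v = q powi (l2 - l3) *s v"
      "t (\<lambda>k. - simple_root i k) v = q powi (l2 - l1) *s v"
      "t (\<lambda>k. - simple_root (Suc i) k) v = q powi (l3 - l2) *s v"
      using ws_t[OF v] r by (simp_all only: wt wt')
    assume "v \<noteq> 0"
    from ws_bound[OF v w this, of i] ws_bound[OF v w this, of "Suc i"] ws_bound[OF v w this, of "Suc (Suc i)"]
    show "\<bar>l1\<bar> \<le> R \<and> \<bar>l2\<bar> \<le> R \<and> \<bar>l3\<bar> \<le> R" by (simp add: upd3_def)
  qed (simp_all add: t_lin r)
qed

end

section \<open>The dynamical operators at a point\<close>

context type_I_module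
begin

abbreviation "dE i \<equiv> divided_power q scale (E i)"
abbreviation "dF i \<equiv> divided_power q scale (F i)"

lemma ws_dF: 
  assumes i: "i \<in> {1..<M}" and v: "v \<in> ws \<mu>"
  shows "dF i n v \<in> ws (\<lambda>k. \<mu> k - int n * simple_root i k)"
proof -
  interpret s: qsl2 q scale "E i" "F i" "Xi i" by (rule qsl2_i[OF i])
  show ?thesis
  proof (induction n)
    case (Suc n)
    have e: "(\<lambda>k. (\<mu> k - int n * simple_root i k) - simple_root i k) = (\<lambda>k. \<mu> k - int (Suc n) * simple_root i k)"
      by (simp add: fun_eq_iff algebra_simps)
    show ?case unfolding s.dpF_Suc using ws_E(2)[OF i Suc] unfolding e by (rule ws_closed(3))
  qed (simp add: v)
qed

lemma dF_eq_0:
  assumes i: "i \<in> {1..<M}" and v: "v \<in> ws \<mu>" "\<mu> \<in> weights M" and n: "int n > 2 * R"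
  shows "dF i n v = 0"
proof (cases "v = 0")
  case True
  interpret s: qsl2 q scale "E i" "F i" "Xi i" by (rule qsl2_i[OF i])
  show ?thesis using True by (simp add: s.dF.zero)
next
  case False
  have "(\<lambda>k. \<mu> k - int n * simple_root i k) \<in> weights M"
    using v(2) simple_root_weights[OF i] by (auto simp: weights_def)
  moreover have "\<not> \<bar>\<mu> i - int n * simple_root i i\<bar> \<le> R"
    using ws_bound[OF v False, of i] n by (simp add: simple_root_def)
  ultimately show ?thesis using ws_bound[OF ws_dF[OF i v(1), of n], of i] by blast
qed

text \<open>
  The coefficient \<open>dyn_coeff\<close> at a point, with \<open>zi\<close> and \<open>zj\<close> the values of \<open>z i\<close> and \<open>z (i + 1)\<close>.
\<close>

definition dyn_factor :: "nat \<Rightarrow> nat \<Rightarrow> complex \<Rightarrow> complex \<Rightarrow> complex" where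
  "dyn_factor j d zi zj = (- q) ^ j * ((zj - q ^ d * zi) / (zj - q ^ (2 * j + d) * zi))"

definition dyn_op_wt :: "nat \<Rightarrow> (nat \<Rightarrow> int) \<Rightarrow> complex \<Rightarrow> complex \<Rightarrow> 'u \<Rightarrow> 'u" where
  "dyn_op_wt i \<mu> zi zj v = (\<Sum>j\<le>nat (2 * R). dyn_factor j (nat \<bar>\<mu> i - \<mu> (Suc i)\<bar>) zi zj *s dyn_term q scale E F i \<mu> j v)"

text \<open>
  The operator \<open>A\<^sub>i\<close> at a point as a linear map on the module, without reference to the basis.  Since the
  module is bounded by \<open>R\<close>, its series stops at \<open>2 R\<close>.
\<close>

definition dyn_op :: "nat \<Rightarrow> complex \<Rightarrow> complex \<Rightarrow> 'u \<Rightarrow> 'u" where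
  "dyn_op i zi zj u = (\<Sum>\<mu>\<in>P. dyn_op_wt i \<mu> zi zj (wcomp \<mu> u))"

lemma linear_dyn_term:
  assumes i: "i \<in> {1..<M}"
  shows "Vector_Spaces.linear scale scale (dyn_term q scale E F i \<mu> j)"
proof -
  interpret s: qsl2 q scale "E i" "F i" "Xi i" by (rule qsl2_i[OF i])
  show ?thesis by unfold_locales (simp_all add: dyn_term_def s.dE.add s.dF.add s.dE.scale s.dF.scale)
qed

lemma linear_dyn_op_wt:
  assumes i: "i \<in> {1..<M}"
  shows "Vector_Spaces.linear scale scale (dyn_op_wt i \<mu> zi zj)"
proof -
  interpret d: Vector_Spaces.linear scale scale "dyn_term q scale E F i \<mu> l" for l by (rule linear_dyn_term[OF i])
  show ?thesis
    by unfold_locales (simp_all add: dyn_op_wt_def d.add d.scale scale_right_distrib sum.distrib scale_sum_right mult.commute)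
qed

lemma linear_dyn_op:
  assumes i: "i \<in> {1..<M}"
  shows "Vector_Spaces.linear scale scale (dyn_op i zi zj)"
proof -
  interpret d: Vector_Spaces.linear scale scale "dyn_op_wt i \<kappa> zi zj" for \<kappa> by (rule linear_dyn_op_wt[OF i])
  show ?thesis
    by unfold_locales (simp_all add: dyn_op_def d.add d.scale wcomp_add wcomp_scale sum.distrib scale_sum_right)
qed

lemma dyn_term_eq_0:
  assumes i: "i \<in> {1..<M}" and "v \<in> ws \<mu>" "\<mu> \<in> weights M" and j: "j > nat (2 * R)"
  shows "dyn_term q scale E F i \<mu> j v = 0"
proof -
  interpret s: qsl2 q scale "E i" "F i" "Xi i" by (rule qsl2_i[OF i])
  have "int (j + nat (\<mu> i - \<mu> (Suc i))) > 2 * R" using j by linarith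
  from dF_eq_0[OF i assms(2,3) this] show ?thesis by (simp add: dyn_term_def s.dE.zero)
qed

lemma dyn_op_ws:
  assumes i: "i \<in> {1..<M}" and v: "v \<in> ws \<mu>" "\<mu> \<in> weights M"
  shows "dyn_op i zi zj v = dyn_op_wt i \<mu> zi zj v"
proof -
  interpret d: Vector_Spaces.linear scale scale "dyn_op_wt i \<kappa> zi zj" for \<kappa> by (rule linear_dyn_op_wt[OF i])
  have "dyn_op i zi zj v = (\<Sum>\<nu>\<in>P. if \<nu> = \<mu> then dyn_op_wt i \<mu> zi zj v else 0)"
    unfolding dyn_op_def
  proof (rule sum.cong)
    fix \<nu>
    show "dyn_op_wt i \<nu> zi zj (wcomp \<nu> v) = (if \<nu> = \<mu> then dyn_op_wt i \<mu> zi zj v else 0)"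
      using wcomp_self[OF v, of \<nu>] d.zero[of \<nu>] by (cases "\<nu> = \<mu>") simp_all
  qed simp
  also have "\<dots> = dyn_op_wt i \<mu> zi zj v"
    using ws_P[OF v] finite_P d.zero[of \<mu>] by (cases "v = 0") simp_all
  finally show ?thesis .
qed

lemma dyn_matrix_eq:
  assumes i: "i \<in> {1..<M}"
  shows "dyn_matrix M q scale B E F t i b c = (\<Sum>\<mu>\<in>P. \<Sum>j\<le>nat (2 * R). dyn_coeff q i \<mu> j *
      rconst (representation B (dyn_term q scale E F i \<mu> j (wcomp \<mu> c)) b))"
proof -
  interpret d: Vector_Spaces.linear scale scale "dyn_term q scale E F i \<kappa> l" for \<kappa> l by (rule linear_dyn_term[OF i])
  have inner: "(Sum_any (\<lambda>j. dyn_coeff q i \<mu> j * rconst (representation B (dyn_term q scale E F i \<mu> j (wcomp \<mu> c)) b)))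
     = (\<Sum>j\<le>nat (2 * R). dyn_coeff q i \<mu> j * rconst (representation B (dyn_term q scale E F i \<mu> j (wcomp \<mu> c)) b))" for \<mu>
  proof (rule Sum_any.expand_superset)
    show "{j. dyn_coeff q i \<mu> j * rconst (representation B (dyn_term q scale E F i \<mu> j (wcomp \<mu> c)) b) \<noteq> 0} \<subseteq> {..nat (2 * R)}"
    proof (rule subsetI, rule ccontr)
      fix j assume j: "j \<in> {j. dyn_coeff q i \<mu> j * rconst (representation B (dyn_term q scale E F i \<mu> j (wcomp \<mu> c)) b) \<noteq> 0}"
        "j \<notin> {..nat (2 * R)}"
      then have "dyn_term q scale E F i \<mu> j (wcomp \<mu> c) = 0"
        using dyn_term_eq_0[OF i wcomp_ws, of \<mu> j] wcomp_outside[of \<mu>] d.zero by (cases "\<mu> \<in> weights M") auto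
      with j(1) show False by (simp add: representation_zero)
    qed
  qed simp
  show ?thesis
    unfolding dyn_matrix_def inner
  proof (rule Sum_any.expand_superset[OF finite_P], rule subsetI, rule ccontr)
    fix \<nu>
    assume \<nu>: "\<nu> \<notin> P" and *: "\<nu> \<in> {\<nu>. (\<Sum>j\<le>nat (2 * R). dyn_coeff q i \<nu> j *
      rconst (representation B (dyn_term q scale E F i \<nu> j (wcomp \<nu> c)) b)) \<noteq> 0}"
    have "wcomp \<nu> c = 0" by (rule wcomp_P[OF \<nu>])
    with * show False by (simp add: d.zero representation_zero)
  qed
qed

text \<open>
  No denominator of \<open>A\<^sub>i\<close> vanishes: the exponents \<open>2 j + \<bar>\<mu>\<^sub>i - \<mu>\<^sub>i\<^sub>+\<^sub>1\<bar>\<close> are at most \<open>6 R\<close>.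
\<close>

definition good :: "complex \<Rightarrow> complex \<Rightarrow> bool" where
  "good zi zj \<longleftrightarrow> (\<forall>n\<le>nat (6 * R). zj - q ^ n * zi \<noteq> 0)"

lemma has_value_dyn_matrix:
  assumes i: "i \<in> {1..<M}" and good: "good (\<zeta> i) (\<zeta> (Suc i))"
  shows "has_value (dyn_matrix M q scale B E F t i b c) \<zeta> (representation B (dyn_op i (\<zeta> i) (\<zeta> (Suc i)) c) b)"
proof -
  have rep_sum: "representation B (sum f A) b = (\<Sum>x\<in>A. representation B (f x) b)" for f :: "'z \<Rightarrow> 'u" and A
    by (induction A rule: infinite_finite_induct)
      (simp_all add: representation_zero representation_add[OF independent_Basis] span_Basis)
  have rep: "representation B (dyn_op i (\<zeta> i) (\<zeta> (Suc i)) c) b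
    = (\<Sum>\<mu>\<in>P. \<Sum>j\<le>nat (2 * R). dyn_factor j (nat \<bar>\<mu> i - \<mu> (Suc i)\<bar>) (\<zeta> i) (\<zeta> (Suc i)) *
      representation B (dyn_term q scale E F i \<mu> j (wcomp \<mu> c)) b)"
    unfolding dyn_op_def dyn_op_wt_def rep_sum representation_scale[OF independent_Basis, unfolded span_Basis, OF UNIV_I] ..
  show ?thesis
    unfolding dyn_matrix_eq[OF i] rep
  proof (intro has_value_sum has_value_mult has_value_rconst)
    fix \<mu> j assume \<mu>: "\<mu> \<in> P" and j: "j \<in> {..nat (2 * R)}"
    define d where "d = nat \<bar>\<mu> i - \<mu> (Suc i)\<bar>"
    have "2 * j + d \<le> nat (6 * R)" using j R_bound[OF \<mu>, of i] R_bound[OF \<mu>, of "Suc i"] unfolding d_def atMost_iff by linarith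
    then have "\<zeta> (Suc i) - q ^ (2 * j + d) * \<zeta> i \<noteq> 0" using good unfolding good_def by blast
    then show "has_value (dyn_coeff q i \<mu> j) \<zeta> (dyn_factor j (nat \<bar>\<mu> i - \<mu> (Suc i)\<bar>) (\<zeta> i) (\<zeta> (Suc i)))"
      unfolding dyn_coeff_def dyn_factor_def Let_def d_def[symmetric]
      by (intro has_value_mult has_value_divide has_value_diff has_value_rconst has_value_rvar)
  qed
qed

text \<open>
  The vector \<open>w\<close> is the value at \<open>\<zeta>\<close> of the vector valued function with coordinates \<open>f\<close>.
\<close>

definition valued :: "('u \<Rightarrow> ratfun) \<Rightarrow> (nat \<Rightarrow> complex) \<Rightarrow> 'u \<Rightarrow> bool" where
  "valued f \<zeta> w \<longleftrightarrow> (\<forall>b. has_value (f b) \<zeta> (representation B w b))"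

abbreviation "dref i \<equiv> dyn_reflection M q scale B E F t i"

text \<open>
  Evaluation turns the reflection into the operator \<open>A\<^sub>i\<close> with exchanged arguments, applied to the value at the
  exchanged point.
\<close>

lemma valued_dref:
  assumes i: "i \<in> {1..<M}" and f: "valued f (\<zeta> \<circ> transpose i (Suc i)) w" and good: "good (\<zeta> (Suc i)) (\<zeta> i)"
  shows "valued (dref i f) \<zeta> (dyn_op i (\<zeta> (Suc i)) (\<zeta> i) w)"
  unfolding valued_def
proof
  fix b
  interpret A: Vector_Spaces.linear scale scale "dyn_op i (\<zeta> (Suc i)) (\<zeta> i)" by (rule linear_dyn_op[OF i])
  let ?\<zeta> = "\<zeta> \<circ> transpose i (Suc i)"
  have D: "has_value (dyn_matrix M q scale B E F t i b c) ?\<zeta> (representation B (dyn_op i (\<zeta> (Suc i)) (\<zeta> i) c) b)" for c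
    using has_value_dyn_matrix[OF i, of ?\<zeta> b c] good by simp
  have rep_sum: "representation B (sum f A) b = (\<Sum>x\<in>A. representation B (f x) b)" for f :: "'z \<Rightarrow> 'u" and A
    by (induction A rule: infinite_finite_induct)
      (simp_all add: representation_zero representation_add[OF independent_Basis] span_Basis)
  have "w = (\<Sum>c\<in>B. representation B w c *s c)"
    using sum_representation_eq[OF independent_Basis _ finite_Basis order_refl, of w] by (simp add: span_Basis)
  then have "dyn_op i (\<zeta> (Suc i)) (\<zeta> i) w = (\<Sum>c\<in>B. representation B w c *s dyn_op i (\<zeta> (Suc i)) (\<zeta> i) c)"
    by (metis (no_types, lifting) A.scale A.sum sum.cong)
  then have "representation B (dyn_op i (\<zeta> (Suc i)) (\<zeta> i) w) b
    = (\<Sum>c\<in>B. representation B (dyn_op i (\<zeta> (Suc i)) (\<zeta> i) c) b * representation B w c)"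
    unfolding rep_sum by (simp add: rep_sum representation_scale[OF independent_Basis] span_Basis mult.commute)
  then show "has_value (dref i f b) \<zeta> (representation B (dyn_op i (\<zeta> (Suc i)) (\<zeta> i) w) b)"
    unfolding dyn_reflection_def
    using D f by (auto simp: valued_def intro!: has_value_sum has_value_mult has_value_swap)
qed

definition const_vec :: "'u \<Rightarrow> 'u \<Rightarrow> ratfun" where
  "const_vec y b = rconst (representation B y b)"

lemma valued_const: "valued (const_vec y) \<zeta> y"
  by (simp add: valued_def const_vec_def has_value_rconst)

text \<open>
  The transported vector of \<open>ww_top\<close> for the \<open>i\<close>-th simple root.
\<close>

definition transport_vec :: "nat \<Rightarrow> int \<Rightarrow> int \<Rightarrow> 'u \<Rightarrow> 'u" where
  "transport_vec i n a y = q powi n *s (\<Sum>k\<le>nat (2 * R). ((-1) powi (int k + n) * br (a + 1) / br (a + 1 - int k)) *s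
     qsl2.dpz q scale (E i) (int k + n) (dF i k y))"

text \<open>
  The factor between the transported vector and the value of \<open>A\<^sub>i\<close>.
\<close>

definition transport_factor :: "int \<Rightarrow> int \<Rightarrow> complex" where
  "transport_factor n a = (if n \<ge> 0 then (- q) powi n else q powi n * br (a + 1) / br (a + 1 + n))"

text \<open>
  At a power of \<open>q\<close> the coefficients of \<open>A\<^sub>i\<close> are quotients of brackets.
\<close>

lemma dyn_factor_value:
  assumes zj: "zj \<noteq> 0" and zi: "zi = q powi (- 2 * A - int d) * zj" and A: "A - int k \<noteq> 0"
  shows "dyn_factor k d zi zj = (-1) ^ k * br A / br (A - int k)"
proof -
  define X Y where "X = q powi A" and "Y = q ^ k"
  have nz: "X \<noteq> 0" "Y \<noteq> 0" by (simp_all add: X_def Y_def)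
  have 1: "q ^ d * zi = inverse (X * X) * zj"
  proof -
    have "q ^ d * q powi (- 2 * A - int d) = q powi (- A + - A)"
      using power_int_add[of q "int d" "- 2 * A - int d"] by simp
    also have "q powi (- A + - A) = inverse X * inverse X"
      unfolding X_def power_int_minus[symmetric] by (rule power_int_add) simp
    finally show ?thesis unfolding zi by (simp add: mult.assoc[symmetric])
  qed
  have 2: "q ^ (2 * k + d) * zi = Y * Y * (inverse (X * X) * zj)"
    unfolding power_add 1[symmetric] by (simp add: Y_def mult_2 power_add)
  have br: "br A = (X - inverse X) / (q - inverse q)" "br (A - int k) = (X / Y - Y / X) / (q - inverse q)"
    by (simp_all add: br_def X_def Y_def power_int_minus power_int_diff)
  have YX: "Y * Y \<noteq> X * X"
  proof
    assume "Y * Y = X * X"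
    then have "q powi (int k + int k) = q powi (A + A)"
      unfolding X_def Y_def power_int_add[OF disjI1[OF q_nz]] by simp
    then show False using A by (simp add: powi_eq_iff)
  qed
  have "dyn_factor k d zi zj = (- q) ^ k * ((1 - inverse (X * X)) / (1 - Y * Y * inverse (X * X)))"
  proof -
    have "zj - inverse (X * X) * zj = zj * (1 - inverse (X * X))"
      "zj - Y * Y * (inverse (X * X) * zj) = zj * (1 - Y * Y * inverse (X * X))" by (simp_all add: algebra_simps)
    then show ?thesis unfolding dyn_factor_def 1 2 using zj by simp
  qed
  also have "\<dots> = (-1) ^ k * (Y * ((X * X - 1) / (X * X - Y * Y)))"
  proof -
    have "(1 - inverse (X * X)) / (1 - Y * Y * inverse (X * X)) = (X * X - 1) / (X * X - Y * Y)"
      using nz YX by (simp add: field_simps)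
    moreover have "(- q) ^ k = (-1) ^ k * Y" unfolding Y_def by (rule power_minus)
    ultimately show ?thesis by (simp add: mult.assoc)
  qed
  also have "Y * ((X * X - 1) / (X * X - Y * Y)) = br A / br (A - int k)"
  proof -
    have "Y * ((X * X - 1) / (X * X - Y * Y)) = (X - inverse X) / (X / Y - Y / X)"
      using nz YX by (simp add: field_simps)
    moreover have "q - inverse q \<noteq> 0" by simp
    ultimately show ?thesis unfolding br by (metis divide_divide_eq_left divide_divide_eq_right mult.commute nonzero_mult_div_cancel_left times_divide_eq_right)
  qed
  finally show ?thesis by simp
qed

text \<open>
  For \<open>n \<ge> 0\<close> the two sums agree term by term.  For \<open>n < 0\<close> the first \<open>- n\<close> terms of the transported vector
  contain negative divided powers, and the rest matches after a shift of the summation index; this also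
  changes the leading bracket and explains the second case of \<open>transport_factor\<close>.
\<close>

lemma transport_vec_eq:
  assumes i: "i \<in> {1..<M}" and y: "y \<in> ws \<omega>" "\<omega> \<in> weights M" and n: "n = \<omega> (Suc i) - \<omega> i"
    and a: "a > 4 * R" and zj: "zj \<noteq> 0" and zi: "zi = q powi (- (2 * (a + 1) + n)) * zj"
  shows "transport_vec i n a y = transport_factor n a *s dyn_op i zi zj y"
proof -
  interpret s: qsl2 q scale "E i" "F i" "Xi i" by (rule qsl2_i[OF i])
  have R0: "R \<ge> 0" by (rule R_nonneg)
  show ?thesis
  proof (cases "n \<ge> 0")
    case True
    have t: "(q powi n * ((-1) powi (int k + n) * br (a + 1) / br (a + 1 - int k))) *s s.dpz (int k + n) (dF i k y)
        = (transport_factor n a * dyn_factor k (nat \<bar>\<omega> i - \<omega> (Suc i)\<bar>) zi zj) *s dyn_term q scale E F i \<omega> k y"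
      if k: "k \<le> nat (2 * R)" for k
    proof -
      have "a + 1 - int k \<noteq> 0" using k a R0 by linarith
      moreover have d: "nat \<bar>\<omega> i - \<omega> (Suc i)\<bar> = nat n" using True n by simp
      moreover have "zi = q powi (- 2 * (a + 1) - int (nat n)) * zj"
        unfolding zi using True by (intro arg_cong[where f = "\<lambda>e. q powi e * zj"]) simp
      ultimately have c: "dyn_factor k (nat \<bar>\<omega> i - \<omega> (Suc i)\<bar>) zi zj = (-1) ^ k * br (a + 1) / br (a + 1 - int k)"
        unfolding d using dyn_factor_value[OF zj] by blast
      have "dyn_term q scale E F i \<omega> k y = s.dpz (int k + n) (dF i k y)"
        using True n by (simp add: dyn_term_def s.dpz_def nat_add_distrib)
      moreover have "q powi n * ((-1) powi (int k + n) * br (a + 1) / br (a + 1 - int k)) = transport_factor n a * ((-1) ^ k * br (a + 1) / br (a + 1 - int k))"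
        using True power_int_mult_distrib[of "-1" q n] by (simp add: transport_factor_def power_int_add)
      ultimately show ?thesis unfolding c by simp
    qed
    show ?thesis
      unfolding transport_vec_def dyn_op_ws[OF i y] dyn_op_wt_def scale_sum_right scale_scale
      by (rule sum.cong[OF refl], rule t) simp
  next
    case False
    define m where "m = nat (- n)"
    have m: "n = - int m" using False by (simp add: m_def)
    define A where "A = a + 1 - int m"
    have dm: "nat \<bar>\<omega> i - \<omega> (Suc i)\<bar> = m" "nat (\<omega> (Suc i) - \<omega> i) = 0" "nat (\<omega> i - \<omega> (Suc i)) = m"
      using n m by auto
    let ?f = "\<lambda>k. (q powi n * ((-1) powi (int k + n) * br (a + 1) / br (a + 1 - int k))) *s s.dpz (int k + n) (dF i k y)"
    let ?g = "\<lambda>j. (transport_factor n a * dyn_factor j m zi zj) *s dE i j (dF i (j + m) y)"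
    show ?thesis
    proof (cases "y = 0")
      case True
      interpret A: Vector_Spaces.linear scale scale "dyn_op i zi zj" by (rule linear_dyn_op[OF i])
      show ?thesis unfolding transport_vec_def True by (simp add: s.dF.zero A.zero)
    next
      case False
      have mR: "int m \<le> 2 * R"
        using ws_bound[OF y False, of i] ws_bound[OF y False, of "Suc i"] n m by linarith
      have t: "?f (j + m) = ?g j" if j: "j \<le> nat (2 * R)" for j
      proof -
        have A0: "A - int j \<noteq> 0" "A \<noteq> 0" using j a mR R0 unfolding A_def by linarith+
        have "zi = q powi (- 2 * A - int m) * zj"
          unfolding zi by (intro arg_cong[where f = "\<lambda>e. q powi e * zj"]) (simp add: A_def m)
        then have c: "dyn_factor j m zi zj = (-1) ^ j * br A / br (A - int j)" using dyn_factor_value[OF zj _ A0(1)] by simp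
        have tf: "transport_factor n a = q powi n * br (a + 1) / br A"
          using m A_def a R0 \<open>\<not> 0 \<le> n\<close> by (simp add: transport_factor_def)
        have e: "a + 1 - int (j + m) = A - int j" "int (j + m) + n = int j" using m by (simp_all add: A_def)
        show ?thesis unfolding c tf e using A0 by (simp add: s.dpz_def)
      qed
      have z1: "?f k = 0" if "k < m" for k using that m by (simp add: s.dpz_def)
      have z2: "?g j = 0" if "j + m > nat (2 * R)" for j
        using dF_eq_0[OF i y, of "j + m"] that by (simp add: s.dE.zero)
      have "transport_vec i n a y = (\<Sum>k\<le>nat (2 * R). ?f k)"
        unfolding transport_vec_def scale_sum_right scale_scale ..
      also have "\<dots> = (\<Sum>k\<in>{m..nat (2 * R)}. ?f k)"
        by (rule sum.mono_neutral_right, simp, force, intro ballI, rule z1, force)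
      also have "\<dots> = (\<Sum>j\<le>nat (2 * R) - m. ?f (j + m))"
        by (rule sum.reindex_bij_witness[of _ "\<lambda>j. j + m" "\<lambda>k. k - m"]) (use mR in auto)
      also have "\<dots> = (\<Sum>j\<le>nat (2 * R) - m. ?g j)" by (rule sum.cong) (use t in auto)
      also have "\<dots> = (\<Sum>j\<le>nat (2 * R). ?g j)"
        by (rule sum.mono_neutral_left, simp, force, intro ballI, rule z2, force)
      also have "\<dots> = transport_factor n a *s dyn_op i zi zj y"
        unfolding dyn_op_ws[OF i y] dyn_op_wt_def dyn_term_def dm scale_sum_right scale_scale by simp
      finally show ?thesis .
    qed
  qed
qed

end

section \<open>The braid relation of the reflections\<close>

context type_I_module
begin

lemma ws_dE: 
  assumes i: "i \<in> {1..<M}" and v: "v \<in> ws \<mu>"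
  shows "dE i n v \<in> ws (\<lambda>k. \<mu> k + int n * simple_root i k)"
proof -
  interpret s: qsl2 q scale "E i" "F i" "Xi i" by (rule qsl2_i[OF i])
  show ?thesis
  proof (induction n)
    case (Suc n)
    have e: "(\<lambda>k. (\<mu> k + int n * simple_root i k) + simple_root i k) = (\<lambda>k. \<mu> k + int (Suc n) * simple_root i k)"
      by (simp add: fun_eq_iff algebra_simps)
    show ?case unfolding s.dpE_Suc using ws_E(1)[OF i Suc] unfolding e by (rule ws_closed(3))
  qed (simp add: v)
qed

lemma ws_dyn_term:
  assumes i: "i \<in> {1..<M}" and v: "v \<in> ws \<mu>"
  shows "dyn_term q scale E F i \<mu> j v \<in> ws (\<mu> \<circ> transpose i (Suc i))"
proof -
  have "(\<lambda>k. (\<mu> k - int (j + nat (\<mu> i - \<mu> (Suc i))) * simple_root i k)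
      + int (j + nat (\<mu> (Suc i) - \<mu> i)) * simple_root i k) = \<mu> \<circ> transpose i (Suc i)"
    by (rule ext) (auto simp: simple_root_def transpose_def)
  then show ?thesis
    using ws_dE[OF i ws_dF[OF i v, of "j + nat (\<mu> i - \<mu> (Suc i))"], of "j + nat (\<mu> (Suc i) - \<mu> i)"]
    by (simp only: dyn_term_def)
qed

lemma ws_dyn_op:
  assumes i: "i \<in> {1..<M}" and v: "v \<in> ws \<mu>" "\<mu> \<in> weights M"
  shows "dyn_op i zi zj v \<in> ws (\<mu> \<circ> transpose i (Suc i))" "\<mu> \<circ> transpose i (Suc i) \<in> weights M"
proof -
  show "dyn_op i zi zj v \<in> ws (\<mu> \<circ> transpose i (Suc i))"
    unfolding dyn_op_ws[OF i v] dyn_op_wt_def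
    by (intro subspace_sum[OF subspace_ws] ws_closed(3) ws_dyn_term[OF i v(1)])
  show "\<mu> \<circ> transpose i (Suc i) \<in> weights M"
    using v(2) i by (auto simp: weights_def transpose_def)
qed

text \<open>
  With \<open>X\<close>, \<open>Y\<close>, \<open>Z\<close> the three summands of the Casimir eigenvalue of a weight, the left hand side is the
  difference between the eigenvalue \<open>n1\<close> and \<open>n2\<close> steps below and that of the weight itself.
\<close>

definition apart :: "complex \<Rightarrow> complex \<Rightarrow> complex \<Rightarrow> bool" where
  "apart X Y Z \<longleftrightarrow> (\<forall>n1 n2 :: nat. int n1 \<le> 2 * R \<longrightarrow> int n2 \<le> 2 * R \<longrightarrow> (n1, n2) \<noteq> (0, 0) \<longrightarrow>
    (q powi (2 * int n1) - 1) * X + (q powi (2 * int n2 - 2 * int n1) - 1) * Y + (q powi (- 2 * int n2) - 1) * Z \<noteq> 0)"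

lemma transport_factor_nz: "a > 4 * R \<Longrightarrow> \<bar>n\<bar> \<le> 2 * R \<Longrightarrow> transport_factor n a \<noteq> 0"
  using R_nonneg by (auto simp: transport_factor_def)

text \<open>
  \<open>braid_integral\<close> in terms of \<open>A\<^sub>i\<close>.  The points are determined by requiring that each ratio of two
  coordinates is the power of \<open>q\<close> in \<open>transport_vec_eq\<close> for the corresponding transport step.  The three factors
  \<open>transport_factor\<close> are the same on both sides and cancel.
\<close>

lemma braid_at_point:
  assumes i: "i \<in> {1..<M}" "Suc i \<in> {1..<M}" and y: "y \<in> ws \<omega>" "\<omega> \<in> weights M"
    and l: "l1 = \<omega> i" "l2 = \<omega> (Suc i)" "l3 = \<omega> (Suc (Suc i))"
    and m: "m2 - m1 > 8 * R" "m3 - m2 > 8 * R"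
    and Z: "Z1 = q powi (2 - 2 * m1 - 2 * l3)" "Z2 = q powi (- 2 * m2 - 2 * l2)" "Z3 = q powi (- 2 - 2 * m3 - 2 * l1)"
    and apart: "apart Z1 Z2 Z3" "apart Z2 Z1 Z3" "apart Z2 Z3 Z1" "apart Z3 Z2 Z1" "apart Z1 Z3 Z2" "apart Z3 Z1 Z2"
    and z: "z1 = q powi (2 - 2 * m1 - l3)" "z2 = q powi (- 2 * m2 - l2)" "z3 = q powi (- 2 - 2 * m3 - l1)"
  shows "dyn_op i z2 z1 (dyn_op (Suc i) z3 z1 (dyn_op i z3 z2 y)) = dyn_op (Suc i) z3 z2 (dyn_op i z3 z1 (dyn_op (Suc i) z2 z1 y))"
proof (cases "y = 0")
  case True
  interpret A: Vector_Spaces.linear scale scale "dyn_op i x x'" for x x' by (rule linear_dyn_op[OF i(1)])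
  interpret A': Vector_Spaces.linear scale scale "dyn_op (Suc i) x x'" for x x' by (rule linear_dyn_op[OF i(2)])
  show ?thesis using True by (simp add: A.zero A'.zero)
next
  case False
  interpret V: verma_tensor q scale "E i" "E (Suc i)" "F i" "F (Suc i)" "\<lambda>k1 k2 k3. ws (upd3 \<omega> i k1 k2 k3)"
      "t (simple_root i)" "t (simple_root (Suc i))" "t (\<lambda>k. - simple_root i k)" "t (\<lambda>k. - simple_root (Suc i) k)" R m1 m2 m3
    by (rule verma_tensor.intro, rule gl3_weighted_i[OF i y(2)])
  interpret A: Vector_Spaces.linear scale scale "dyn_op i x x'" for x x' by (rule linear_dyn_op[OF i(1)])
  interpret A': Vector_Spaces.linear scale scale "dyn_op (Suc i) x x'" for x x' by (rule linear_dyn_op[OF i(2)])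
  have lb: "\<bar>l1\<bar> \<le> R" "\<bar>l2\<bar> \<le> R" "\<bar>l3\<bar> \<le> R"
    using ws_bound[OF y False] by (simp_all add: l)
  have R0: "R \<ge> 0" by (rule R_nonneg)
  have nz: "z1 \<noteq> 0" "z2 \<noteq> 0" "z3 \<noteq> 0" by (simp_all add: z)
  have yX: "y \<in> ws (upd3 \<omega> i l1 l2 l3)"
    using y(1) by (simp add: upd3_def l)
  define a1 a2 a3 where "a1 = m2 - m1 - (l3 - l2)" and "a2 = m3 - m2 - (l2 - l1)" and "a3 = m3 - m1 + 1 - (l3 - l1)"
  have a: "a1 > 4 * R" "a2 > 4 * R" "a3 > 4 * R"
    using m lb R0 unfolding a1_def a2_def a3_def by linarith+
  have zz: "z3 = q powi (- (2 * (a2 + 1) + (l2 - l1))) * z2" "z3 = q powi (- (2 * (a3 + 1) + (l3 - l1))) * z1"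
    "z2 = q powi (- (2 * (a1 + 1) + (l3 - l2))) * z1"
    unfolding z a1_def a2_def a3_def power_int_add[symmetric, OF disjI1[OF q_nz]]
    by (rule arg_cong[where f = "(powi) q"], simp)+
  have t1: "transport_vec i n a = V.transport1 n a" and t2: "transport_vec (Suc i) n a = V.transport2 n a" for n a
    unfolding transport_vec_def V.transport1_def V.transport2_def by (rule ext, rule refl)+
  define D where "D = {(n1 :: nat, n2 :: nat). int n1 \<le> 2 * R \<and> int n2 \<le> 2 * R \<and> (n1, n2) \<noteq> (0, 0)}"
  \<comment> \<open>The Casimir eigenvalues strictly below the weight \<open>(c1, c2, c3)\<close>.\<close>
  define fam where "fam c1 c2 c3 = (\<lambda>(n1, n2). V.chi (c1 - int n1) (c2 + int n1 - int n2) (c3 + int n2)) ` D" for c1 c2 c3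
  have "D \<subseteq> {..nat (2 * R)} \<times> {..nat (2 * R)}" by (auto simp: D_def)
  then have "finite D" by (rule finite_subset) simp
  then have fin: "finite (fam c1 c2 c3)" for c1 c2 c3 by (simp add: fam_def)
  have fam_notin: "Z1 + Z2 + Z3 \<notin> fam c1 c2 c3"
    if ap: "apart X Y Z" and s: "X + Y + Z = Z1 + Z2 + Z3"
      and c: "X = q powi (2 - 2 * c1)" "Y = q powi (- 2 * c2)" "Z = q powi (- 2 * c3 - 2)" for c1 c2 c3 X Y Z
  proof
    assume "Z1 + Z2 + Z3 \<in> fam c1 c2 c3"
    then obtain n1 n2 where n: "(n1, n2) \<in> D" and
      e: "X + Y + Z = V.chi (c1 - int n1) (c2 + int n1 - int n2) (c3 + int n2)"
      unfolding fam_def s by auto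
    have "V.chi (c1 - int n1) (c2 + int n1 - int n2) (c3 + int n2)
      = q powi (2 * int n1) * X + q powi (2 * int n2 - 2 * int n1) * Y + q powi (- 2 * int n2) * Z"
      unfolding V.chi_def c power_int_add[symmetric, OF disjI1[OF q_nz]]
      by (intro arg_cong2[where f = "(+)"] arg_cong[where f = "(powi) q"]) simp_all
    with e have "(q powi (2 * int n1) - 1) * X + (q powi (2 * int n2 - 2 * int n1) - 1) * Y + (q powi (- 2 * int n2) - 1) * Z = 0"
      by (simp add: algebra_simps)
    then show False using ap n unfolding apart_def D_def by blast
  qed
  define K where "K = fam (m1 + l3) (m2 + l2) (m3 + l1) \<union> fam (m2 + 1 + l2) (m1 - 1 + l3) (m3 + l1)
    \<union> fam (m2 + 1 + l2) (m3 + 1 + l1) (m1 - 2 + l3) \<union> fam (m3 + 2 + l1) (m2 + l2) (m1 - 2 + l3)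
    \<union> fam (m1 + l3) (m3 + 1 + l1) (m2 - 1 + l2) \<union> fam (m3 + 2 + l1) (m1 - 1 + l3) (m2 - 1 + l2)"
  have "finite K" unfolding K_def by (intro finite_UnI fin)
  then obtain ks where ks: "set ks = K" using finite_list by blast
  have kc: "V.separates ks c1 c2 c3" if "fam c1 c2 c3 \<subseteq> K" for c1 c2 c3
    using that unfolding V.separates_def ks fam_def D_def by auto
  have c0: "V.chi (m1 + l3) (m2 + l2) (m3 + l1) = Z1 + Z2 + Z3"
    unfolding V.chi_def Z by (intro arg_cong2[where f = "(+)"] arg_cong[where f = "(powi) q"]) simp_all
  have "Z1 + Z2 + Z3 \<notin> K"
    unfolding K_def Un_iff de_Morgan_disj
  proof (intro conjI)
    show "Z1 + Z2 + Z3 \<notin> fam (m1 + l3) (m2 + l2) (m3 + l1)"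
      by (rule fam_notin[OF apart(1)], simp add: add_ac) (unfold Z, (rule arg_cong[where f = "(powi) q"], simp)+)
    show "Z1 + Z2 + Z3 \<notin> fam (m2 + 1 + l2) (m1 - 1 + l3) (m3 + l1)"
      by (rule fam_notin[OF apart(2)], simp add: add_ac) (unfold Z, (rule arg_cong[where f = "(powi) q"], simp)+)
    show "Z1 + Z2 + Z3 \<notin> fam (m2 + 1 + l2) (m3 + 1 + l1) (m1 - 2 + l3)"
      by (rule fam_notin[OF apart(3)], simp add: add_ac) (unfold Z, (rule arg_cong[where f = "(powi) q"], simp)+)
    show "Z1 + Z2 + Z3 \<notin> fam (m3 + 2 + l1) (m2 + l2) (m1 - 2 + l3)"
      by (rule fam_notin[OF apart(4)], simp add: add_ac) (unfold Z, (rule arg_cong[where f = "(powi) q"], simp)+)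
    show "Z1 + Z2 + Z3 \<notin> fam (m1 + l3) (m3 + 1 + l1) (m2 - 1 + l2)"
      by (rule fam_notin[OF apart(5)], simp add: add_ac) (unfold Z, (rule arg_cong[where f = "(powi) q"], simp)+)
    show "Z1 + Z2 + Z3 \<notin> fam (m3 + 2 + l1) (m1 - 1 + l3) (m2 - 1 + l2)"
      by (rule fam_notin[OF apart(6)], simp add: add_ac) (unfold Z, (rule arg_cong[where f = "(powi) q"], simp)+)
  qed
  then have "V.chi (m1 + l3) (m2 + l2) (m3 + l1) \<notin> set ks" by (simp add: c0 ks)
  note braid = V.braid_integral[OF yX lb m kc kc kc kc kc kc this a1_def a2_def a3_def, folded t1 t2]
  have br: "transport_vec i (l3 - l2) a1 (transport_vec (Suc i) (l3 - l1) a3 (transport_vec i (l2 - l1) a2 y))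
    = transport_vec (Suc i) (l2 - l1) a2 (transport_vec i (l3 - l1) a3 (transport_vec (Suc i) (l3 - l2) a1 y))"
    by (rule braid) (auto simp: K_def)
  let ?c = "transport_factor (l3 - l2) a1 * (transport_factor (l3 - l1) a3 * transport_factor (l2 - l1) a2)"
  have tl: "transport_vec j n a (c *s v) = c *s transport_vec j n a v" if "j = i \<or> j = Suc i" for j n a c v
  proof -
    have j: "j \<in> {1..<M}" using that i by blast
    interpret s: qsl2 q scale "E j" "F j" "Xi j" by (rule qsl2_i[OF j])
    have "s.dpz k (c *s w) = c *s s.dpz k w" for k w by (simp add: s.dpz_def s.dE.scale)
    then show ?thesis by (simp add: transport_vec_def s.dF.scale scale_sum_right mult_ac)
  qed
  note tvi = transport_vec_eq[OF i(1)] and tvj = transport_vec_eq[OF i(2)]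
  have "transport_vec i (l2 - l1) a2 y = transport_factor (l2 - l1) a2 *s dyn_op i z3 z2 y"
    by (rule tvi[OF y _ a(2) nz(2) zz(1)]) (simp add: l)
  moreover have "transport_vec (Suc i) (l3 - l1) a3 (dyn_op i z3 z2 y) = transport_factor (l3 - l1) a3 *s dyn_op (Suc i) z3 z1 (dyn_op i z3 z2 y)"
    by (rule tvj[OF ws_dyn_op[OF i(1) y] _ a(3) nz(1) zz(2)]) (simp add: l)
  moreover have "transport_vec i (l3 - l2) a1 (dyn_op (Suc i) z3 z1 (dyn_op i z3 z2 y))
      = transport_factor (l3 - l2) a1 *s dyn_op i z2 z1 (dyn_op (Suc i) z3 z1 (dyn_op i z3 z2 y))"
    by (rule tvi[OF ws_dyn_op[OF i(2) ws_dyn_op[OF i(1) y]] _ a(1) nz(1) zz(3)]) (simp add: l)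
  ultimately have L: "transport_vec i (l3 - l2) a1 (transport_vec (Suc i) (l3 - l1) a3 (transport_vec i (l2 - l1) a2 y))
     = ?c *s dyn_op i z2 z1 (dyn_op (Suc i) z3 z1 (dyn_op i z3 z2 y))"
    by (simp add: tl mult_ac)
  have "transport_vec (Suc i) (l3 - l2) a1 y = transport_factor (l3 - l2) a1 *s dyn_op (Suc i) z2 z1 y"
    by (rule tvj[OF y _ a(1) nz(1) zz(3)]) (simp add: l)
  moreover have "transport_vec i (l3 - l1) a3 (dyn_op (Suc i) z2 z1 y) = transport_factor (l3 - l1) a3 *s dyn_op i z3 z1 (dyn_op (Suc i) z2 z1 y)"
    by (rule tvi[OF ws_dyn_op[OF i(2) y] _ a(3) nz(1) zz(2)]) (simp add: l)
  moreover have "transport_vec (Suc i) (l2 - l1) a2 (dyn_op i z3 z1 (dyn_op (Suc i) z2 z1 y))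
      = transport_factor (l2 - l1) a2 *s dyn_op (Suc i) z3 z2 (dyn_op i z3 z1 (dyn_op (Suc i) z2 z1 y))"
    by (rule tvj[OF ws_dyn_op[OF i(1) ws_dyn_op[OF i(2) y]] _ a(2) nz(2) zz(1)]) (simp add: l)
  ultimately have R': "transport_vec (Suc i) (l2 - l1) a2 (transport_vec i (l3 - l1) a3 (transport_vec (Suc i) (l3 - l2) a1 y))
     = ?c *s dyn_op (Suc i) z3 z2 (dyn_op i z3 z1 (dyn_op (Suc i) z2 z1 y))"
    by (simp add: tl mult_ac)
  have "?c \<noteq> 0" using a lb by (simp add: transport_factor_nz)
  with br show ?thesis unfolding L R' by (metis scale_left_imp_eq)
qed

text \<open>
  The conditions \<open>apart\<close> are linear in the coordinates of the point, with these linear forms.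
\<close>

definition lin3 :: "nat \<Rightarrow> complex \<Rightarrow> complex \<Rightarrow> complex \<Rightarrow> cpoly" where
  "lin3 i \<alpha> \<beta> \<gamma> = Poly_Mapping.single (Poly_Mapping.single i 1) \<alpha>
     + Poly_Mapping.single (Poly_Mapping.single (Suc i) 1) \<beta>
     + Poly_Mapping.single (Poly_Mapping.single (Suc (Suc i)) 1) \<gamma>"

lemma peval_lin3: "peval \<zeta> (lin3 i \<alpha> \<beta> \<gamma>) = \<alpha> * \<zeta> i + \<beta> * \<zeta> (Suc i) + \<gamma> * \<zeta> (Suc (Suc i))"
  by (simp add: lin3_def peval_add)

lemma lin3_eq_0_iff: "lin3 i \<alpha> \<beta> \<gamma> = 0 \<longleftrightarrow> \<alpha> = 0 \<and> \<beta> = 0 \<and> \<gamma> = 0"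
proof
  assume "lin3 i \<alpha> \<beta> \<gamma> = 0"
  then have *: "\<alpha> * \<zeta> i + \<beta> * \<zeta> (Suc i) + \<gamma> * \<zeta> (Suc (Suc i)) = 0" for \<zeta>
    using peval_lin3[of \<zeta> i \<alpha> \<beta> \<gamma>] by simp
  show "\<alpha> = 0 \<and> \<beta> = 0 \<and> \<gamma> = 0" using *[of "\<lambda>k. if k = i then 1 else 0"] *[of "\<lambda>k. if k = Suc i then 1 else 0"]
      *[of "\<lambda>k. if k = Suc (Suc i) then 1 else 0"] by simp
qed (simp add: lin3_def)

text \<open>
  The grid consists of the points of \<open>braid_at_point\<close>: the coordinates \<open>z i\<close>, \<open>z (i + 1)\<close>, \<open>z (i + 2)\<close> are
  powers of \<open>q\<close> with exponents in fixed residue classes modulo \<open>2\<close>, each sufficiently far below the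
  previous one.  The product \<open>g\<close> of linear forms excludes coinciding Casimir eigenvalues.
\<close>

lemma braid_const_ws:
  assumes i: "i \<in> {1..<M}" "Suc i \<in> {1..<M}" and y: "y \<in> ws \<omega>" "\<omega> \<in> weights M"
  shows "dref i (dref (Suc i) (dref i (const_vec y))) = dref (Suc i) (dref i (dref (Suc i) (const_vec y)))"
    (is "?L = ?R")
proof (rule ext)
  fix b
  define l1 l2 l3 where l: "l1 = \<omega> i" "l2 = \<omega> (Suc i)" "l3 = \<omega> (Suc (Suc i))"
  \<comment> \<open>The exponents of the points of \<open>braid_at_point\<close> up to the part that varies.\<close>
  define e where "e k = (if k = i then 2 - l3 else if k = Suc i then - l2 else - 2 - l1)" for k
  define S where "S \<zeta> k = {q powi (e k - 2 * m) | m. \<forall>m'. 0 < k \<longrightarrow> \<zeta> (k - 1) = q powi (e (k - 1) - 2 * m') \<longrightarrow> m - m' > 8 * R}"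
    for \<zeta> :: "nat \<Rightarrow> complex" and k
  define D where "D = {(n1 :: nat, n2 :: nat). int n1 \<le> 2 * R \<and> int n2 \<le> 2 * R \<and> (n1, n2) \<noteq> (0, 0)}"
  define A1 A2 A3 where "A1 = (\<lambda>(n1 :: nat, n2 :: nat). q powi (2 * int n1) - 1)"
    and "A2 = (\<lambda>(n1 :: nat, n2 :: nat). q powi (2 * int n2 - 2 * int n1) - 1)"
    and "A3 = (\<lambda>(n1 :: nat, n2 :: nat). q powi (- 2 * int n2) - 1)"
  define L where "L = (\<lambda>(\<alpha>, \<beta>, \<gamma>). lin3 i (\<alpha> * q powi (- l3)) (\<beta> * q powi (- l2)) (\<gamma> * q powi (- l1)))"
  \<comment> \<open>The six orders in which the coordinates enter, one for each weight along the two words.\<close>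
  define T where "T = (\<lambda>p. {(A1 p, A2 p, A3 p), (A2 p, A1 p, A3 p), (A3 p, A1 p, A2 p), (A3 p, A2 p, A1 p), (A1 p, A3 p, A2 p), (A2 p, A3 p, A1 p)})"
  define g where "g = (\<Prod>p\<in>D. \<Prod>x\<in>T p. L x)"
  have "D \<subseteq> {..nat (2 * R)} \<times> {..nat (2 * R)}" by (auto simp: D_def)
  then have finD: "finite D" by (rule finite_subset) simp
  have finT: "finite (T p)" for p by (simp add: T_def)
  have A: "A1 p \<noteq> 0 \<or> A3 p \<noteq> 0" if "p \<in> D" for p
  proof -
    obtain n1 n2 where p: "p = (n1, n2)" by (cases p)
    show ?thesis using that powi_eq_1_iff[of "2 * int n1"] powi_eq_1_iff[of "- 2 * int n2"]
      by (cases "n1 = 0") (auto simp: p D_def A1_def A3_def)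
  qed
  have "L x \<noteq> 0" if "p \<in> D" "x \<in> T p" for p x
    using A[OF that(1)] that(2) unfolding T_def L_def by (auto simp: lin3_eq_0_iff)
  then have g: "g \<noteq> 0" unfolding g_def using finD finT by simp
  have inf: "infinite (S \<zeta> k)" for \<zeta> k
  proof -
    \<comment> \<open>The previous coordinate determines its exponent, so one lower bound suffices.\<close>
    define m0 where "m0 = (if \<exists>m'. \<zeta> (k - 1) = q powi (e (k - 1) - 2 * m')
      then (SOME m'. \<zeta> (k - 1) = q powi (e (k - 1) - 2 * m')) + 8 * R else 0)"
    have m0: "m' + 8 * R = m0" if "\<zeta> (k - 1) = q powi (e (k - 1) - 2 * m')" for m'
    proof -
      have "(SOME m'. \<zeta> (k - 1) = q powi (e (k - 1) - 2 * m')) = m'"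
      proof (rule some_equality[where P = "\<lambda>m'. \<zeta> (k - 1) = q powi (e (k - 1) - 2 * m')", OF that])
        fix m'' assume *: "\<zeta> (k - 1) = q powi (e (k - 1) - 2 * m'')"
        have "q powi (e (k - 1) - 2 * m'') = q powi (e (k - 1) - 2 * m')" by (rule trans[OF sym[OF *] that])
        then show "m'' = m'" by (simp add: powi_eq_iff)
      qed
      then show ?thesis using that unfolding m0_def by auto
    qed
    have "(\<lambda>m. q powi (e k - 2 * m)) ` {m0<..} \<subseteq> S \<zeta> k"
      unfolding S_def using m0 by fastforce
    moreover have "infinite ((\<lambda>m. q powi (e k - 2 * m)) ` {m0<..})"
      by (subst finite_image_iff) (auto simp: inj_on_def powi_eq_iff infinite_Ioi)
    ultimately show ?thesis by (metis finite_subset)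
  qed
  have "?L b - ?R b = 0"
  proof (rule ratfun_eq_0_if_grid[of S g "i + 3"])
    show "infinite (S \<zeta> k)" for \<zeta> k by (rule inf)
    show "g \<noteq> 0" by (rule g)
    show "S \<zeta> k = S \<zeta>' k" if "\<And>j. j < k \<Longrightarrow> \<zeta> j = \<zeta>' j" for \<zeta> \<zeta>' k
      using that[of "k - 1"] unfolding S_def by (cases "k = 0") simp_all
    fix \<zeta> assume grid: "\<And>k. k < i + 3 \<Longrightarrow> \<zeta> k \<in> S \<zeta> k" and gz: "peval \<zeta> g \<noteq> 0"
    obtain m1 where m1: "\<zeta> i = q powi (e i - 2 * m1)" using grid[of i] unfolding S_def by auto
    obtain m2 where m2: "\<zeta> (Suc i) = q powi (e (Suc i) - 2 * m2)" "m2 - m1 > 8 * R"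
      using grid[of "Suc i"] m1 unfolding S_def by auto
    obtain m3 where m3: "\<zeta> (Suc (Suc i)) = q powi (e (Suc (Suc i)) - 2 * m3)" "m3 - m2 > 8 * R"
      using grid[of "Suc (Suc i)"] m2 unfolding S_def by auto
    define Z1 Z2 Z3 where Z: "Z1 = q powi (2 - 2 * m1 - 2 * l3)" "Z2 = q powi (- 2 * m2 - 2 * l2)" "Z3 = q powi (- 2 - 2 * m3 - 2 * l1)"
    have z: "\<zeta> i = q powi (2 - 2 * m1 - l3)" "\<zeta> (Suc i) = q powi (- 2 * m2 - l2)" "\<zeta> (Suc (Suc i)) = q powi (- 2 - 2 * m3 - l1)"
      unfolding m1 m2(1) m3(1) e_def by (rule arg_cong[where f = "(powi) q"], simp)+
    have ZZ: "Z1 = q powi (- l3) * \<zeta> i" "Z2 = q powi (- l2) * \<zeta> (Suc i)" "Z3 = q powi (- l1) * \<zeta> (Suc (Suc i))"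
      unfolding Z z power_int_add[symmetric, OF disjI1[OF q_nz]] by (rule arg_cong[where f = "(powi) q"], simp)+
    have pL: "peval \<zeta> (L (\<alpha>, \<beta>, \<gamma>)) = \<alpha> * Z1 + \<beta> * Z2 + \<gamma> * Z3" for \<alpha> \<beta> \<gamma>
      unfolding L_def ZZ by (simp add: peval_lin3)
    have "peval \<zeta> (L x) \<noteq> 0" if "p \<in> D" "x \<in> T p" for p x
      using gz that finD finT unfolding g_def peval_prod by auto
    then have T: "\<alpha> * Z1 + \<beta> * Z2 + \<gamma> * Z3 \<noteq> 0" if "p \<in> D" "(\<alpha>, \<beta>, \<gamma>) \<in> T p" for p \<alpha> \<beta> \<gamma>
      using that pL by metis
    have apart: "apart X Y Z" if "\<And>p. p \<in> D \<Longrightarrow> A1 p * X + A2 p * Y + A3 p * Z \<noteq> 0" for X Y Z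
      unfolding apart_def using that by (auto simp: D_def A1_def A2_def A3_def)
    have ap: "apart Z1 Z2 Z3" "apart Z2 Z1 Z3" "apart Z2 Z3 Z1" "apart Z3 Z2 Z1" "apart Z1 Z3 Z2" "apart Z3 Z1 Z2"
    proof -
      show "apart Z1 Z2 Z3" by (rule apart) (use T[of _ "A1 _" "A2 _" "A3 _"] in \<open>simp add: T_def add_ac\<close>)
      show "apart Z2 Z1 Z3" by (rule apart) (use T[of _ "A2 _" "A1 _" "A3 _"] in \<open>simp add: T_def add_ac\<close>)
      show "apart Z2 Z3 Z1" by (rule apart) (use T[of _ "A3 _" "A1 _" "A2 _"] in \<open>simp add: T_def add_ac\<close>)
      show "apart Z3 Z2 Z1" by (rule apart) (use T[of _ "A3 _" "A2 _" "A1 _"] in \<open>simp add: T_def add_ac\<close>)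
      show "apart Z1 Z3 Z2" by (rule apart) (use T[of _ "A1 _" "A3 _" "A2 _"] in \<open>simp add: T_def add_ac\<close>)
      show "apart Z3 Z1 Z2" by (rule apart) (use T[of _ "A2 _" "A3 _" "A1 _"] in \<open>simp add: T_def add_ac\<close>)
    qed
    have good: "good (\<zeta> k') (\<zeta> k)" if "\<zeta> k = q powi c" "\<zeta> k' = q powi c'" "c - c' > 6 * R" for k k' c c'
      unfolding good_def that(1,2)
    proof (intro allI impI)
      fix n assume "n \<le> nat (6 * R)"
      then have "int n + c' \<noteq> c" using that(3) R_nonneg by linarith
      then have "q powi c \<noteq> q powi (int n + c')" by (simp add: powi_eq_iff)
      then show "q powi c - q ^ n * q powi c' \<noteq> 0" by (simp add: power_int_add)
    qed
    show "has_value (?L b - ?R b) \<zeta> 0"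
    proof (cases "y = 0")
      case True
      have z0: "dref j (\<lambda>_. 0) = (\<lambda>_. 0)" for j
        by (simp add: dyn_reflection_def fun_eq_iff swap_ratfun_rconst[of _ 0, simplified])
      have "const_vec y = (\<lambda>_. 0)" by (simp add: True const_vec_def representation_zero fun_eq_iff)
      then show ?thesis using has_value_rconst[of 0 \<zeta>] by (simp add: z0)
    next
      case False
      have lb: "\<bar>l1\<bar> \<le> R" "\<bar>l2\<bar> \<le> R" "\<bar>l3\<bar> \<le> R"
        using ws_bound[OF y False] by (simp_all add: l)
      have g12: "good (\<zeta> (Suc i)) (\<zeta> i)" by (rule good[OF z(1,2)]) (use m2 m3 lb in linarith)
      have g23: "good (\<zeta> (Suc (Suc i))) (\<zeta> (Suc i))" by (rule good[OF z(2,3)]) (use m2 m3 lb in linarith)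
      have g13: "good (\<zeta> (Suc (Suc i))) (\<zeta> i)" by (rule good[OF z(1,3)]) (use m2 m3 lb in linarith)
      let ?s = "transpose i (Suc i)" and ?r = "transpose (Suc i) (Suc (Suc i))"
      let ?z1 = "\<zeta> i" and ?z2 = "\<zeta> (Suc i)" and ?z3 = "\<zeta> (Suc (Suc i))"
      have e: "(\<zeta> \<circ> ?s) (Suc i) = ?z1" "(\<zeta> \<circ> ?s) (Suc (Suc i)) = ?z3" "(\<zeta> \<circ> ?s \<circ> ?r) i = ?z2" "(\<zeta> \<circ> ?s \<circ> ?r) (Suc i) = ?z3"
        "(\<zeta> \<circ> ?r) (Suc i) = ?z3" "(\<zeta> \<circ> ?r) i = ?z1" "(\<zeta> \<circ> ?r \<circ> ?s) (Suc i) = ?z1" "(\<zeta> \<circ> ?r \<circ> ?s) (Suc (Suc i)) = ?z2"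
        by (simp_all add: transpose_def)
      note v = valued_dref[OF i(1)] and v' = valued_dref[OF i(2)]
      have "valued (dref i (const_vec y)) (\<zeta> \<circ> ?s \<circ> ?r) (dyn_op i ?z3 ?z2 y)"
        using v[OF valued_const, of "\<zeta> \<circ> ?s \<circ> ?r" y] g23 unfolding e by blast
      from v'[OF this] have "valued (dref (Suc i) (dref i (const_vec y))) (\<zeta> \<circ> ?s) (dyn_op (Suc i) ?z3 ?z1 (dyn_op i ?z3 ?z2 y))"
        using g13 unfolding e by blast
      from v[OF this g12] have vL: "valued ?L \<zeta> (dyn_op i ?z2 ?z1 (dyn_op (Suc i) ?z3 ?z1 (dyn_op i ?z3 ?z2 y)))" .
      have "valued (dref (Suc i) (const_vec y)) (\<zeta> \<circ> ?r \<circ> ?s) (dyn_op (Suc i) ?z2 ?z1 y)"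
        using v'[OF valued_const, of "\<zeta> \<circ> ?r \<circ> ?s" y] g12 unfolding e by blast
      from v[OF this] have "valued (dref i (dref (Suc i) (const_vec y))) (\<zeta> \<circ> ?r) (dyn_op i ?z3 ?z1 (dyn_op (Suc i) ?z2 ?z1 y))"
        using g13 unfolding e by blast
      from v'[OF this g23] have vR: "valued ?R \<zeta> (dyn_op (Suc i) ?z3 ?z2 (dyn_op i ?z3 ?z1 (dyn_op (Suc i) ?z2 ?z1 y)))" .
      have eq: "dyn_op i ?z2 ?z1 (dyn_op (Suc i) ?z3 ?z1 (dyn_op i ?z3 ?z2 y)) = dyn_op (Suc i) ?z3 ?z2 (dyn_op i ?z3 ?z1 (dyn_op (Suc i) ?z2 ?z1 y))"
        by (rule braid_at_point[OF i y l m2(2) m3(2) Z ap z])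
      show ?thesis
        using has_value_diff[of "?L b" \<zeta> _ "?R b"] vL vR unfolding valued_def eq by (metis diff_self)
    qed
  qed
  then show "?L b = ?R b" by simp
qed

end

section \<open>Unitarity, commutation and reduction to constant vectors\<close>

lemma rconst_add: "rconst (x + y) = rconst x + rconst y"
  by (simp add: rconst_def single_add)

lemma rconst_1: "rconst 1 = 1"
  by (simp add: rconst_def One_fract_def)

lemma rconst_sum: "rconst (sum f A) = (\<Sum>x\<in>A. rconst (f x))"
  by (induction A rule: infinite_finite_induct) (simp_all add: rconst_add)

lemma swap_ratfun_1: "swap_ratfun i 1 = 1"
  using swap_ratfun_rconst[of i 1] by (simp add: rconst_1)

context type_I_module
begin

lemma representation_sum: "representation B (sum f A) b = (\<Sum>x\<in>A. representation B (f x) b)"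
  by (induction A rule: infinite_finite_induct)
    (simp_all add: representation_zero representation_add[OF independent_Basis] span_Basis)

lemma const_vec_sum: "const_vec (sum f A) = (\<lambda>b. \<Sum>x\<in>A. 1 * const_vec (f x) b)"
  by (rule ext) (simp add: const_vec_def representation_sum rconst_sum)

lemma dref_sum: "dref i (\<lambda>b. \<Sum>x\<in>A. r x * h x b) = (\<lambda>b. \<Sum>x\<in>A. swap_ratfun i (r x) * dref i (h x) b)"
proof
  fix b
  have "dref i (\<lambda>b. \<Sum>x\<in>A. r x * h x b) b = (\<Sum>c\<in>B. \<Sum>x\<in>A. swap_ratfun i (r x) * (swap_ratfun i (dyn_matrix M q scale B E F t i b c) * swap_ratfun i (h x c)))"
    unfolding dyn_reflection_def swap_ratfun_sum swap_ratfun_mult sum_distrib_left by (simp add: mult.left_commute)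
  also have "\<dots> = (\<Sum>x\<in>A. swap_ratfun i (r x) * dref i (h x) b)"
    unfolding dyn_reflection_def sum_distrib_left by (rule sum.swap)
  finally show "dref i (\<lambda>b. \<Sum>x\<in>A. r x * h x b) b = (\<Sum>x\<in>A. swap_ratfun i (r x) * dref i (h x) b)" .
qed

lemma dref_add: "dref i (\<lambda>b. f b + h b) = (\<lambda>b. dref i f b + dref i h b)"
  by (simp add: dyn_reflection_def swap_ratfun_add distrib_left sum.distrib)

lemma dref_rconst: "dref i (\<lambda>b. rconst c * f b) = (\<lambda>b. rconst c * dref i f b)"
  by (simp add: dyn_reflection_def swap_ratfun_mult swap_ratfun_rconst sum_distrib_left mult.left_commute)

lemma dref_word_sum:
  "foldr dref w (\<lambda>b. \<Sum>x\<in>A. r x * h x b) = (\<lambda>b. \<Sum>x\<in>A. foldr swap_ratfun w (r x) * foldr dref w (h x) b)"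
  by (induction w) (simp_all add: dref_sum)

lemma swap_word_1: "foldr swap_ratfun w 1 = 1"
  by (induction w) (simp_all add: swap_ratfun_1)

text \<open>
  Reduction to constant functions: every rational vector is a combination of constant ones with
  rational coefficients, and a product of reflections is additive and transforms the coefficients by the
  corresponding substitution of variables.
\<close>

lemma dref_word_eqI:
  assumes cv: "\<And>y \<omega>. y \<in> ws \<omega> \<Longrightarrow> \<omega> \<in> weights M \<Longrightarrow> foldr dref u (const_vec y) = foldr dref v (const_vec y)"
    and sw: "\<And>r. foldr swap_ratfun u r = foldr swap_ratfun v r"
    and f: "\<And>b. b \<notin> B \<Longrightarrow> f b = 0"
  shows "foldr dref u f = foldr dref v f"
proof -
  have c: "foldr dref u (const_vec y) = foldr dref v (const_vec y)" for y
  proof -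
    have y: "const_vec y = (\<lambda>b. \<Sum>\<mu>\<in>P. 1 * const_vec (wcomp \<mu> y) b)"
      using const_vec_sum[of "\<lambda>\<mu>. wcomp \<mu> y" P] by (simp only: sum_wcomp)
    have "foldr dref u (const_vec (wcomp \<mu> y)) = foldr dref v (const_vec (wcomp \<mu> y))" if "\<mu> \<in> P" for \<mu>
      using cv[OF wcomp_ws, of \<mu> y] P_weights that by blast
    then show ?thesis unfolding y dref_word_sum swap_word_1 by simp
  qed
  have "f = (\<lambda>b. \<Sum>e\<in>B. f e * const_vec e b)"
  proof
    fix b
    have "(\<Sum>e\<in>B. f e * const_vec e b) = (\<Sum>e\<in>B. if e = b then f e else 0)"
      by (rule sum.cong) (auto simp: const_vec_def representation_basis[OF independent_Basis] rconst_1)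
    also have "\<dots> = f b" using f[of b] by (simp add: finite_Basis)
    finally show "f b = (\<Sum>e\<in>B. f e * const_vec e b)" ..
  qed
  then have "foldr dref w f = (\<lambda>b. \<Sum>e\<in>B. foldr swap_ratfun w (f e) * foldr dref w (const_vec e) b)" for w
    using dref_word_sum[of w f const_vec B] by simp
  then show ?thesis by (simp only: c sw)
qed

lemma dref_rational_vectors:
  assumes i: "i \<in> {1..<M}" and f: "f \<in> rational_vectors M B"
  shows "dref i f \<in> rational_vectors M B"
proof -
  have coeff: "dyn_coeff q i \<mu> j \<in> ratfuns M" for \<mu> j
    unfolding dyn_coeff_def Let_def divide_inverse
    by (intro ratfuns_mult ratfuns_rconst ratfuns_inverse ratfuns_diff ratfuns_rvar) (use i in auto)
  have D: "dyn_matrix M q scale B E F t i b c \<in> ratfuns M" for b c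
    unfolding dyn_matrix_eq[OF i] by (intro ratfuns_sum ratfuns_mult coeff ratfuns_rconst)
  have 0: "dyn_matrix M q scale B E F t i b c = 0" if "b \<notin> B" for b c
  proof -
    have "representation B v b = 0" for v using representation_ne_zero[of B v b] that by blast
    then show ?thesis unfolding dyn_matrix_eq[OF i] by simp
  qed
  have s0: "swap_ratfun i 0 = 0" using swap_ratfun_rconst[of i 0] by simp
  show ?thesis using f
    unfolding rational_vectors_def dyn_reflection_def
    by (auto intro!: ratfuns_sum ratfuns_mult ratfuns_swap[OF i] D simp: 0 s0)
qed

lemma pow_eq_0: 
  assumes i: "i \<in> {1..<M}" and v: "v \<in> ws \<mu>" "\<mu> \<in> weights M"
  shows "(F i ^^ Suc (nat (2 * R))) v = 0" "(E i ^^ Suc (nat (2 * R))) v = 0"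
proof -
  let ?n = "Suc (nat (2 * R))"
  have n: "int ?n > 2 * R" by linarith
  have "dF i ?n v = 0" by (rule dF_eq_0[OF i v n])
  then show "(F i ^^ ?n) v = 0" by (simp add: divided_power_def del: funpow.simps)
  have "dE i ?n v = 0"
  proof (rule ccontr)
    assume nz: "dE i ?n v \<noteq> 0"
    have "(\<lambda>k. \<mu> k + int ?n * simple_root i k) \<in> weights M"
      using v(2) simple_root_weights[OF i] by (auto simp: weights_def)
    from ws_bound[OF ws_dE[OF i v(1), of ?n] this nz, of i] have "\<bar>\<mu> i + int ?n\<bar> \<le> R" by (simp add: simple_root_def del: of_nat_Suc)
    moreover have "v \<noteq> 0"
    proof
      interpret s: qsl2 q scale "E i" "F i" "Xi i" by (rule qsl2_i[OF i])
      assume "v = 0" then show False using nz s.dE.zero by simp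
    qed
    from ws_bound[OF v this, of i] have "\<bar>\<mu> i\<bar> \<le> R" .
    ultimately show False using n by linarith
  qed
  then show "(E i ^^ ?n) v = 0" by (simp add: divided_power_def del: funpow.simps)
qed

text \<open>
  Dividing numerator and denominator of the coefficients by \<open>zj\<close> gives the sum defining \<open>esum\<close>.
\<close>

lemma sum_dyn_factor: 
  assumes zj: "zj \<noteq> 0"
  shows "(\<Sum>j\<le>p. dyn_factor j d zi zj * ebin d p j) = esum d p (q ^ d * zi / zj)"
  unfolding esum_def
proof (rule sum.cong[OF refl])
  fix j
  have "zj - q ^ d * zi = zj * (1 - q ^ d * zi / zj)" "zj - q ^ (2 * j + d) * zi = zj * (1 - q ^ (2 * j) * (q ^ d * zi / zj))"
    using zj by (simp_all add: field_simps power_add)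
  then have "(zj - q ^ d * zi) / (zj - q ^ (2 * j + d) * zi) = (1 - q ^ d * zi / zj) / (1 - q ^ (2 * j) * (q ^ d * zi / zj))"
    using zj by simp
  then show "dyn_factor j d zi zj * ebin d p j = (- q) ^ j * ((1 - q ^ d * zi / zj) / (1 - q ^ (2 * j) * (q ^ d * zi / zj))) * ebin d p j"
    unfolding dyn_factor_def by simp
qed

text \<open>
  On weight vectors both operators are of the form \<open>dynA\<close> in opposite weights, so the scalars of
  \<open>esum_unitary\<close> apply.
\<close>

lemma dyn_op_unitary:
  assumes i: "i \<in> {1..<M}" and y: "y \<in> ws \<mu>" "\<mu> \<in> weights M"
    and z: "z1 \<noteq> 0" "z2 \<noteq> 0" "good z1 z2" "good z2 z1"
  shows "dyn_op i z1 z2 (dyn_op i z2 z1 y) = y"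
proof (cases "y = 0")
  case True
  interpret A: Vector_Spaces.linear scale scale "dyn_op i x x'" for x x' by (rule linear_dyn_op[OF i])
  show ?thesis using True by (simp add: A.zero)
next
  case False
  interpret s: qsl2 q scale "E i" "F i" "Xi i" by (rule qsl2_i[OF i])
  define h d where "h = \<mu> i - \<mu> (Suc i)" and "d = nat \<bar>h\<bar>"
  have d2: "int d \<le> 2 * R" using ws_bound[OF y False, of i] ws_bound[OF y False, of "Suc i"] by (simp add: d_def h_def)
  have A: "dyn_op_wt i \<nu> zi zj v = s.dynA (nat (2 * R)) (\<nu> i - \<nu> (Suc i)) (\<lambda>j. dyn_factor j (nat \<bar>\<nu> i - \<nu> (Suc i)\<bar>) zi zj) v" for \<nu> zi zj v
    by (simp add: dyn_op_wt_def s.dynA_def dyn_term_def)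
  have nz: "1 - q ^ (2 * t) * (q ^ d * zi / zj) \<noteq> 0" if "t \<le> p" "p \<le> nat (2 * R)" "good zi zj" "zj \<noteq> 0" for t p zi zj
  proof -
    have "2 * t + d \<le> nat (6 * R)" using that d2 by linarith
    then have "zj - q ^ (2 * t + d) * zi \<noteq> 0" using that unfolding good_def by blast
    then show ?thesis using that(4) by (simp add: field_simps power_add)
  qed
  have one: "(\<Sum>j\<le>p. dyn_factor j d z1 z2 * ebin d p j) * (\<Sum>j\<le>p. dyn_factor j d z2 z1 * ebin d p j) = 1" if p: "p \<le> nat (2 * R)" for p
    unfolding sum_dyn_factor[OF z(1)] sum_dyn_factor[OF z(2)]
  proof (rule esum_unitary)
    show "1 - q ^ (2 * t) * (q ^ d * z2 / z1) \<noteq> 0" if "t \<le> p" for t by (rule nz[OF that p z(4,1)])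
    show "1 - q ^ (2 * t) * (q ^ d * z1 / z2) \<noteq> 0" if "t \<le> p" for t by (rule nz[OF that p z(3,2)])
    show "q ^ d * z2 / z1 * (q ^ d * z1 / z2) = q ^ (2 * d)" using z by (simp add: power_mult power2_eq_square mult.commute[of 2])
  qed
  have sub: "subspace (Xi i h)" for h
    unfolding subspace_def Xi_def using simple_root_weights[OF i] by (auto simp: t_lin scale_right_distrib mult.commute)
  have e: "(\<mu> \<circ> transpose i (Suc i)) i - (\<mu> \<circ> transpose i (Suc i)) (Suc i) = - h" by (simp add: h_def)
  have "dyn_op i z1 z2 (dyn_op i z2 z1 y) = s.dynA (nat (2 * R)) (- h) (\<lambda>j. dyn_factor j d z1 z2) (s.dynA (nat (2 * R)) h (\<lambda>j. dyn_factor j d z2 z1) y)"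
    unfolding dyn_op_ws[OF i ws_dyn_op[OF i y]] A e unfolding dyn_op_ws[OF i y] A h_def[symmetric] d_def by simp
  also have "\<dots> = y"
  proof (rule s.dynA_unitary[OF sub])
    show "y \<in> Xi i h" unfolding h_def by (rule ws_Xi[OF i y(1)])
  qed (use pow_eq_0[OF i y] one in \<open>simp_all add: d_def del: funpow.simps\<close>)
  finally show ?thesis .
qed

text \<open>
  Given the previous coordinate, only finitely many values of the next one are excluded.
\<close>

lemma ratfun_eq_0_if_good:
  assumes "\<And>\<zeta>. (\<And>k. k \<in> {1..n} \<Longrightarrow> \<zeta> k \<noteq> 0) \<Longrightarrow>
      (\<And>k. k \<in> {1..<n} \<Longrightarrow> good (\<zeta> k) (\<zeta> (Suc k)) \<and> good (\<zeta> (Suc k)) (\<zeta> k)) \<Longrightarrow> has_value r \<zeta> 0"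
  shows "r = 0"
proof -
  define S where "S \<zeta> k = (if k = 0 then UNIV else {z. z \<noteq> 0 \<and> good (\<zeta> (k - 1)) z \<and> good z (\<zeta> (k - 1))})"
    for \<zeta> :: "nat \<Rightarrow> complex" and k
  show ?thesis
  proof (rule ratfun_eq_0_if_grid[of S 1 "Suc n"])
    show "infinite (S \<zeta> k)" for \<zeta> k
    proof -
      let ?c = "\<zeta> (k - 1)" and ?N = "{..nat (6 * R)}"
      have "- S \<zeta> k \<subseteq> {0} \<union> (\<lambda>n. q ^ n * ?c) ` ?N \<union> (\<lambda>n. ?c / q ^ n) ` ?N"
      proof
        fix z assume "z \<in> - S \<zeta> k"
        then consider "z = 0" | n where "n \<le> nat (6 * R)" "z - q ^ n * ?c = 0" | n where "n \<le> nat (6 * R)" "?c - q ^ n * z = 0"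
          unfolding S_def good_def by (auto split: if_splits)
        then show "z \<in> {0} \<union> (\<lambda>n. q ^ n * ?c) ` ?N \<union> (\<lambda>n. ?c / q ^ n) ` ?N"
          by cases (auto simp: field_simps intro!: image_eqI)
      qed
      then have "finite (- S \<zeta> k)" by (rule finite_subset) simp
      then show ?thesis using infinite_UNIV_char_0 by (metis finite_Un Compl_partition)
    qed
    show "S \<zeta> k = S \<zeta>' k" if "\<And>j. j < k \<Longrightarrow> \<zeta> j = \<zeta>' j" for \<zeta> \<zeta>' k
      using that[of "k - 1"] unfolding S_def by (cases "k = 0") simp_all
    show "(1 :: cpoly) \<noteq> 0" by simp
    fix \<zeta> assume grid: "\<And>k. k < Suc n \<Longrightarrow> \<zeta> k \<in> S \<zeta> k"
    show "has_value r \<zeta> 0"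
    proof (rule assms)
      show "\<zeta> k \<noteq> 0" if "k \<in> {1..n}" for k using grid[of k] that by (simp add: S_def split: if_splits)
      show "good (\<zeta> k) (\<zeta> (Suc k)) \<and> good (\<zeta> (Suc k)) (\<zeta> k)" if "k \<in> {1..<n}" for k
        using grid[of "Suc k"] that by (simp add: S_def)
    qed
  qed
qed

lemma eq_if_good:
  assumes "\<And>\<zeta>. (\<And>k. k \<in> {1..M} \<Longrightarrow> \<zeta> k \<noteq> 0) \<Longrightarrow>
      (\<And>k. k \<in> {1..<M} \<Longrightarrow> good (\<zeta> k) (\<zeta> (Suc k)) \<and> good (\<zeta> (Suc k)) (\<zeta> k)) \<Longrightarrow> \<exists>w. valued f \<zeta> w \<and> valued g \<zeta> w"
  shows "f = g"
proof
  fix b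
  have "f b - g b = 0"
  proof (rule ratfun_eq_0_if_good[of M])
    fix \<zeta>
    assume "\<And>k. k \<in> {1..M} \<Longrightarrow> \<zeta> k \<noteq> 0"
      "\<And>k. k \<in> {1..<M} \<Longrightarrow> good (\<zeta> k) (\<zeta> (Suc k)) \<and> good (\<zeta> (Suc k)) (\<zeta> k)"
    then have "\<exists>w. valued f \<zeta> w \<and> valued g \<zeta> w" by (rule assms)
    then obtain w where "valued f \<zeta> w" "valued g \<zeta> w" by blast
    then show "has_value (f b - g b) \<zeta> 0"
      using has_value_diff[of "f b" \<zeta> "representation B w b" "g b" "representation B w b"] by (simp add: valued_def)
  qed
  then show "f b = g b" by simp
qed

lemma dref_involutive_const:
  assumes i: "i \<in> {1..<M}" and y: "y \<in> ws \<omega>" "\<omega> \<in> weights M"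
  shows "dref i (dref i (const_vec y)) = const_vec y"
proof (rule eq_if_good)
  fix \<zeta> :: "nat \<Rightarrow> complex"
  assume nz: "\<And>k. k \<in> {1..M} \<Longrightarrow> \<zeta> k \<noteq> 0"
    and good: "\<And>k. k \<in> {1..<M} \<Longrightarrow> good (\<zeta> k) (\<zeta> (Suc k)) \<and> good (\<zeta> (Suc k)) (\<zeta> k)"
  have g: "good (\<zeta> i) (\<zeta> (Suc i))" "good (\<zeta> (Suc i)) (\<zeta> i)" using good[OF i] by simp_all
  have z: "\<zeta> i \<noteq> 0" "\<zeta> (Suc i) \<noteq> 0" using nz i by simp_all
  have "valued (dref i (const_vec y)) (\<zeta> \<circ> transpose i (Suc i)) (dyn_op i (\<zeta> i) (\<zeta> (Suc i)) y)"
    using valued_dref[OF i valued_const, of "\<zeta> \<circ> transpose i (Suc i)" y] g by simp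
  from valued_dref[OF i this g(2)] have "valued (dref i (dref i (const_vec y))) \<zeta> y"
    by (simp add: dyn_op_unitary[OF i y z(2,1) g(2,1)])
  then show "\<exists>w. valued (dref i (dref i (const_vec y))) \<zeta> w \<and> valued (const_vec y) \<zeta> w"
    using valued_const by blast
qed

lemma funpow_commute:
  assumes "\<And>u. f (g u) = g (f u)"
  shows "(f ^^ n) ((g ^^ m) u) = (g ^^ m) ((f ^^ n) u)"
proof -
  have 1: "f ((g ^^ m) u) = (g ^^ m) (f u)" for u by (induction m) (simp_all add: assms)
  show ?thesis by (induction n) (simp_all add: 1)
qed

lemma dyn_term_commute:
  assumes i: "i \<in> {1..<M}" and j: "j \<in> {1..<M}" and ij: "Suc i < j"
  shows "dyn_term q scale E F i \<mu> m (dyn_term q scale E F j \<nu> n u) = dyn_term q scale E F j \<nu> n (dyn_term q scale E F i \<mu> m u)"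
proof -
  interpret si: qsl2 q scale "E i" "F i" "Xi i" by (rule qsl2_i[OF i])
  interpret sj: qsl2 q scale "E j" "F j" "Xi j" by (rule qsl2_i[OF j])
  have ij': "\<bar>int i - int j\<bar> \<ge> 2" "\<bar>int j - int i\<bar> \<ge> 2" "i \<noteq> j" using ij by auto
  have c: "E i (E j u) = E j (E i u)" "F i (F j u) = F j (F i u)" "E i (F j u) = F j (E i u)" "F i (E j u) = E j (F i u)" for u
    using serre_E_far[OF i j ij'(1)] serre_F_far[OF i j ij'(1)] E_F[OF i j, of u] E_F[OF j i, of u] ij'(3) by simp_all
  have "dE i n (dE j m u) = dE j m (dE i n u)" "dF i n (dF j m u) = dF j m (dF i n u)"
    "dE i n (dF j m u) = dF j m (dE i n u)" "dF i n (dE j m u) = dE j m (dF i n u)" for n m u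
    unfolding divided_power_def si.E_pow_scale si.F_pow_scale sj.E_pow_scale sj.F_pow_scale
    by (simp_all add: funpow_commute[of "E i" "E j"] funpow_commute[of "F i" "F j"] funpow_commute[of "E i" "F j"]
        funpow_commute[of "F i" "E j"] c mult.commute)
  then show ?thesis by (simp only: dyn_term_def)
qed

lemma dyn_op_far:
  assumes i: "i \<in> {1..<M}" and j: "j \<in> {1..<M}" and ij: "Suc i < j" and y: "y \<in> ws \<mu>" "\<mu> \<in> weights M"
  shows "dyn_op i a b (dyn_op j c d y) = dyn_op j c d (dyn_op i a b y)"
proof -
  interpret di: Vector_Spaces.linear scale scale "dyn_term q scale E F i \<kappa> l" for \<kappa> l by (rule linear_dyn_term[OF i])
  interpret dj: Vector_Spaces.linear scale scale "dyn_term q scale E F j \<kappa> l" for \<kappa> l by (rule linear_dyn_term[OF j])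
  have same: "dyn_op_wt k \<nu> a b v = dyn_op_wt k \<nu>' a b v" if "\<nu> k = \<nu>' k" "\<nu> (Suc k) = \<nu>' (Suc k)" for k \<nu> \<nu>' a b v
    using that by (simp add: dyn_op_wt_def dyn_term_def)
  have "dyn_op i a b (dyn_op j c d y) = dyn_op_wt i \<mu> a b (dyn_op_wt j \<mu> c d y)"
    unfolding dyn_op_ws[OF i ws_dyn_op[OF j y]] unfolding dyn_op_ws[OF j y] by (rule same) (use ij in \<open>simp_all add: transpose_def\<close>)
  also have "\<dots> = dyn_op_wt j \<mu> c d (dyn_op_wt i \<mu> a b y)"
    unfolding dyn_op_wt_def di.sum dj.sum di.scale dj.scale scale_sum_right dyn_term_commute[OF i j ij]
    by (subst sum.swap) (simp add: mult.commute)
  also have "\<dots> = dyn_op j c d (dyn_op i a b y)"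
    unfolding dyn_op_ws[OF j ws_dyn_op[OF i y]] unfolding dyn_op_ws[OF i y] by (rule same) (use ij in \<open>simp_all add: transpose_def\<close>)
  finally show ?thesis .
qed

lemma dref_far_const:
  assumes i: "i \<in> {1..<M}" and j: "j \<in> {1..<M}" and ij: "Suc i < j" and y: "y \<in> ws \<omega>" "\<omega> \<in> weights M"
  shows "dref i (dref j (const_vec y)) = dref j (dref i (const_vec y))"
proof (rule eq_if_good)
  fix \<zeta> :: "nat \<Rightarrow> complex"
  assume good: "\<And>k. k \<in> {1..<M} \<Longrightarrow> good (\<zeta> k) (\<zeta> (Suc k)) \<and> good (\<zeta> (Suc k)) (\<zeta> k)"
  have g: "good (\<zeta> (Suc i)) (\<zeta> i)" "good (\<zeta> (Suc j)) (\<zeta> j)" using good[OF i] good[OF j] by simp_all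
  let ?s = "transpose i (Suc i)" and ?r = "transpose j (Suc j)"
  have e: "(\<zeta> \<circ> ?s) j = \<zeta> j" "(\<zeta> \<circ> ?s) (Suc j) = \<zeta> (Suc j)" "(\<zeta> \<circ> ?r) i = \<zeta> i" "(\<zeta> \<circ> ?r) (Suc i) = \<zeta> (Suc i)"
    using ij by (simp_all add: transpose_def)
  have "valued (dref j (const_vec y)) (\<zeta> \<circ> ?s) (dyn_op j (\<zeta> (Suc j)) (\<zeta> j) y)"
    using valued_dref[OF j valued_const, of "\<zeta> \<circ> ?s" y] g unfolding e by blast
  from valued_dref[OF i this g(1)]
  have 1: "valued (dref i (dref j (const_vec y))) \<zeta> (dyn_op i (\<zeta> (Suc i)) (\<zeta> i) (dyn_op j (\<zeta> (Suc j)) (\<zeta> j) y))" .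
  have "valued (dref i (const_vec y)) (\<zeta> \<circ> ?r) (dyn_op i (\<zeta> (Suc i)) (\<zeta> i) y)"
    using valued_dref[OF i valued_const, of "\<zeta> \<circ> ?r" y] g unfolding e by blast
  from valued_dref[OF j this g(2)]
  have 2: "valued (dref j (dref i (const_vec y))) \<zeta> (dyn_op j (\<zeta> (Suc j)) (\<zeta> j) (dyn_op i (\<zeta> (Suc i)) (\<zeta> i) y))" .
  show "\<exists>w. valued (dref i (dref j (const_vec y))) \<zeta> w \<and> valued (dref j (dref i (const_vec y))) \<zeta> w"
    using 1 2 dyn_op_far[OF i j ij y] by metis
qed

lemma dref_relations:
  assumes f: "f \<in> rational_vectors M B"
  shows "i \<in> {1..<M} \<Longrightarrow> dref i (dref i f) = f"
    and "i \<in> {1..<M} \<Longrightarrow> Suc i \<in> {1..<M} \<Longrightarrow> dref i (dref (Suc i) (dref i f)) = dref (Suc i) (dref i (dref (Suc i) f))"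
    and "i \<in> {1..<M} \<Longrightarrow> j \<in> {1..<M} \<Longrightarrow> Suc i < j \<Longrightarrow> dref i (dref j f) = dref j (dref i f)"
proof -
  have f0: "\<And>b. b \<notin> B \<Longrightarrow> f b = 0" using f by (simp add: rational_vectors_def)
  show "dref i (dref i f) = f" if "i \<in> {1..<M}"
    using dref_word_eqI[of "[i, i]" "[]" f, OF _ _ f0] dref_involutive_const[OF that] by simp
  show "dref i (dref (Suc i) (dref i f)) = dref (Suc i) (dref i (dref (Suc i) f))" if "i \<in> {1..<M}" "Suc i \<in> {1..<M}"
    using dref_word_eqI[of "[i, Suc i, i]" "[Suc i, i, Suc i]" f, OF _ _ f0] braid_const_ws[OF that] swap_ratfun_braid by simp
  show "dref i (dref j f) = dref j (dref i f)" if "i \<in> {1..<M}" "j \<in> {1..<M}" "Suc i < j"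
    using dref_word_eqI[of "[i, j]" "[j, i]" f, OF _ _ f0] dref_far_const[OF that] swap_ratfun_far[OF that(3)] by simp
qed

end

section \<open>The symmetric group by generators and relations\<close>

text \<open>
  The congruence generated by the Coxeter relations, oriented as needed for the reduction to
  normal form.  Generating it inductively on words makes the reduction available both for permutations and
  for any action satisfying the relations.
\<close>

inductive weq :: "nat list \<Rightarrow> nat list \<Rightarrow> bool" where
  weq_refl: "weq w w"
| weq_trans: "weq u v \<Longrightarrow> weq v w \<Longrightarrow> weq u w"
| weq_inv: "weq (a @ [i, i] @ b) (a @ b)"
| weq_braid: "weq (a @ [Suc i, i, Suc i] @ b) (a @ [i, Suc i, i] @ b)"
| weq_far: "Suc i < j \<or> Suc j < i \<Longrightarrow> weq (a @ [i, j] @ b) (a @ [j, i] @ b)"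

lemma weq_cong: "weq u v \<Longrightarrow> weq (c @ u @ d) (c @ v @ d)"
proof (induction rule: weq.induct)
  case (weq_inv a i b)
  show ?case using weq.weq_inv[of "c @ a" i "b @ d"] by simp
next
  case (weq_braid a i b)
  show ?case using weq.weq_braid[of "c @ a" i "b @ d"] by simp
next
  case (weq_far i j a b)
  then show ?case using weq.weq_far[of i j "c @ a" "b @ d"] by simp
qed (blast intro: weq.intros)+

lemma weq_set: "weq u v \<Longrightarrow> set v \<subseteq> set u"
  by (induction rule: weq.induct) auto

lemma weq_shift:
  assumes "\<And>j. j \<in> set c \<Longrightarrow> Suc i < j \<or> Suc j < i"
  shows "weq (i # c) (c @ [i])"
  using assms
proof (induction c)
  case (Cons j c)
  have "weq (i # j # c) (j # i # c)" using weq_far[of i j "[]" c] Cons.prems[of j] by simp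
  moreover have "weq (j # i # c) (j # c @ [i])" using weq_cong[of "i # c" "c @ [i]" "[j]" "[]"] Cons by simp
  ultimately show ?case using weq_trans by simp
qed (simp add: weq_refl)

text \<open>
  Every word in the first \<open>n\<close> generators can be brought into the form \<open>s\<^sub>k s\<^sub>k\<^sub>+\<^sub>1 \<dots> s\<^sub>n u\<close> with \<open>u\<close> in the first
  \<open>n - 1\<close> generators.  It suffices to multiply such a form by a generator \<open>s\<^sub>i\<close> from the left: for \<open>i = k - 1\<close>
  the first factor grows, for \<open>i = k\<close> it shrinks, for \<open>i < k - 1\<close> the generator passes through, and for
  \<open>i > k\<close> it becomes \<open>s\<^sub>i\<^sub>-\<^sub>1\<close> by a braid relation and then passes through.
\<close>

lemma weq_normal_form:
  "set w \<subseteq> {1..n} \<Longrightarrow> \<exists>k u. k \<in> {1..Suc n} \<and> set u \<subseteq> {1..<n} \<and> weq w ([k..<Suc n] @ u)"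
proof (induction w)
  case Nil
  show ?case by (rule exI[of _ "Suc n"], rule exI[of _ "[]"]) (simp add: weq_refl)
next
  case (Cons i w)
  then obtain k u where k: "k \<in> {1..Suc n}" and u: "set u \<subseteq> {1..<n}" and w: "weq w ([k..<Suc n] @ u)" by auto
  have i: "1 \<le> i" "i \<le> n" using Cons.prems by auto
  have iw: "weq (i # w) (i # [k..<Suc n] @ u)" using weq_cong[OF w, of "[i]" "[]"] by simp
  consider "Suc i = k" | "i = k" | "Suc i < k" | "k < i" by linarith
  then show ?case
  proof cases
    case 1
    then have e: "[i..<Suc n] = i # [k..<Suc n]" using i by (simp add: upt_conv_Cons)
    have "weq (i # w) ([i..<Suc n] @ u)" unfolding e append_Cons by (rule iw)
    then show ?thesis using u i by (intro exI[of _ i] exI[of _ u]) (simp del: upt_Suc)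
  next
    case 2
    then have e: "[k..<Suc n] = i # [Suc i..<Suc n]" using i by (simp add: upt_conv_Cons)
    have "weq (i # [k..<Suc n] @ u) ([Suc i..<Suc n] @ u)"
      using weq_inv[of "[]" i "[Suc i..<Suc n] @ u"] unfolding e by simp
    from weq_trans[OF iw this] show ?thesis using u i by (intro exI[of _ "Suc i"] exI[of _ u]) simp
  next
    case 3
    have "weq (i # [k..<Suc n]) ([k..<Suc n] @ [i])" by (rule weq_shift) (use 3 in auto)
    from weq_trans[OF iw, of "[k..<Suc n] @ i # u"] weq_cong[OF this, of "[]" u]
    have "weq (i # w) ([k..<Suc n] @ i # u)" by (simp del: upt_Suc)
    moreover have "set (i # u) \<subseteq> {1..<n}" using u i 3 k by auto
    ultimately show ?thesis using k by blast
  next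
    case 4
    obtain j where j: "i = Suc j" using i by (cases i) auto
    have s: "[k..<Suc n] = [k..<j] @ [j, i] @ [Suc i..<Suc n]"
    proof -
      have "[k..<Suc n] = [k..<j] @ [j..<Suc n]" using 4 i j upt_add_eq_append[of k j "Suc n - j"] by simp
      also have "[j..<Suc n] = j # i # [Suc i..<Suc n]" using i j by (simp add: upt_conv_Cons del: upt_Suc)
      finally show ?thesis by (simp del: upt_Suc)
    qed
    have 1: "weq (i # [k..<j]) ([k..<j] @ [i])" by (rule weq_shift) (use j in auto)
    have "weq (i # [k..<Suc n] @ u) ([k..<j] @ [i, j, i] @ [Suc i..<Suc n] @ u)"
      using weq_cong[OF 1, of "[]" "[j, i] @ [Suc i..<Suc n] @ u"] unfolding s by (simp del: upt_Suc)
    moreover have "weq ([k..<j] @ [i, j, i] @ [Suc i..<Suc n] @ u) ([k..<j] @ [j, i, j] @ [Suc i..<Suc n] @ u)"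
      unfolding j by (rule weq_braid)
    moreover have 2: "weq (j # [Suc i..<Suc n]) ([Suc i..<Suc n] @ [j])" by (rule weq_shift) (use j in auto)
    have "weq ([k..<j] @ [j, i, j] @ [Suc i..<Suc n] @ u) ([k..<Suc n] @ j # u)"
      using weq_cong[OF 2, of "[k..<j] @ [j, i]" u] unfolding s by (simp del: upt_Suc)
    ultimately have "weq (i # w) ([k..<Suc n] @ j # u)" using iw weq_trans by meson
    moreover have "set (j # u) \<subseteq> {1..<n}" using u i j 4 k by auto
    ultimately show ?thesis using k by blast
  qed
qed

definition wperm :: "nat list \<Rightarrow> nat \<Rightarrow> nat" where
  "wperm w = foldr (\<lambda>i \<pi>. transpose i (Suc i) \<circ> \<pi>) w id"

lemma wperm_simps [simp]: "wperm [] = id" "wperm (i # w) = transpose i (Suc i) \<circ> wperm w"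
  by (simp_all add: wperm_def)

lemma wperm_append: "wperm (u @ v) = wperm u \<circ> wperm v"
  by (induction u) (simp_all add: comp_assoc)

lemma weq_wperm: "weq u v \<Longrightarrow> wperm u = wperm v"
proof (induction rule: weq.induct)
  case (weq_far i j a b)
  then have "transpose i (Suc i) (transpose j (Suc j) k) = transpose j (Suc j) (transpose i (Suc i) k)" for k
    using transpose_far[of i j k] transpose_far[of j i k] by auto
  then show ?case by (simp add: wperm_append fun_eq_iff)
qed (simp_all add: wperm_append fun_eq_iff transpose_braid)

lemma wperm_fix: "set u \<subseteq> {1..<n} \<Longrightarrow> wperm u (Suc n) = Suc n"
  by (induction u) (auto simp: transpose_def)

lemma wperm_cycle: "k \<le> n \<Longrightarrow> wperm [k..<n] n = k"
  by (induction k rule: inc_induct) (simp_all add: upt_conv_Cons)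

lemma wperm_rev: "wperm (rev w) \<circ> wperm w = id"
  by (induction w) (simp_all add: wperm_append fun_eq_iff)

lemma wperm_permutes: "set w \<subseteq> {1..<M} \<Longrightarrow> wperm w permutes {1..M}"
  by (induction w) (auto intro!: permutes_compose permutes_swap_id simp: permutes_id)

text \<open>
  The normal form maps \<open>n + 1\<close> to \<open>k\<close>.  For the identity this forces \<open>k = n + 1\<close>, the first factor is
  empty, and the word lies in fewer generators.
\<close>

lemma weq_Nil: "set w \<subseteq> {1..n} \<Longrightarrow> wperm w = id \<Longrightarrow> weq w []"
proof (induction n arbitrary: w)
  case (Suc n)
  from weq_normal_form[OF Suc.prems(1)] obtain k u where
    k: "k \<in> {1..Suc (Suc n)}" and u: "set u \<subseteq> {1..<Suc n}" and w: "weq w ([k..<Suc (Suc n)] @ u)" by blast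
  have id: "wperm [k..<Suc (Suc n)] \<circ> wperm u = id" using weq_wperm[OF w] Suc.prems(2) by (simp only: wperm_append)
  have "(wperm [k..<Suc (Suc n)] \<circ> wperm u) (Suc (Suc n)) = k"
    using wperm_fix[OF u] wperm_cycle[of k "Suc (Suc n)"] k by (simp del: upt_Suc)
  then have "k = Suc (Suc n)" by (simp only: id id_apply)
  then have wu: "weq w u" and "wperm u = id" using w id by simp_all
  moreover have "set u \<subseteq> {1..n}" using u by auto
  ultimately show ?case using Suc.IH weq_trans by blast
qed (simp add: weq_refl)

text \<open>
  Dividing by the cycle that moves \<open>n + 1\<close> to its image reduces to a permutation of fewer points.
\<close>

lemma wperm_surj: "\<pi> permutes {1..M} \<Longrightarrow> \<exists>w. set w \<subseteq> {1..<M} \<and> wperm w = \<pi>"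
proof (induction M arbitrary: \<pi>)
  case 0
  then have "\<pi> = id" by (simp add: permutes_empty)
  then show ?case by (intro exI[of _ "[]"]) simp
next
  case (Suc n)
  define k where "k = \<pi> (Suc n)"
  have k: "1 \<le> k" "k \<le> Suc n" using permutes_in_image[OF Suc.prems, of "Suc n"] by (auto simp: k_def)
  define c where "c = [k..<Suc n]"
  have c: "set c \<subseteq> {1..<Suc n}" using k by (auto simp: c_def)
  have rc: "wperm c \<circ> wperm (rev c) = id" using wperm_rev[of "rev c"] by simp
  define \<sigma> where "\<sigma> = wperm (rev c) \<circ> \<pi>"
  have \<sigma>: "\<sigma> permutes {1..Suc n}"
    unfolding \<sigma>_def by (rule permutes_compose[OF Suc.prems wperm_permutes]) (use c in simp)
  have "\<sigma> (Suc n) = wperm (rev c) (wperm c (Suc n))"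
    using wperm_cycle[OF k(2)] by (simp add: \<sigma>_def c_def k_def)
  also have "\<dots> = Suc n" using wperm_rev[of c] by (metis comp_apply id_apply)
  finally have fix_: "\<sigma> (Suc n) = Suc n" .
  have "\<sigma> permutes {1..n}"
  proof (rule permutes_superset[OF \<sigma>])
    fix x assume "x \<in> {1..Suc n} - {1..n}"
    then show "\<sigma> x = x" using fix_ by (cases "x = Suc n") auto
  qed
  from Suc.IH[OF this] obtain w where w: "set w \<subseteq> {1..<n}" "wperm w = \<sigma>" by blast
  have "wperm (c @ w) = \<pi>"
    unfolding wperm_append w(2) \<sigma>_def comp_assoc[symmetric] rc by simp
  moreover have "set (c @ w) \<subseteq> {1..<Suc n}" using c w(1) by auto
  ultimately show ?case by blast
qed

text \<open>
  An action of the generators that satisfies the Coxeter relations on a set; such actions extend to the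
  symmetric group because words for the same permutation act in the same way (\<open>word_eq\<close>).
\<close>

locale coxeter_action =
  fixes M :: nat and T :: "nat \<Rightarrow> 'x \<Rightarrow> 'x" and V :: "'x set"
  assumes closed: "i \<in> {1..<M} \<Longrightarrow> x \<in> V \<Longrightarrow> T i x \<in> V"
    and invol: "i \<in> {1..<M} \<Longrightarrow> x \<in> V \<Longrightarrow> T i (T i x) = x"
    and braid: "i \<in> {1..<M} \<Longrightarrow> Suc i \<in> {1..<M} \<Longrightarrow> x \<in> V \<Longrightarrow>
      T i (T (Suc i) (T i x)) = T (Suc i) (T i (T (Suc i) x))"
    and far: "i \<in> {1..<M} \<Longrightarrow> j \<in> {1..<M} \<Longrightarrow> Suc i < j \<Longrightarrow> x \<in> V \<Longrightarrow> T i (T j x) = T j (T i x)"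
begin

lemma word_closed: "set w \<subseteq> {1..<M} \<Longrightarrow> x \<in> V \<Longrightarrow> foldr T w x \<in> V"
  by (induction w) (auto intro: closed)

lemma weq_foldr: "weq u v \<Longrightarrow> set u \<subseteq> {1..<M} \<Longrightarrow> x \<in> V \<Longrightarrow> foldr T u x = foldr T v x"
proof (induction rule: weq.induct)
  case (weq_trans u v w)
  then show ?case using weq_set[of u v] by (metis subset_trans)
next
  case (weq_inv a i b)
  then show ?case by (simp add: invol word_closed)
next
  case (weq_braid a i b)
  then show ?case by (simp add: braid[symmetric] word_closed)
next
  case (weq_far i j a b)
  then show ?case using far[of i j "foldr T b x"] far[of j i "foldr T b x"] word_closed[of b x] by auto
qed simp

lemma word_rev: "set w \<subseteq> {1..<M} \<Longrightarrow> x \<in> V \<Longrightarrow> foldr T (rev w) (foldr T w x) = x"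
proof (induction w)
  case (Cons i w)
  then show ?case by (simp add: invol word_closed)
qed simp

lemma word_eq:
  assumes u: "set u \<subseteq> {1..<M}" and v: "set v \<subseteq> {1..<M}" and e: "wperm u = wperm v" and x: "x \<in> V"
  shows "foldr T u x = foldr T v x"
proof -
  have "wperm (u @ rev v) = id" using wperm_rev[of "rev v"] by (simp add: wperm_append e)
  moreover have "set (u @ rev v) \<subseteq> {1..M - 1}" using u v by (fastforce simp: subset_iff)
  ultimately have "weq (u @ rev v) []" by (intro weq_Nil)
  then have "foldr T (u @ rev v) (foldr T v x) = foldr T v x"
    using weq_foldr[of "u @ rev v" "[]"] u v word_closed[OF v x] by simp
  then show ?thesis using word_rev[OF v x] by simp
qed

definition word :: "(nat \<Rightarrow> nat) \<Rightarrow> nat list" where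
  "word \<pi> = (SOME w. set w \<subseteq> {1..<M} \<and> wperm w = \<pi>)"

lemma word: "\<pi> permutes {1..M} \<Longrightarrow> set (word \<pi>) \<subseteq> {1..<M} \<and> wperm (word \<pi>) = \<pi>"
  unfolding word_def by (rule someI_ex, rule wperm_surj)

definition act :: "(nat \<Rightarrow> nat) \<Rightarrow> 'x \<Rightarrow> 'x" where
  "act \<pi> = restrict (foldr T (word \<pi>)) V"

lemma act_word: "set w \<subseteq> {1..<M} \<Longrightarrow> x \<in> V \<Longrightarrow> act (wperm w) x = foldr T w x"
  using word_eq[of "word (wperm w)" w x] word[OF wperm_permutes, of w] by (simp add: act_def)

lemma act_transpose: "i \<in> {1..<M} \<Longrightarrow> x \<in> V \<Longrightarrow> act (transpose i (Suc i)) x = T i x"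
  using act_word[of "[i]" x] by simp

lemma act_Bij: "\<pi> permutes {1..M} \<Longrightarrow> act \<pi> \<in> Bij V"
proof -
  assume "\<pi> permutes {1..M}"
  note w = word[OF this]
  then have r: "set (rev (word \<pi>)) \<subseteq> {1..<M}" by simp
  have "bij_betw (foldr T (word \<pi>)) V V"
    by (rule bij_betw_byWitness[where f' = "foldr T (rev (word \<pi>))"])
      (use w r word_closed word_rev[of "word \<pi>"] word_rev[of "rev (word \<pi>)"] in auto)
  then show ?thesis unfolding Bij_def act_def by (simp add: bij_betw_restrict_eq)
qed

lemma act_comp:
  assumes "\<pi> permutes {1..M}" "\<sigma> permutes {1..M}"
  shows "act (\<pi> \<circ> \<sigma>) = compose V (act \<pi>) (act \<sigma>)"
proof (rule ext)
  fix x
  note w = word[OF assms(1)] word[OF assms(2)]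
  show "act (\<pi> \<circ> \<sigma>) x = compose V (act \<pi>) (act \<sigma>) x"
  proof (cases "x \<in> V")
    case True
    have "act (\<pi> \<circ> \<sigma>) x = foldr T (word \<pi> @ word \<sigma>) x"
      using act_word[of "word \<pi> @ word \<sigma>" x] w True by (simp add: wperm_append)
    then show ?thesis using True w word_closed by (simp add: compose_def act_def)
  qed (simp add: act_def compose_def)
qed

theorem group_action_act: "group_action (sym_group M) V act"
  unfolding group_action_def
proof (rule group_hom.intro[OF sym_group_is_group group_BijGroup], rule group_hom_axioms.intro, rule homI)
  fix \<pi> \<sigma> assume "\<pi> \<in> carrier (sym_group M)" "\<sigma> \<in> carrier (sym_group M)"
  then have p: "\<pi> permutes {1..M}" "\<sigma> permutes {1..M}" by (simp_all add: sym_group_def)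
  show "act \<pi> \<in> carrier (BijGroup V)" using act_Bij[OF p(1)] by (simp add: BijGroup_def)
  show "act (\<pi> \<otimes>\<^bsub>sym_group M\<^esub> \<sigma>) = act \<pi> \<otimes>\<^bsub>BijGroup V\<^esub> act \<sigma>"
    using act_Bij[OF p(1)] act_Bij[OF p(2)] act_comp[OF p] by (simp add: BijGroup_def sym_group_def)
qed

end

section \<open>The representation\<close>

context type_I_module
begin

lemma coxeter_dref: "coxeter_action M dref (rational_vectors M B)"
  by unfold_locales (blast intro: dref_rational_vectors dref_relations)+

lemma dref_word_add: "foldr dref w (\<lambda>b. f b + h b) = (\<lambda>b. foldr dref w f b + foldr dref w h b)"
  by (induction w) (simp_all add: dref_add)

lemma dref_word_rconst: "foldr dref w (\<lambda>b. rconst c * f b) = (\<lambda>b. rconst c * foldr dref w f b)"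
  by (induction w) (simp_all add: dref_rconst)

lemma dynamical_representation:
  "\<exists>\<rho>. linear_representation (sym_group M) (rational_vectors M B) \<rho> \<and>
    (\<forall>i \<in> {1..<M}. \<forall>f \<in> rational_vectors M B. \<rho> (transpose i (Suc i)) f = dref i f)"
proof -
  interpret C: coxeter_action M dref "rational_vectors M B" by (rule coxeter_dref)
  have add: "(\<lambda>b. f b + h b) \<in> rational_vectors M B" if "f \<in> rational_vectors M B" "h \<in> rational_vectors M B" for f h
    using that by (simp add: rational_vectors_def ratfuns_add)
  have mult: "(\<lambda>b. rconst c * f b) \<in> rational_vectors M B" if "f \<in> rational_vectors M B" for c f
    using that by (simp add: rational_vectors_def ratfuns_mult ratfuns_rconst)
  have "linear_representation (sym_group M) (rational_vectors M B) C.act"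
    unfolding linear_representation_def
    using C.group_action_act
    by (auto simp: C.act_def add mult dref_word_add dref_word_rconst)
  then show ?thesis using C.act_transpose by (intro exI[of _ C.act]) simp
qed

end

theorem corollary4p2:
  fixes M :: nat and q :: complex
    and scale :: "complex \<Rightarrow> 'u::ab_group_add \<Rightarrow> 'u" and B :: "'u set"
    and E F :: "nat \<Rightarrow> 'u \<Rightarrow> 'u" and t :: "(nat \<Rightarrow> int) \<Rightarrow> 'u \<Rightarrow> 'u"
  assumes "M \<ge> 2"
    and "q \<noteq> 0" and "\<And>n::nat. n > 0 \<Longrightarrow> q ^ n \<noteq> 1"
    and "finite_dimensional_vector_space scale B"
    and "Uq_gl_module scale M q E F t"
    and "type_I M q scale t"
  shows "\<exists>\<rho>. linear_representation (sym_group M) (rational_vectors M B) \<rho> \<and>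
    (\<forall>i \<in> {1..<M}. \<forall>f \<in> rational_vectors M B.
      \<rho> (transpose i (Suc i)) f = dyn_reflection M q scale B E F t i f)"
proof -
  interpret type_I_module scale M q E F t B
    using assms(2-6) by (intro type_I_module.intro type_I_module_axioms.intro generic_q.intro)
  show ?thesis by (rule dynamical_representation)
qed

end
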